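(* Let $0<\sigma<8/21$, let $K\subset Q_T$ be compact, and let $E>0$. There is a constant $c$, depending only on $E$, $K$, $\nu_1,\nu_2$, $Q_T$ (and on $\sigma$ and the bound $c_e$ on the data), and in particular independent of $\varepsilon\in(0,1]$ and of the solution, such that the following holds. If $(\varrho_\varepsilon,\mathbf u_\varepsilon)$ is a weak solution of the compressible Navier--Stokes problem with pressure $p(\varrho)=\varrho^{3/2}(1+\varepsilon\varrho^m)$ satisfying the energy estimate $$\|\varrho_\varepsilon^{3/2}(1+\varepsilon\varrho_\varepsilon^m)\|_{L^\infty(0,T;L^1(\Omega))}+\|\varrho_\varepsilon|\mathbf u_\varepsilon|^2\|_{L^\infty(0,T;L^1(\Omega))}+\|\mathbf u_\varepsilon\|_{L^2(0,T;W^{1,2}(\Omega))}\le E,$$ then $$\int_K \varrho_\varepsilon|\mathbf u_\varepsilon|^2\big(\ln(1+\varrho_\varepsilon|\mathbf u_\varepsilon|^2)\big)^\sigma\,dx\,dt\le c .$$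
   Context: $\Omega\subset\mathbb R^3$ is a bounded domain with $C^2$ boundary, $T>0$, $Q_T=\Omega\times(0,T)$. The viscosity coefficients satisfy $\nu_1>0$, $\nu_1+\nu_2\ge0$, and $\mathbb S(\mathbf u)=\nu_1(\nabla\mathbf u+\nabla\mathbf u^\top)+\nu_2\,\mathrm{div}\,\mathbf u\,\mathbb I$. The exponent $m>1$ is fixed and $\varepsilon\in(0,1]$ is a (small) parameter; $P_\varepsilon(\varrho)=1+\varepsilon\varrho^m$. The data satisfy $\varrho_0,\mathbf u_0\in L^\infty(\Omega)$, $\mathbf f\in L^\infty(Q_T)$, $\|\mathbf u_0\|_{W^{1,2}_0(\Omega)}+\|\varrho_0\|_{L^\infty(\Omega)}+\|\mathbf f\|_{L^\infty(Q_T)}\le c_e$, and $\varrho_0>c_0>0$, where $c_e,c_0$ are positive constants. The problem is: $\partial_t(\varrho\mathbf u)+\mathrm{div}(\varrho\mathbf u\otimes\mathbf u)+\nabla p(\varrho)=\mathrm{div}\,\mathbb S(\mathbf u)+\varrho\mathbf f$ and $\partial_t\varrho+\mathrm{div}(\varrho\mathbf u)=0$, $\varrho\ge0$, in $Q_T$; $\mathbf u=0$ on $\partial\Omega\times(0,T)$; $\mathbf u(x,0)=\mathbf u_0(x)$, $\varrho(x,0)=\varrho_0(x)$ in $\Omega$. A weak solution is a pair $\varrho\ge0$, $\mathbf u\in L^2(0,T;W^{1,2}_0(\Omega))$ such that $$\int_{Q_T}\varrho\mathbf u\cdot\partial_t\boldsymbol\xi\,dxdt+\int_{Q_T}\big(\varrho\mathbf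 u\otimes\mathbf u+\varrho^{3/2}P_\varepsilon(\varrho)\mathbb I-\mathbb S(\mathbf u)\big):\nabla\boldsymbol\xi\,dxdt+\int_{Q_T}\varrho\mathbf f\cdot\boldsymbol\xi\,dxdt+\int_\Omega\varrho_0\mathbf u_0\cdot\boldsymbol\xi(x,0)\,dx=0,$$ $$\int_{Q_T}\big(\varrho\,\partial_t\psi+\varrho\mathbf u\cdot\nabla\psi\big)\,dxdt+\int_\Omega\psi(x,0)\varrho_0(x)\,dx=0$$ for all vector fields $\boldsymbol\xi$ and functions $\psi$ that are $C^\infty$ on $\overline{Q_T}$ with $\boldsymbol\xi(x,T)=0$, $\psi(x,T)=0$ in $\Omega$ and $\boldsymbol\xi=0$ on $\partial\Omega\times(0,T)$. *)

theory Defs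
  imports "HOL-Analysis.Analysis" "HOL-Probability.Essential_Supremum"
begin

type_synonym R3 = "real ^ 3"

text \<open>Points of space-time are pairs \<open>(x, t)\<close>.\<close>

text \<open>For open \<open>S\<close> this is the class \<open>C^k(S)\<close>: a function is \<open>C^(k+1)\<close> iff it is
  differentiable and all its partial derivatives are \<open>C^k\<close>.\<close>

primrec Ck_on :: "nat \<Rightarrow> 'a::euclidean_space set \<Rightarrow> ('a \<Rightarrow> 'b::real_normed_vector) \<Rightarrow> bool" where
  "Ck_on 0 S f \<longleftrightarrow> continuous_on S f"
| "Ck_on (Suc k) S f \<longleftrightarrow> f differentiable_on S \<and>
     (\<forall>b\<in>Basis. Ck_on k S (\<lambda>x. frechet_derivative f (at x) b))"

definition smooth_on :: "'a::euclidean_space set \<Rightarrow> ('a \<Rightarrow> 'b::real_normed_vector) \<Rightarrow> bool" where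
  "smooth_on S f \<longleftrightarrow> (\<forall>k. Ck_on k S f)"

text \<open>\<open>C^\<infinity>\<close> on the closure of \<open>S\<close>: smooth on some open neighbourhood of the closure.\<close>

definition smooth_upto_boundary ::
  "'a::euclidean_space set \<Rightarrow> ('a \<Rightarrow> 'b::real_normed_vector) \<Rightarrow> bool" where
  "smooth_upto_boundary S f \<longleftrightarrow> (\<exists>U. open U \<and> closure S \<subseteq> U \<and> smooth_on U f)"

definition test_function ::
  "'a::euclidean_space set \<Rightarrow> ('a \<Rightarrow> 'b::real_normed_vector) \<Rightarrow> bool" where
  "test_function S \<phi> \<longleftrightarrow> smooth_on UNIV \<phi> \<and> (\<exists>C. compact C \<and> C \<subseteq> S \<and> (\<forall>x. x \<notin> C \<longrightarrow> \<phi> x = 0))"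

text \<open>Near each boundary point and after an orthogonal change \<open>R\<close> of coordinates, the set is the
  region above the graph of a \<open>C^2\<close> function of two variables.\<close>

definition C2_boundary :: "R3 set \<Rightarrow> bool" where
  "C2_boundary \<Omega> \<longleftrightarrow> (\<forall>x0\<in>frontier \<Omega>. \<exists>r>0. \<exists>R :: R3 \<Rightarrow> R3. \<exists>\<gamma> :: real ^ 2 \<Rightarrow> real.
     orthogonal_transformation R \<and> Ck_on 2 UNIV \<gamma> \<and>
     \<Omega> \<inter> ball x0 r = {x \<in> ball x0 r. R x $ 3 > \<gamma> (vector [R x $ 1, R x $ 2])})"

definition bounded_C2_domain :: "R3 set \<Rightarrow> bool" where
  "bounded_C2_domain \<Omega> \<longleftrightarrow>
     open \<Omega> \<and> connected \<Omega> \<and> \<Omega> \<noteq> {} \<and> bounded \<Omega> \<and> C2_boundary \<Omega>"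

definition cylinder :: "R3 set \<Rightarrow> real \<Rightarrow> (R3 \<times> real) set" where
  "cylinder \<Omega> T = \<Omega> \<times> {0<..<T}"

text \<open>Norms take values in \<^typ>\<open>ennreal\<close>; the value \<open>\<infinity>\<close> means that the function is not in the space.\<close>

definition ennreal_sqrt :: "ennreal \<Rightarrow> ennreal" where
  "ennreal_sqrt a = (if a = \<infinity> then \<infinity> else ennreal (sqrt (enn2real a)))"

definition Linf_norm :: "'a::euclidean_space set \<Rightarrow> ('a \<Rightarrow> 'b::euclidean_space) \<Rightarrow> ennreal" where
  "Linf_norm S g = esssup (lebesgue_on S) (\<lambda>x. ennreal (norm (g x)))"

definition Linf :: "'a::euclidean_space set \<Rightarrow> ('a \<Rightarrow> 'b::euclidean_space) set" where
  "Linf S = {g \<in> borel_measurable (lebesgue_on S). Linf_norm S g < \<infinity>}"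

definition locally_integrable_on ::
  "'a::euclidean_space set \<Rightarrow> ('a \<Rightarrow> 'b::euclidean_space) \<Rightarrow> bool" where
  "locally_integrable_on S g \<longleftrightarrow> (\<forall>C. compact C \<and> C \<subseteq> S \<longrightarrow> integrable (lebesgue_on C) g)"

text \<open>\<open>G\<close> is the distributional gradient of the vector field \<open>v\<close>, with
  \<open>G x $ i $ j\<close> the derivative of the \<open>i\<close>-th component in direction \<open>j\<close>.\<close>

definition weak_gradient :: "R3 set \<Rightarrow> (R3 \<Rightarrow> R3) \<Rightarrow> (R3 \<Rightarrow> real ^ 3 ^ 3) \<Rightarrow> bool" where
  "weak_gradient \<Omega> v G \<longleftrightarrow> locally_integrable_on \<Omega> v \<and> locally_integrable_on \<Omega> G \<and>
     (\<forall>\<phi> :: R3 \<Rightarrow> real. test_function \<Omega> \<phi> \<longrightarrow> (\<forall>i j.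
        (\<integral>x. v x $ i * frechet_derivative \<phi> (at x) (axis j 1) \<partial>lebesgue_on \<Omega>) =
        - (\<integral>x. G x $ i $ j * \<phi> x \<partial>lebesgue_on \<Omega>)))"

text \<open>The weak gradient is unique up to null sets, so the infimum is over a single value;
  it is \<open>\<infinity>\<close> if there is no weak gradient.\<close>

definition W12_norm :: "R3 set \<Rightarrow> (R3 \<Rightarrow> R3) \<Rightarrow> ennreal" where
  "W12_norm \<Omega> v = (INF G\<in>Collect (weak_gradient \<Omega> v). ennreal_sqrt
     ((\<integral>\<^sup>+x. ennreal ((norm (v x))\<^sup>2) \<partial>lebesgue_on \<Omega>) +
      (\<integral>\<^sup>+x. ennreal ((norm (G x))\<^sup>2) \<partial>lebesgue_on \<Omega>)))"

definition W12 :: "R3 set \<Rightarrow> (R3 \<Rightarrow> R3) set" where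
  "W12 \<Omega> = {v. W12_norm \<Omega> v < \<infinity>}"

definition W12_0 :: "R3 set \<Rightarrow> (R3 \<Rightarrow> R3) set" where
  "W12_0 \<Omega> = {v \<in> W12 \<Omega>. \<exists>\<phi>. (\<forall>n. test_function \<Omega> (\<phi> n)) \<and>
     (\<lambda>n. W12_norm \<Omega> (\<lambda>x. v x - \<phi> n x)) \<longlonglongrightarrow> 0}"

definition LinfL1_norm :: "R3 set \<Rightarrow> real \<Rightarrow> (R3 \<times> real \<Rightarrow> real) \<Rightarrow> ennreal" where
  "LinfL1_norm \<Omega> T g = esssup (lebesgue_on {0<..<T})
     (\<lambda>t. \<integral>\<^sup>+x. ennreal \<bar>g (x, t)\<bar> \<partial>lebesgue_on \<Omega>)"

definition L2W12_norm :: "R3 set \<Rightarrow> real \<Rightarrow> (R3 \<times> real \<Rightarrow> R3) \<Rightarrow> ennreal" where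
  "L2W12_norm \<Omega> T u = ennreal_sqrt
     (\<integral>\<^sup>+t. (W12_norm \<Omega> (\<lambda>x. u (x, t)))\<^sup>2 \<partial>lebesgue_on {0<..<T})"

text \<open>Since \<open>W12_0\<close> is a separable Hilbert space, Bochner measurability in time amounts to joint
  measurability of a representative.\<close>

definition L2W12_0 :: "R3 set \<Rightarrow> real \<Rightarrow> (R3 \<times> real \<Rightarrow> R3) set" where
  "L2W12_0 \<Omega> T = {u \<in> borel_measurable (lebesgue_on (cylinder \<Omega> T)).
     (AE t in lebesgue_on {0<..<T}. (\<lambda>x. u (x, t)) \<in> W12_0 \<Omega>) \<and> L2W12_norm \<Omega> T u < \<infinity>}"

definition spatial_weak_gradient ::
  "R3 set \<Rightarrow> real \<Rightarrow> (R3 \<times> real \<Rightarrow> R3) \<Rightarrow> (R3 \<times> real \<Rightarrow> real ^ 3 ^ 3) \<Rightarrow> bool" where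
  "spatial_weak_gradient \<Omega> T u G \<longleftrightarrow> G \<in> borel_measurable (lebesgue_on (cylinder \<Omega> T)) \<and>
     (AE t in lebesgue_on {0<..<T}. weak_gradient \<Omega> (\<lambda>x. u (x, t)) (\<lambda>x. G (x, t)))"

definition time_deriv :: "(R3 \<times> real \<Rightarrow> 'b::real_normed_vector) \<Rightarrow> R3 \<times> real \<Rightarrow> 'b" where
  "time_deriv g z = frechet_derivative g (at z) (0, 1)"

definition space_deriv :: "3 \<Rightarrow> (R3 \<times> real \<Rightarrow> 'b::real_normed_vector) \<Rightarrow> R3 \<times> real \<Rightarrow> 'b" where
  "space_deriv j g z = frechet_derivative g (at z) (axis j 1, 0)"

definition grad :: "(R3 \<times> real \<Rightarrow> real) \<Rightarrow> R3 \<times> real \<Rightarrow> R3" where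
  "grad \<psi> z = (\<chi> j. space_deriv j \<psi> z)"

definition grad_vec :: "(R3 \<times> real \<Rightarrow> R3) \<Rightarrow> R3 \<times> real \<Rightarrow> real ^ 3 ^ 3" where
  "grad_vec \<xi> z = (\<chi> i j. space_deriv j \<xi> z $ i)"

definition tensor :: "R3 \<Rightarrow> R3 \<Rightarrow> real ^ 3 ^ 3" where
  "tensor a b = (\<chi> i j. a $ i * b $ j)"

text \<open>The viscous stress as a function of the velocity gradient \<open>G\<close>.\<close>

definition stress :: "real \<Rightarrow> real \<Rightarrow> real ^ 3 ^ 3 \<Rightarrow> real ^ 3 ^ 3" where
  "stress \<nu>1 \<nu>2 G = \<nu>1 *\<^sub>R (G + transpose G) + (\<nu>2 * trace G) *\<^sub>R mat 1"

definition pressure :: "real \<Rightarrow> real \<Rightarrow> real \<Rightarrow> real" where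
  "pressure m \<epsilon> r = r powr (3/2) * (1 + \<epsilon> * r powr m)"

definition momentum_eq ::
  "R3 set \<Rightarrow> real \<Rightarrow> real \<Rightarrow> real \<Rightarrow> (real \<Rightarrow> real) \<Rightarrow> (R3 \<times> real \<Rightarrow> R3) \<Rightarrow>
   (R3 \<Rightarrow> real) \<Rightarrow> (R3 \<Rightarrow> R3) \<Rightarrow> (R3 \<times> real \<Rightarrow> real) \<Rightarrow> (R3 \<times> real \<Rightarrow> R3) \<Rightarrow>
   (R3 \<times> real \<Rightarrow> real ^ 3 ^ 3) \<Rightarrow> (R3 \<times> real \<Rightarrow> R3) \<Rightarrow> bool" where
  "momentum_eq \<Omega> T \<nu>1 \<nu>2 p f \<rho>0 u0 \<rho> u Du \<xi> \<longleftrightarrow>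
     (\<integral>z. \<rho> z * (u z \<bullet> time_deriv \<xi> z) \<partial>lebesgue_on (cylinder \<Omega> T)) +
     (\<integral>z. (\<rho> z *\<^sub>R tensor (u z) (u z) + p (\<rho> z) *\<^sub>R mat 1 - stress \<nu>1 \<nu>2 (Du z)) \<bullet> grad_vec \<xi> z
        \<partial>lebesgue_on (cylinder \<Omega> T)) +
     (\<integral>z. \<rho> z * (f z \<bullet> \<xi> z) \<partial>lebesgue_on (cylinder \<Omega> T)) +
     (\<integral>x. \<rho>0 x * (u0 x \<bullet> \<xi> (x, 0)) \<partial>lebesgue_on \<Omega>) = 0"

definition continuity_eq ::
  "R3 set \<Rightarrow> real \<Rightarrow> (R3 \<Rightarrow> real) \<Rightarrow> (R3 \<times> real \<Rightarrow> real) \<Rightarrow> (R3 \<times> real \<Rightarrow> R3) \<Rightarrow>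
   (R3 \<times> real \<Rightarrow> real) \<Rightarrow> bool" where
  "continuity_eq \<Omega> T \<rho>0 \<rho> u \<psi> \<longleftrightarrow>
     (\<integral>z. \<rho> z * time_deriv \<psi> z + \<rho> z * (u z \<bullet> grad \<psi> z) \<partial>lebesgue_on (cylinder \<Omega> T)) +
     (\<integral>x. \<psi> (x, 0) * \<rho>0 x \<partial>lebesgue_on \<Omega>) = 0"

text \<open>The Bochner integral of a non-integrable function is 0, so the integrability that gives the
  integral identities their meaning is required explicitly: integrability of \<open>p (\<rho>)\<close> and
  \<open>\<rho> |u|^2\<close> makes every term of the identities integrable, and it follows from finiteness of the
  energy. The gradient \<open>Du\<close> is determined by \<open>u\<close> up to a null set.\<close>

definition weak_solution ::
  "R3 set \<Rightarrow> real \<Rightarrow> real \<Rightarrow> real \<Rightarrow> (real \<Rightarrow> real) \<Rightarrow> (R3 \<times> real \<Rightarrow> R3) \<Rightarrow>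
   (R3 \<Rightarrow> real) \<Rightarrow> (R3 \<Rightarrow> R3) \<Rightarrow> (R3 \<times> real \<Rightarrow> real) \<Rightarrow> (R3 \<times> real \<Rightarrow> R3) \<Rightarrow> bool" where
  "weak_solution \<Omega> T \<nu>1 \<nu>2 p f \<rho>0 u0 \<rho> u \<longleftrightarrow>
     \<rho> \<in> borel_measurable (lebesgue_on (cylinder \<Omega> T)) \<and>
     (AE z in lebesgue_on (cylinder \<Omega> T). \<rho> z \<ge> 0) \<and>
     u \<in> L2W12_0 \<Omega> T \<and>
     integrable (lebesgue_on (cylinder \<Omega> T)) (\<lambda>z. p (\<rho> z)) \<and>
     integrable (lebesgue_on (cylinder \<Omega> T)) (\<lambda>z. \<rho> z * (norm (u z))\<^sup>2) \<and>
     (\<exists>Du. spatial_weak_gradient \<Omega> T u Du \<and>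
       (\<forall>\<xi>. smooth_upto_boundary (cylinder \<Omega> T) \<xi> \<and> (\<forall>x\<in>\<Omega>. \<xi> (x, T) = 0) \<and>
            (\<forall>x\<in>frontier \<Omega>. \<forall>t\<in>{0<..<T}. \<xi> (x, t) = 0) \<longrightarrow>
          momentum_eq \<Omega> T \<nu>1 \<nu>2 p f \<rho>0 u0 \<rho> u Du \<xi>)) \<and>
     (\<forall>\<psi>. smooth_upto_boundary (cylinder \<Omega> T) \<psi> \<and> (\<forall>x\<in>\<Omega>. \<psi> (x, T) = 0) \<longrightarrow>
          continuity_eq \<Omega> T \<rho>0 \<rho> u \<psi>)"

definition admissible_data ::
  "R3 set \<Rightarrow> real \<Rightarrow> real \<Rightarrow> real \<Rightarrow> (R3 \<times> real \<Rightarrow> R3) \<Rightarrow> (R3 \<Rightarrow> real) \<Rightarrow> (R3 \<Rightarrow> R3) \<Rightarrow> bool" where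
  "admissible_data \<Omega> T c\<^sub>e c\<^sub>0 f \<rho>0 u0 \<longleftrightarrow>
     \<rho>0 \<in> Linf \<Omega> \<and> u0 \<in> Linf \<Omega> \<and> f \<in> Linf (cylinder \<Omega> T) \<and> u0 \<in> W12_0 \<Omega> \<and>
     W12_norm \<Omega> u0 + Linf_norm \<Omega> \<rho>0 + Linf_norm (cylinder \<Omega> T) f \<le> ennreal c\<^sub>e \<and>
     (AE x in lebesgue_on \<Omega>. \<rho>0 x > c\<^sub>0)"

definition energy_norm ::
  "R3 set \<Rightarrow> real \<Rightarrow> (real \<Rightarrow> real) \<Rightarrow> (R3 \<times> real \<Rightarrow> real) \<Rightarrow> (R3 \<times> real \<Rightarrow> R3) \<Rightarrow> ennreal" where
  "energy_norm \<Omega> T p \<rho> u =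
     LinfL1_norm \<Omega> T (\<lambda>z. p (\<rho> z)) + LinfL1_norm \<Omega> T (\<lambda>z. \<rho> z * (norm (u z))\<^sup>2) +
     L2W12_norm \<Omega> T u"

end

theory Submission
  imports Defs
begin

text \<open>
  The momentum equation is tested with \<open>k(x - y)\<close>, weighted by \<open>\<rho>(y, t')\<close> and localised in space-time,
  and the continuity equation with \<open>u(x, t) \<cdot> k(x - y)\<close>. Here \<open>k(z) = h(|z|\<^sup>2) z\<close>, where \<open>h(q)\<close> behaves
  like \<open>q\<^sup>-\<^sup>1\<^sup>/\<^sup>2 (ln (a / q))\<^sup>s\<close> with \<open>s = 7\<sigma>/2 < 4/3\<close>. Space and time variables are doubled
  and the two times tied together by a mollifier, so that the solution needs no regularity in time:
  the time derivatives cancel. After symmetrisation the convective term becomes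
  \<open>\<rho> \<rho>' (u - u') \<cdot> \<nabla>k(x - y) (u - u')\<close>, which is bounded below by \<open>- C \<rho> \<rho>' |u - u'|\<^sup>2\<close> times a kernel that
  carries only the power \<open>s - 1\<close> of the logarithm; since \<open>s < 4/3\<close>, Sobolev's inequality and the
  pressure absorb it. What remains bounds the integral of \<open>\<rho>\<^sup>3\<^sup>/\<^sup>2 (h * \<rho>)\<close>. A Hardy inequality with weight
  \<open>N / (1 + N * |\<cdot>|\<^sup>-\<^sup>1)\<close>, \<open>N = \<rho> (ln (e + \<rho>))\<^sup>s\<close>, then turns this and the bound on \<open>\<nabla>u\<close> into a bound on
  \<open>\<rho> |u|\<^sup>2 (ln (e + \<rho>))\<^sup>2\<^sup>s\<^sup>/\<^sup>7\<close>.
\<close>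

text \<open>The pressure power 3/2 is borderline: the energy puts the density in L^(3/2) of space,
  the dual of L^3, and 1/|x| misses L^3 by a logarithm. Both thresholds come from this. The negative
  part of the convective term is \<rho> |u|^2 against a kernel that has lost one logarithm; Young's
  inequality with weights 2/5 and 3/5 gains a further 2/3 of a logarithm, and the remaining kernel,
  with logarithm to the power s - 5/3 over |x|, lies in L^3 exactly when 3 s - 5 < -1, that is s <
  4/3. The final interpolation keeps 2/7 of the logarithmic gain, and 2/7 of 4/3 is 8/21. The kernel
  is singular at 0 and its logarithm changes sign far away. The test fields therefore use |x|^2 +
  \<delta> in place of |x|^2, and a scale \<open>a\<close> well above the squared diameter of the
  domain; no estimate depends on \<delta> or on the width of the mollifier, so both can be removed
  at the end. The constant does not see \<epsilon>, because the pressure law enters through the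
  bound on its integral, through \<open>p 0 = 0\<close> and through
  \<open>s powr (3 / 2) \<le> p s\<close>.\<close>

text \<open>An integral without a measure is taken with respect to Lebesgue measure on Borel sets.\<close>

abbreviation (input) nn_integral_lborel :: "('a::euclidean_space \<Rightarrow> ennreal) \<Rightarrow> ennreal" (binder "\<integral>\<^sup>+" 10) where
  "nn_integral_lborel f \<equiv> integral\<^sup>N lborel f"

abbreviation (input) integral_lborel :: "('a::euclidean_space \<Rightarrow> 'b::{banach, second_countable_topology}) \<Rightarrow> 'b" (binder "\<integral>" 10) where
  "integral_lborel f \<equiv> integral\<^sup>L lborel f"

section \<open>Elementary smooth functions\<close>

text \<open>For \<open>p = 1\<close> this is the classical flat function exp(-1/s). The polynomial
  in 1/s is carried as a parameter because the family is then closed under differentiation.\<close>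

definition bump :: "real poly \<Rightarrow> real \<Rightarrow> real" where
  "bump p s = (if s > 0 then poly p (1 / s) * exp (- 1 / s) else 0)"

lemma poly_exp_tendsto_0: "((\<lambda>y::real. poly p y * exp (- y)) \<longlongrightarrow> 0) at_top"
proof -
  have "((\<lambda>y::real. \<Sum>i\<le>degree p. coeff p i * (y ^ i / exp y)) \<longlongrightarrow> (\<Sum>i\<le>degree p. coeff p i * 0)) at_top"
    by (intro tendsto_sum tendsto_mult tendsto_const tendsto_power_div_exp_0)
  then show ?thesis
    by (simp add: poly_altdef sum_distrib_right exp_minus divide_inverse mult.assoc)
qed

text \<open>With y = 1/s the function is p(y) exp(-y) and dy/ds = -y^2, which gives the polynomial
  \<open>[:0, 0, 1:] * (p - pderiv p)\<close>. At 0 the difference quotient from the right is y p(y)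
  exp(-y), and it tends to 0 as y grows.\<close>

lemma bump_has_real_derivative:
  "(bump p has_real_derivative bump ([:0, 0, 1:] * (p - pderiv p)) s) (at s)"
proof -
  consider "s > 0" | "s < 0" | "s = 0" by linarith
  then show ?thesis
  proof cases
    case 1
    have "((\<lambda>s. poly p (1 / s) * exp (- 1 / s)) has_real_derivative
        bump ([:0, 0, 1:] * (p - pderiv p)) s) (at s)"
      using 1 by (auto intro!: derivative_eq_intros poly_DERIV[THEN DERIV_chain2]
          simp: bump_def field_simps power2_eq_square)
    then show ?thesis
      by (rule has_field_derivative_transform_within_open[where S = "{0<..}"])
        (use 1 in \<open>auto simp: bump_def\<close>)
  next
    case 2
    have "((\<lambda>s. 0::real) has_real_derivative bump ([:0, 0, 1:] * (p - pderiv p)) s) (at s)"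
      using 2 by (auto simp: bump_def)
    then show ?thesis
      by (rule has_field_derivative_transform_within_open[where S = "{..<0}"])
        (use 2 in \<open>auto simp: bump_def\<close>)
  next
    case 3
    have "((\<lambda>y::real. poly ([:0, 1:] * p) y * exp (- y)) \<longlongrightarrow> 0) at_top"
      by (rule poly_exp_tendsto_0)
    then have r: "((\<lambda>h::real. bump p h / h) \<longlongrightarrow> 0) (at_right 0)"
      unfolding filterlim_at_top_to_right[of _ "nhds 0"]
      by (rule Lim_transform_eventually)
        (auto simp: bump_def eventually_at_right_less divide_inverse mult.commute mult.left_commute
           intro!: eventually_at_rightI[of 0 1])
    have l: "((\<lambda>h::real. bump p h / h) \<longlongrightarrow> 0) (at_left 0)"
      by (rule Lim_transform_eventually[OF tendsto_const])
        (auto simp: bump_def intro!: eventually_at_leftI[of "-1"])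
    show ?thesis
      unfolding 3 DERIV_def using filterlim_split_at[OF l r] by (simp add: bump_def)
  qed
qed

text \<open>A syntactic class of expressions closed under differentiation, so that smoothness of the
  concrete test functions is read off from their shape. The side conditions of \<open>ln\<close> and
  \<open>inverse\<close> are imposed on \<open>U\<close> alone: the kernel makes no sense
  everywhere.\<close>

inductive elem_smooth :: "'a::euclidean_space set \<Rightarrow> ('a \<Rightarrow> real) \<Rightarrow> bool" for U where
  const: "elem_smooth U (\<lambda>x. c)"
| inner: "elem_smooth U (\<lambda>x. x \<bullet> v)"
| add: "elem_smooth U f \<Longrightarrow> elem_smooth U g \<Longrightarrow> elem_smooth U (\<lambda>x. f x + g x)"
| mult: "elem_smooth U f \<Longrightarrow> elem_smooth U g \<Longrightarrow> elem_smooth U (\<lambda>x. f x * g x)"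
| exp: "elem_smooth U f \<Longrightarrow> elem_smooth U (\<lambda>x. exp (f x))"
| ln: "elem_smooth U f \<Longrightarrow> (\<And>x. x \<in> U \<Longrightarrow> f x > 0) \<Longrightarrow> elem_smooth U (\<lambda>x. ln (f x))"
| inverse: "elem_smooth U f \<Longrightarrow> (\<And>x. x \<in> U \<Longrightarrow> f x \<noteq> 0) \<Longrightarrow> elem_smooth U (\<lambda>x. inverse (f x))"
| bump: "elem_smooth U f \<Longrightarrow> elem_smooth U (\<lambda>x. bump p (f x))"

lemma elem_smooth_uminus: "elem_smooth U f \<Longrightarrow> elem_smooth U (\<lambda>x. - f x)"
  using elem_smooth.mult[OF elem_smooth.const[of U "-1"], of f] by simp

text \<open>Each directional derivative stays in the class; this single structural induction is what
  yields derivatives of all orders.\<close>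

lemma elem_smooth_has_derivative:
  assumes "elem_smooth U f" "open U"
  shows "\<exists>D. (\<forall>x\<in>U. (f has_derivative D x) (at x)) \<and> (\<forall>b. elem_smooth U (\<lambda>x. D x b))"
  using assms(1)
proof induction
  case (const c)
  then show ?case
    by (intro exI[of _ "\<lambda>x b. 0"]) (auto intro: elem_smooth.intros)
next
  case (inner v)
  then show ?case
    by (intro exI[of _ "\<lambda>x b. b \<bullet> v"]) (auto intro!: elem_smooth.intros derivative_eq_intros)
next
  case (add f g)
  then obtain D E where "\<forall>x\<in>U. (f has_derivative D x) (at x)" "\<forall>b. elem_smooth U (\<lambda>x. D x b)"
    "\<forall>x\<in>U. (g has_derivative E x) (at x)" "\<forall>b. elem_smooth U (\<lambda>x. E x b)" by blast
  then show ?case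
    by (intro exI[of _ "\<lambda>x b. D x b + E x b"]) (auto intro!: elem_smooth.intros derivative_intros)
next
  case (mult f g)
  then obtain D E where "\<forall>x\<in>U. (f has_derivative D x) (at x)" "\<forall>b. elem_smooth U (\<lambda>x. D x b)"
    "\<forall>x\<in>U. (g has_derivative E x) (at x)" "\<forall>b. elem_smooth U (\<lambda>x. E x b)" by blast
  with mult.hyps show ?case
    by (intro exI[of _ "\<lambda>x b. f x * E x b + D x b * g x"])
      (auto intro!: elem_smooth.intros derivative_intros)
next
  case (exp f)
  then obtain D where "\<forall>x\<in>U. (f has_derivative D x) (at x)" "\<forall>b. elem_smooth U (\<lambda>x. D x b)"
    by blast
  with exp.hyps show ?case
    by (intro exI[of _ "\<lambda>x b. exp (f x) * D x b"])
      (auto intro!: elem_smooth.intros derivative_eq_intros)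
next
  case (ln f)
  then obtain D where D: "\<forall>x\<in>U. (f has_derivative D x) (at x)" "\<forall>b. elem_smooth U (\<lambda>x. D x b)"
    by blast
  have "elem_smooth U (\<lambda>x. inverse (f x))"
    using ln.hyps by (intro elem_smooth.inverse) force+
  with D ln.hyps show ?case
    by (intro exI[of _ "\<lambda>x b. inverse (f x) * D x b"])
      (auto intro!: elem_smooth.intros derivative_eq_intros simp: divide_inverse mult.commute)
next
  case (inverse f)
  then obtain D where "\<forall>x\<in>U. (f has_derivative D x) (at x)" "\<forall>b. elem_smooth U (\<lambda>x. D x b)"
    by blast
  with inverse.hyps show ?case
    by (intro exI[of _ "\<lambda>x b. - (inverse (f x) * D x b * inverse (f x))"])
      (auto intro!: elem_smooth_uminus elem_smooth.intros derivative_eq_intros)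
next
  case (bump f p)
  then obtain D where D: "\<forall>x\<in>U. (f has_derivative D x) (at x)" "\<forall>b. elem_smooth U (\<lambda>x. D x b)"
    by blast
  define q where "q = [:0, 0, 1:] * (p - pderiv p)"
  have "((\<lambda>x. bump p (f x)) has_derivative (\<lambda>b. bump q (f x) * D x b)) (at x)" if "x \<in> U" for x
    unfolding q_def
    by (rule has_derivative_compose[OF D(1)[rule_format, OF that]
          bump_has_real_derivative[unfolded has_field_derivative_def]])
  moreover have "elem_smooth U (\<lambda>x. bump q (f x) * D x b)" for b
    by (rule elem_smooth.mult[OF elem_smooth.bump[OF bump.hyps] D(2)[rule_format]])
  ultimately show ?case
    by (intro exI[of _ "\<lambda>x b. bump q (f x) * D x b"]) simp
qed

lemma Ck_on_cong:
  assumes "open U" "\<And>x. x \<in> U \<Longrightarrow> f x = g x" "Ck_on k U f"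
  shows "Ck_on k U g"
  using assms(2,3)
proof (induction k arbitrary: f g)
  case 0
  then show ?case by (auto cong: continuous_on_cong)
next
  case (Suc k)
  have der: "(f has_derivative D) (at x) \<longleftrightarrow> (g has_derivative D) (at x)" if "x \<in> U" for x D
    using has_derivative_transform_within_open[of f D x UNIV U g]
      has_derivative_transform_within_open[of g D x UNIV U f] assms(1) that Suc.prems(1) by auto
  \<comment> \<open>\<open>frechet_derivative\<close> is a choice; since f and g have the same
    derivatives at \<open>x\<close>, the two choices are made from the same predicate.\<close>
  have fr: "frechet_derivative f (at x) = frechet_derivative g (at x)" if "x \<in> U" for x
    unfolding frechet_derivative_def der[OF that] ..
  have f: "f differentiable_on U" "\<And>b. b \<in> Basis \<Longrightarrow> Ck_on k U (\<lambda>x. frechet_derivative f (at x) b)"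
    using Suc.prems(2) by simp_all
  have "g differentiable_on U"
    unfolding differentiable_on_eq_differentiable_at[OF assms(1)] differentiable_def
  proof
    fix x assume "x \<in> U"
    then show "\<exists>D. (g has_derivative D) (at x)"
      using f(1) der unfolding differentiable_on_eq_differentiable_at[OF assms(1)] differentiable_def
      by blast
  qed
  moreover have "Ck_on k U (\<lambda>x. frechet_derivative g (at x) b)" if "b \<in> Basis" for b
    by (rule Suc.IH[OF _ f(2)[OF that]]) (rule fun_cong[OF fr])
  ultimately show ?case by simp
qed

text \<open>Finite combinations with fixed vectors \<open>v i\<close> make the induction on k cover
  scalar and vector valued functions at once: differentiation changes the coefficients only.\<close>

lemma elem_smooth_sum_Ck_on:
  fixes f :: "'i \<Rightarrow> 'a::euclidean_space \<Rightarrow> real" and v :: "'i \<Rightarrow> 'b::real_normed_vector"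
  assumes "open U" "finite I" "\<And>i. i \<in> I \<Longrightarrow> elem_smooth U (f i)"
  shows "Ck_on k U (\<lambda>x. \<Sum>i\<in>I. f i x *\<^sub>R v i)"
  using assms(3)
proof (induction k arbitrary: f)
  case 0
  have "continuous_on U (f i)" if i: "i \<in> I" for i
  proof -
    obtain D where "\<forall>x\<in>U. (f i has_derivative D x) (at x)"
      using elem_smooth_has_derivative[OF 0[OF i] assms(1)] by blast
    then show ?thesis
      by (intro has_derivative_continuous_on[of U "f i" D]) (auto intro: has_derivative_at_withinI)
  qed
  then show ?case by (auto intro!: continuous_intros)
next
  case (Suc k)
  obtain D where D: "\<And>i x. i \<in> I \<Longrightarrow> x \<in> U \<Longrightarrow> (f i has_derivative D i x) (at x)"
    "\<And>i b. i \<in> I \<Longrightarrow> elem_smooth U (\<lambda>x. D i x b)"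
    using elem_smooth_has_derivative[OF Suc.prems assms(1)] by metis
  have *: "((\<lambda>x. \<Sum>i\<in>I. f i x *\<^sub>R v i) has_derivative (\<lambda>b. \<Sum>i\<in>I. D i x b *\<^sub>R v i)) (at x)"
    if "x \<in> U" for x
    using that D(1) by (auto intro!: derivative_intros)
  have "Ck_on k U (\<lambda>x. frechet_derivative (\<lambda>x. \<Sum>i\<in>I. f i x *\<^sub>R v i) (at x) b)" for b
  proof (rule Ck_on_cong[OF assms(1)])
    show "Ck_on k U (\<lambda>x. \<Sum>i\<in>I. D i x b *\<^sub>R v i)"
      using D(2) by (rule Suc.IH)
    show "(\<Sum>i\<in>I. D i x b *\<^sub>R v i) = frechet_derivative (\<lambda>x. \<Sum>i\<in>I. f i x *\<^sub>R v i) (at x) b"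
      if "x \<in> U" for x
      using fun_cong[OF frechet_derivative_at[OF *[OF that]], of b] .
  qed
  moreover have "(\<lambda>x. \<Sum>i\<in>I. f i x *\<^sub>R v i) differentiable_on U"
    using * by (meson differentiableI differentiable_at_withinI differentiable_on_def)
  ultimately show ?case by simp
qed

lemma elem_smooth_smooth_on:
  assumes "open U" "elem_smooth U f"
  shows "smooth_on U f"
proof -
  have "Ck_on k U (\<lambda>x. \<Sum>i\<in>{()}. f x *\<^sub>R (1::real))" for k
    by (rule elem_smooth_sum_Ck_on[where f = "\<lambda>_. f" and v = "\<lambda>_. 1"]) (use assms in auto)
  then show ?thesis
    by (simp add: smooth_on_def)
qed

lemma elem_smooth_vec_smooth_on:
  fixes f :: "'a::euclidean_space \<Rightarrow> R3"
  assumes "open U" "\<And>i. elem_smooth U (\<lambda>x. f x $ i)"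
  shows "smooth_on U f"
proof -
  have *: "(\<lambda>x. \<Sum>i\<in>UNIV. f x $ i *\<^sub>R axis i 1) = f"
    by (rule ext) (simp add: basis_expansion flip: scalar_mult_eq_scaleR)
  have "Ck_on k U (\<lambda>x. \<Sum>i\<in>UNIV. f x $ i *\<^sub>R (axis i 1 :: R3))" for k
    by (rule elem_smooth_sum_Ck_on[where f = "\<lambda>i x. f x $ i" and v = "\<lambda>i. axis i 1"])
      (use assms in auto)
  then show ?thesis
    unfolding smooth_on_def * by blast
qed

lemma elem_smooth_diff:
  "elem_smooth U f \<Longrightarrow> elem_smooth U g \<Longrightarrow> elem_smooth U (\<lambda>x. f x - g x)"
  using elem_smooth.add[OF _ elem_smooth.mult[OF elem_smooth.const[of U "-1"]], of f g] by simp

lemma elem_smooth_sum: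
  "finite I \<Longrightarrow> (\<And>i. i \<in> I \<Longrightarrow> elem_smooth U (f i)) \<Longrightarrow> elem_smooth U (\<lambda>x. \<Sum>i\<in>I. f i x)"
  by (induction I rule: finite_induct) (auto intro: elem_smooth.intros)

lemma elem_smooth_prod:
  "finite I \<Longrightarrow> (\<And>i. i \<in> I \<Longrightarrow> elem_smooth U (f i)) \<Longrightarrow> elem_smooth U (\<lambda>x. \<Prod>i\<in>I. f i x)"
  by (induction I rule: finite_induct) (auto intro: elem_smooth.intros)

lemma smooth_on_has_derivative:
  assumes "smooth_on U f" "open U" "x \<in> U"
  shows "(f has_derivative frechet_derivative f (at x)) (at x)"
proof -
  have "f differentiable_on U"
    using assms(1) Ck_on.simps(2)[of 0 U f] unfolding smooth_on_def by blast
  then show ?thesis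
    using assms(2,3) by (simp add: differentiable_on_eq_differentiable_at frechet_derivative_works)
qed

lemma smooth_on_continuous_deriv:
  assumes "smooth_on U f" "b \<in> Basis"
  shows "continuous_on U (\<lambda>x. frechet_derivative f (at x) b)"
  using assms Ck_on.simps(2)[of 0 U f] Ck_on.simps(1)[of U] unfolding smooth_on_def by blast

section \<open>The Sobolev inequality\<close>

lemma integrable_compact_support:
  fixes f :: "'a::euclidean_space \<Rightarrow> 'b::{banach, second_countable_topology}"
  assumes "continuous_on UNIV f" "compact C" "\<And>x. x \<notin> C \<Longrightarrow> f x = 0"
  shows "integrable lborel f"
proof -
  have "integrable lborel (\<lambda>x. indicator C x *\<^sub>R f x)"
    using assms by (intro borel_integrable_compact) (auto intro: continuous_on_subset)
  moreover have "indicator C x *\<^sub>R f x = f x" for x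
    using assms(3) by (cases "x \<in> C") auto
  ultimately show ?thesis by simp
qed

lemma bounded_compact_support:
  fixes f :: "'a::euclidean_space \<Rightarrow> 'b::real_normed_vector"
  assumes "continuous_on UNIV f" "compact C" "\<And>x. x \<notin> C \<Longrightarrow> f x = 0"
  shows "\<exists>M>0. \<forall>x. norm (f x) \<le> M"
proof -
  have "bounded (f ` C)"
    using assms by (intro compact_imp_bounded compact_continuous_image) (auto intro: continuous_on_subset)
  then obtain M where "M > 0" "\<forall>x\<in>C. norm (f x) \<le> M"
    by (auto simp: bounded_pos)
  then show ?thesis
    using assms(3) by (metis less_eq_real_def norm_zero)
qed

lemma has_derivative_zero_off_closed:
  assumes "(f has_derivative D) (at x)" "closed C" "\<And>x. x \<notin> C \<Longrightarrow> f x = 0" "x \<notin> C"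
  shows "D = (\<lambda>_. 0)"
proof -
  have "((\<lambda>x. 0) has_derivative D) (at x)"
    using has_derivative_transform_within_open[OF assms(1), of "- C" "\<lambda>x. 0"] assms(2-4) by auto
  then show ?thesis
    by (metis has_derivative_const has_derivative_unique)
qed

text \<open>The difference quotients in direction \<open>b\<close> have integral zero by translation
  invariance. The mean value theorem bounds them by the maximum of the derivative, and they live in
  one ball, so dominated convergence applies and no Fubini argument is needed.\<close>

lemma integral_directional_derivative_zero:
  fixes f :: "'a::euclidean_space \<Rightarrow> real"
  assumes D: "\<And>x. (f has_derivative D x) (at x)"
    and cont: "continuous_on UNIV (\<lambda>x. D x b)"
    and C: "compact C" "\<And>x. x \<notin> C \<Longrightarrow> f x = 0"
  shows "(\<integral>x. D x b) = 0"
proof -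
  have contf: "continuous_on UNIV f"
    using D by (meson has_derivative_continuous_on has_derivative_at_withinI)
  have D0: "D x b = 0" if "x \<notin> C" for x
    using has_derivative_zero_off_closed[OF D compact_imp_closed[OF C(1)] C(2) that] by simp
  obtain M where M: "M > 0" "\<And>x. \<bar>D x b\<bar> \<le> M"
    using bounded_compact_support[OF cont C(1) D0] by auto
  obtain K where K: "K > 0" "C \<subseteq> cball 0 K"
    using compact_imp_bounded[OF C(1)] unfolding bounded_pos by (auto simp: subset_iff)
  define h where "h n = 1 / (real n + 1)" for n
  have h: "h n > 0" "h n \<le> 1" for n by (auto simp: h_def)
  have h0: "h \<longlonglongrightarrow> 0" unfolding h_def by real_asymp
  have intf: "integrable lborel f"
    by (rule integrable_compact_support[OF contf C])
  have trans: "integrable lborel (\<lambda>x. f (x + c))" "(\<integral>x. f (x + c)) = (\<integral>x. f x)" for c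
  proof -
    have "integrable (distr lborel borel ((+) c)) f"
      using intf by (simp only: lborel_distr_plus)
    then show "integrable lborel (\<lambda>x. f (x + c))"
      by (subst (asm) integrable_distr_eq)
        (use contf in \<open>auto simp: add.commute intro: borel_measurable_continuous_onI\<close>)
    have "(\<integral>x. f x) = (\<integral>x. f x \<partial>distr lborel borel ((+) c))"
      by (simp only: lborel_distr_plus)
    also have "\<dots> = (\<integral>x. f (x + c))"
      by (subst integral_distr)
        (use contf in \<open>auto simp: add.commute intro: borel_measurable_continuous_onI\<close>)
    finally show "(\<integral>x. f (x + c)) = (\<integral>x. f x)" by simp
  qed
  define q where "q n x = (f (x + h n *\<^sub>R b) - f x) / h n" for n x
  have q0: "(\<integral>x. q n x) = 0" for n
    unfolding q_def using trans[of "h n *\<^sub>R b"] intf by simp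
  have line: "((\<lambda>s. f (x + s *\<^sub>R b)) has_real_derivative D (x + s *\<^sub>R b) b) (at s)" for x s
  proof -
    have "((\<lambda>s. x + s *\<^sub>R b) has_derivative (\<lambda>s. s *\<^sub>R b)) (at s)"
      by (auto intro!: derivative_eq_intros)
    from has_derivative_compose[OF this D]
    have "((\<lambda>s. f (x + s *\<^sub>R b)) has_derivative (\<lambda>t. D (x + s *\<^sub>R b) (t *\<^sub>R b))) (at s)" .
    moreover have "D (x + s *\<^sub>R b) (t *\<^sub>R b) = D (x + s *\<^sub>R b) b * t" for t
      using linear_scale[OF has_derivative_linear[OF D], of "x + s *\<^sub>R b" t b] by simp
    ultimately show ?thesis by (simp add: has_field_derivative_def)
  qed
  have qlim: "(\<lambda>n. q n x) \<longlonglongrightarrow> D x b" for x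
  proof -
    have "((\<lambda>s. (f (x + s *\<^sub>R b) - f x) / s) \<longlongrightarrow> D x b) (at 0)"
      using line[of x 0] by (simp add: DERIV_def)
    moreover have "filterlim h (at 0) sequentially"
      using h0 h(1) by (auto simp: filterlim_at intro!: always_eventually) (metis less_irrefl)
    ultimately show ?thesis
      unfolding q_def by (rule filterlim_compose)
  qed
  have qb: "\<bar>q n x\<bar> \<le> M" for n x
  proof -
    have "\<exists>z. 0 < z \<and> z < h n \<and> f (x + h n *\<^sub>R b) - f (x + 0 *\<^sub>R b) = (h n - 0) * D (x + z *\<^sub>R b) b"
      by (rule MVT2[where f = "\<lambda>s. f (x + s *\<^sub>R b)"]) (use h line in auto)
    then obtain z where "f (x + h n *\<^sub>R b) - f x = h n * D (x + z *\<^sub>R b) b" by auto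
    then have "q n x = D (x + z *\<^sub>R b) b"
      using h[of n] by (simp add: q_def)
    then show ?thesis using M by simp
  qed
  have q00: "q n x = 0" if "norm x > K + norm b" for n x
  proof -
    have "h n * norm b \<le> 1 * norm b"
      by (rule mult_right_mono) (use h in auto)
    then have "norm (x + h n *\<^sub>R b) > K"
      using norm_triangle_ineq2[of x "- (h n *\<^sub>R b)"] that h[of n] by simp
    moreover have "norm x > K" using that norm_ge_zero[of b] by linarith
    ultimately have "x + h n *\<^sub>R b \<notin> C" "x \<notin> C" using K by (auto simp: subset_iff dist_norm)
    then show ?thesis using C(2) by (simp add: q_def)
  qed
  have "(\<lambda>n. \<integral>x. q n x) \<longlonglongrightarrow> (\<integral>x. D x b)"
  proof (rule integral_dominated_convergence[where w = "\<lambda>x. indicator (cball 0 (K + norm b)) x *\<^sub>R M"])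
    show "integrable lborel (\<lambda>x. indicator (cball 0 (K + norm b)) x *\<^sub>R M)"
      by (rule borel_integrable_compact) auto
    show "(\<lambda>x. D x b) \<in> borel_measurable lborel"
      using cont by (auto intro: borel_measurable_continuous_onI)
    show "q n \<in> borel_measurable lborel" for n
      using trans(1)[of "h n *\<^sub>R b"] intf unfolding q_def by measurable
    show "AE x in lborel. norm (q n x) \<le> indicator (cball 0 (K + norm b)) x *\<^sub>R M" for n
      using qb q00 by (auto simp: indicator_def not_le)
  qed (use qlim in auto)
  then have "(\<lambda>n. 0) \<longlonglongrightarrow> (\<integral>x. D x b)"
    by (simp only: q0)
  from LIMSEQ_unique[OF tendsto_const this] show ?thesis by simp
qed

lemma ennreal_abs_le_integral_derivative_atMost:
  fixes f f' :: "real \<Rightarrow> real"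
  assumes "\<And>x. (f has_real_derivative f' x) (at x)" "continuous_on UNIV f'"
    and "\<And>x. \<bar>x\<bar> > M \<Longrightarrow> f x = 0"
  shows "ennreal \<bar>f a\<bar> \<le> (\<integral>\<^sup>+x. ennreal \<bar>f' x\<bar> * indicator {..a} x)"
proof -
  define l where "l = - (\<bar>M\<bar> + \<bar>a\<bar> + 1)"
  have l: "l \<le> a" "f l = 0" using assms(3) by (auto simp: l_def)
  have "has_bochner_integral lborel (\<lambda>x. f' x * indicator {l..a} x) (f a - f l)"
    using l assms(1,2) by (intro has_bochner_integral_FTC_Icc_real)
      (auto simp: continuous_on_eq_continuous_at)
  then have *: "integrable lborel (\<lambda>x. f' x * indicator {l..a} x)"
    "(\<integral>x. f' x * indicator {l..a} x) = f a"
    using l by (auto simp: has_bochner_integral_iff)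
  have "ennreal \<bar>f a\<bar> \<le> (\<integral>\<^sup>+x. norm (f' x * indicator {l..a} x))"
    using integral_norm_bound_ennreal[OF *(1)] *(2) by simp
  also have "\<dots> \<le> (\<integral>\<^sup>+x. ennreal \<bar>f' x\<bar> * indicator {..a} x)"
    by (intro nn_integral_mono) (auto simp: indicator_def)
  finally show ?thesis .
qed

lemma ennreal_abs_le_integral_derivative:
  fixes f f' :: "real \<Rightarrow> real"
  assumes "\<And>x. (f has_real_derivative f' x) (at x)" "continuous_on UNIV f'"
    and "\<And>x. \<bar>x\<bar> > M \<Longrightarrow> f x = 0"
  shows "ennreal \<bar>f a\<bar> \<le> (\<integral>\<^sup>+x. ennreal \<bar>f' x\<bar>)"
  by (rule order_trans[OF ennreal_abs_le_integral_derivative_atMost[OF assms]])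
    (auto intro!: nn_integral_mono simp: indicator_def)

text \<open>Cauchy-Schwarz in \<open>a\<close> bounds the square of the inner integral by
  \<open>P c * Q b\<close>, a product of separated variables; Cauchy-Schwarz in the pair (b, c) then
  splits off \<open>g1\<close>.\<close>

lemma Loomis_Whitney:
  fixes g1 g2 g3 :: "real \<times> real \<Rightarrow> ennreal"
  assumes [measurable]: "g1 \<in> borel_measurable (lborel \<Otimes>\<^sub>M lborel)"
    "g2 \<in> borel_measurable (lborel \<Otimes>\<^sub>M lborel)" "g3 \<in> borel_measurable (lborel \<Otimes>\<^sub>M lborel)"
  shows "(\<integral>\<^sup>+c. \<integral>\<^sup>+b. \<integral>\<^sup>+a. g1 (b, c) * (g2 (a, c) * g3 (a, b)))\<^sup>2 \<le>
    (\<integral>\<^sup>+c. \<integral>\<^sup>+b. (g1 (b, c))\<^sup>2) * (\<integral>\<^sup>+c. \<integral>\<^sup>+a. (g2 (a, c))\<^sup>2) *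
    (\<integral>\<^sup>+b. \<integral>\<^sup>+a. (g3 (a, b))\<^sup>2)"
proof -
  define P where "P c = (\<integral>\<^sup>+a. (g2 (a, c))\<^sup>2)" for c
  define Q where "Q b = (\<integral>\<^sup>+a. (g3 (a, b))\<^sup>2)" for b
  define J where "J b c = (\<integral>\<^sup>+a. g2 (a, c) * g3 (a, b))" for b c
  have [measurable]: "P \<in> borel_measurable lborel" "Q \<in> borel_measurable lborel"
    unfolding P_def Q_def by measurable
  have [measurable]: "case_prod J \<in> borel_measurable (lborel \<Otimes>\<^sub>M lborel)"
    unfolding J_def by measurable
  have J: "(J b c)\<^sup>2 \<le> P c * Q b" for b c
    unfolding J_def P_def Q_def by (rule Cauchy_Schwarz_nn_integral) measurable
  have "(\<integral>\<^sup>+c. \<integral>\<^sup>+b. \<integral>\<^sup>+a. g1 (b, c) * (g2 (a, c) * g3 (a, b))) =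
      (\<integral>\<^sup>+c. \<integral>\<^sup>+b. g1 (b, c) * J b c)"
    unfolding J_def by (intro nn_integral_cong nn_integral_cmult) measurable
  also have "\<dots> = (\<integral>\<^sup>+z. g1 z * (case_prod J z) \<partial>(lborel \<Otimes>\<^sub>M lborel))"
    by (subst lborel_pair.nn_integral_snd[symmetric]) (auto)
  finally have "(\<integral>\<^sup>+c. \<integral>\<^sup>+b. \<integral>\<^sup>+a. g1 (b, c) * (g2 (a, c) * g3 (a, b)))\<^sup>2 \<le>
      (\<integral>\<^sup>+z. (g1 z)\<^sup>2 \<partial>(lborel \<Otimes>\<^sub>M lborel)) * (\<integral>\<^sup>+z. (case_prod J z)\<^sup>2 \<partial>(lborel \<Otimes>\<^sub>M lborel))"
    by (simp add: Cauchy_Schwarz_nn_integral)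
  also have "(\<integral>\<^sup>+z. (g1 z)\<^sup>2 \<partial>(lborel \<Otimes>\<^sub>M lborel)) = (\<integral>\<^sup>+c. \<integral>\<^sup>+b. (g1 (b, c))\<^sup>2)"
    by (subst lborel_pair.nn_integral_snd[symmetric]) auto
  also have "(\<integral>\<^sup>+z. (case_prod J z)\<^sup>2 \<partial>(lborel \<Otimes>\<^sub>M lborel)) =
      (\<integral>\<^sup>+c. \<integral>\<^sup>+b. (J b c)\<^sup>2)"
    by (subst lborel_pair.nn_integral_snd[symmetric]) auto
  also have "\<dots> \<le> (\<integral>\<^sup>+c. \<integral>\<^sup>+b. P c * Q b)"
    by (intro nn_integral_mono J)
  also have "\<dots> = (\<integral>\<^sup>+c. P c) * (\<integral>\<^sup>+b. Q b)"
    by (simp add: nn_integral_cmult nn_integral_multc)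
  finally show ?thesis
    unfolding P_def Q_def by (simp add: mult.assoc mult_left_mono)
qed

definition vec3 :: "real \<times> real \<times> real \<Rightarrow> R3" where
  "vec3 z = vector [fst z, fst (snd z), snd (snd z)]"

lemma vec3_nth [simp]: "vec3 (a, b, c) $ 1 = a" "vec3 (a, b, c) $ 2 = b" "vec3 (a, b, c) $ 3 = c"
  by (simp_all add: vec3_def)

lemma vec3_eq: "vec3 (a, b, c) = a *\<^sub>R axis 1 1 + b *\<^sub>R axis 2 1 + c *\<^sub>R axis 3 1"
  by (auto simp: vec_eq_iff forall_3 axis_def)

lemma continuous_vec3: "continuous_on UNIV vec3"
proof -
  have *: "vec3 = (\<lambda>z. fst z *\<^sub>R axis 1 1 + fst (snd z) *\<^sub>R axis 2 1 + snd (snd z) *\<^sub>R axis 3 1)"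
    by (auto simp: vec3_eq)
  show ?thesis unfolding * by (intro continuous_intros)
qed

lemma measurable_vec3 [measurable]: "vec3 \<in> borel_measurable borel"
  by (rule borel_measurable_continuous_onI[OF continuous_vec3])

lemma Basis_R3: "(Basis :: R3 set) = {axis 1 1, axis 2 1, axis 3 1}"
  by (auto simp: Basis_vec_def UNIV_3)

lemma inner_axis_R3 [simp]: "(x :: R3) \<bullet> axis i 1 = x $ i"
  by (simp add: inner_axis)

lemma lborel_distr_vec3: "distr lborel borel vec3 = (lborel :: R3 measure)"
proof (rule lborel_eqI[symmetric])
  fix l u :: R3
  assume "\<And>b. b \<in> Basis \<Longrightarrow> l \<bullet> b \<le> u \<bullet> b"
  from this[of "axis 1 1"] this[of "axis 2 1"] this[of "axis 3 1"]
  have lu: "l $ 1 \<le> u $ 1" "l $ 2 \<le> u $ 2" "l $ 3 \<le> u $ 3"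
    by (auto simp: Basis_R3)
  have "vec3 -` box l u \<inter> space lborel = box (l $ 1, l $ 2, l $ 3) (u $ 1, u $ 2, u $ 3)"
    by (auto simp: box_def Basis_R3 Basis_prod_def ball_Un)
  moreover have "axis 1 1 \<noteq> (axis 2 1 :: R3)" "axis 1 1 \<noteq> (axis 3 1 :: R3)" "axis 2 1 \<noteq> (axis 3 1 :: R3)"
    by (auto simp: axis_eq_axis)
  ultimately show "emeasure (distr lborel borel vec3) (box l u) = ennreal (\<Prod>b\<in>Basis. (u - l) \<bullet> b)"
    using lu
    by (subst emeasure_distr)
      (auto simp: Basis_R3 Basis_prod_def emeasure_lborel_box_eq prod.union_disjoint ball_Un mult.assoc)
qed simp

lemma nn_integral_R3:
  assumes [measurable]: "f \<in> borel_measurable borel"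
  shows "(\<integral>\<^sup>+x. f x \<partial>(lborel :: R3 measure)) =
    (\<integral>\<^sup>+c. \<integral>\<^sup>+b. \<integral>\<^sup>+a. f (vec3 (a, b, c)))"
proof -
  have [measurable]: "(\<lambda>z. f (vec3 z)) \<in> borel_measurable (lborel \<Otimes>\<^sub>M lborel)"
    unfolding lborel_prod by measurable
  have [measurable]: "(\<lambda>z. f (vec3 z)) \<in> borel_measurable (lborel \<Otimes>\<^sub>M (lborel \<Otimes>\<^sub>M lborel))"
    unfolding lborel_prod by measurable
  have "(\<integral>\<^sup>+x. f x \<partial>(lborel :: R3 measure)) = (\<integral>\<^sup>+z. f (vec3 z))"
    by (subst lborel_distr_vec3[symmetric], subst nn_integral_distr) auto
  also have "\<dots> = (\<integral>\<^sup>+z. f (vec3 z) \<partial>(lborel \<Otimes>\<^sub>M lborel))"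
    by (simp only: lborel_prod)
  also have "\<dots> = (\<integral>\<^sup>+y. \<integral>\<^sup>+a. f (vec3 (a, y)))"
    by (subst lborel_pair.nn_integral_snd[symmetric]) auto
  also have "\<dots> = (\<integral>\<^sup>+y. \<integral>\<^sup>+a. f (vec3 (a, y)) \<partial>lborel \<partial>(lborel \<Otimes>\<^sub>M lborel))"
    by (simp only: lborel_prod)
  also have "\<dots> = (\<integral>\<^sup>+c. \<integral>\<^sup>+b. \<integral>\<^sup>+a. f (vec3 (a, b, c)))"
    by (subst lborel_pair.nn_integral_snd[symmetric]) auto
  finally show ?thesis .
qed

definition jacobian :: "(R3 \<Rightarrow> R3) \<Rightarrow> R3 \<Rightarrow> real ^ 3 ^ 3" where
  "jacobian \<phi> x = (\<chi> i j. frechet_derivative \<phi> (at x) (axis j 1) $ i)"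

lemma norm_column_le_norm_matrix:
  fixes A :: "real ^ 'n ^ 'm"
  shows "norm (\<chi> i. A $ i $ j) \<le> norm A"
proof -
  have "(norm (\<chi> i. A $ i $ j))\<^sup>2 \<le> (norm A)\<^sup>2"
    unfolding power2_norm_eq_inner inner_vec_def
    by (auto intro!: sum_mono member_le_sum)
  then show ?thesis by (simp add: power2_le_iff_abs_le)
qed

lemma norm_directional_derivative_le_jacobian:
  "norm (frechet_derivative \<phi> (at x) (axis j 1)) \<le> norm (jacobian \<phi> x)"
  using norm_column_le_norm_matrix[of "jacobian \<phi> x" j] by (simp add: jacobian_def)

lemma norm_matrix_vector_le: "norm (A *v v) \<le> norm A * norm (v :: R3)" for A :: "real ^ 3 ^ 3"
proof -
  have "(norm (A *v v))\<^sup>2 = (\<Sum>i\<in>UNIV. (A $ i \<bullet> v)\<^sup>2)"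
    unfolding power2_norm_eq_inner inner_vec_def[of "A *v v"]
    by (simp add: matrix_vector_mult_def inner_vec_def power2_eq_square)
  also have "\<dots> \<le> (\<Sum>i\<in>UNIV. (A $ i \<bullet> A $ i) * (v \<bullet> v))"
    by (intro sum_mono Cauchy_Schwarz_ineq)
  also have "\<dots> = (norm A * norm v)\<^sup>2"
    unfolding power_mult_distrib power2_norm_eq_inner inner_vec_def[of A]
    by (simp flip: sum_distrib_right)
  finally show ?thesis by (simp add: power2_le_iff_abs_le)
qed

text \<open>|F| is at most the line integral of each of its three partial derivatives, and each of
  these is independent of one coordinate. The product of their square roots bounds |F|^(3/2) and has
  the form treated by \<open>Loomis_Whitney\<close>.\<close>

theorem Gagliardo_Nirenberg_3:
  fixes F :: "R3 \<Rightarrow> real"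
  assumes D: "\<And>x. (F has_derivative D x) (at x)"
    and cont: "\<And>j. continuous_on UNIV (\<lambda>x. D x (axis j 1))"
    and C: "compact C" "\<And>x. x \<notin> C \<Longrightarrow> F x = 0"
    and le: "\<And>j x. ennreal \<bar>D x (axis j 1)\<bar> \<le> H x" and [measurable]: "H \<in> borel_measurable borel"
  shows "(\<integral>\<^sup>+x. ennreal (sqrt \<bar>F x\<bar> ^ 3))\<^sup>2 \<le> (\<integral>\<^sup>+x. H x) ^ 3"
proof -
  have D0: "D x b = 0" if "x \<notin> C" for x b
    using has_derivative_zero_off_closed[OF D compact_imp_closed[OF C(1)] C(2) that] by simp
  obtain K where K: "K > 0" "C \<subseteq> cball 0 K"
    using compact_imp_bounded[OF C(1)] unfolding bounded_pos by (auto simp: subset_iff)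
  have C0: "vec3 (a, b, c) \<notin> C" if "\<bar>a\<bar> > K \<or> \<bar>b\<bar> > K \<or> \<bar>c\<bar> > K" for a b c
  proof -
    have "\<bar>a\<bar> \<le> norm (vec3 (a, b, c))" "\<bar>b\<bar> \<le> norm (vec3 (a, b, c))" "\<bar>c\<bar> \<le> norm (vec3 (a, b, c))"
      using component_le_norm_cart[of "vec3 (a, b, c)" 1] component_le_norm_cart[of "vec3 (a, b, c)" 2]
        component_le_norm_cart[of "vec3 (a, b, c)" 3] by simp_all
    then show ?thesis using that K(2) by auto
  qed
  have contF: "continuous_on UNIV F"
    using D by (meson has_derivative_continuous_on has_derivative_at_withinI)
  have [measurable]: "F \<in> borel_measurable borel" "(\<lambda>x. D x (axis j 1)) \<in> borel_measurable borel" for j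
    using contF cont by (auto intro: borel_measurable_continuous_onI)
  have m[measurable]: "(\<lambda>z. D (vec3 z) (axis j 1)) \<in> borel_measurable (lborel \<Otimes>\<^sub>M (lborel \<Otimes>\<^sub>M lborel))" for j
    unfolding lborel_prod by measurable
  have p1: "(\<lambda>(z, a). (a, z)) \<in> (lborel \<Otimes>\<^sub>M lborel) \<Otimes>\<^sub>M lborel \<rightarrow>\<^sub>M lborel \<Otimes>\<^sub>M (lborel \<Otimes>\<^sub>M lborel)"
    by measurable
  define d where "d j x = \<bar>D x (axis j 1)\<bar>" for j x
  have dm[measurable]: "(\<lambda>(a, b, c). d j (vec3 (a, b, c))) \<in> borel_measurable (lborel \<Otimes>\<^sub>M (lborel \<Otimes>\<^sub>M lborel))" for j
    using m[of j] unfolding d_def by (simp add: case_prod_unfold)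
  have dm'[measurable]: "d j \<in> borel_measurable borel" for j
    unfolding d_def by measurable
  have dcont: "continuous_on UNIV (d j)" for j
    unfolding d_def by (intro continuous_intros cont)
  have fin: "(\<integral>\<^sup>+a. ennreal (d j (w a))) < \<infinity>"
    if "continuous_on UNIV w" "\<And>a. \<bar>a\<bar> > K \<Longrightarrow> w a \<notin> C" for j and w :: "real \<Rightarrow> R3"
  proof -
    have "integrable lborel (\<lambda>a. d j (w a))"
    proof (rule integrable_compact_support)
      show "continuous_on UNIV (\<lambda>a. d j (w a))"
        using continuous_on_compose2[OF dcont that(1)] by simp
      show "d j (w a) = 0" if "a \<notin> cball 0 K" for a
        using that \<open>\<And>a. \<bar>a\<bar> > K \<Longrightarrow> w a \<notin> C\<close>[of a] D0 by (simp add: d_def)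
    qed simp
    then show ?thesis
      by (auto simp: integrable_iff_bounded d_def)
  qed
  \<comment> \<open>The line integrals are finite by compact support; real values are taken so that
    square roots can be formed.\<close>
  define f1 where "f1 = (\<lambda>(b, c). enn2real (\<integral>\<^sup>+a. ennreal (d 1 (vec3 (a, b, c)))))"
  define f2 where "f2 = (\<lambda>(a, c). enn2real (\<integral>\<^sup>+b. ennreal (d 2 (vec3 (a, b, c)))))"
  define f3 where "f3 = (\<lambda>(a, b). enn2real (\<integral>\<^sup>+c. ennreal (d 3 (vec3 (a, b, c)))))"
  have w: "continuous_on UNIV (\<lambda>a. vec3 (a, b, c))" "continuous_on UNIV (\<lambda>b. vec3 (a, b, c))"
    "continuous_on UNIV (\<lambda>c. vec3 (a, b, c))" for a b c
    by (auto intro!: continuous_on_compose2[OF continuous_vec3] continuous_intros)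
  have e1: "ennreal (f1 (b, c)) = (\<integral>\<^sup>+a. ennreal (d 1 (vec3 (a, b, c))))" for b c
    using fin[OF w(1)[of b c], of 1] C0 by (simp add: f1_def)
  have e2: "ennreal (f2 (a, c)) = (\<integral>\<^sup>+b. ennreal (d 2 (vec3 (a, b, c))))" for a c
    using fin[OF w(2)[of a c], of 2] C0 by (simp add: f2_def)
  have e3: "ennreal (f3 (a, b)) = (\<integral>\<^sup>+c. ennreal (d 3 (vec3 (a, b, c))))" for a b
    using fin[OF w(3)[of a b], of 3] C0 by (simp add: f3_def)
  have f0: "f1 z \<ge> 0" "f2 z \<ge> 0" "f3 z \<ge> 0" for z
    by (auto simp: f1_def f2_def f3_def split: prod.split)
  have [measurable]: "f1 \<in> borel_measurable (lborel \<Otimes>\<^sub>M lborel)" "f2 \<in> borel_measurable (lborel \<Otimes>\<^sub>M lborel)"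
    "f3 \<in> borel_measurable (lborel \<Otimes>\<^sub>M lborel)"
    unfolding f1_def f2_def f3_def by measurable
  have chain: "((\<lambda>a. F (w a)) has_real_derivative D (w a) v) (at a)"
    if "(w has_derivative (\<lambda>h. h *\<^sub>R v)) (at a)" for w :: "real \<Rightarrow> R3" and v a
    using has_derivative_compose[OF that D] linear_scale[OF has_derivative_linear[OF D], of "w a" _ v]
    by (simp add: has_field_derivative_def mult_commute_abs)
  have b1: "\<bar>F (vec3 (a, b, c))\<bar> \<le> f1 (b, c)" for a b c
  proof -
    have "((\<lambda>a. F (vec3 (a, b, c))) has_real_derivative D (vec3 (a, b, c)) (axis 1 1)) (at a)" for a
      by (rule chain) (auto simp: vec3_eq intro!: derivative_eq_intros)
    moreover have "continuous_on UNIV (\<lambda>a. D (vec3 (a, b, c)) (axis 1 1))"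
      using continuous_on_compose2[OF cont w(1)] by simp
    ultimately have "ennreal \<bar>F (vec3 (a, b, c))\<bar> \<le> (\<integral>\<^sup>+a. ennreal \<bar>D (vec3 (a, b, c)) (axis 1 1)\<bar>)"
      by (rule ennreal_abs_le_integral_derivative[where M = K and f = "\<lambda>a. F (vec3 (a, b, c))"])
        (use C(2) C0 in auto)
    then show ?thesis
      using e1[of b c] f0 by (simp add: d_def flip: ennreal_le_iff)
  qed
  have b2: "\<bar>F (vec3 (a, b, c))\<bar> \<le> f2 (a, c)" for a b c
  proof -
    have "((\<lambda>b. F (vec3 (a, b, c))) has_real_derivative D (vec3 (a, b, c)) (axis 2 1)) (at b)" for b
      by (rule chain) (auto simp: vec3_eq intro!: derivative_eq_intros)
    moreover have "continuous_on UNIV (\<lambda>b. D (vec3 (a, b, c)) (axis 2 1))"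
      using continuous_on_compose2[OF cont w(2)] by simp
    ultimately have "ennreal \<bar>F (vec3 (a, b, c))\<bar> \<le> (\<integral>\<^sup>+b. ennreal \<bar>D (vec3 (a, b, c)) (axis 2 1)\<bar>)"
      by (rule ennreal_abs_le_integral_derivative[where M = K and f = "\<lambda>b. F (vec3 (a, b, c))"])
        (use C(2) C0 in auto)
    then show ?thesis
      using e2[of a c] f0 by (simp add: d_def flip: ennreal_le_iff)
  qed
  have b3: "\<bar>F (vec3 (a, b, c))\<bar> \<le> f3 (a, b)" for a b c
  proof -
    have "((\<lambda>c. F (vec3 (a, b, c))) has_real_derivative D (vec3 (a, b, c)) (axis 3 1)) (at c)" for c
      by (rule chain) (auto simp: vec3_eq intro!: derivative_eq_intros)
    moreover have "continuous_on UNIV (\<lambda>c. D (vec3 (a, b, c)) (axis 3 1))"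
      using continuous_on_compose2[OF cont w(3)] by simp
    ultimately have "ennreal \<bar>F (vec3 (a, b, c))\<bar> \<le> (\<integral>\<^sup>+c. ennreal \<bar>D (vec3 (a, b, c)) (axis 3 1)\<bar>)"
      by (rule ennreal_abs_le_integral_derivative[where M = K and f = "\<lambda>c. F (vec3 (a, b, c))"])
        (use C(2) C0 in auto)
    then show ?thesis
      using e3[of a b] f0 by (simp add: d_def flip: ennreal_le_iff)
  qed
  define g1 where "g1 z = ennreal (sqrt (f1 z))" for z
  define g2 where "g2 z = ennreal (sqrt (f2 z))" for z
  define g3 where "g3 z = ennreal (sqrt (f3 z))" for z
  have [measurable]: "g1 \<in> borel_measurable (lborel \<Otimes>\<^sub>M lborel)" "g2 \<in> borel_measurable (lborel \<Otimes>\<^sub>M lborel)"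
    "g3 \<in> borel_measurable (lborel \<Otimes>\<^sub>M lborel)"
    unfolding g1_def g2_def g3_def by measurable
  have sq: "(g1 z)\<^sup>2 = ennreal (f1 z)" "(g2 z)\<^sup>2 = ennreal (f2 z)" "(g3 z)\<^sup>2 = ennreal (f3 z)" for z
    using f0[of z] by (simp_all add: g1_def g2_def g3_def ennreal_power)
  have "(\<integral>\<^sup>+x. ennreal (sqrt \<bar>F x\<bar> ^ 3)) =
      (\<integral>\<^sup>+c. \<integral>\<^sup>+b. \<integral>\<^sup>+a. ennreal (sqrt \<bar>F (vec3 (a, b, c))\<bar> ^ 3))"
    by (rule nn_integral_R3) measurable
  also have "\<dots> \<le> (\<integral>\<^sup>+c. \<integral>\<^sup>+b. \<integral>\<^sup>+a. g1 (b, c) * (g2 (a, c) * g3 (a, b)))"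
  proof (intro nn_integral_mono)
    fix a b c
    have "sqrt \<bar>F (vec3 (a, b, c))\<bar> ^ 3 \<le> sqrt (f1 (b, c)) * (sqrt (f2 (a, c)) * sqrt (f3 (a, b)))"
      unfolding power3_eq_cube mult.assoc using b1 b2 b3 f0
      by (intro mult_mono) auto
    then show "ennreal (sqrt \<bar>F (vec3 (a, b, c))\<bar> ^ 3) \<le> g1 (b, c) * (g2 (a, c) * g3 (a, b))"
      using f0 by (simp add: g1_def g2_def g3_def ennreal_mult[symmetric])
  qed
  finally have "(\<integral>\<^sup>+x. ennreal (sqrt \<bar>F x\<bar> ^ 3))\<^sup>2 \<le>
      (\<integral>\<^sup>+c. \<integral>\<^sup>+b. \<integral>\<^sup>+a. g1 (b, c) * (g2 (a, c) * g3 (a, b)))\<^sup>2"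
    by (rule power_mono) simp
  also have "\<dots> \<le> (\<integral>\<^sup>+c. \<integral>\<^sup>+b. (g1 (b, c))\<^sup>2) * (\<integral>\<^sup>+c. \<integral>\<^sup>+a. (g2 (a, c))\<^sup>2) *
      (\<integral>\<^sup>+b. \<integral>\<^sup>+a. (g3 (a, b))\<^sup>2)"
    by (rule Loomis_Whitney) measurable
  also have "(\<integral>\<^sup>+c. \<integral>\<^sup>+b. (g1 (b, c))\<^sup>2) = (\<integral>\<^sup>+x. ennreal (d 1 x))"
    by (simp add: sq e1 nn_integral_R3)
  also have "(\<integral>\<^sup>+c. \<integral>\<^sup>+a. (g2 (a, c))\<^sup>2) = (\<integral>\<^sup>+x. ennreal (d 2 x))"
    unfolding sq e2
    by (subst lborel_pair.Fubini') (auto simp: nn_integral_R3)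
  also have "(\<integral>\<^sup>+b. \<integral>\<^sup>+a. (g3 (a, b))\<^sup>2) = (\<integral>\<^sup>+x. ennreal (d 3 x))"
  proof -
    have "(\<integral>\<^sup>+b. \<integral>\<^sup>+a. (g3 (a, b))\<^sup>2) =
        (\<integral>\<^sup>+b. \<integral>\<^sup>+c. \<integral>\<^sup>+a. ennreal (d 3 (vec3 (a, b, c))))"
      unfolding sq e3 by (intro nn_integral_cong lborel_pair.Fubini') measurable
    also have "\<dots> = (\<integral>\<^sup>+c. \<integral>\<^sup>+b. \<integral>\<^sup>+a. ennreal (d 3 (vec3 (a, b, c))))"
      by (intro lborel_pair.Fubini') measurable
    finally show ?thesis by (simp add: nn_integral_R3)
  qed
  also have "(\<integral>\<^sup>+x. ennreal (d 1 x)) * (\<integral>\<^sup>+x. ennreal (d 2 x)) * (\<integral>\<^sup>+x. ennreal (d 3 x))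
      \<le> (\<integral>\<^sup>+x. H x) ^ 3"
    unfolding power3_eq_cube d_def
    by (intro mult_mono nn_integral_mono le) auto
  finally show ?thesis .
qed

lemma test_function_has_derivative:
  "test_function S \<phi> \<Longrightarrow> (\<phi> has_derivative frechet_derivative \<phi> (at x)) (at x)"
  unfolding test_function_def by (meson UNIV_I open_UNIV smooth_on_has_derivative)

lemma test_function_continuous: "test_function S \<phi> \<Longrightarrow> continuous_on UNIV \<phi>"
  by (meson has_derivative_continuous_on has_derivative_at_withinI test_function_has_derivative)

lemma test_function_continuous_deriv:
  "test_function S \<phi> \<Longrightarrow> b \<in> Basis \<Longrightarrow> continuous_on UNIV (\<lambda>x. frechet_derivative \<phi> (at x) b)"
  unfolding test_function_def by (elim conjE) (rule smooth_on_continuous_deriv)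

lemma continuous_jacobian:
  assumes "test_function S \<phi>"
  shows "continuous_on UNIV (jacobian \<phi>)"
  unfolding jacobian_def
  using test_function_continuous_deriv[OF assms, of "axis _ 1"]
  by (auto simp: axis_in_Basis_iff intro!: continuous_intros)

lemma jacobian_zero:
  assumes "(\<phi> has_derivative frechet_derivative \<phi> (at x)) (at x)" "closed C" "\<And>x. x \<notin> C \<Longrightarrow> \<phi> x = 0" "x \<notin> C"
  shows "jacobian \<phi> x = 0"
  using has_derivative_zero_off_closed[OF assms] by (simp add: jacobian_def vec_eq_iff)

lemma jacobian_mult_vec:
  assumes "(\<phi> has_derivative frechet_derivative \<phi> (at x)) (at x)"
  shows "frechet_derivative \<phi> (at x) v = jacobian \<phi> x *v v"
proof -
  have "frechet_derivative \<phi> (at x) v = frechet_derivative \<phi> (at x) (\<Sum>j\<in>UNIV. v $ j *\<^sub>R axis j 1)"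
    by (simp add: basis_expansion flip: scalar_mult_eq_scaleR)
  also have "\<dots> = (\<Sum>j\<in>UNIV. v $ j *\<^sub>R frechet_derivative \<phi> (at x) (axis j 1))"
    using has_derivative_linear[OF assms] by (simp add: linear_sum linear_scale)
  also have "\<dots> = jacobian \<phi> x *v v"
    by (simp add: vec_eq_iff jacobian_def matrix_vector_mult_def mult.commute)
  finally show ?thesis .
qed

text \<open>\<open>Gagliardo_Nirenberg_3\<close> is applied to |\<phi>|^4, written as a polynomial
  so that zeros of \<phi> do no harm. With X the integral of |\<phi>|^6, A that of the squared
  gradient and I that of 4 |\<phi>|^3 times the gradient norm, this gives X^2 \<le> I^3 and I^2
  \<le> 16 X A, hence X^4 \<le> 4096 X^3 A^3. Compact support makes X finite, so that X^3 can be
  cancelled.\<close>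

theorem Sobolev_test_function:
  assumes \<phi>: "test_function S \<phi>"
  shows "(\<integral>\<^sup>+x. ennreal (norm (\<phi> x) ^ 6)) \<le>
    4096 * (\<integral>\<^sup>+x. ennreal ((norm (jacobian \<phi> x))\<^sup>2)) ^ 3"
proof -
  obtain C where C: "compact C" "\<And>x. x \<notin> C \<Longrightarrow> \<phi> x = 0"
    using \<phi> unfolding test_function_def by blast
  note D = test_function_has_derivative[OF \<phi>]
  have cont: "continuous_on UNIV \<phi>" "continuous_on UNIV (jacobian \<phi>)"
    "continuous_on UNIV (\<lambda>x. frechet_derivative \<phi> (at x) (axis j 1))" for j
    using test_function_continuous[OF \<phi>] continuous_jacobian[OF \<phi>] test_function_continuous_deriv[OF \<phi>]
    by (auto simp: axis_in_Basis_iff)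
  have [measurable]: "\<phi> \<in> borel_measurable borel" "jacobian \<phi> \<in> borel_measurable borel"
    using cont by (auto intro: borel_measurable_continuous_onI)
  have jac0: "jacobian \<phi> x = 0" if "x \<notin> C" for x
    using jacobian_zero[OF D compact_imp_closed[OF C(1)] C(2) that] .
  define F where "F x = (\<phi> x \<bullet> \<phi> x)\<^sup>2" for x
  define DF where "DF x v = 4 * (\<phi> x \<bullet> \<phi> x) * (\<phi> x \<bullet> frechet_derivative \<phi> (at x) v)" for x v
  define H where "H x = ennreal (4 * norm (\<phi> x) ^ 3 * norm (jacobian \<phi> x))" for x
  have DF: "(F has_derivative DF x) (at x)" for x
    unfolding F_def DF_def
    by (auto intro!: derivative_eq_intros D simp: inner_commute algebra_simps)
  have leH: "ennreal \<bar>DF x (axis j 1)\<bar> \<le> H x" for j x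
  proof -
    have "\<bar>DF x (axis j 1)\<bar> = 4 * (norm (\<phi> x))\<^sup>2 * \<bar>\<phi> x \<bullet> frechet_derivative \<phi> (at x) (axis j 1)\<bar>"
      by (simp add: DF_def abs_mult power2_norm_eq_inner)
    also have "\<dots> \<le> 4 * (norm (\<phi> x))\<^sup>2 * (norm (\<phi> x) * norm (jacobian \<phi> x))"
      by (intro mult_left_mono order_trans[OF Cauchy_Schwarz_ineq2] norm_directional_derivative_le_jacobian)
        auto
    finally show ?thesis
      by (simp add: H_def power3_eq_cube power2_eq_square mult.assoc)
  qed
  define X where "X = (\<integral>\<^sup>+x. ennreal (norm (\<phi> x) ^ 6))"
  define A where "A = (\<integral>\<^sup>+x. ennreal ((norm (jacobian \<phi> x))\<^sup>2))"
  define I where "I = (\<integral>\<^sup>+x. H x)"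
  have "sqrt \<bar>F x\<bar> ^ 3 = norm (\<phi> x) ^ 6" for x
  proof -
    have "sqrt \<bar>F x\<bar> = (norm (\<phi> x))\<^sup>2"
      unfolding F_def power2_norm_eq_inner by (simp only: abs_power2 real_sqrt_abs abs_of_nonneg inner_ge_zero)
    then have "sqrt \<bar>F x\<bar> ^ 3 = ((norm (\<phi> x))\<^sup>2) ^ 3" by (simp only:)
    also have "\<dots> = norm (\<phi> x) ^ (2 * 3)" by (rule power_mult[symmetric])
    finally show ?thesis by simp
  qed
  then have "X = (\<integral>\<^sup>+x. ennreal (sqrt \<bar>F x\<bar> ^ 3))"
    unfolding X_def by (simp only:)
  moreover have "(\<integral>\<^sup>+x. ennreal (sqrt \<bar>F x\<bar> ^ 3))\<^sup>2 \<le> I ^ 3"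
    unfolding I_def
  proof (rule Gagliardo_Nirenberg_3[OF DF _ C(1) _ leH])
    show "continuous_on UNIV (\<lambda>x. DF x (axis j 1))" for j
      unfolding DF_def by (intro continuous_intros cont)
    show "H \<in> borel_measurable borel" unfolding H_def by measurable
  qed (use C(2) in \<open>simp add: F_def\<close>)
  ultimately have 1: "X\<^sup>2 \<le> I ^ 3" by (simp only:)
  have "I = (\<integral>\<^sup>+x. 4 * (ennreal (norm (\<phi> x) ^ 3) * ennreal (norm (jacobian \<phi> x))))"
    unfolding I_def H_def
    by (intro nn_integral_cong) (simp add: ennreal_mult mult.assoc)
  also have "\<dots> = 4 * (\<integral>\<^sup>+x. ennreal (norm (\<phi> x) ^ 3) * ennreal (norm (jacobian \<phi> x)))"
    by (rule nn_integral_cmult) measurable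
  finally have "I\<^sup>2 \<le> 16 * ((\<integral>\<^sup>+x. ennreal (norm (\<phi> x) ^ 3) ^ 2) * (\<integral>\<^sup>+x. ennreal (norm (jacobian \<phi> x)) ^ 2))"
    by (simp add: power_mult_distrib Cauchy_Schwarz_nn_integral mult_left_mono)
  then have 2: "I\<^sup>2 \<le> 16 * (X * A)"
    by (simp add: X_def A_def ennreal_power flip: power_mult)
  have "X < \<infinity>" "A < \<infinity>"
  proof -
    have "integrable lborel (\<lambda>x. norm (\<phi> x) ^ 6)" "integrable lborel (\<lambda>x. (norm (jacobian \<phi> x))\<^sup>2)"
      by (rule integrable_compact_support[OF _ C(1)]; use cont C(2) jac0 in \<open>auto intro!: continuous_intros\<close>)+
    then show "X < \<infinity>" "A < \<infinity>"
      by (auto simp: integrable_iff_bounded X_def A_def)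
  qed
  then obtain x a where xa: "x \<ge> 0" "a \<ge> 0" "X = ennreal x" "A = ennreal a"
    by (metis ennreal_cases less_irrefl infinity_ennreal_def)
  have I: "I < \<infinity>"
    using 2 xa by (cases I) (auto simp: ennreal_mult[symmetric] top_unique ennreal_top_eq_mult_iff simp flip: ennreal_numeral)
  then obtain i where i: "i \<ge> 0" "I = ennreal i"
    by (metis ennreal_cases less_irrefl infinity_ennreal_def)
  have r1: "x\<^sup>2 \<le> i ^ 3" using 1 xa i by (simp add: ennreal_power)
  have r2: "i\<^sup>2 \<le> 16 * (x * a)"
    using 2 xa i by (simp add: ennreal_power ennreal_mult[symmetric] flip: ennreal_numeral)
  have "x * x ^ 3 = (x\<^sup>2)\<^sup>2" by algebra
  also have "\<dots> \<le> (i ^ 3)\<^sup>2" by (rule power_mono[OF r1]) simp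
  also have "\<dots> = (i\<^sup>2) ^ 3" by algebra
  also have "\<dots> \<le> (16 * (x * a)) ^ 3" by (rule power_mono[OF r2]) simp
  also have "\<dots> = (4096 * a ^ 3) * x ^ 3" by algebra
  finally have "x \<le> 4096 * a ^ 3"
    using xa by (cases "x = 0") (auto simp: mult_le_cancel_right)
  then have "ennreal x \<le> ennreal (4096 * a ^ 3)" using xa by (intro ennreal_leI) auto
  also have "\<dots> = 4096 * ennreal a ^ 3"
    using xa by (simp add: ennreal_mult ennreal_power)
  finally show ?thesis
    using xa unfolding X_def A_def by simp
qed

section \<open>Continuity of translations and singular kernels\<close>

lemma integrable_lborel_translate:
  fixes f :: "'a::euclidean_space \<Rightarrow> 'b::{banach, second_countable_topology}"
  assumes "integrable lborel f"
  shows "integrable lborel (\<lambda>x. f (x + c))"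
proof -
  have "integrable (distr lborel borel ((+) c)) f"
    using assms by (simp only: lborel_distr_plus)
  then show ?thesis
    by (subst (asm) integrable_distr_eq) (use assms in \<open>auto simp: add.commute\<close>)
qed

lemma integral_lborel_translate:
  fixes f :: "'a::euclidean_space \<Rightarrow> 'b::{banach, second_countable_topology}"
  assumes "f \<in> borel_measurable borel"
  shows "(\<integral>x. f (x + c)) = (\<integral>x. f x)"
proof -
  have "(\<integral>x. f x) = (\<integral>x. f x \<partial>distr lborel borel ((+) c))"
    by (simp only: lborel_distr_plus)
  also have "\<dots> = (\<integral>x. f (x + c))"
    by (subst integral_distr) (use assms in \<open>auto simp: add.commute\<close>)
  finally show ?thesis by simp
qed

lemma nn_integral_lborel_scale:
  fixes f :: "'a::euclidean_space \<Rightarrow> ennreal"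
  assumes [measurable]: "f \<in> borel_measurable borel" and "c > 0"
  shows "(\<integral>\<^sup>+x. f x) = (\<integral>\<^sup>+x. ennreal (c ^ DIM('a)) * f (t + c *\<^sub>R x))"
  using assms
  by (subst lborel_affine[of c t])
    (auto simp: nn_integral_density nn_integral_distr nn_integral_cmult)

lemma nn_integral_lborel_reflect:
  fixes h :: "'a::euclidean_space \<Rightarrow> ennreal"
  assumes [measurable]: "h \<in> borel_measurable borel"
  shows "(\<integral>\<^sup>+y. h (x - y)) = (\<integral>\<^sup>+y. h y)"
proof -
  have "(\<integral>\<^sup>+y. h y) = (\<integral>\<^sup>+y. h (x + (- 1) *\<^sub>R y))"
    by (subst lborel_affine[of "- 1" x]) (auto simp: nn_integral_density nn_integral_distr)
  then show ?thesis by simp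
qed

text \<open>Induction over integrable functions reduces the claim to indicators of sets of finite
  measure, where outer regularity replaces the set by an open one: for an open set the indicator is
  eventually 1 along the shifts of each of its points.\<close>

lemma translation_continuous_L1:
  fixes f :: "'a::euclidean_space \<Rightarrow> real"
  assumes "integrable lborel f" and h: "h \<longlonglongrightarrow> (0 :: 'a)"
  shows "(\<lambda>n. \<integral>x. \<bar>f (x + h n) - f x\<bar>) \<longlonglongrightarrow> 0"
  using assms(1)
proof (induction rule: integrable_induct)
  case (base S c)
  have S: "S \<in> sets borel" "emeasure lborel S < \<infinity>" using base by auto
  note [measurable] = S(1)
  define i :: "nat \<Rightarrow> real" where "i n = (\<integral>x. \<bar>indicator S (x + h n) - indicator S x\<bar>)" for n
  have intS: "integrable lborel (\<lambda>x. indicator S x :: real)"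
    using base by (simp add: integrable_indicator_iff)
  have "i \<longlonglongrightarrow> 0"
  proof (rule LIMSEQ_I)
    fix e :: real assume "e > 0"
    obtain U where U: "open U" "S \<subseteq> U" "U - S \<in> lmeasurable" "emeasure lebesgue (U - S) < ennreal (e / 4)"
      using sets_lebesgue_outer_open[of S "e / 4"] S \<open>e > 0\<close> by (auto simp: sets_completionI_sets)
    have Um[measurable]: "U \<in> sets borel" using U by auto
    have eU: "emeasure lborel (U - S) < ennreal (e / 4)" using U by simp
    have intU: "integrable lborel (\<lambda>x. indicator (U - S) x :: real)"
      using eU by (simp add: integrable_indicator_iff order_less_trans)
    have mU: "(\<integral>x. indicator (U - S) x) < e / 4"
    proof -
      have "emeasure lborel (U - S) = ennreal (measure lborel (U - S))"
        using eU by (intro emeasure_eq_ennreal_measure) auto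
      then show ?thesis using eU \<open>e > 0\<close> by (simp add: ennreal_less_iff)
    qed
    have lim: "(\<lambda>n. \<integral>x. indicator S x * (1 - indicator U (x + h n))) \<longlonglongrightarrow> (\<integral>x. 0 \<partial>(lborel :: 'a measure) :: real)"
    proof (rule integral_dominated_convergence[where w = "\<lambda>x. indicator S x :: real"])
      show "AE x in lborel. (\<lambda>n. indicator S x * (1 - indicator U (x + h n)) :: real) \<longlonglongrightarrow> 0"
      proof (rule AE_I2)
        fix x
        show "(\<lambda>n. indicator S x * (1 - indicator U (x + h n)) :: real) \<longlonglongrightarrow> 0"
        proof (cases "x \<in> S")
          case True
          have "(\<lambda>n. x + h n) \<longlonglongrightarrow> x + 0" by (intro tendsto_intros h)
          then have "\<forall>\<^sub>F n in sequentially. x + h n \<in> U"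
            using U True by (auto intro: topological_tendstoD)
          then have "\<forall>\<^sub>F n in sequentially. indicator S x * (1 - indicator U (x + h n)) = (0 :: real)"
            by (rule eventually_mono) simp
          then show ?thesis by (rule tendsto_eventually)
        qed simp
      qed
      show "AE x in lborel. norm (indicator S x * (1 - indicator U (x + h n)) :: real) \<le> indicator S x" for n
        by (auto simp: indicator_def)
    qed (use intS in auto)
    then obtain N where N: "\<And>n. n \<ge> N \<Longrightarrow> (\<integral>x. indicator S x * (1 - indicator U (x + h n))) < e / 4"
      using \<open>e > 0\<close> order_tendstoD(2)[OF lim, of "e / 4"] by (auto simp: eventually_sequentially)
    show "\<exists>N. \<forall>n\<ge>N. norm (i n - 0) < e"
    proof (intro exI allI impI)
      fix n assume n: "n \<ge> N"
      have i1: "integrable lborel (\<lambda>x. indicator S x * (1 - indicator U (x + h n)) :: real)"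
        by (rule Bochner_Integration.integrable_bound[OF intS]) (auto simp: indicator_def)
      note i2 = integrable_lborel_translate[OF intU, of "h n"]
      note i3 = integrable_lborel_translate[OF intS, of "h n"]
      \<comment> \<open>For indicators |a - b| = (a - b) + 2 b (1 - a). With a shifted and b not,
        the first summand integrates to zero, and 1 - a splits into the complement of
        \<open>U\<close> and the small set \<open>U - S\<close>.\<close>
      have "i n \<le> (\<integral>x. (indicator S (x + h n) - indicator S x) +
          (2 * (indicator S x * (1 - indicator U (x + h n))) + 2 * indicator (U - S) (x + h n)))"
        unfolding i_def
      proof (rule integral_mono)
        show "integrable lborel (\<lambda>x. \<bar>indicator S (x + h n) - indicator S x\<bar> :: real)"
          using i3 intS by auto
        show "integrable lborel (\<lambda>x. (indicator S (x + h n) - indicator S x) +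
          (2 * (indicator S x * (1 - indicator U (x + h n))) + 2 * indicator (U - S) (x + h n)) :: real)"
          using i1 i2 i3 intS by auto
      qed (use U(2) in \<open>auto simp: indicator_def\<close>)
      also have "\<dots> = ((\<integral>x. indicator S (x + h n)) - (\<integral>x. indicator S x)) +
          (2 * (\<integral>x. indicator S x * (1 - indicator U (x + h n))) +
           2 * (\<integral>x. indicator (U - S) (x + h n)))"
        using i1 i2 i3 intS by simp
      also have "(\<integral>x. indicator S (x + h n)) = (\<integral>x. indicator S x \<partial>lborel :: real)"
        by (rule integral_lborel_translate) measurable
      also have "(\<integral>x. indicator (U - S) (x + h n)) = (\<integral>x. indicator (U - S) x \<partial>lborel :: real)"
        by (rule integral_lborel_translate) measurable
      finally have "i n < e" using N[OF n] mU by linarith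
      moreover have "i n \<ge> 0" unfolding i_def by simp
      ultimately show "norm (i n - 0) < e" by simp
    qed
  qed
  then have "(\<lambda>n. i n * \<bar>c\<bar>) \<longlonglongrightarrow> 0 * \<bar>c\<bar>" by (intro tendsto_intros)
  moreover have "(\<integral>x. \<bar>indicator S (x + h n) *\<^sub>R c - indicator S x *\<^sub>R c\<bar>) = i n * \<bar>c\<bar>" for n
    unfolding i_def by (simp add: abs_mult flip: left_diff_distrib)
  ultimately show ?case by simp
next
  case (add f g)
  note [simp] = integrable_lborel_translate[OF add.hyps(1)] integrable_lborel_translate[OF add.hyps(2)] add.hyps
  have "(\<lambda>n. (\<integral>x. \<bar>f (x + h n) - f x\<bar>) + (\<integral>x. \<bar>g (x + h n) - g x\<bar>)) \<longlonglongrightarrow> 0 + 0"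
    by (intro tendsto_intros add.IH)
  then have *: "(\<lambda>n. (\<integral>x. \<bar>f (x + h n) - f x\<bar> + \<bar>g (x + h n) - g x\<bar>)) \<longlonglongrightarrow> 0"
    by (simp)
  have le: "(\<integral>x. \<bar>f (x + h n) + g (x + h n) - (f x + g x)\<bar>) \<le>
      (\<integral>x. \<bar>f (x + h n) - f x\<bar> + \<bar>g (x + h n) - g x\<bar>)" for n
    by (rule integral_mono) auto
  show ?case
  proof (rule tendsto_sandwich[OF _ _ tendsto_const *])
    show "\<forall>\<^sub>F n in sequentially. 0 \<le> (\<integral>x. \<bar>f (x + h n) + g (x + h n) - (f x + g x)\<bar>)"
      by simp
    show "\<forall>\<^sub>F n in sequentially. (\<integral>x. \<bar>f (x + h n) + g (x + h n) - (f x + g x)\<bar>) \<le>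
      (\<integral>x. \<bar>f (x + h n) - f x\<bar> + \<bar>g (x + h n) - g x\<bar>)"
      by (rule always_eventually) (rule allI, rule le)
  qed
next
  case (lim f s)
  have sf: "(\<lambda>i. \<integral>x. \<bar>s i x - f x\<bar>) \<longlonglongrightarrow> (\<integral>x. 0 \<partial>(lborel :: 'a measure))"
  proof (rule integral_dominated_convergence[where w = "\<lambda>x. 3 * norm (f x)"])
    show "AE x in lborel. (\<lambda>i. \<bar>s i x - f x\<bar>) \<longlonglongrightarrow> 0"
      using lim.hyps(2) by (auto simp: tendsto_rabs_zero_iff LIM_zero_iff)
    show "AE x in lborel. norm \<bar>s i x - f x\<bar> \<le> 3 * norm (f x)" for i
    proof (rule AE_I2)
      fix x
      show "norm \<bar>s i x - f x\<bar> \<le> 3 * norm (f x)"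
        using lim.hyps(3)[of x i] by simp
    qed
  qed (use lim.hyps(1,4) in auto)
  show ?case
  proof (rule LIMSEQ_I)
    fix e :: real assume "e > 0"
    then obtain i where i: "(\<integral>x. \<bar>s i x - f x\<bar>) < e / 4"
      using order_tendstoD(2)[OF sf, of "e / 4"] by (auto simp: eventually_sequentially)
    obtain N where N: "\<And>n. n \<ge> N \<Longrightarrow> (\<integral>x. \<bar>s i (x + h n) - s i x\<bar>) < e / 4"
      using order_tendstoD(2)[OF lim.IH[of i], of "e / 4"] \<open>e > 0\<close> by (auto simp: eventually_sequentially)
    have "norm ((\<integral>x. \<bar>f (x + h n) - f x\<bar>) - 0) < e" if "n \<ge> N" for n
    proof -
      have [measurable]: "s i \<in> borel_measurable borel" "f \<in> borel_measurable borel"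
        using borel_measurable_integrable[OF lim.hyps(1)] borel_measurable_integrable[OF lim.hyps(4)] by auto
      note [simp] = lim.hyps(1,4) integrable_lborel_translate[OF lim.hyps(1)] integrable_lborel_translate[OF lim.hyps(4)]
      have "(\<integral>x. \<bar>f (x + h n) - f x\<bar>) \<le>
          (\<integral>x. \<bar>s i (x + h n) - f (x + h n)\<bar> + (\<bar>s i (x + h n) - s i x\<bar> + \<bar>s i x - f x\<bar>))"
        by (rule integral_mono) auto
      also have "\<dots> = (\<integral>x. \<bar>s i (x + h n) - f (x + h n)\<bar>) +
          ((\<integral>x. \<bar>s i (x + h n) - s i x\<bar>) + (\<integral>x. \<bar>s i x - f x\<bar>))"
        by simp
      also have "(\<integral>x. \<bar>s i (x + h n) - f (x + h n)\<bar>) = (\<integral>x. \<bar>s i x - f x\<bar>)"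
        by (rule integral_lborel_translate[of "\<lambda>x. \<bar>s i x - f x\<bar>"]) measurable
      finally show ?thesis using i N[OF that] \<open>e > 0\<close> by (simp)
    qed
    then show "\<exists>N. \<forall>n\<ge>N. norm ((\<integral>x. \<bar>f (x + h n) - f x\<bar>) - 0) < e" by blast
  qed
qed

section \<open>Integrability of singular kernels over dyadic shells\<close>

lemma dyadic_shell:
  fixes D r :: real
  assumes "0 < r" "r \<le> D"
  obtains j :: nat where "D / 2 ^ Suc j < r" "r \<le> D / 2 ^ j"
proof -
  obtain n where n: "D / r < 2 ^ n"
    using real_arch_pow[of 2 "D / r"] by auto
  define j where "j = (LEAST n. D / 2 ^ Suc n < r)"
  have ex: "D / 2 ^ Suc n < r"
    using n assms by (simp add: field_simps)
  have 1: "D / 2 ^ Suc j < r" unfolding j_def by (rule LeastI[of _ n]) (rule ex)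
  have "r \<le> D / 2 ^ j"
  proof (cases j)
    case 0
    then show ?thesis using assms by simp
  next
    case (Suc k)
    then have "\<not> D / 2 ^ Suc k < r" unfolding j_def using not_less_Least[of k "\<lambda>n. D / 2 ^ Suc n < r"] by simp
    then show ?thesis using Suc by simp
  qed
  with 1 show ?thesis by (rule that)
qed

lemma suminf_ge:
  fixes F :: "nat \<Rightarrow> ennreal"
  shows "F j \<le> (\<Sum>i. F i)"
  using sum_le_suminf[of F "{j}"] by simp

text \<open>Each shell is enlarged to the ball around it, whose volume is a constant times 8^(-j).
  The overlap costs only a constant, and no polar coordinates are needed.\<close>

lemma nn_integral_dyadic_finite:
  fixes g :: "R3 \<Rightarrow> ennreal"
  assumes "D > 0" and [measurable]: "g \<in> borel_measurable borel"
    and le: "\<And>j x. D / 2 ^ Suc j < norm x \<Longrightarrow> norm x \<le> D / 2 ^ j \<Longrightarrow> g x \<le> ennreal (c j)"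
    and c: "\<And>j. c j \<ge> 0" "summable (\<lambda>j. c j / 8 ^ j)"
  shows "(\<integral>\<^sup>+x. g x * indicator (cball 0 D) x) < \<infinity>"
proof -
  define V where "V = unit_ball_vol 3 * D ^ 3"
  have V: "V \<ge> 0" using assms(1) by (simp add: V_def)
  have "(\<integral>\<^sup>+x. g x * indicator (cball 0 D) x) \<le>
      (\<integral>\<^sup>+x. (\<Sum>j. ennreal (c j) * indicator (cball 0 (D / 2 ^ j)) x) \<partial>(lborel :: R3 measure))"
  proof (rule nn_integral_mono_AE)
    have "AE x in lborel. x \<noteq> (0 :: R3)"
      by (rule AE_lborel_singleton)
    then show "AE x in lborel. g x * indicator (cball 0 D) x \<le>
        (\<Sum>j. ennreal (c j) * indicator (cball 0 (D / 2 ^ j)) x)"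
    proof eventually_elim
      fix x :: R3 assume x: "x \<noteq> 0"
      show "g x * indicator (cball 0 D) x \<le> (\<Sum>j. ennreal (c j) * indicator (cball 0 (D / 2 ^ j)) x)"
      proof (cases "norm x \<le> D")
        case True
        then obtain j where j: "D / 2 ^ Suc j < norm x" "norm x \<le> D / 2 ^ j"
          using dyadic_shell[of "norm x" D] x by auto
        have "g x * indicator (cball 0 D) x \<le> ennreal (c j) * indicator (cball 0 (D / 2 ^ j)) x"
          using le[OF j] True j by simp
        also have "\<dots> \<le> (\<Sum>j. ennreal (c j) * indicator (cball 0 (D / 2 ^ j)) x)"
          by (rule suminf_ge[of "\<lambda>j. ennreal (c j) * indicator (cball 0 (D / 2 ^ j)) x"])
        finally show ?thesis .
      qed simp
    qed
  qed
  also have "\<dots> = (\<Sum>j. \<integral>\<^sup>+x. ennreal (c j) * indicator (cball 0 (D / 2 ^ j)) x \<partial>(lborel :: R3 measure))"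
    by (intro nn_integral_suminf borel_measurable_times_ennreal borel_measurable_indicator
        borel_measurable_const) auto
  also have "\<dots> = (\<Sum>j. ennreal (V * (c j / 8 ^ j)))"
  proof (intro suminf_cong)
    fix j
    have "(\<integral>\<^sup>+x. ennreal (c j) * indicator (cball 0 (D / 2 ^ j)) x \<partial>(lborel :: R3 measure)) =
        ennreal (c j) * ennreal (unit_ball_vol 3 * (D / 2 ^ j) ^ 3)"
      using assms(1) by (subst nn_integral_cmult_indicator) (simp_all add: emeasure_cball)
    also have "\<dots> = ennreal (c j * (unit_ball_vol 3 * (D / 2 ^ j) ^ 3))"
      using c assms(1) by (intro ennreal_mult[symmetric]) auto
    also have "c j * (unit_ball_vol 3 * (D / 2 ^ j) ^ 3) = V * (c j / 8 ^ j)"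
    proof -
      have "((2::real) ^ j) ^ 3 = 8 ^ j"
        by (simp flip: power_mult add: mult.commute[of j]) (simp add: power_mult)
      then show ?thesis by (simp add: V_def power_divide)
    qed
    finally show "(\<integral>\<^sup>+x. ennreal (c j) * indicator (cball 0 (D / 2 ^ j)) x \<partial>(lborel :: R3 measure)) =
      ennreal (V * (c j / 8 ^ j))" .
  qed
  also have "\<dots> < \<infinity>"
    using c V summable_mult[OF c(2), of V]
    by (subst suminf_ennreal2) auto
  finally show ?thesis .
qed

lemma powr_kernel_integrable:
  assumes "D > 0" "0 \<le> p" "p < 3"
  shows "(\<integral>\<^sup>+x. ennreal (norm x powr (- p)) * indicator (cball 0 D) x \<partial>(lborel :: R3 measure)) < \<infinity>"
proof (rule nn_integral_dyadic_finite)
  show "ennreal (norm x powr (- p)) \<le> ennreal ((D / 2 ^ Suc j) powr (- p))"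
    if "D / 2 ^ Suc j < norm x" for j and x :: R3
  proof -
    have "norm x powr (- p) \<le> (D / 2 ^ Suc j) powr (- p)"
      using that assms by (intro powr_mono2') (auto intro!: divide_pos_pos)
    then show ?thesis by (rule ennreal_leI)
  qed
  have "(2::real) powr p < 2 powr 3" using assms by (intro powr_less_mono) auto
  then have sm: "summable (\<lambda>j. (D / 2) powr (- p) * (2 powr p / 8) ^ j)"
    by (intro summable_mult summable_geometric) simp
  moreover have "(D / 2 ^ Suc j) powr (- p) / 8 ^ j = (D / 2) powr (- p) * (2 powr p / 8) ^ j" for j
  proof -
    have "(D / 2 ^ Suc j) powr (- p) = (D / 2) powr (- p) * ((1 / 2) ^ j) powr (- p)"
      using assms by (simp flip: powr_mult add: power_divide)
    also have "((1 / 2 :: real) ^ j) powr (- p) = (2 powr p) ^ j"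
      by (simp add: powr_powr powr_minus power_one_over powr_realpow[symmetric] powr_divide mult.commute)
    finally show ?thesis by (simp add: power_divide)
  qed
  ultimately show "summable (\<lambda>j. (D / 2 ^ Suc j) powr (- p) / 8 ^ j)" by simp
qed (use assms in auto)

text \<open>The volume of the j-th shell cancels |x|^(-3), and the logarithm grows linearly in j, so
  the series is that of (j + 1)^(-1 - \<tau>). This is the borderline case at which the restriction
  on the exponent originates.\<close>

lemma log_kernel_integrable:
  assumes "D > 0" "D\<^sup>2 < a" "\<tau> > 0"
  shows "(\<integral>\<^sup>+x. ennreal (norm x powr (- 3) * ln (a / (norm x)\<^sup>2) powr (- 1 - \<tau>)) * indicator (cball 0 D) x
    \<partial>(lborel :: R3 measure)) < \<infinity>"
proof -
  \<comment> \<open>The logarithm is at least ln (a / D^2) on the outermost shell and its lower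
    bound gains 2 ln 2 from one shell to the next; the smaller of the two gives
    \<open>m * (j + 1)\<close> as a common lower bound.\<close>
  define m where "m = min (ln (a / D\<^sup>2)) (2 * ln 2)"
  have "1 < a / D\<^sup>2" using assms by simp
  from ln_gt_zero[OF this] have m: "m > 0" by (simp add: m_def)
  show ?thesis
  proof (rule nn_integral_dyadic_finite)
    show "ennreal (norm x powr (- 3) * ln (a / (norm x)\<^sup>2) powr (- 1 - \<tau>)) \<le>
        ennreal ((8 / D ^ 3) * 8 ^ j * (m * real (Suc j)) powr (- 1 - \<tau>))"
      if x: "D / 2 ^ Suc j < norm x" "norm x \<le> D / 2 ^ j" for j and x :: R3
    proof (intro ennreal_leI mult_mono)
      have x0: "norm x > 0" using x(1) assms(1) by (smt (verit) divide_pos_pos zero_less_power)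
      have "norm x powr (- 3) \<le> (D / 2 ^ Suc j) powr (- 3)"
        using x assms by (intro powr_mono2') (auto intro!: divide_pos_pos)
      also have "\<dots> = 1 / (D / 2 ^ Suc j) ^ 3"
      proof -
        define p where "p = D / 2 ^ Suc j"
        have "p > 0" using assms(1) by (simp add: p_def)
        then have "p powr (- 3) = 1 / p ^ 3" using powr_minus_divide[of p 3] by simp
        then show ?thesis by (simp only: p_def)
      qed
      also have "\<dots> = (8 / D ^ 3) * 8 ^ j"
      proof -
        have "((2::real) ^ j) ^ 3 = 8 ^ j"
          by (simp flip: power_mult add: mult.commute[of j]) (simp add: power_mult)
        then show ?thesis by (simp add: power_divide power_mult_distrib)
      qed
      finally show "norm x powr (- 3) \<le> (8 / D ^ 3) * 8 ^ j" .
      have "m * real (Suc j) \<le> ln (a / D\<^sup>2) + real j * (2 * ln 2)"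
      proof -
        have "m * real (Suc j) = m + real j * m" by (simp add: algebra_simps)
        also have "\<dots> \<le> ln (a / D\<^sup>2) + real j * (2 * ln 2)"
          by (intro add_mono mult_left_mono) (auto simp: m_def)
        finally show ?thesis .
      qed
      also have "\<dots> = ln (a / (D / 2 ^ j)\<^sup>2)"
      proof -
        have "a > 0" using assms(2) zero_le_power2[of D] by linarith
        then show ?thesis
          using assms by (simp add: ln_div ln_mult ln_realpow power_divide algebra_simps)
      qed
      also have "\<dots> \<le> ln (a / (norm x)\<^sup>2)"
      proof (subst ln_le_cancel_iff)
        have a: "a > 0" using assms(2) zero_le_power2[of D] by linarith
        show "0 < a / (D / 2 ^ j)\<^sup>2" "0 < a / (norm x)\<^sup>2" using a assms(1) x0 by auto
        show "a / (D / 2 ^ j)\<^sup>2 \<le> a / (norm x)\<^sup>2"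
          using a x0 x(2) assms(1) by (intro divide_left_mono power_mono mult_pos_pos) auto
      qed
      finally show "ln (a / (norm x)\<^sup>2) powr (- 1 - \<tau>) \<le> (m * real (Suc j)) powr (- 1 - \<tau>)"
        using m assms by (intro powr_mono2') auto
    qed (use assms in auto)
    have "summable (\<lambda>j. real (Suc j) powr (- 1 - \<tau>))"
      using assms by (subst summable_Suc_iff) (simp add: summable_real_powr_iff)
    then have "summable (\<lambda>j. (8 / D ^ 3) * m powr (- 1 - \<tau>) * real (Suc j) powr (- 1 - \<tau>))"
      by (rule summable_mult)
    then show "summable (\<lambda>j. (8 / D ^ 3) * 8 ^ j * (m * real (Suc j)) powr (- 1 - \<tau>) / 8 ^ j)"
      using m by (simp add: powr_mult mult.assoc)
    have "(\<lambda>x :: R3. ennreal (norm x powr (- 3) * ln (a / (norm x)\<^sup>2) powr (- 1 - \<tau>))) \<in> borel_measurable borel"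
      by measurable
    then show "(\<lambda>x :: R3. ennreal (norm x powr (- 3) * ln (a / (norm x)\<^sup>2) powr (- 1 - \<tau>))) \<in> borel_measurable borel" .
  qed (use assms in auto)
qed

section \<open>A Hardy inequality with the Newtonian potential as weight\<close>

lemma divide_left_mono_ennreal:
  fixes a b c :: ennreal
  assumes "a \<le> b"
  shows "c / b \<le> c / a"
proof -
  have "inverse b \<le> inverse a"
  proof (cases "a = 0 \<or> b = top")
    case False
    then obtain x y where xy: "0 \<le> x" "a = ennreal x" "0 \<le> y" "b = ennreal y"
      using assms by (metis ennreal_cases top.extremum_uniqueI)
    with False have "x > 0" by (auto simp: less_le)
    moreover have "x \<le> y" using assms xy by simp
    ultimately show ?thesis using xy by (simp add: inverse_ennreal ennreal_leI)
  qed auto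
  then show ?thesis unfolding divide_ennreal_def by (rule mult_left_mono) simp
qed

lemma integrable_pair_mult:
  fixes f :: "'a::euclidean_space \<Rightarrow> real" and g :: "'b::euclidean_space \<Rightarrow> real"
  assumes "integrable lborel f" "integrable lborel g"
  shows "integrable (lborel \<Otimes>\<^sub>M lborel) (\<lambda>z. f (fst z) * g (snd z))"
proof (rule lborel_pair.Fubini_integrable)
  show "(\<lambda>z. f (fst z) * g (snd z)) \<in> borel_measurable (lborel \<Otimes>\<^sub>M lborel)"
    using borel_measurable_integrable[OF assms(1)] borel_measurable_integrable[OF assms(2)] by measurable
  show "integrable lborel (\<lambda>x. \<integral>y. norm (f (fst (x, y)) * g (snd (x, y))))"
    using assms by (simp add: abs_mult)
  show "AE x in lborel. integrable lborel (\<lambda>y. f (fst (x, y)) * g (snd (x, y)))"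
    using assms by simp
qed

text \<open>Integrating the derivative of \<open>\<phi>\<close> along the rays \<open>t \<mapsto> x - t v\<close>, \<open>t \<le> 0\<close>, and averaging over the
  shell \<open>1 \<le> norm v \<le> 2\<close> avoids polar coordinates.\<close>

lemma Riesz_potential_bound:
  assumes \<phi>: "test_function S \<phi>"
  shows "ennreal (norm (\<phi> x)) \<le> (\<integral>\<^sup>+y. ennreal (norm (jacobian \<phi> y)) * ennreal (1 / (norm (x - y))\<^sup>2))"
proof -
  define g where "g y = ennreal (norm (jacobian \<phi> y))" for y
  define A :: "R3 set" where "A = cball 0 2 - ball 0 1"
  have A: "v \<in> A \<longleftrightarrow> 1 \<le> norm v \<and> norm v \<le> 2" for v by (auto simp: A_def)
  have [measurable]: "g \<in> borel_measurable borel" "A \<in> sets borel"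
    using borel_measurable_continuous_onI[OF continuous_jacobian[OF \<phi>]] by (auto simp: g_def[abs_def] A_def)
  obtain C where C: "compact C" "\<And>x. x \<notin> C \<Longrightarrow> \<phi> x = 0"
    using \<phi> unfolding test_function_def by blast
  obtain M where M: "\<And>y. y \<in> C \<Longrightarrow> norm y \<le> M"
    using compact_imp_bounded[OF C(1)] unfolding bounded_iff by blast
  note D = test_function_has_derivative[OF \<phi>]
  have ray: "ennreal (norm (\<phi> x)) \<le> (\<integral>\<^sup>+t. 2 * g (x - t *\<^sub>R v) * indicator {..0} t)" if v: "v \<in> A" for v
  proof -
    define e where "e = sgn (\<phi> x)"
    define f' where "f' t = - ((jacobian \<phi> (x - t *\<^sub>R v) *v v) \<bullet> e)" for t
    have "ennreal \<bar>\<phi> (x - 0 *\<^sub>R v) \<bullet> e\<bar> \<le> (\<integral>\<^sup>+t. ennreal \<bar>f' t\<bar> * indicator {..0} t)"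
    proof (rule ennreal_abs_le_integral_derivative_atMost)
      show "((\<lambda>t. \<phi> (x - t *\<^sub>R v) \<bullet> e) has_real_derivative f' t) (at t)" for t
      proof -
        have "((\<lambda>t. x - t *\<^sub>R v) has_derivative (\<lambda>h. - (h *\<^sub>R v))) (at t)" by (auto intro!: derivative_eq_intros)
        from has_derivative_compose[OF this D]
        have "((\<lambda>t. \<phi> (x - t *\<^sub>R v) \<bullet> e) has_derivative (\<lambda>h. frechet_derivative \<phi> (at (x - t *\<^sub>R v)) (- (h *\<^sub>R v)) \<bullet> e)) (at t)"
          by (rule has_derivative_inner_left)
        moreover have "frechet_derivative \<phi> (at (x - t *\<^sub>R v)) (- (h *\<^sub>R v)) \<bullet> e = f' t * h" for h
          unfolding jacobian_mult_vec[OF D] f'_def by (simp add: vec.neg linear_scale[OF matrix_vector_mul_linear])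
        ultimately show ?thesis by (simp add: has_field_derivative_def)
      qed
      have c: "continuous_on UNIV (\<lambda>t. jacobian \<phi> (x - t *\<^sub>R v))"
        by (rule continuous_on_compose2[OF continuous_jacobian[OF \<phi>]]) (auto intro!: continuous_intros)
      then show "continuous_on UNIV f'"
        unfolding f'_def inner_vec_def matrix_vector_mult_def by (auto intro!: continuous_intros)
      show "\<phi> (x - t *\<^sub>R v) \<bullet> e = 0" if "\<bar>t\<bar> > M + norm x" for t
      proof -
        have "\<bar>t\<bar> * 1 \<le> \<bar>t\<bar> * norm v" using v A by (intro mult_left_mono) auto
        also have "\<dots> \<le> norm (x - t *\<^sub>R v) + norm x" using norm_triangle_ineq4[of x "x - t *\<^sub>R v"] by simp
        finally have "x - t *\<^sub>R v \<notin> C" using M[of "x - t *\<^sub>R v"] that by auto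
        then show ?thesis using C(2) by simp
      qed
    qed
    also have "\<dots> \<le> (\<integral>\<^sup>+t. 2 * g (x - t *\<^sub>R v) * indicator {..0} t)"
    proof (intro nn_integral_mono mult_right_mono)
      fix t
      have e: "norm e \<le> 1" by (simp add: e_def norm_sgn)
      have "\<bar>f' t\<bar> \<le> norm (jacobian \<phi> (x - t *\<^sub>R v) *v v) * norm e"
        unfolding f'_def abs_minus_cancel by (rule Cauchy_Schwarz_ineq2)
      also have "\<dots> \<le> (norm (jacobian \<phi> (x - t *\<^sub>R v)) * 2) * 1"
        using v A e by (intro mult_mono order_trans[OF norm_matrix_vector_le] mult_left_mono) auto
      finally have "ennreal \<bar>f' t\<bar> \<le> ennreal (2 * norm (jacobian \<phi> (x - t *\<^sub>R v)))" by (intro ennreal_leI) simp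
      then show "ennreal \<bar>f' t\<bar> \<le> 2 * g (x - t *\<^sub>R v)" by (simp add: g_def ennreal_mult)
    qed simp
    also have "\<phi> (x - 0 *\<^sub>R v) \<bullet> e = norm (\<phi> x)"
      by (cases "\<phi> x = 0") (simp_all add: e_def sgn_div_norm power2_norm_eq_inner[symmetric] power2_eq_square)
    finally show ?thesis by simp
  qed
  have ind: "indicator {- norm (x - z)..- norm (x - z) / 2} t = (if - norm (x - z) \<le> t \<and> t \<le> - norm (x - z) / 2 then 1 else 0 :: ennreal)" for z t
    by (simp add: indicator_def)
  \<comment> \<open>For fixed t < 0 the substitution z = x - t v has Jacobian |t|^3 and maps the
    shell onto |t| \<le> |x - z| \<le> 2 |t|. Read as a condition on t for given z, this is the
    interval in the indicator. For t > 0 both sides vanish.\<close>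
  have shell: "(\<integral>\<^sup>+v. 2 * g (x - t *\<^sub>R v) * indicator {..0} t * indicator A v) =
      (\<integral>\<^sup>+z. 2 * g z * (ennreal (1 / (- t) ^ 3) * indicator {- norm (x - z)..- norm (x - z) / 2} t))" if "t \<noteq> 0" for t
  proof (cases "t < 0")
    case True
    define c where "c = - t"
    have c: "c > 0" using True by (simp add: c_def)
    define F where "F z = 2 * g z * (ennreal (1 / c ^ 3) * indicator {- norm (x - z)..- norm (x - z) / 2} t)" for z
    have F: "ennreal (c ^ DIM(R3)) * F (x + c *\<^sub>R v) = 2 * g (x - t *\<^sub>R v) * indicator {..0} t * indicator A v" for v
    proof -
      have "(t \<in> {- norm (x - (x + c *\<^sub>R v))..- norm (x - (x + c *\<^sub>R v)) / 2}) = (v \<in> A)"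
        using c by (auto simp: A c_def)
      then have "indicator {- norm (x - (x + c *\<^sub>R v))..- norm (x - (x + c *\<^sub>R v)) / 2} t = (indicator A v :: ennreal)"
        by (simp only: indicator_def)
      then have "ennreal (c ^ DIM(R3)) * F (x + c *\<^sub>R v) = (ennreal (c ^ 3) * ennreal (1 / c ^ 3)) * (2 * g (x + c *\<^sub>R v) * indicator A v)"
        unfolding F_def by (simp add: mult_ac)
      also have "ennreal (c ^ 3) * ennreal (1 / c ^ 3) = 1" using c by (subst ennreal_mult[symmetric]) auto
      finally show ?thesis using True by (simp add: c_def)
    qed
    have "F \<in> borel_measurable borel" unfolding F_def[abs_def] ind by measurable
    from nn_integral_lborel_scale[OF this c, of x] show ?thesis unfolding F unfolding F_def c_def by simp
  next
    case False
    then have "t > 0" using that by simp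
    then have "indicator {- norm (x - z)..- norm (x - z) / 2} t = (0 :: ennreal)" "indicator {..0} t = (0 :: ennreal)" for z
      using norm_ge_zero[of "x - z"] unfolding ind by (auto simp del: norm_ge_zero)
    then show ?thesis by (simp only:) simp
  qed
  \<comment> \<open>The volume is 28 pi / 3; the crude bound 8 is what cancels the factor 8 left by
    the integration in t below.\<close>
  have V: "8 \<le> emeasure lborel A"
  proof -
    have "emeasure lborel A = emeasure lborel (cball (0 :: R3) 2) - emeasure lborel (ball (0 :: R3) 1)"
      unfolding A_def by (intro emeasure_Diff) (auto simp: less_imp_neq[OF emeasure_lborel_ball_finite, simplified])
    also have "\<dots> = ennreal (7 * unit_ball_vol 3)"
      by (simp add: emeasure_cball emeasure_ball ennreal_minus unit_ball_vol_nonneg)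
    finally have "emeasure lborel A = ennreal (7 * unit_ball_vol 3)" .
    moreover have "8 \<le> 7 * unit_ball_vol 3" using pi_gt3 by (simp add: unit_ball_vol_3)
    ultimately show ?thesis using ennreal_leI[of 8 "7 * unit_ball_vol 3"] by simp
  qed
  have "8 * ennreal (norm (\<phi> x)) \<le> emeasure lborel A * ennreal (norm (\<phi> x))"
    by (intro mult_right_mono V) simp
  also have "\<dots> = (\<integral>\<^sup>+v. ennreal (norm (\<phi> x)) * indicator A v)"
    by (subst nn_integral_cmult_indicator) (simp_all add: mult.commute)
  also have "\<dots> \<le> (\<integral>\<^sup>+v. (\<integral>\<^sup>+t. 2 * g (x - t *\<^sub>R v) * indicator {..0} t * indicator A v))"
  proof (rule nn_integral_mono)
    fix v show "ennreal (norm (\<phi> x)) * indicator A v \<le> (\<integral>\<^sup>+t. 2 * g (x - t *\<^sub>R v) * indicator {..0} t * indicator A v)"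
      using ray[of v] by (cases "v \<in> A") auto
  qed
  also have "\<dots> = (\<integral>\<^sup>+t. \<integral>\<^sup>+v. 2 * g (x - t *\<^sub>R v) * indicator {..0} t * indicator A v)"
    by (rule lborel_pair.Fubini') measurable
  also have "\<dots> = (\<integral>\<^sup>+t. \<integral>\<^sup>+z. 2 * g z * (ennreal (1 / (- t) ^ 3) * indicator {- norm (x - z)..- norm (x - z) / 2} t))"
    by (rule nn_integral_cong_AE) (use AE_lborel_singleton[of "0 :: real"] shell in \<open>auto elim: eventually_mono\<close>)
  also have "\<dots> = (\<integral>\<^sup>+z. \<integral>\<^sup>+t. 2 * g z * (ennreal (1 / (- t) ^ 3) * indicator {- norm (x - z)..- norm (x - z) / 2} t))"
    unfolding ind by (rule lborel_pair.Fubini') measurable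
  also have "\<dots> \<le> (\<integral>\<^sup>+z. 8 * (g z * ennreal (1 / (norm (x - z))\<^sup>2)))"
  proof (rule nn_integral_mono_AE)
    show "AE z in lborel. (\<integral>\<^sup>+t. 2 * g z * (ennreal (1 / (- t) ^ 3) * indicator {- norm (x - z)..- norm (x - z) / 2} t))
        \<le> 8 * (g z * ennreal (1 / (norm (x - z))\<^sup>2))"
      using AE_lborel_singleton[of x]
    proof eventually_elim
      case (elim z)
      define d where "d = norm (x - z)"
      have d: "d > 0" using elim by (simp add: d_def)
      have "(\<integral>\<^sup>+t. 2 * g z * (ennreal (1 / (- t) ^ 3) * indicator {- d..- d / 2} t)) \<le>
          (\<integral>\<^sup>+t. 2 * g z * ennreal (8 / d ^ 3) * indicator {- d..- d / 2} t)"
      proof (rule nn_integral_mono)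
        fix t
        show "2 * g z * (ennreal (1 / (- t) ^ 3) * indicator {- d..- d / 2} t) \<le> 2 * g z * ennreal (8 / d ^ 3) * indicator {- d..- d / 2} t"
        proof (cases "t \<in> {- d..- d / 2}")
          case True
          have "(d / 2) ^ 3 \<le> (- t) ^ 3" using True d by (intro power_mono) auto
          then have "1 / (- t) ^ 3 \<le> 1 / (d / 2) ^ 3" using d by (intro divide_left_mono mult_pos_pos) (use True in auto)
          then have "ennreal (1 / (- t) ^ 3) \<le> ennreal (8 / d ^ 3)" by (intro ennreal_leI) (simp add: power_divide)
          then show ?thesis using True by (simp add: mult_left_mono)
        qed simp
      qed
      also have "\<dots> = 2 * g z * ennreal (8 / d ^ 3) * ennreal (d / 2)"
        using d by (subst nn_integral_cmult_indicator) auto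
      also have "\<dots> = 2 * g z * ennreal (4 / d\<^sup>2)"
        using d by (simp add: mult.assoc ennreal_mult[symmetric] power2_eq_square power3_eq_cube)
      also have "\<dots> = 8 * (g z * ennreal (1 / d\<^sup>2))"
      proof -
        have "ennreal (4 / d\<^sup>2) = 4 * ennreal (1 / d\<^sup>2)" using ennreal_mult'[of 4 "1 / d\<^sup>2"] by simp
        then show ?thesis by (simp add: mult_ac)
      qed
      finally show ?case unfolding d_def .
    qed
  qed
  also have "\<dots> = 8 * (\<integral>\<^sup>+z. g z * ennreal (1 / (norm (x - z))\<^sup>2))"
    by (rule nn_integral_cmult) measurable
  finally show ?thesis
    unfolding g_def using ennreal_mult_le_mult_iff[of 8] by simp
qed

text \<open>A majorant, in units of d = |x - y|, of the product of |x - z|^(-2) and |y - z|^(-2) as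
  a function of the position of z relative to the nearer of the two points. Within distance 1 the
  other point is at least 1/2 away, which gives the factor 4; further out both distances are at
  least that of the nearer point.\<close>

definition Riesz_profile :: "R3 \<Rightarrow> real" where
  "Riesz_profile z = (if norm z \<le> 1 then 4 * norm z powr - 2 else norm z powr - 4)"

definition Riesz_const :: ennreal where
  "Riesz_const = 2 * (\<integral>\<^sup>+z. ennreal (Riesz_profile z))"

lemma Riesz_profile_measurable [measurable]: "Riesz_profile \<in> borel_measurable borel"
  unfolding Riesz_profile_def[abs_def] by measurable

text \<open>In the outer region |z|^(-4) is written as the integral of 4 t^(-5) over t \<ge> |z|.
  Exchanging the integrals turns it into a one-dimensional integral of ball volumes, of order
  t^(-2).\<close>

lemma Riesz_const_finite: "Riesz_const < \<infinity>"
proof -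
  have [measurable]: "cball (0 :: R3) t \<in> sets borel" for t by simp
  have far: "ennreal (norm z powr - 4) * indicator (- cball (0 :: R3) 1) z \<le>
      (\<integral>\<^sup>+t. ennreal (4 * t powr - 5) * indicator {1..} t * indicator (cball 0 t) z)" for z
  proof (cases "norm z \<le> 1")
    case False
    define d where "d = norm z"
    have d: "d > 1" using False by (simp add: d_def)
    have "((\<lambda>t :: real. - (t powr - 4)) \<longlongrightarrow> 0) at_top" by real_asymp
    then have "(\<integral>\<^sup>+t. ennreal (4 * t powr - 5) * indicator {d..} t) = ennreal (0 - (- (d powr - 4)))"
      using d by (intro nn_integral_FTC_atLeast) (auto intro!: derivative_eq_intros)
    then have "ennreal (d powr - 4) = (\<integral>\<^sup>+t. ennreal (4 * t powr - 5) * indicator {d..} t)" by simp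
    also have "\<dots> = (\<integral>\<^sup>+t. ennreal (4 * t powr - 5) * indicator {1..} t * indicator (cball 0 t) z)"
      using d by (intro nn_integral_cong) (auto simp: d_def indicator_def)
    finally have "ennreal (d powr - 4) = (\<integral>\<^sup>+t. ennreal (4 * t powr - 5) * indicator {1..} t * indicator (cball 0 t) z)" .
    then show ?thesis using d unfolding d_def by (simp only: indicator_simps Compl_iff mem_cball_0 not_le if_True order_refl mult_1_right)
  qed simp
  have "(\<integral>\<^sup>+z. ennreal (Riesz_profile z)) \<le> (\<integral>\<^sup>+z. 4 * (ennreal (norm z powr - 2) * indicator (cball 0 1) z) +
      ennreal (norm z powr - 4) * indicator (- cball (0 :: R3) 1) z)"
    by (intro nn_integral_mono) (auto simp: Riesz_profile_def ennreal_mult' indicator_def)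
  also have "\<dots> = 4 * (\<integral>\<^sup>+z. ennreal (norm z powr - 2) * indicator (cball (0 :: R3) 1) z) +
      (\<integral>\<^sup>+z. ennreal (norm z powr - 4) * indicator (- cball (0 :: R3) 1) z)"
    by (simp add: nn_integral_add nn_integral_cmult)
  also have "(\<integral>\<^sup>+z. ennreal (norm z powr - 4) * indicator (- cball (0 :: R3) 1) z) \<le>
      (\<integral>\<^sup>+z. \<integral>\<^sup>+t. ennreal (4 * t powr - 5) * indicator {1..} t * indicator (cball (0 :: R3) t) z)"
    by (intro nn_integral_mono far)
  also have "\<dots> = (\<integral>\<^sup>+t. \<integral>\<^sup>+z. ennreal (4 * t powr - 5) * indicator {1..} t * indicator (cball (0 :: R3) t) z)"
    unfolding mem_cball_0[symmetric] by (rule lborel_pair.Fubini') (simp add: indicator_def)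
  also have "\<dots> = (\<integral>\<^sup>+t. ennreal (4 * unit_ball_vol 3 * t powr - 2) * indicator {1..} t)"
  proof (rule nn_integral_cong)
    fix t :: real
    show "(\<integral>\<^sup>+z. ennreal (4 * t powr - 5) * indicator {1..} t * indicator (cball (0 :: R3) t) z) =
        ennreal (4 * unit_ball_vol 3 * t powr - 2) * indicator {1..} t"
    proof (cases "t \<ge> 1")
      case True
      have "t powr - 5 * t ^ 3 = t powr - 2"
        using True powr_add[of t "- 5" 3] by (simp add: powr_numeral)
      then have e: "4 * t powr - 5 * (unit_ball_vol 3 * t ^ 3) = 4 * unit_ball_vol 3 * t powr - 2" by (simp add: mult_ac)
      have "(\<integral>\<^sup>+z. ennreal (4 * t powr - 5) * indicator (cball (0 :: R3) t) z) = ennreal (4 * t powr - 5) * ennreal (unit_ball_vol 3 * t ^ 3)"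
        using True by (subst nn_integral_cmult_indicator) (simp_all add: emeasure_cball)
      also have "\<dots> = ennreal (4 * unit_ball_vol 3 * t powr - 2)"
        unfolding e[symmetric] by (rule ennreal_mult'[symmetric]) simp
      finally show ?thesis using True by simp
    qed simp
  qed
  also have "\<dots> = ennreal (0 - (- (4 * unit_ball_vol 3 * inverse 1)))"
  proof (rule nn_integral_FTC_atLeast[where F = "\<lambda>t. - (4 * unit_ball_vol 3 * inverse t)"])
    show "((\<lambda>t. - (4 * unit_ball_vol 3 * inverse t)) \<longlongrightarrow> 0) at_top"
      using tendsto_minus[OF tendsto_mult_right_zero[OF tendsto_inverse_0_at_top[OF filterlim_ident], of "4 * unit_ball_vol 3"]] by simp
    show "((\<lambda>t. - (4 * unit_ball_vol 3 * inverse t)) has_real_derivative 4 * unit_ball_vol 3 * t powr - 2) (at t)" if "1 \<le> t" for t :: real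
      using that by (auto intro!: derivative_eq_intros simp: powr_minus_divide powr_numeral power2_eq_square divide_inverse)
  qed (auto simp: unit_ball_vol_nonneg)
  also have "4 * (\<integral>\<^sup>+z. ennreal (norm z powr - 2) * indicator (cball (0 :: R3) 1) z) + ennreal (0 - (- (4 * unit_ball_vol 3 * inverse 1))) < \<infinity>"
    using powr_kernel_integrable[of 1 2] by (simp add: ennreal_mult_less_top)
  finally show ?thesis unfolding Riesz_const_def by (simp add: ennreal_mult_less_top)
qed

text \<open>Each z is nearer to x or to y, and the rescaled profile centred at that point bounds the
  integrand. Scaling by d leaves d^3 / d^4, the claimed 1 / |x - y|; the two centres account for the
  factor 2 in \<open>Riesz_const\<close>.\<close>

lemma Riesz_composition:
  fixes x y :: R3
  assumes "x \<noteq> y"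
  shows "(\<integral>\<^sup>+z. ennreal (1 / (norm (x - z))\<^sup>2) * ennreal (1 / (norm (y - z))\<^sup>2)) \<le> Riesz_const * ennreal (1 / norm (x - y))"
proof -
  define d where "d = norm (x - y)"
  have d: "d > 0" using assms by (simp add: d_def)
  define k where "k z = ennreal (1 / d ^ 4 * Riesz_profile ((1 / d) *\<^sub>R z))" for z
  have [measurable]: "k \<in> borel_measurable borel" unfolding k_def[abs_def] by measurable
  have k: "ennreal (1 / (norm a)\<^sup>2) * ennreal (1 / (norm b)\<^sup>2) \<le> k a"
    if "norm a \<le> norm b" "d \<le> norm a + norm b" for a b :: R3
  proof (cases "a = 0")
    case False
    then have a: "norm a > 0" "norm b > 0" "norm a / d > 0" using that(1) d by (auto intro: less_le_trans)
    have n: "norm ((1 / d) *\<^sub>R a) = norm a / d" using d by simp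
    have "1 / (norm a)\<^sup>2 * (1 / (norm b)\<^sup>2) \<le> 1 / d ^ 4 * Riesz_profile ((1 / d) *\<^sub>R a)"
    proof (cases "norm a \<le> d")
      case True
      have "(d / 2)\<^sup>2 \<le> (norm b)\<^sup>2" using that d by (intro power_mono) auto
      then have "1 / (norm a)\<^sup>2 * (1 / (norm b)\<^sup>2) \<le> 1 / (norm a)\<^sup>2 * (1 / (d / 2)\<^sup>2)"
        using d a that by (intro mult_left_mono divide_left_mono) auto
      also have "\<dots> = 1 / d ^ 4 * Riesz_profile ((1 / d) *\<^sub>R a)"
        unfolding Riesz_profile_def n powr_minus_divide using True a divide_le_eq_1_pos[OF d, of "norm a"] by (simp add: powr_numeral power_divide eval_nat_numeral)
      finally show ?thesis .
    next
      case False
      have "(norm a)\<^sup>2 \<le> (norm b)\<^sup>2" using that by (intro power_mono) auto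
      then have "1 / (norm a)\<^sup>2 * (1 / (norm b)\<^sup>2) \<le> 1 / (norm a)\<^sup>2 * (1 / (norm a)\<^sup>2)"
        using a that by (intro mult_left_mono divide_left_mono) auto
      also have "\<dots> = 1 / d ^ 4 * Riesz_profile ((1 / d) *\<^sub>R a)"
        unfolding Riesz_profile_def n powr_minus_divide using False d a by (simp add: powr_numeral power_divide eval_nat_numeral)
      finally show ?thesis .
    qed
    then show ?thesis unfolding k_def by (subst ennreal_mult[symmetric]) (auto intro: ennreal_leI)
  qed simp
  have K: "(\<integral>\<^sup>+z. k (x - z)) = (\<integral>\<^sup>+z. ennreal (Riesz_profile z)) * ennreal (1 / d)" for x :: R3
  proof -
    have "(\<integral>\<^sup>+z. k (x - z)) = (\<integral>\<^sup>+z. k z)" by (rule nn_integral_lborel_reflect) measurable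
    also have "\<dots> = (\<integral>\<^sup>+z. ennreal (d ^ DIM(R3)) * k (0 + d *\<^sub>R z))"
      by (rule nn_integral_lborel_scale) (use d in auto)
    also have "\<dots> = (\<integral>\<^sup>+z. ennreal (Riesz_profile z) * ennreal (1 / d))"
      unfolding k_def using d
      by (intro nn_integral_cong) (simp add: ennreal_mult[symmetric] Riesz_profile_def eval_nat_numeral)
    also have "\<dots> = (\<integral>\<^sup>+z. ennreal (Riesz_profile z)) * ennreal (1 / d)"
      by (rule nn_integral_multc) measurable
    finally show ?thesis .
  qed
  have "(\<integral>\<^sup>+z. ennreal (1 / (norm (x - z))\<^sup>2) * ennreal (1 / (norm (y - z))\<^sup>2)) \<le> (\<integral>\<^sup>+z. k (x - z) + k (y - z))"
  proof (rule nn_integral_mono)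
    fix z
    have "d \<le> norm (x - z) + norm (y - z)" unfolding d_def using norm_triangle_ineq4[of "x - z" "y - z"] by simp
    then show "ennreal (1 / (norm (x - z))\<^sup>2) * ennreal (1 / (norm (y - z))\<^sup>2) \<le> k (x - z) + k (y - z)"
      using k[of "x - z" "y - z"] k[of "y - z" "x - z"]
      by (cases "norm (x - z) \<le> norm (y - z)") (auto simp: mult.commute add.commute intro: add_increasing2 add_increasing)
  qed
  also have "\<dots> = Riesz_const * ennreal (1 / d)"
    by (simp add: nn_integral_add K Riesz_const_def mult_2 distrib_right)
  finally show ?thesis by (simp add: d_def)
qed

text \<open>A Schur test: with \<open>\<theta> = 1 / (1 + N * |\<cdot>|\<^sup>-\<^sup>1)\<close> the double integral of
  \<open>N(x) \<theta>(x) |\<phi>(x)| N(y) \<theta>(y) |\<phi>(y)| / |x - y|\<close> is at most twice that of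
  \<open>N(x) (\<theta>(x) |\<phi>(x)|)\<^sup>2 N(y) / |x - y|\<close>, and \<open>\<theta> (N * |\<cdot>|\<^sup>-\<^sup>1) \<le> 1\<close>.\<close>

lemma Hardy_bounded:
  assumes \<phi>: "test_function S \<phi>"
    and N [measurable]: "N \<in> borel_measurable borel" and N0: "\<And>x. 0 \<le> N x" "\<And>x. N x \<le> k"
  shows "(\<integral>\<^sup>+x. ennreal (N x * (norm (\<phi> x))\<^sup>2) / (1 + (\<integral>\<^sup>+y. ennreal (N y / norm (x - y)))))
    \<le> 2 * Riesz_const * (\<integral>\<^sup>+x. ennreal ((norm (jacobian \<phi> x))\<^sup>2))" (is "?X \<le> _ * ?J")
proof -
  define n where "n x = ennreal (N x)" for x
  define a where "a x = ennreal (norm (\<phi> x))" for x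
  define g where "g x = ennreal (norm (jacobian \<phi> x))" for x
  define W where "W x = 1 + (\<integral>\<^sup>+y. ennreal (N y / norm (x - y)))" for x
  define b where "b x = inverse (W x) * a x" for x
  define k2 where "k2 x y = ennreal (1 / (norm (x - y))\<^sup>2)" for x y :: R3
  define k1 where "k1 x y = ennreal (1 / norm (x - y))" for x y :: R3
  have [measurable]: "\<phi> \<in> borel_measurable borel" "jacobian \<phi> \<in> borel_measurable borel"
    by (intro borel_measurable_continuous_onI test_function_continuous[OF \<phi>] continuous_jacobian[OF \<phi>])+
  have [measurable]: "W \<in> borel_measurable borel" unfolding W_def[abs_def] by measurable
  have [measurable]: "n \<in> borel_measurable borel" "a \<in> borel_measurable borel" "g \<in> borel_measurable borel" "b \<in> borel_measurable borel"
    unfolding n_def[abs_def] a_def[abs_def] g_def[abs_def] b_def[abs_def] by measurable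
  have k_sym: "k1 x y = k1 y x" "k2 x y = k2 y x" for x y by (simp_all add: k1_def k2_def norm_minus_commute)
  have inv1: "inverse (W x) \<le> 1" for x
    using divide_left_mono_ennreal[of 1 "W x" 1] by (simp add: W_def divide_ennreal_def)
  have invW: "inverse (W x) * (\<integral>\<^sup>+y. n y * k1 x y) \<le> 1" for x
  proof -
    have "(\<integral>\<^sup>+y. n y * k1 x y) \<le> W x"
      unfolding W_def n_def k1_def using N0 by (simp add: ennreal_mult[symmetric])
    then have "inverse (W x) * (\<integral>\<^sup>+y. n y * k1 x y) \<le> inverse (W x) * W x" by (rule mult_left_mono) simp
    also have "\<dots> \<le> 1"
      by (cases "W x = top") (auto simp: W_def less_top ennreal_divide_self mult.commute[of "inverse _"] simp flip: divide_ennreal_def)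
    finally show ?thesis .
  qed
  define X where "X = (\<integral>\<^sup>+x. n x * (inverse (W x) * (a x)\<^sup>2))"
  have XX: "?X = X"
    unfolding X_def W_def[symmetric] n_def a_def divide_ennreal_def using N0
    by (simp add: ennreal_mult ennreal_power mult_ac)
  have J: "?J = (\<integral>\<^sup>+y. (g y)\<^sup>2)" by (simp add: g_def ennreal_power)
  define S where "S y = (\<integral>\<^sup>+x. n x * b x * k2 x y)" for y
  have k2m [measurable]: "(\<lambda>q. k2 (fst q) (snd q)) \<in> borel_measurable (borel \<Otimes>\<^sub>M borel)" "(\<lambda>q. k1 (fst q) (snd q)) \<in> borel_measurable (borel \<Otimes>\<^sub>M borel)"
    unfolding k2_def k1_def by measurable
  have Sm [measurable]: "S \<in> borel_measurable borel" unfolding S_def[abs_def] k2_def by measurable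
  \<comment> \<open>Squaring produces a double integral over x and x', and integrating out y
    composes two kernels |.|^(-2) into |.|^(-1). The bound b b' \<le> b^2 + b'^2 leaves two equal
    terms, each at most X, because one of the two factors 1 / W in b^2 absorbs the potential of
    N.\<close>
  have S2: "(\<integral>\<^sup>+y. (S y)\<^sup>2) \<le> 2 * Riesz_const * X"
  proof -
    have "(\<integral>\<^sup>+y. (S y)\<^sup>2) = (\<integral>\<^sup>+y. \<integral>\<^sup>+x. \<integral>\<^sup>+x'. (n x * b x * k2 x y) * (n x' * b x' * k2 x' y))"
      unfolding power2_eq_square S_def k2_def
      by (intro nn_integral_cong, subst nn_integral_multc[symmetric], measurable, intro nn_integral_cong nn_integral_cmult[symmetric]) measurable
    also have "\<dots> = (\<integral>\<^sup>+x. \<integral>\<^sup>+y. \<integral>\<^sup>+x'. (n x * b x * k2 x y) * (n x' * b x' * k2 x' y))"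
      unfolding k2_def by (rule lborel_pair.Fubini') measurable
    also have "\<dots> = (\<integral>\<^sup>+x. \<integral>\<^sup>+x'. \<integral>\<^sup>+y. (n x * b x * k2 x y) * (n x' * b x' * k2 x' y))"
      unfolding k2_def by (intro nn_integral_cong lborel_pair.Fubini') measurable
    also have "\<dots> = (\<integral>\<^sup>+x. \<integral>\<^sup>+x'. (n x * b x * (n x' * b x')) * (\<integral>\<^sup>+y. k2 x y * k2 x' y))"
      unfolding k2_def by (intro nn_integral_cong, subst nn_integral_cmult[symmetric]) (auto intro!: nn_integral_cong simp: mult_ac)
    also have "\<dots> \<le> (\<integral>\<^sup>+x. \<integral>\<^sup>+x'. Riesz_const * (n x * n x' * (b x)\<^sup>2 * k1 x x' + n x * n x' * (b x')\<^sup>2 * k1 x x'))"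
    proof (rule nn_integral_mono, rule nn_integral_mono_AE)
      fix x
      show "AE x' in lborel. (n x * b x * (n x' * b x')) * (\<integral>\<^sup>+y. k2 x y * k2 x' y) \<le>
          Riesz_const * (n x * n x' * (b x)\<^sup>2 * k1 x x' + n x * n x' * (b x')\<^sup>2 * k1 x x')"
        using AE_lborel_singleton[of x]
      proof eventually_elim
        case (elim x')
        have "b x * b x' \<le> (b x)\<^sup>2 + (b x')\<^sup>2"
          unfolding power2_eq_square
          using mult_right_mono[of "b x" "b x'" "b x'"] mult_left_mono[of "b x'" "b x" "b x"]
          by (cases "b x \<le> b x'") (auto intro: add_increasing add_increasing2)
        then have "(n x * n x') * (b x * b x') * (Riesz_const * k1 x x') \<le> (n x * n x') * ((b x)\<^sup>2 + (b x')\<^sup>2) * (Riesz_const * k1 x x')"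
          by (intro mult_right_mono mult_left_mono) auto
        moreover have "(\<integral>\<^sup>+y. k2 x y * k2 x' y) \<le> Riesz_const * k1 x x'"
          unfolding k2_def k1_def using Riesz_composition[of x x'] elim by auto
        then have "(n x * b x * (n x' * b x')) * (\<integral>\<^sup>+y. k2 x y * k2 x' y) \<le> (n x * b x * (n x' * b x')) * (Riesz_const * k1 x x')"
          by (rule mult_left_mono) simp
        ultimately show ?case by (simp add: distrib_left distrib_right mult_ac)
      qed
    qed
    also have "\<dots> = Riesz_const * ((\<integral>\<^sup>+x. \<integral>\<^sup>+x'. n x * n x' * (b x)\<^sup>2 * k1 x x') +
        (\<integral>\<^sup>+x. \<integral>\<^sup>+x'. n x * n x' * (b x')\<^sup>2 * k1 x x'))"
      unfolding k1_def by (simp add: nn_integral_add nn_integral_cmult)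
    also have "(\<integral>\<^sup>+x. \<integral>\<^sup>+x'. n x * n x' * (b x')\<^sup>2 * k1 x x') = (\<integral>\<^sup>+x'. \<integral>\<^sup>+x. n x * n x' * (b x')\<^sup>2 * k1 x x')"
      unfolding k1_def by (rule lborel_pair.Fubini') measurable
    also have "\<dots> = (\<integral>\<^sup>+x. \<integral>\<^sup>+x'. n x * n x' * (b x)\<^sup>2 * k1 x x')"
      by (intro nn_integral_cong) (simp add: mult.commute[of "n _" "n _"] k_sym)
    also have "(\<integral>\<^sup>+x. \<integral>\<^sup>+x'. n x * n x' * (b x)\<^sup>2 * k1 x x') = (\<integral>\<^sup>+x. n x * (b x)\<^sup>2 * (\<integral>\<^sup>+x'. n x' * k1 x x'))"
      unfolding k1_def by (intro nn_integral_cong, subst nn_integral_cmult[symmetric]) (auto intro!: nn_integral_cong simp: mult_ac)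
    also have "\<dots> \<le> X"
      unfolding X_def
    proof (rule nn_integral_mono)
      fix x
      have "n x * (b x)\<^sup>2 * (\<integral>\<^sup>+x'. n x' * k1 x x') = n x * (inverse (W x) * (a x)\<^sup>2) * (inverse (W x) * (\<integral>\<^sup>+x'. n x' * k1 x x'))"
        by (simp add: b_def power2_eq_square mult_ac)
      also have "\<dots> \<le> n x * (inverse (W x) * (a x)\<^sup>2) * 1" by (intro mult_left_mono invW) simp
      finally show "n x * (b x)\<^sup>2 * (\<integral>\<^sup>+x'. n x' * k1 x x') \<le> n x * (inverse (W x) * (a x)\<^sup>2)" by simp
    qed
    finally have "(\<integral>\<^sup>+y. (S y)\<^sup>2) \<le> Riesz_const * (X + X)"
      by (simp add: add_mono mult_left_mono)
    then show ?thesis by (simp add: mult_2 distrib_left distrib_right)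
  qed
  have "X \<le> (\<integral>\<^sup>+x. n x * b x * (\<integral>\<^sup>+y. g y * k2 x y))"
    unfolding X_def
  proof (rule nn_integral_mono)
    fix x
    have "n x * (inverse (W x) * (a x)\<^sup>2) = n x * b x * a x" by (simp add: b_def power2_eq_square mult_ac)
    also have "\<dots> \<le> n x * b x * (\<integral>\<^sup>+y. g y * k2 x y)"
      unfolding a_def g_def k2_def by (intro mult_left_mono Riesz_potential_bound[OF \<phi>]) simp
    finally show "n x * (inverse (W x) * (a x)\<^sup>2) \<le> n x * b x * (\<integral>\<^sup>+y. g y * k2 x y)" .
  qed
  also have "\<dots> = (\<integral>\<^sup>+x. \<integral>\<^sup>+y. n x * b x * (g y * k2 x y))"
    unfolding k2_def by (intro nn_integral_cong nn_integral_cmult[symmetric]) measurable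
  also have "\<dots> = (\<integral>\<^sup>+y. \<integral>\<^sup>+x. n x * b x * (g y * k2 x y))"
    unfolding k2_def by (rule lborel_pair.Fubini') measurable
  also have "\<dots> = (\<integral>\<^sup>+y. g y * S y)"
    unfolding S_def k2_def by (intro nn_integral_cong, subst nn_integral_cmult[symmetric]) (auto intro!: nn_integral_cong simp: mult_ac)
  finally have "X\<^sup>2 \<le> (\<integral>\<^sup>+y. g y * S y)\<^sup>2" by (rule power_mono) simp
  also have "\<dots> \<le> ?J * (\<integral>\<^sup>+y. (S y)\<^sup>2)"
    unfolding J by (rule Cauchy_Schwarz_nn_integral) measurable
  also have "\<dots> \<le> ?J * (2 * Riesz_const * X)" by (intro mult_left_mono S2) simp
  finally have XXle: "X * X \<le> (2 * Riesz_const * ?J) * X" by (simp add: power2_eq_square mult_ac)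
  \<comment> \<open>Boundedness of \<open>N\<close> makes X finite, so that one factor X can be
    cancelled from X^2 \<le> C X.\<close>
  have "X \<le> (\<integral>\<^sup>+x. ennreal k * (a x)\<^sup>2)"
    unfolding X_def n_def using N0 inv1
    by (intro nn_integral_mono mult_mono ennreal_leI order_trans[OF mult_right_mono[OF inv1]]) auto
  also have "\<dots> = ennreal k * (\<integral>\<^sup>+x. ennreal ((norm (\<phi> x))\<^sup>2))"
    by (simp add: nn_integral_cmult a_def ennreal_power)
  also have "\<dots> < \<infinity>"
  proof -
    obtain C where C: "compact C" "\<And>x. x \<notin> C \<Longrightarrow> \<phi> x = 0"
      using \<phi> unfolding test_function_def by blast
    have "integrable lborel (\<lambda>x. (norm (\<phi> x))\<^sup>2)"
      by (rule integrable_compact_support[OF _ C(1)])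
        (use C(2) test_function_continuous[OF \<phi>] in \<open>auto intro!: continuous_intros\<close>)
    then show ?thesis by (simp add: nn_integral_eq_integral ennreal_mult_less_top)
  qed
  finally have "X < \<infinity>" .
  show ?thesis
    unfolding XX
  proof (cases "X = 0")
    case False
    have "X * X \<le> X * (2 * Riesz_const * ?J)" using XXle by (subst mult.commute[of X "2 * Riesz_const * ?J"])
    then show "X \<le> 2 * Riesz_const * ?J" using False \<open>X < \<infinity>\<close> by (subst (asm) ennreal_mult_le_mult_iff) auto
  qed simp
qed

text \<open>The summand 1 gives positivity without a lower bound on
  \<open>Riesz_const\<close>.\<close>

definition Hardy_const :: real where
  "Hardy_const = 2 * enn2real Riesz_const + 1"

lemma Hardy_const: "2 * Riesz_const \<le> ennreal Hardy_const" "0 < Hardy_const"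
proof -
  have "2 * Riesz_const = ennreal (2 * enn2real Riesz_const)"
    using Riesz_const_finite by (simp add: ennreal_mult)
  also have "\<dots> \<le> ennreal Hardy_const" unfolding Hardy_const_def by (rule ennreal_leI) simp
  finally show "2 * Riesz_const \<le> ennreal Hardy_const" .
  show "0 < Hardy_const" unfolding Hardy_const_def by (simp add: add_nonneg_pos)
qed

text \<open>Truncating \<open>N\<close> lowers the weight in the denominator as well, so the bound
  for bounded weights applies to the truncations with the larger quotient. Their constant is
  independent of the truncation level, and Fatou's lemma gives the general case.\<close>

theorem Hardy_test_function:
  assumes \<phi>: "test_function S \<phi>"
    and N[measurable]: "N \<in> borel_measurable borel" and N0: "\<And>x. 0 \<le> N x"
  shows "(\<integral>\<^sup>+x. ennreal (N x * (norm (\<phi> x))\<^sup>2) / (1 + (\<integral>\<^sup>+y. ennreal (N y / norm (x - y)))))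
    \<le> ennreal Hardy_const * (\<integral>\<^sup>+x. ennreal ((norm (jacobian \<phi> x))\<^sup>2))" (is "_ \<le> ?J")
proof -
  have [measurable]: "\<phi> \<in> borel_measurable borel"
    by (rule borel_measurable_continuous_onI[OF test_function_continuous[OF \<phi>]])
  define W where "W x = 1 + (\<integral>\<^sup>+y. ennreal (N y / norm (x - y)))" for x
  have [measurable]: "W \<in> borel_measurable borel"
    unfolding W_def by measurable
  define M where "M k x = min (N x) (real k)" for k x
  have [measurable]: "M k \<in> borel_measurable borel" for k unfolding M_def by measurable
  have MN: "0 \<le> M k x" "M k x \<le> N x" "M k x \<le> real k" for k x
    using N0[of x] by (auto simp: M_def)
  have le: "(\<integral>\<^sup>+x. ennreal (M k x * (norm (\<phi> x))\<^sup>2) / W x) \<le> ?J" for k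
  proof -
    have "(\<integral>\<^sup>+x. ennreal (M k x * (norm (\<phi> x))\<^sup>2) / W x) \<le>
        (\<integral>\<^sup>+x. ennreal (M k x * (norm (\<phi> x))\<^sup>2) / (1 + (\<integral>\<^sup>+y. ennreal (M k y / norm (x - y)))))"
      unfolding W_def using MN
      by (intro nn_integral_mono divide_left_mono_ennreal add_left_mono ennreal_leI divide_right_mono) auto
    also have "\<dots> \<le> ?J"
      by (rule order_trans[OF Hardy_bounded[OF \<phi>, where k = "real k"] mult_right_mono[OF Hardy_const(1)]]) (use MN in auto)
    finally show ?thesis .
  qed
  have "(\<integral>\<^sup>+x. ennreal (N x * (norm (\<phi> x))\<^sup>2) / W x) =
      (\<integral>\<^sup>+x. liminf (\<lambda>k. ennreal (M k x * (norm (\<phi> x))\<^sup>2) / W x))"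
  proof (intro nn_integral_cong)
    fix x
    obtain k0 :: nat where k0: "N x \<le> real k0" using real_arch_simple by blast
    have "\<forall>\<^sub>F k in sequentially. ennreal (M k x * (norm (\<phi> x))\<^sup>2) / W x = ennreal (N x * (norm (\<phi> x))\<^sup>2) / W x"
      using eventually_ge_at_top[of k0] by eventually_elim (use k0 in \<open>auto simp: M_def min_def\<close>)
    then show "ennreal (N x * (norm (\<phi> x))\<^sup>2) / W x = liminf (\<lambda>k. ennreal (M k x * (norm (\<phi> x))\<^sup>2) / W x)"
      by (rule lim_imp_Liminf[OF sequentially_bot tendsto_eventually, symmetric])
  qed
  also have "\<dots> \<le> liminf (\<lambda>k. \<integral>\<^sup>+x. ennreal (M k x * (norm (\<phi> x))\<^sup>2) / W x)"
    by (rule nn_integral_liminf) measurable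
  also have "\<dots> \<le> ?J"
    by (rule Liminf_le) (use le in auto)
  finally show ?thesis unfolding W_def .
qed

section \<open>Weak gradients\<close>

text \<open>The positive and the negative part of \<open>g\<close> are densities of two measures
  that agree on boxes. Boxes form a generator closed under intersection, so the measures coincide
  and so do their densities.\<close>

lemma AE_zero_if_box_integrals_zero:
  fixes g :: "'a::euclidean_space \<Rightarrow> real"
  assumes g: "integrable lborel g"
    and box: "\<And>c d. (\<integral>x. g x * indicator (box c d) x) = 0"
  shows "AE x in lborel. g x = 0"
proof -
  note [measurable] = borel_measurable_integrable[OF g]
  let ?f = "\<lambda>x. ennreal (g x)" and ?f' = "\<lambda>x. ennreal (- g x)"
  have eq: "emeasure (density lborel ?f) (box c d) = emeasure (density lborel ?f') (box c d)" for c d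
  proof -
    have i: "integrable lborel (\<lambda>x. max 0 (g x) * indicator (box c d) x)"
      "integrable lborel (\<lambda>x. max 0 (- g x) * indicator (box c d) x)"
      using g by (auto intro!: integrable_real_mult_indicator)
    have "(\<integral>x. max 0 (g x) * indicator (box c d) x) - (\<integral>x. max 0 (- g x) * indicator (box c d) x) =
        (\<integral>x. max 0 (g x) * indicator (box c d) x - max 0 (- g x) * indicator (box c d) x)"
      using i by simp
    also have "\<dots> = (\<integral>x. g x * indicator (box c d) x)"
      by (intro Bochner_Integration.integral_cong) (auto simp: max_def indicator_def)
    finally have *: "(\<integral>x. max 0 (g x) * indicator (box c d) x) = (\<integral>x. max 0 (- g x) * indicator (box c d) x)"
      using box by simp
    have "emeasure (density lborel ?f) (box c d) = (\<integral>\<^sup>+x. ennreal (max 0 (g x) * indicator (box c d) x))"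
      by (subst emeasure_density) (auto intro!: nn_integral_cong simp: indicator_def max_def ennreal_neg)
    also have "\<dots> = (\<integral>\<^sup>+x. ennreal (max 0 (- g x) * indicator (box c d) x))"
      using i * by (subst (1 2) nn_integral_eq_integral) auto
    also have "\<dots> = emeasure (density lborel ?f') (box c d)"
      by (subst emeasure_density) (auto intro!: nn_integral_cong simp: indicator_def max_def ennreal_neg)
    finally show ?thesis .
  qed
  have "density lborel ?f = density lborel ?f'"
  proof (rule measure_eqI_generator_eq)
    let ?E = "range (\<lambda>(a, b). box a b::'a set)"
    show "Int_stable ?E"
      by (auto simp: Int_stable_def box_Int_box)
    show "?E \<subseteq> Pow UNIV" "sets (density lborel ?f) = sigma_sets UNIV ?E" "sets (density lborel ?f') = sigma_sets UNIV ?E"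
      by (simp_all add: borel_eq_box)
    let ?A = "\<lambda>n::nat. box (- (real n *\<^sub>R One)) (real n *\<^sub>R One) :: 'a set"
    show "range ?A \<subseteq> ?E" "(\<Union>i. ?A i) = UNIV"
      unfolding UN_box_eq_UNIV by auto
    show "emeasure (density lborel ?f) (?A i) \<noteq> \<infinity>" for i
    proof -
      have "emeasure (density lborel ?f) (?A i) \<le> (\<integral>\<^sup>+x. ennreal (norm (g x)))"
        by (subst emeasure_density) (auto intro!: nn_integral_mono simp: indicator_def ennreal_leI)
      also have "\<dots> < \<infinity>" using g by (simp add: integrable_iff_bounded)
      finally show ?thesis by simp
    qed
    show "emeasure (density lborel ?f) X = emeasure (density lborel ?f') X" if "X \<in> ?E" for X
      using that eq by auto
  qed
  then have "AE x in lborel. ?f x = ?f' x"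
    by (intro sigma_finite_measure.density_unique[OF sigma_finite_lborel]) auto
  then show ?thesis
  proof eventually_elim
    case (elim x)
    then show ?case
      by (cases "g x \<ge> 0") (auto simp: ennreal_neg)
  qed
qed

lemma bump_tendsto_indicator: "(\<lambda>n. bump [:1:] (real (Suc n) * s)) \<longlonglongrightarrow> (if s > 0 then 1 else 0)"
proof (cases "s > 0")
  case True
  have "(\<lambda>n. exp (- (1 / s) * (1 / real (Suc n)))) \<longlonglongrightarrow> exp (- (1 / s) * 0)"
    by (intro tendsto_intros LIMSEQ_inverse_real_of_nat[unfolded inverse_eq_divide])
  then show ?thesis using True by (simp add: bump_def mult.commute)
qed (auto simp: bump_def zero_less_mult_iff)

lemma bump_bounds: "0 \<le> bump [:1:] s" "bump [:1:] s \<le> 1"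
  by (auto simp: bump_def)

text \<open>A product over all faces of exp(-1 / (n s)), with s the distance to the face: each
  factor tends to 1 inside, and it vanishes for every n outside.\<close>

lemma test_function_box_approximation:
  fixes c d :: R3
  obtains \<phi> :: "nat \<Rightarrow> R3 \<Rightarrow> real" where "\<And>n S. cbox c d \<subseteq> S \<Longrightarrow> test_function S (\<phi> n)"
    "\<And>n x. 0 \<le> \<phi> n x" "\<And>n x. \<phi> n x \<le> 1" "\<And>n x. x \<notin> cbox c d \<Longrightarrow> \<phi> n x = 0"
    "\<And>x. (\<lambda>n. \<phi> n x) \<longlonglongrightarrow> indicator (box c d) x"
proof
  define \<phi> where "\<phi> n x = (\<Prod>i\<in>UNIV. bump [:1:] (real (Suc n) * (x $ i - c $ i)) *
      bump [:1:] (real (Suc n) * (d $ i - x $ i)))" for n and x :: R3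
  show off: "\<phi> n x = 0" if "x \<notin> cbox c d" for n x
  proof -
    have "\<exists>i. x $ i < c $ i \<or> d $ i < x $ i"
      using that by (auto simp: mem_box_cart not_le)
    then obtain i where "x $ i < c $ i \<or> d $ i < x $ i" ..
    then have "bump [:1:] (real (Suc n) * (x $ i - c $ i)) * bump [:1:] (real (Suc n) * (d $ i - x $ i)) = 0"
      by (auto simp: bump_def zero_less_mult_iff)
    then show ?thesis unfolding \<phi>_def by (intro prod_zero) auto
  qed
  show "0 \<le> \<phi> n x" "\<phi> n x \<le> 1" for n x
    unfolding \<phi>_def using bump_bounds by (auto intro!: prod_nonneg prod_le_1 mult_le_one)
  have "elem_smooth UNIV (\<phi> n)" for n
    unfolding \<phi>_def inner_axis_R3[symmetric]
    by (intro elem_smooth_prod elem_smooth.mult elem_smooth.bump elem_smooth.const elem_smooth_diff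
        elem_smooth.inner) auto
  then show "test_function S (\<phi> n)" if "cbox c d \<subseteq> S" for n S
    using that off unfolding test_function_def
    by (meson compact_cbox elem_smooth_smooth_on open_UNIV)
  show "(\<lambda>n. \<phi> n x) \<longlonglongrightarrow> indicator (box c d) x" for x
  proof -
    have "(\<lambda>n. \<phi> n x) \<longlonglongrightarrow> (\<Prod>i\<in>UNIV. (if x $ i - c $ i > 0 then 1 else 0) * (if d $ i - x $ i > 0 then 1 else 0))"
      unfolding \<phi>_def by (intro tendsto_prod tendsto_mult bump_tendsto_indicator)
    moreover have "(\<Prod>i\<in>UNIV. (if x $ i - c $ i > 0 then 1 else 0) * (if d $ i - x $ i > 0 then 1 else 0)) =
        (indicator (box c d) x :: real)"
    proof (cases "x \<in> box c d")
      case True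
      then show ?thesis by (auto simp: mem_box_cart)
    next
      case False
      then obtain i where "\<not> (c $ i < x $ i \<and> x $ i < d $ i)" by (auto simp: mem_box_cart)
      then have "(if x $ i - c $ i > 0 then 1 else 0) * (if d $ i - x $ i > 0 then 1 else 0) = (0 :: real)" by auto
      then have "(\<Prod>i\<in>UNIV. (if x $ i - c $ i > 0 then 1 else 0) * (if d $ i - x $ i > 0 then 1 else 0)) = (0 :: real)"
        by (intro prod_zero bexI[of _ i]) auto
      then show ?thesis using False by simp
    qed
    ultimately show ?thesis by simp
  qed
qed

text \<open>On a closed box inside the domain \<open>g\<close> is replaced by a Borel version, whose
  integral over every sub-box vanishes by approximation with test functions. Countably many such
  boxes exhaust the domain.\<close>

lemma fundamental_lemma_calculus_of_variations:
  fixes g :: "R3 \<Rightarrow> real"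
  assumes \<Omega>: "open \<Omega>" and g: "locally_integrable_on \<Omega> g"
    and zero: "\<And>\<phi> :: R3 \<Rightarrow> real. test_function \<Omega> \<phi> \<Longrightarrow> (\<integral>x. g x * \<phi> x \<partial>lebesgue_on \<Omega>) = 0"
  shows "AE x in lebesgue_on \<Omega>. g x = 0"
proof -
  have \<Omega>m: "\<Omega> \<in> sets lebesgue" using \<Omega> by auto
  have local: "AE x in lebesgue. x \<in> cbox a b \<longrightarrow> g x = 0" if ab: "cbox a b \<subseteq> \<Omega>" for a b
  proof -
    have "integrable (lebesgue_on (cbox a b)) g"
      using g ab unfolding locally_integrable_on_def by auto
    then have int1: "integrable lebesgue (\<lambda>x. indicator (cbox a b) x * g x)"
      by (subst (asm) integrable_restrict_space) auto
    then obtain g2 where [measurable]: "g2 \<in> borel_measurable lborel"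
      and g2: "AE x in lborel. indicator (cbox a b) x * g x = g2 x"
      using completion_ex_borel_measurable_real[OF borel_measurable_integrable] by blast
    have g2': "AE x in lebesgue. indicator (cbox a b) x * g x = g2 x"
      using g2 by (rule AE_completion)
    have "integrable lebesgue g2"
      by (rule integrable_cong_AE_imp[OF int1 _ g2']) (auto simp: measurable_completion)
    then have int2: "integrable lborel g2"
      by (simp add: integrable_completion)
    have int3: "integrable lborel (\<lambda>x. g2 x * indicator (box a b) x)"
      using int2 by (intro integrable_real_mult_indicator) auto
    have "AE x in lborel. g2 x * indicator (box a b) x = 0"
    proof (rule AE_zero_if_box_integrals_zero[OF int3])
      fix c d :: R3
      \<comment> \<open>An arbitrary box is first intersected with the fixed one, so that the
        approximating functions are supported in \<Omega>.\<close>
      obtain p q where pq: "box a b \<inter> box c d = box p q" "cbox a b \<inter> cbox c d = cbox p q"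
        unfolding box_Int_box Int_interval by blast
      obtain \<phi> :: "nat \<Rightarrow> R3 \<Rightarrow> real" where \<phi>: "\<And>n S. cbox p q \<subseteq> S \<Longrightarrow> test_function S (\<phi> n)"
        "\<And>n x. 0 \<le> \<phi> n x" "\<And>n x. \<phi> n x \<le> 1" "\<And>n x. x \<notin> cbox p q \<Longrightarrow> \<phi> n x = 0"
        "\<And>x. (\<lambda>n. \<phi> n x) \<longlonglongrightarrow> indicator (box p q) x"
        using test_function_box_approximation[of p q] by blast
      have "cbox p q \<subseteq> \<Omega>" using pq(2) ab by blast
      then have t: "test_function \<Omega> (\<phi> n)" for n by (rule \<phi>(1))
      have [measurable]: "\<phi> n \<in> borel_measurable borel" for n
      proof -
        have "continuous_on UNIV (\<phi> n)"
          using t[of n] unfolding test_function_def smooth_on_def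
          by (metis Ck_on.simps(1))
        then show ?thesis by (rule borel_measurable_continuous_onI)
      qed
      have z: "(\<integral>x. g2 x * \<phi> n x) = 0" for n
      proof -
        have "(\<integral>x. g2 x * \<phi> n x) = (\<integral>x. g2 x * \<phi> n x \<partial>lebesgue)"
          by (rule integral_completion[symmetric]) measurable
        also have "\<dots> = (\<integral>x. (indicator (cbox a b) x * g x) * \<phi> n x \<partial>lebesgue)"
        proof (rule integral_cong_AE)
          show "(\<lambda>x. indicator (cbox a b) x * g x * \<phi> n x) \<in> borel_measurable lebesgue"
            by (rule borel_measurable_times[OF borel_measurable_integrable[OF int1]])
              (auto simp: measurable_completion)
          show "AE x in lebesgue. g2 x * \<phi> n x = indicator (cbox a b) x * g x * \<phi> n x"
            using g2' by eventually_elim simp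
        qed (auto simp: measurable_completion)
        also have "\<dots> = (\<integral>x. indicator \<Omega> x *\<^sub>R (g x * \<phi> n x) \<partial>lebesgue)"
        proof (rule Bochner_Integration.integral_cong[OF refl])
          fix x show "indicator (cbox a b) x * g x * \<phi> n x = indicator \<Omega> x *\<^sub>R (g x * \<phi> n x)"
            using \<phi>(4)[of x n] pq(2) ab by (cases "x \<in> cbox p q") (auto simp: indicator_def)
        qed
        also have "\<dots> = (\<integral>x. g x * \<phi> n x \<partial>lebesgue_on \<Omega>)"
          using \<Omega>m by (subst integral_restrict_space) auto
        finally show ?thesis using zero[OF t] by simp
      qed
      have "(\<lambda>n. \<integral>x. g2 x * \<phi> n x) \<longlonglongrightarrow> (\<integral>x. g2 x * indicator (box p q) x)"
      proof (rule integral_dominated_convergence[where w = "\<lambda>x. norm (g2 x)"])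
        show "AE x in lborel. (\<lambda>n. g2 x * \<phi> n x) \<longlonglongrightarrow> g2 x * indicator (box p q) x"
          by (intro AE_I2 tendsto_intros \<phi>(5))
        show "AE x in lborel. norm (g2 x * \<phi> n x) \<le> norm (g2 x)" for n
          using \<phi>(2,3) by (intro AE_I2) (auto simp: abs_mult intro!: mult_left_le)
      qed (use int2 in auto)
      then have "(\<lambda>n. 0) \<longlonglongrightarrow> (\<integral>x. g2 x * indicator (box p q) x)"
        by (simp only: z)
      from LIMSEQ_unique[OF tendsto_const this]
      have "(\<integral>x. g2 x * indicator (box p q) x) = 0" by simp
      moreover have "g2 x * indicator (box a b) x * indicator (box c d) x = g2 x * indicator (box p q) x" for x
        using pq(1) by (auto simp: indicator_def)
      ultimately show "(\<integral>x. g2 x * indicator (box a b) x * indicator (box c d) x) = 0" by (simp only:)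
    qed
    moreover have "AE x in lborel. x \<notin> cbox a b - box a b"
    proof (rule AE_not_in)
      have "cbox a b - box a b \<in> null_sets lebesgue"
        using negligible_frontier_interval by (simp add: negligible_iff_null_sets)
      then show "cbox a b - box a b \<in> null_sets lborel"
        by (auto simp: null_sets_completion_iff)
    qed
    ultimately have "AE x in lborel. x \<in> cbox a b \<longrightarrow> g x = 0"
      using g2
    proof eventually_elim
      case (elim x)
      then show ?case by (auto simp: indicator_def split: if_splits)
    qed
    then show ?thesis by (rule AE_completion)
  qed
  obtain \<D> :: "R3 set set" where D: "countable \<D>" "\<D> \<subseteq> Pow \<Omega>" "\<And>X. X \<in> \<D> \<Longrightarrow> \<exists>a b. X = cbox a b" "\<Union>\<D> = \<Omega>"
    using open_countable_Union_open_cbox[OF \<Omega>] by metis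
  have "AE x in lebesgue. \<forall>X\<in>\<D>. x \<in> X \<longrightarrow> g x = 0"
  proof (subst AE_ball_countable[OF D(1)], intro ballI)
    fix X assume X: "X \<in> \<D>"
    then obtain a b where "X = cbox a b" using D(3) by blast
    then show "AE x in lebesgue. x \<in> X \<longrightarrow> g x = 0" using local[of a b] D(2) X by auto
  qed
  then have "AE x in lebesgue. x \<in> \<Omega> \<longrightarrow> g x = 0"
    by eventually_elim (use D(4) in blast)
  then show ?thesis using \<Omega>m by (subst AE_restrict_space_iff) auto
qed

lemma borel_measurable_locally_integrable:
  fixes g :: "'a::euclidean_space \<Rightarrow> 'b::euclidean_space"
  assumes \<Omega>: "open \<Omega>" and g: "locally_integrable_on \<Omega> g"
  shows "g \<in> borel_measurable (lebesgue_on \<Omega>)"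
proof -
  obtain \<D> :: "'a set set" where D: "countable \<D>" "\<D> \<subseteq> Pow \<Omega>" "\<And>X. X \<in> \<D> \<Longrightarrow> \<exists>a b. X = cbox a b" "\<Union>\<D> = \<Omega>"
    using open_countable_Union_open_cbox[OF \<Omega>] by metis
  have X: "compact X" "X \<subseteq> \<Omega>" "X \<in> sets lebesgue" if XD: "X \<in> \<D>" for X
  proof -
    obtain a b where "X = cbox a b" using D(3)[OF XD] by blast
    then show "compact X" "X \<subseteq> \<Omega>" "X \<in> sets lebesgue" using D(2) XD by auto
  qed
  show ?thesis
  proof (rule measurable_piecewise_restrict[OF D(1)])
    show "X \<inter> space (lebesgue_on \<Omega>) \<in> sets (lebesgue_on \<Omega>)" if "X \<in> \<D>" for X
      using X[OF that] \<Omega> by (auto simp: sets_restrict_space)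
    show "g \<in> borel_measurable (restrict_space (lebesgue_on \<Omega>) X)" if "X \<in> \<D>" for X
    proof -
      have "restrict_space (lebesgue_on \<Omega>) X = lebesgue_on X"
        using X[OF that] \<Omega> by (subst restrict_restrict_space) (auto simp: Int_absorb1)
      moreover have "integrable (lebesgue_on X) g"
        using g X[OF that] unfolding locally_integrable_on_def by blast
      ultimately show ?thesis by simp
    qed
  qed (use D(4) in auto)
qed

section \<open>Uniqueness of weak gradients and their compatibility with classical ones\<close>

lemma integrable_locally_integrable_mult_test:
  fixes g :: "'a::euclidean_space \<Rightarrow> real" and \<phi> :: "'a \<Rightarrow> real"
  assumes \<Omega>: "\<Omega> \<in> sets lebesgue" and g: "locally_integrable_on \<Omega> g"
    and \<phi>: "continuous_on UNIV \<phi>" "compact C" "C \<subseteq> \<Omega>" "\<And>x. x \<notin> C \<Longrightarrow> \<phi> x = 0"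
  shows "integrable (lebesgue_on \<Omega>) (\<lambda>x. g x * \<phi> x)"
proof -
  obtain M where M: "\<And>x. \<bar>\<phi> x\<bar> \<le> M"
    using bounded_compact_support[OF \<phi>(1,2,4)] by auto
  have [measurable]: "\<phi> \<in> borel_measurable lebesgue"
    using \<phi>(1) by (intro measurable_completion) (auto intro: borel_measurable_continuous_onI)
  have "integrable (lebesgue_on C) g"
    using g \<phi>(2,3) unfolding locally_integrable_on_def by blast
  then have i: "integrable lebesgue (\<lambda>x. indicator C x * g x)"
    using fmeasurableD[OF lmeasurable_compact[OF \<phi>(2)]] by (subst (asm) integrable_restrict_space) auto
  have "integrable lebesgue (\<lambda>x. (indicator C x * g x) * \<phi> x)"
  proof (rule Bochner_Integration.integrable_bound)
    show "integrable lebesgue (\<lambda>x. (indicator C x * g x) * M)" using i by simp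
    show "AE x in lebesgue. norm ((indicator C x * g x) * \<phi> x) \<le> norm ((indicator C x * g x) * M)"
      using M by (intro AE_I2) (auto simp: abs_mult intro!: mult_left_mono order_trans[OF M])
    show "(\<lambda>x. (indicator C x * g x) * \<phi> x) \<in> borel_measurable lebesgue"
      using borel_measurable_integrable[OF i] by measurable
  qed
  moreover have "(indicator C x * g x) * \<phi> x = indicator \<Omega> x *\<^sub>R (g x * \<phi> x)" for x
    using \<phi>(3,4) by (cases "x \<in> C") (auto simp: indicator_def)
  ultimately show ?thesis
    using \<Omega> by (subst integrable_restrict_space) auto
qed

lemma integrable_vec_nth_R3:
  fixes w :: "'a \<Rightarrow> R3"
  assumes "integrable M w"
  shows "integrable M (\<lambda>x. w x $ i)"
  using integrable_inner_left[OF assms, of "axis i 1"] by simp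

lemma locally_integrable_on_component:
  fixes G :: "'a::euclidean_space \<Rightarrow> real ^ 3 ^ 3"
  assumes "locally_integrable_on \<Omega> G"
  shows "locally_integrable_on \<Omega> (\<lambda>x. G x $ i $ j)"
proof -
  have "G x $ i $ j = G x \<bullet> axis i (axis j 1)" for x
    by (simp add: inner_axis)
  then show ?thesis using assms unfolding locally_integrable_on_def by simp
qed

lemma locally_integrable_on_diff:
  assumes "locally_integrable_on \<Omega> f" "locally_integrable_on \<Omega> g"
  shows "locally_integrable_on \<Omega> (\<lambda>x. f x - g x)"
  using assms unfolding locally_integrable_on_def by auto

lemma locally_integrable_on_continuous:
  fixes f :: "'a::euclidean_space \<Rightarrow> 'b::euclidean_space"
  assumes "continuous_on UNIV f"
  shows "locally_integrable_on \<Omega> f"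
  unfolding locally_integrable_on_def
proof (intro allI impI, elim conjE)
  fix C :: "'a set" assume C: "compact C" "C \<subseteq> \<Omega>"
  have "integrable lborel (\<lambda>x. indicator C x *\<^sub>R f x)"
    using assms C(1) by (intro borel_integrable_compact) (auto intro: continuous_on_subset)
  then have "integrable lebesgue (\<lambda>x. indicator C x *\<^sub>R f x)"
    by (subst integrable_completion) auto
  then show "integrable (lebesgue_on C) f"
    using fmeasurableD[OF lmeasurable_compact[OF C(1)]] by (subst integrable_restrict_space) auto
qed

lemma test_function_real_props:
  fixes \<phi> :: "R3 \<Rightarrow> real"
  assumes "test_function S \<phi>"
  obtains C where "compact C" "C \<subseteq> S" "\<And>x. x \<notin> C \<Longrightarrow> \<phi> x = 0" "continuous_on UNIV \<phi>"
    "\<And>x j. x \<notin> C \<Longrightarrow> frechet_derivative \<phi> (at x) (axis j 1) = 0"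
    "\<And>j. continuous_on UNIV (\<lambda>x. frechet_derivative \<phi> (at x) (axis j 1))"
proof -
  obtain C where C: "compact C" "C \<subseteq> S" "\<And>x. x \<notin> C \<Longrightarrow> \<phi> x = 0"
    using assms unfolding test_function_def by blast
  show ?thesis
  proof (rule that[OF C])
    show "continuous_on UNIV \<phi>" by (rule test_function_continuous[OF assms])
    show "frechet_derivative \<phi> (at x) (axis j 1) = 0" if "x \<notin> C" for x j
      using has_derivative_zero_off_closed[OF test_function_has_derivative[OF assms] compact_imp_closed[OF C(1)] C(3) that]
      by simp
    show "continuous_on UNIV (\<lambda>x. frechet_derivative \<phi> (at x) (axis j 1))" for j
      by (rule test_function_continuous_deriv[OF assms]) (simp add: axis_in_Basis_iff)
  qed
qed

theorem weak_gradient_unique: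
  assumes \<Omega>: "open \<Omega>" and G: "weak_gradient \<Omega> v G" and G': "weak_gradient \<Omega> v G'"
  shows "AE x in lebesgue_on \<Omega>. G x = G' x"
proof -
  have "AE x in lebesgue_on \<Omega>. G x $ i $ j - G' x $ i $ j = 0" for i j
  proof (rule fundamental_lemma_calculus_of_variations[OF \<Omega>])
    have li: "locally_integrable_on \<Omega> (\<lambda>x. G x $ i $ j)" "locally_integrable_on \<Omega> (\<lambda>x. G' x $ i $ j)"
      using G G' unfolding weak_gradient_def by (auto intro: locally_integrable_on_component)
    then show "locally_integrable_on \<Omega> (\<lambda>x. G x $ i $ j - G' x $ i $ j)"
      by (rule locally_integrable_on_diff)
    fix \<phi> :: "R3 \<Rightarrow> real" assume t: "test_function \<Omega> \<phi>"
    obtain C where C: "compact C" "C \<subseteq> \<Omega>" "\<And>x. x \<notin> C \<Longrightarrow> \<phi> x = 0" "continuous_on UNIV \<phi>"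
      using test_function_real_props[OF t] by metis
    have "integrable (lebesgue_on \<Omega>) (\<lambda>x. G x $ i $ j * \<phi> x)" "integrable (lebesgue_on \<Omega>) (\<lambda>x. G' x $ i $ j * \<phi> x)"
      using \<Omega> by (auto intro!: integrable_locally_integrable_mult_test[OF _ _ C(4,1,2,3)] li)
    then have "(\<integral>x. (G x $ i $ j - G' x $ i $ j) * \<phi> x \<partial>lebesgue_on \<Omega>) =
        (\<integral>x. G x $ i $ j * \<phi> x \<partial>lebesgue_on \<Omega>) - (\<integral>x. G' x $ i $ j * \<phi> x \<partial>lebesgue_on \<Omega>)"
      by (simp add: left_diff_distrib)
    moreover have "(\<integral>x. G x $ i $ j * \<phi> x \<partial>lebesgue_on \<Omega>) = (\<integral>x. G' x $ i $ j * \<phi> x \<partial>lebesgue_on \<Omega>)"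
    proof -
      have "(\<integral>x. v x $ i * frechet_derivative \<phi> (at x) (axis j 1) \<partial>lebesgue_on \<Omega>) = - (\<integral>x. G x $ i $ j * \<phi> x \<partial>lebesgue_on \<Omega>)"
        "(\<integral>x. v x $ i * frechet_derivative \<phi> (at x) (axis j 1) \<partial>lebesgue_on \<Omega>) = - (\<integral>x. G' x $ i $ j * \<phi> x \<partial>lebesgue_on \<Omega>)"
        using G G' t unfolding weak_gradient_def by simp_all
      then show ?thesis by linarith
    qed
    ultimately show "(\<integral>x. (G x $ i $ j - G' x $ i $ j) * \<phi> x \<partial>lebesgue_on \<Omega>) = 0" by simp
  qed
  then have "AE x in lebesgue_on \<Omega>. \<forall>i\<in>UNIV. \<forall>j\<in>UNIV. G x $ i $ j - G' x $ i $ j = 0"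
    by (intro AE_finite_allI) auto
  then show ?thesis
    by eventually_elim (auto simp: vec_eq_iff)
qed

lemma integral_lebesgue_on_eq_lborel:
  fixes f :: "'a::euclidean_space \<Rightarrow> 'b::{banach, second_countable_topology}"
  assumes "f \<in> borel_measurable borel" "\<Omega> \<in> sets borel" "\<And>x. x \<notin> \<Omega> \<Longrightarrow> f x = 0"
  shows "(\<integral>x. f x \<partial>lebesgue_on \<Omega>) = (\<integral>x. f x)"
proof -
  have "(\<integral>x. f x \<partial>lebesgue_on \<Omega>) = (\<integral>x. indicator \<Omega> x *\<^sub>R f x \<partial>lebesgue)"
    using assms(2) by (subst integral_restrict_space) auto
  also have "(\<lambda>x. indicator \<Omega> x *\<^sub>R f x) = f"
    using assms(3) by (auto simp: indicator_def)
  also have "(\<integral>x. f x \<partial>lebesgue) = (\<integral>x. f x)"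
    by (rule integral_completion) (use assms(1) in simp)
  finally show ?thesis .
qed

text \<open>Integration by parts: the directional derivative of the compactly supported product of a
  component of \<phi> with \<psi> has integral zero.\<close>

lemma weak_gradient_test_function:
  fixes \<phi> :: "R3 \<Rightarrow> R3"
  assumes \<Omega>: "open \<Omega>" and \<phi>: "test_function \<Omega> \<phi>"
  shows "weak_gradient \<Omega> \<phi> (jacobian \<phi>)"
  unfolding weak_gradient_def
proof (intro conjI allI impI)
  note cont\<phi> = test_function_continuous[OF \<phi>] and contj = continuous_jacobian[OF \<phi>]
  show "locally_integrable_on \<Omega> \<phi>" "locally_integrable_on \<Omega> (jacobian \<phi>)"
    by (rule locally_integrable_on_continuous, fact)+
  fix \<psi> :: "R3 \<Rightarrow> real" and i j assume \<psi>: "test_function \<Omega> \<psi>"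
  obtain C where C: "compact C" "C \<subseteq> \<Omega>" "\<And>x. x \<notin> C \<Longrightarrow> \<psi> x = 0" "continuous_on UNIV \<psi>"
    "\<And>x. x \<notin> C \<Longrightarrow> frechet_derivative \<psi> (at x) (axis j 1) = 0"
    "continuous_on UNIV (\<lambda>x. frechet_derivative \<psi> (at x) (axis j 1))"
    using test_function_real_props[OF \<psi>] by metis
  have c1: "continuous_on UNIV (\<lambda>x. \<phi> x $ i * frechet_derivative \<psi> (at x) (axis j 1))"
    by (intro continuous_intros cont\<phi> C(6))
  have c2: "continuous_on UNIV (\<lambda>x. jacobian \<phi> x $ i $ j * \<psi> x)"
    by (intro continuous_intros contj C(4))
  have i1: "integrable lborel (\<lambda>x. \<phi> x $ i * frechet_derivative \<psi> (at x) (axis j 1))"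
    by (rule integrable_compact_support[OF c1 C(1)]) (simp add: C)
  have i2: "integrable lborel (\<lambda>x. jacobian \<phi> x $ i $ j * \<psi> x)"
    by (rule integrable_compact_support[OF c2 C(1)]) (simp add: C)
  have "(\<integral>x. \<phi> x $ i * frechet_derivative \<psi> (at x) (axis j 1) +
      frechet_derivative \<phi> (at x) (axis j 1) $ i * \<psi> x) = 0"
  proof (rule integral_directional_derivative_zero[where f = "\<lambda>x. \<phi> x $ i * \<psi> x" and C = C and
        D = "\<lambda>x v. \<phi> x $ i * frechet_derivative \<psi> (at x) v + frechet_derivative \<phi> (at x) v $ i * \<psi> x"])
    show "((\<lambda>x. \<phi> x $ i * \<psi> x) has_derivative
        (\<lambda>v. \<phi> x $ i * frechet_derivative \<psi> (at x) v + frechet_derivative \<phi> (at x) v $ i * \<psi> x)) (at x)" for x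
      by (intro has_derivative_mult test_function_has_derivative[OF \<psi>]
          bounded_linear.has_derivative[OF bounded_linear_vec_nth test_function_has_derivative[OF \<phi>]])
    show "continuous_on UNIV (\<lambda>x. \<phi> x $ i * frechet_derivative \<psi> (at x) (axis j 1) +
        frechet_derivative \<phi> (at x) (axis j 1) $ i * \<psi> x)"
      using continuous_on_add[OF c1 c2] by (simp add: jacobian_def)
  qed (use C in auto)
  then have "(\<integral>x. \<phi> x $ i * frechet_derivative \<psi> (at x) (axis j 1)) = - (\<integral>x. jacobian \<phi> x $ i $ j * \<psi> x)"
    using i1 i2 by (simp add: jacobian_def)
  moreover have "(\<integral>x. \<phi> x $ i * frechet_derivative \<psi> (at x) (axis j 1) \<partial>lebesgue_on \<Omega>) =
      (\<integral>x. \<phi> x $ i * frechet_derivative \<psi> (at x) (axis j 1))"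
    using \<Omega> C(2,5) by (intro integral_lebesgue_on_eq_lborel borel_measurable_continuous_onI c1) auto
  moreover have "(\<integral>x. jacobian \<phi> x $ i $ j * \<psi> x \<partial>lebesgue_on \<Omega>) = (\<integral>x. jacobian \<phi> x $ i $ j * \<psi> x)"
    using \<Omega> C(2,3) by (intro integral_lebesgue_on_eq_lborel borel_measurable_continuous_onI c2) auto
  ultimately show "(\<integral>x. \<phi> x $ i * frechet_derivative \<psi> (at x) (axis j 1) \<partial>lebesgue_on \<Omega>) =
      - (\<integral>x. jacobian \<phi> x $ i $ j * \<psi> x \<partial>lebesgue_on \<Omega>)" by simp
qed

lemma weak_gradient_diff_test:
  assumes \<Omega>: "open \<Omega>" and G: "weak_gradient \<Omega> v G" and \<phi>: "test_function \<Omega> \<phi>"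
  shows "weak_gradient \<Omega> (\<lambda>x. v x - \<phi> x) (\<lambda>x. G x - jacobian \<phi> x)"
  unfolding weak_gradient_def
proof (intro conjI allI impI)
  note J = weak_gradient_test_function[OF \<Omega> \<phi>]
  show "locally_integrable_on \<Omega> (\<lambda>x. v x - \<phi> x)" "locally_integrable_on \<Omega> (\<lambda>x. G x - jacobian \<phi> x)"
    using G J unfolding weak_gradient_def by (auto intro: locally_integrable_on_diff)
  fix \<psi> :: "R3 \<Rightarrow> real" and i j assume \<psi>: "test_function \<Omega> \<psi>"
  obtain C where C: "compact C" "C \<subseteq> \<Omega>" "\<And>x. x \<notin> C \<Longrightarrow> \<psi> x = 0" "continuous_on UNIV \<psi>"
    "\<And>x. x \<notin> C \<Longrightarrow> frechet_derivative \<psi> (at x) (axis j 1) = 0"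
    "continuous_on UNIV (\<lambda>x. frechet_derivative \<psi> (at x) (axis j 1))"
    using test_function_real_props[OF \<psi>] by metis
  have comp: "locally_integrable_on \<Omega> (\<lambda>x. w x $ i)" if "locally_integrable_on \<Omega> w" for w :: "R3 \<Rightarrow> R3"
    using that unfolding locally_integrable_on_def by (auto intro: integrable_vec_nth_R3)
  have i1: "integrable (lebesgue_on \<Omega>) (\<lambda>x. w x $ i * frechet_derivative \<psi> (at x) (axis j 1))"
    if "locally_integrable_on \<Omega> w" for w :: "R3 \<Rightarrow> R3"
    using \<Omega> by (intro integrable_locally_integrable_mult_test[OF _ comp[OF that] C(6,1,2,5)]) auto
  have i2: "integrable (lebesgue_on \<Omega>) (\<lambda>x. H x $ i $ j * \<psi> x)" if "locally_integrable_on \<Omega> H" for H :: "R3 \<Rightarrow> real ^ 3 ^ 3"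
    using \<Omega> by (intro integrable_locally_integrable_mult_test[OF _ locally_integrable_on_component[OF that] C(4,1,2,3)]) auto
  have *: "locally_integrable_on \<Omega> v" "locally_integrable_on \<Omega> \<phi>" "locally_integrable_on \<Omega> G" "locally_integrable_on \<Omega> (jacobian \<phi>)"
    "(\<integral>x. v x $ i * frechet_derivative \<psi> (at x) (axis j 1) \<partial>lebesgue_on \<Omega>) = - (\<integral>x. G x $ i $ j * \<psi> x \<partial>lebesgue_on \<Omega>)"
    "(\<integral>x. \<phi> x $ i * frechet_derivative \<psi> (at x) (axis j 1) \<partial>lebesgue_on \<Omega>) = - (\<integral>x. jacobian \<phi> x $ i $ j * \<psi> x \<partial>lebesgue_on \<Omega>)"
    using G J \<psi> unfolding weak_gradient_def by blast+
  show "(\<integral>x. (v x - \<phi> x) $ i * frechet_derivative \<psi> (at x) (axis j 1) \<partial>lebesgue_on \<Omega>) =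
      - (\<integral>x. (G x - jacobian \<phi> x) $ i $ j * \<psi> x \<partial>lebesgue_on \<Omega>)"
    using i1[OF *(1)] i1[OF *(2)] i2[OF *(3)] i2[OF *(4)] *(5,6)
    by (simp add: left_diff_distrib)
qed

section \<open>Functional inequalities in the Sobolev space\<close>

lemma ennreal_sqrt_power2: "(ennreal_sqrt a)\<^sup>2 = a"
proof (cases a)
  case (real r)
  then show ?thesis by (simp add: ennreal_sqrt_def ennreal_power)
qed (simp add: ennreal_sqrt_def power2_eq_square)

lemma nn_integral_lebesgue_on:
  fixes f :: "'a::euclidean_space \<Rightarrow> ennreal"
  assumes "S \<in> sets lebesgue"
  shows "(\<integral>\<^sup>+x. f x \<partial>lebesgue_on S) = (\<integral>\<^sup>+x. f x * indicator S x)"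
  using assms by (simp add: nn_integral_restrict_space nn_integral_completion)

lemma nn_integral_lebesgue_on_cong_lborel:
  fixes f g :: "'a::euclidean_space \<Rightarrow> ennreal"
  assumes "S \<in> sets lebesgue" "AE x in lborel. x \<in> S \<longrightarrow> f x = g x" "\<And>x. x \<notin> S \<Longrightarrow> g x = 0"
  shows "(\<integral>\<^sup>+x. f x \<partial>lebesgue_on S) = (\<integral>\<^sup>+x. g x)"
  unfolding nn_integral_lebesgue_on[OF assms(1)]
  by (rule nn_integral_cong_AE, use assms(2) in eventually_elim) (use assms(3) in \<open>auto simp: indicator_def\<close>)

lemma nn_integral_lebesgue_on_eq_lborel:
  fixes f :: "'a::euclidean_space \<Rightarrow> ennreal"
  assumes "S \<in> sets lebesgue" "\<And>x. x \<notin> S \<Longrightarrow> f x = 0"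
  shows "(\<integral>\<^sup>+x. f x \<partial>lebesgue_on S) = (\<integral>\<^sup>+x. f x)"
  using assms by (intro nn_integral_lebesgue_on_cong_lborel) auto

lemma W12_norm_eq:
  assumes \<Omega>: "open \<Omega>" and G: "weak_gradient \<Omega> v G"
  shows "(W12_norm \<Omega> v)\<^sup>2 = (\<integral>\<^sup>+x. ennreal ((norm (v x))\<^sup>2) \<partial>lebesgue_on \<Omega>) +
      (\<integral>\<^sup>+x. ennreal ((norm (G x))\<^sup>2) \<partial>lebesgue_on \<Omega>)"
proof -
  have "(\<integral>\<^sup>+x. ennreal ((norm (G' x))\<^sup>2) \<partial>lebesgue_on \<Omega>) = (\<integral>\<^sup>+x. ennreal ((norm (G x))\<^sup>2) \<partial>lebesgue_on \<Omega>)"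
    if "G' \<in> Collect (weak_gradient \<Omega> v)" for G'
    using weak_gradient_unique[OF \<Omega> _ G, of G'] that
    by (intro nn_integral_cong_AE) (auto elim: eventually_mono)
  then have "W12_norm \<Omega> v = (INF G'\<in>Collect (weak_gradient \<Omega> v). ennreal_sqrt
      ((\<integral>\<^sup>+x. ennreal ((norm (v x))\<^sup>2) \<partial>lebesgue_on \<Omega>) + (\<integral>\<^sup>+x. ennreal ((norm (G x))\<^sup>2) \<partial>lebesgue_on \<Omega>)))"
    unfolding W12_norm_def by (intro INF_cong) auto
  also have "\<dots> = ennreal_sqrt ((\<integral>\<^sup>+x. ennreal ((norm (v x))\<^sup>2) \<partial>lebesgue_on \<Omega>) +
      (\<integral>\<^sup>+x. ennreal ((norm (G x))\<^sup>2) \<partial>lebesgue_on \<Omega>))"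
    using G by (intro cINF_const) auto
  finally show ?thesis by (simp add: ennreal_sqrt_power2)
qed

lemma W12_weak_gradient:
  assumes "v \<in> W12 \<Omega>"
  obtains G where "weak_gradient \<Omega> v G"
  using assms unfolding W12_def W12_norm_def
  by (cases "Collect (weak_gradient \<Omega> v) = {}") (auto simp: top_ennreal_def)

lemma W12_0_approximation:
  assumes \<Omega>: "open \<Omega>" and v: "v \<in> W12_0 \<Omega>" and G: "weak_gradient \<Omega> v G"
  obtains \<phi> where "\<And>n. test_function \<Omega> (\<phi> n)" "AE x in lebesgue_on \<Omega>. (\<lambda>n. \<phi> n x) \<longlonglongrightarrow> v x"
    "(\<lambda>n. \<integral>\<^sup>+x. ennreal ((norm (G x - jacobian (\<phi> n) x))\<^sup>2) \<partial>lebesgue_on \<Omega>) \<longlonglongrightarrow> 0"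
proof -
  obtain \<phi>0 where \<phi>0: "\<And>n. test_function \<Omega> (\<phi>0 n)" "(\<lambda>n. W12_norm \<Omega> (\<lambda>x. v x - \<phi>0 n x)) \<longlonglongrightarrow> 0"
    using v unfolding W12_0_def by blast
  have "(\<lambda>n. W12_norm \<Omega> (\<lambda>x. v x - \<phi>0 n x) * W12_norm \<Omega> (\<lambda>x. v x - \<phi>0 n x)) \<longlonglongrightarrow> 0 * 0"
    by (intro tendsto_mult_ennreal \<phi>0) auto
  then have lim0: "(\<lambda>n. (\<integral>\<^sup>+x. ennreal ((norm (v x - \<phi>0 n x))\<^sup>2) \<partial>lebesgue_on \<Omega>) +
      (\<integral>\<^sup>+x. ennreal ((norm (G x - jacobian (\<phi>0 n) x))\<^sup>2) \<partial>lebesgue_on \<Omega>)) \<longlonglongrightarrow> 0"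
    by (simp add: W12_norm_eq[OF \<Omega> weak_gradient_diff_test[OF \<Omega> G \<phi>0(1)], unfolded power2_eq_square] power2_eq_square)
  obtain n0 where n0: "\<And>n. n \<ge> n0 \<Longrightarrow> (\<integral>\<^sup>+x. ennreal ((norm (v x - \<phi>0 n x))\<^sup>2) \<partial>lebesgue_on \<Omega>) +
      (\<integral>\<^sup>+x. ennreal ((norm (G x - jacobian (\<phi>0 n) x))\<^sup>2) \<partial>lebesgue_on \<Omega>) < 1"
    using order_tendstoD(2)[OF lim0, of 1] by (auto simp: eventually_sequentially)
  \<comment> \<open>The tail is chosen so that every L^2 distance is below 1; the differences are
    then integrable, as the passage to an almost everywhere convergent subsequence requires.\<close>
  define \<phi>1 where "\<phi>1 n = \<phi>0 (n + n0)" for n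
  define a where "a n = (\<integral>\<^sup>+x. ennreal ((norm (v x - \<phi>1 n x))\<^sup>2) \<partial>lebesgue_on \<Omega>)" for n
  define b where "b n = (\<integral>\<^sup>+x. ennreal ((norm (G x - jacobian (\<phi>1 n) x))\<^sup>2) \<partial>lebesgue_on \<Omega>)" for n
  have ab: "(\<lambda>n. a n + b n) \<longlonglongrightarrow> 0"
    using LIMSEQ_ignore_initial_segment[OF lim0, of n0] by (simp add: a_def b_def \<phi>1_def)
  have a0: "a \<longlonglongrightarrow> 0" and b0: "b \<longlonglongrightarrow> 0"
    by (rule tendsto_sandwich[OF _ _ tendsto_const ab]; simp)+
  have a1: "a n < 1" for n
    using n0[of "n + n0"] order.strict_trans1[of "a n" "a n + b n" 1] by (simp add: a_def b_def \<phi>1_def)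
  have vm: "v \<in> borel_measurable (lebesgue_on \<Omega>)"
    using G \<Omega> unfolding weak_gradient_def by (intro borel_measurable_locally_integrable) auto
  have \<phi>m: "\<phi>1 n \<in> borel_measurable (lebesgue_on \<Omega>)" for n
    using test_function_continuous[OF \<phi>0(1)] \<Omega> unfolding \<phi>1_def
    by (intro measurable_restrict_space1 measurable_completion) (auto intro: borel_measurable_continuous_onI)
  have int: "integrable (lebesgue_on \<Omega>) (\<lambda>x. (norm (v x - \<phi>1 n x))\<^sup>2)" for n
    using a1[of n] vm \<phi>m[of n] by (auto simp: integrable_iff_bounded a_def order_less_trans)
  have "(\<lambda>n. \<integral>x. norm ((norm (v x - \<phi>1 n x))\<^sup>2) \<partial>lebesgue_on \<Omega>) \<longlonglongrightarrow> 0"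
  proof -
    have "ennreal (\<integral>x. norm ((norm (v x - \<phi>1 n x))\<^sup>2) \<partial>lebesgue_on \<Omega>) = a n" for n
      using int[of n] by (simp add: a_def nn_integral_eq_integral)
    then have "(\<lambda>n. ennreal (\<integral>x. norm ((norm (v x - \<phi>1 n x))\<^sup>2) \<partial>lebesgue_on \<Omega>)) \<longlonglongrightarrow> ennreal 0"
      using a0 by simp
    then show ?thesis by (subst (asm) tendsto_ennreal_iff) auto
  qed
  from tendsto_L1_AE_subseq[OF int this]
  obtain r where r: "strict_mono r" "AE x in lebesgue_on \<Omega>. (\<lambda>n. (norm (v x - \<phi>1 (r n) x))\<^sup>2) \<longlonglongrightarrow> 0"
    by blast
  show ?thesis
  proof (rule that[of "\<lambda>n. \<phi>1 (r n)"])
    show "test_function \<Omega> (\<phi>1 (r n))" for n by (simp add: \<phi>1_def \<phi>0)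
    show "AE x in lebesgue_on \<Omega>. (\<lambda>n. \<phi>1 (r n) x) \<longlonglongrightarrow> v x"
      using r(2)
    proof eventually_elim
      case (elim x)
      then have "(\<lambda>n. sqrt ((norm (v x - \<phi>1 (r n) x))\<^sup>2)) \<longlonglongrightarrow> sqrt 0" by (intro tendsto_intros)
      then have "(\<lambda>n. norm (\<phi>1 (r n) x - v x)) \<longlonglongrightarrow> 0" by (simp add: norm_minus_commute)
      then show ?case by (simp add: tendsto_norm_zero_iff LIM_zero_iff)
    qed
    show "(\<lambda>n. \<integral>\<^sup>+x. ennreal ((norm (G x - jacobian (\<phi>1 (r n)) x))\<^sup>2) \<partial>lebesgue_on \<Omega>) \<longlonglongrightarrow> 0"
      using LIMSEQ_subseq_LIMSEQ[OF b0 r(1)] by (simp add: b_def o_def)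
  qed
qed

text \<open>A common density argument for the Sobolev inequality (\<open>k = 3\<close>) and the
  Hardy inequality (\<open>k = 1\<close>): along an almost everywhere convergent subsequence Fatou's
  lemma handles the left side, which may depend on x through a weight. The factor 2 is the price of
  bounding the gradients of the approximations by those of \<open>v\<close> through (p + q)^2 \<le>
  2 p^2 + 2 q^2.\<close>

lemma W12_0_inequality:
  fixes \<Psi> :: "R3 \<Rightarrow> R3 \<Rightarrow> ennreal"
  assumes \<Omega>: "open \<Omega>" and v: "v \<in> W12_0 \<Omega>" and c: "c \<ge> 0"
    and cont: "\<And>x y ys. ys \<longlonglongrightarrow> y \<Longrightarrow> (\<lambda>n. \<Psi> x (ys n)) \<longlonglongrightarrow> \<Psi> x y"
    and meas: "\<And>\<phi>. test_function \<Omega> \<phi> \<Longrightarrow> (\<lambda>x. \<Psi> x (\<phi> x)) \<in> borel_measurable borel"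
    and le: "\<And>\<phi>. test_function \<Omega> \<phi> \<Longrightarrow> (\<integral>\<^sup>+x. \<Psi> x (\<phi> x)) \<le>
      ennreal c * (\<integral>\<^sup>+x. ennreal ((norm (jacobian \<phi> x))\<^sup>2)) ^ k"
  shows "(\<integral>\<^sup>+x. \<Psi> x (v x) \<partial>lebesgue_on \<Omega>) \<le> ennreal c * (2 * (W12_norm \<Omega> v)\<^sup>2) ^ k"
proof -
  have \<Omega>m: "\<Omega> \<in> sets lebesgue" using \<Omega> by auto
  have vW: "v \<in> W12 \<Omega>" using v by (simp add: W12_0_def)
  obtain G where G: "weak_gradient \<Omega> v G" using W12_weak_gradient[OF vW] .
  obtain \<phi> where \<phi>: "\<And>n. test_function \<Omega> (\<phi> n)" "AE x in lebesgue_on \<Omega>. (\<lambda>n. \<phi> n x) \<longlonglongrightarrow> v x"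
    "(\<lambda>n. \<integral>\<^sup>+x. ennreal ((norm (G x - jacobian (\<phi> n) x))\<^sup>2) \<partial>lebesgue_on \<Omega>) \<longlonglongrightarrow> 0"
    by (rule W12_0_approximation[OF \<Omega> v G]) (rule that)
  have Gm: "G \<in> borel_measurable (lebesgue_on \<Omega>)"
    using G \<Omega> unfolding weak_gradient_def by (intro borel_measurable_locally_integrable) auto
  have jm: "jacobian (\<phi> n) \<in> borel_measurable (lebesgue_on \<Omega>)" for n
    using continuous_jacobian[OF \<phi>(1)] \<Omega>
    by (intro measurable_restrict_space1 measurable_completion) (auto intro: borel_measurable_continuous_onI)
  define a where "a = (\<integral>\<^sup>+x. ennreal ((norm (G x))\<^sup>2) \<partial>lebesgue_on \<Omega>)"
  define e where "e n = (\<integral>\<^sup>+x. ennreal ((norm (G x - jacobian (\<phi> n) x))\<^sup>2) \<partial>lebesgue_on \<Omega>)" for n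
  have aW: "a \<le> (W12_norm \<Omega> v)\<^sup>2"
    unfolding a_def W12_norm_eq[OF \<Omega> G] by simp
  have "(W12_norm \<Omega> v)\<^sup>2 < \<infinity>"
    using vW by (simp add: W12_def power2_eq_square ennreal_mult_less_top)
  with aW have "a < \<infinity>" by (rule order.strict_trans1)
  then obtain A where A: "a = ennreal A" "A \<ge> 0" by (cases a) auto
  have J: "(\<integral>\<^sup>+x. ennreal ((norm (jacobian (\<phi> n) x))\<^sup>2)) \<le> 2 * a + 2 * e n" for n
  proof -
    have "(\<integral>\<^sup>+x. ennreal ((norm (jacobian (\<phi> n) x))\<^sup>2)) =
        (\<integral>\<^sup>+x. ennreal ((norm (jacobian (\<phi> n) x))\<^sup>2) \<partial>lebesgue_on \<Omega>)"
    proof (rule nn_integral_lebesgue_on_eq_lborel[symmetric, OF \<Omega>m])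
      obtain C where C: "compact C" "C \<subseteq> \<Omega>" "\<And>x. x \<notin> C \<Longrightarrow> \<phi> n x = 0"
        using \<phi>(1)[of n] unfolding test_function_def by blast
      fix x assume "x \<notin> \<Omega>"
      then have "x \<notin> C" using C(2) by blast
      from jacobian_zero[OF test_function_has_derivative[OF \<phi>(1)] compact_imp_closed[OF C(1)] C(3) this]
      show "ennreal ((norm (jacobian (\<phi> n) x))\<^sup>2) = 0" by simp
    qed
    also have "\<dots> \<le> (\<integral>\<^sup>+x. 2 * ennreal ((norm (G x))\<^sup>2) + 2 * ennreal ((norm (G x - jacobian (\<phi> n) x))\<^sup>2) \<partial>lebesgue_on \<Omega>)"
    proof (intro nn_integral_mono)
      fix x
      let ?p = "norm (G x)" and ?q = "norm (G x - jacobian (\<phi> n) x)"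
      have "norm (jacobian (\<phi> n) x) \<le> ?p + ?q"
        using norm_triangle_ineq4[of "G x" "G x - jacobian (\<phi> n) x"] by simp
      then have "(norm (jacobian (\<phi> n) x))\<^sup>2 \<le> (?p + ?q)\<^sup>2" by (rule power_mono) simp
      also have "\<dots> \<le> 2 * ?p\<^sup>2 + 2 * ?q\<^sup>2"
        using sum_squares_bound[of ?p ?q] by (simp add: power2_sum)
      finally have "ennreal ((norm (jacobian (\<phi> n) x))\<^sup>2) \<le> ennreal (2 * ?p\<^sup>2 + 2 * ?q\<^sup>2)" by (rule ennreal_leI)
      then show "ennreal ((norm (jacobian (\<phi> n) x))\<^sup>2) \<le> 2 * ennreal (?p\<^sup>2) + 2 * ennreal (?q\<^sup>2)"
        by (simp add: ennreal_mult)
    qed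
    also have "\<dots> = 2 * a + 2 * e n"
      unfolding a_def e_def using Gm jm[of n]
      by (subst nn_integral_add) (auto simp: nn_integral_cmult)
    finally show ?thesis .
  qed
  define X where "X = (\<integral>\<^sup>+x. \<Psi> x (v x) \<partial>lebesgue_on \<Omega>)"
  have X: "X \<le> liminf (\<lambda>n. \<integral>\<^sup>+x. \<Psi> x (\<phi> n x) \<partial>lebesgue_on \<Omega>)"
  proof -
    have "X = (\<integral>\<^sup>+x. liminf (\<lambda>n. \<Psi> x (\<phi> n x)) \<partial>lebesgue_on \<Omega>)"
      unfolding X_def
    proof (rule nn_integral_cong_AE)
      show "AE x in lebesgue_on \<Omega>. \<Psi> x (v x) = liminf (\<lambda>n. \<Psi> x (\<phi> n x))"
        using \<phi>(2)
      proof eventually_elim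
        case (elim x)
        from cont[OF this, of x] show ?case
          by (rule lim_imp_Liminf[symmetric, rotated]) simp
      qed
    qed
    also have "\<dots> \<le> liminf (\<lambda>n. \<integral>\<^sup>+x. \<Psi> x (\<phi> n x) \<partial>lebesgue_on \<Omega>)"
    proof (rule nn_integral_liminf)
      show "(\<lambda>x. \<Psi> x (\<phi> n x)) \<in> borel_measurable (lebesgue_on \<Omega>)" for n
        using meas[OF \<phi>(1)[of n]] by (intro measurable_restrict_space1 measurable_completion) simp
    qed
    finally show ?thesis .
  qed
  have Xd: "X \<le> ennreal (c * (2 * A + 2 * d) ^ k)" if d: "d > 0" for d
  proof -
    have ev: "\<forall>\<^sub>F n in sequentially. e n < ennreal d"
      using order_tendstoD(2)[OF \<phi>(3), of "ennreal d"] d by (simp add: e_def)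
    have "\<forall>\<^sub>F n in sequentially. (\<integral>\<^sup>+x. \<Psi> x (\<phi> n x) \<partial>lebesgue_on \<Omega>) \<le> ennreal (c * (2 * A + 2 * d) ^ k)"
      using ev
    proof eventually_elim
      case (elim n)
      have "(\<integral>\<^sup>+x. \<Psi> x (\<phi> n x) \<partial>lebesgue_on \<Omega>) \<le> (\<integral>\<^sup>+x. \<Psi> x (\<phi> n x))"
        unfolding nn_integral_lebesgue_on[OF \<Omega>m] by (intro nn_integral_mono) (auto simp: indicator_def)
      also have "\<dots> \<le> ennreal c * (\<integral>\<^sup>+x. ennreal ((norm (jacobian (\<phi> n) x))\<^sup>2)) ^ k"
        by (rule le[OF \<phi>(1)])
      also have "\<dots> \<le> ennreal c * (2 * a + 2 * ennreal d) ^ k"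
        using J[of n] elim
        by (intro mult_left_mono power_mono order_trans[OF J] add_left_mono) auto
      also have "2 * a + 2 * ennreal d = ennreal (2 * A + 2 * d)"
        using A d by (simp add: ennreal_mult)
      also have "ennreal c * ennreal (2 * A + 2 * d) ^ k = ennreal (c * (2 * A + 2 * d) ^ k)"
      proof -
        have "2 * A + 2 * d \<ge> 0" using A d by simp
        then show ?thesis using c by (simp only: ennreal_power ennreal_mult zero_le_power)
      qed
      finally show ?case .
    qed
    then have "liminf (\<lambda>n. \<integral>\<^sup>+x. \<Psi> x (\<phi> n x) \<partial>lebesgue_on \<Omega>) \<le> ennreal (c * (2 * A + 2 * d) ^ k)"
      by (rule Liminf_le[rotated]) simp
    with X show ?thesis by (rule order_trans)
  qed
  have "X < \<infinity>" using Xd[of 1] by (simp add: order.strict_trans1)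
  then obtain x where x: "X = ennreal x" "x \<ge> 0" by (cases X) auto
  have "x \<le> c * (2 * A + 2 * 0) ^ k"
  proof (rule tendsto_lowerbound)
    show "((\<lambda>d. c * (2 * A + 2 * d) ^ k) \<longlongrightarrow> c * (2 * A + 2 * 0) ^ k) (at_right 0)"
      by (intro tendsto_intros)
    show "\<forall>\<^sub>F d in at_right 0. x \<le> c * (2 * A + 2 * d) ^ k"
    proof (rule eventually_at_rightI[of 0 1])
      fix d :: real assume "d \<in> {0<..<1}"
      then show "x \<le> c * (2 * A + 2 * d) ^ k"
        using Xd[of d] x A c by (simp add: ennreal_le_iff)
    qed simp
  qed simp
  then have "X \<le> ennreal (c * (2 * A) ^ k)" using x by (simp add: ennreal_leI)
  also have "\<dots> = ennreal c * (2 * a) ^ k"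
    using A c by (simp add: ennreal_mult ennreal_power[symmetric])
  also have "\<dots> \<le> ennreal c * (2 * (W12_norm \<Omega> v)\<^sup>2) ^ k"
    by (intro mult_left_mono power_mono aW) auto
  finally show ?thesis unfolding X_def .
qed

theorem Sobolev_W12_0:
  assumes \<Omega>: "open \<Omega>" and v: "v \<in> W12_0 \<Omega>"
  shows "(\<integral>\<^sup>+x. ennreal (norm (v x) ^ 6) \<partial>lebesgue_on \<Omega>) \<le> 4096 * (2 * (W12_norm \<Omega> v)\<^sup>2) ^ 3"
proof -
  have "(\<integral>\<^sup>+x. ennreal (norm (v x) ^ 6) \<partial>lebesgue_on \<Omega>) \<le> ennreal 4096 * (2 * (W12_norm \<Omega> v)\<^sup>2) ^ 3"
  proof (rule W12_0_inequality[OF \<Omega> v])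
    show "(\<lambda>n. ennreal (norm (ys n) ^ 6)) \<longlonglongrightarrow> ennreal (norm y ^ 6)" if "ys \<longlonglongrightarrow> y" for x ys and y :: R3
      by (intro tendsto_intros that)
    show "(\<lambda>x. ennreal (norm (\<phi> x) ^ 6)) \<in> borel_measurable borel" if "test_function \<Omega> \<phi>" for \<phi> :: "R3 \<Rightarrow> R3"
      using borel_measurable_continuous_onI[OF test_function_continuous[OF that]] by measurable
    show "(\<integral>\<^sup>+x. ennreal (norm (\<phi> x) ^ 6)) \<le>
        ennreal 4096 * (\<integral>\<^sup>+x. ennreal ((norm (jacobian \<phi> x))\<^sup>2)) ^ 3" if "test_function \<Omega> \<phi>" for \<phi>
      using Sobolev_test_function[OF that] by simp
  qed simp
  then show ?thesis by simp
qed

theorem Hardy_W12_0: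
  assumes \<Omega>: "open \<Omega>" and v: "v \<in> W12_0 \<Omega>"
    and N[measurable]: "N \<in> borel_measurable borel" and N0: "\<And>x. 0 \<le> N x"
  shows "(\<integral>\<^sup>+x. ennreal (N x * (norm (v x))\<^sup>2) / (1 + (\<integral>\<^sup>+y. ennreal (N y / norm (x - y)))) \<partial>lebesgue_on \<Omega>)
    \<le> ennreal Hardy_const * (2 * (W12_norm \<Omega> v)\<^sup>2)"
proof -
  define W where "W x = 1 + (\<integral>\<^sup>+y. ennreal (N y / norm (x - y)))" for x
  have [measurable]: "W \<in> borel_measurable borel" unfolding W_def by measurable
  have W0: "W x \<noteq> 0" for x unfolding W_def by simp
  have "(\<integral>\<^sup>+x. ennreal (N x * (norm (v x))\<^sup>2) / W x \<partial>lebesgue_on \<Omega>) \<le> ennreal Hardy_const * (2 * (W12_norm \<Omega> v)\<^sup>2) ^ 1"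
  proof (rule W12_0_inequality[OF \<Omega> v])
    show "(\<lambda>n. ennreal (N x * (norm (ys n))\<^sup>2) / W x) \<longlonglongrightarrow> ennreal (N x * (norm y)\<^sup>2) / W x"
      if "ys \<longlonglongrightarrow> y" for x ys and y :: R3
    proof -
      have "(\<lambda>n. inverse (W x) * ennreal (N x * (norm (ys n))\<^sup>2)) \<longlonglongrightarrow> inverse (W x) * ennreal (N x * (norm y)\<^sup>2)"
        using W0[of x] by (intro ennreal_tendsto_cmult tendsto_intros that) (simp add: top.not_eq_extremum)
      then show ?thesis by (simp add: divide_ennreal_def mult.commute)
    qed
    show "(\<lambda>x. ennreal (N x * (norm (\<phi> x))\<^sup>2) / W x) \<in> borel_measurable borel" if "test_function \<Omega> \<phi>" for \<phi> :: "R3 \<Rightarrow> R3"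
      using borel_measurable_continuous_onI[OF test_function_continuous[OF that]] by measurable
    show "(\<integral>\<^sup>+x. ennreal (N x * (norm (\<phi> x))\<^sup>2) / W x) \<le>
        ennreal Hardy_const * (\<integral>\<^sup>+x. ennreal ((norm (jacobian \<phi> x))\<^sup>2)) ^ 1" if "test_function \<Omega> \<phi>" for \<phi>
      using Hardy_test_function[OF that N N0] by (simp add: W_def)
  qed (use Hardy_const(2) in simp)
  then show ?thesis by (simp add: W_def)
qed

section \<open>Borel representatives of a weak solution\<close>

lemma borel_measurable_nth [measurable (raw)]:
  fixes g :: "'a \<Rightarrow> 'b::euclidean_space ^ 'n"
  assumes "g \<in> borel_measurable M"
  shows "(\<lambda>x. g x $ i) \<in> borel_measurable M"
  by (rule measurable_compose[OF assms]) (auto intro!: borel_measurable_continuous_onI continuous_intros)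

lemma borel_measurable_fst_pair [measurable (raw)]:
  fixes g :: "'a \<Rightarrow> 'b::second_countable_topology \<times> 'c::second_countable_topology"
  assumes "g \<in> borel_measurable M"
  shows "(\<lambda>x. fst (g x)) \<in> borel_measurable M" "(\<lambda>x. snd (g x)) \<in> borel_measurable M"
  by (rule measurable_compose[OF assms]; intro borel_measurable_continuous_onI continuous_intros)+

lemma borel_measurable_matI:
  fixes A :: "'a \<Rightarrow> real ^ 3 ^ 3"
  assumes "\<And>i j. (\<lambda>x. A x $ i $ j) \<in> borel_measurable M"
  shows "A \<in> borel_measurable M"
  unfolding borel_measurable_euclidean_space[of A]
  using assms by (auto simp: Basis_vec_def inner_axis)

lemma borel_measurable_tensor [measurable (raw)]:
  assumes [measurable]: "g \<in> borel_measurable M" "h \<in> borel_measurable M"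
  shows "(\<lambda>x. tensor (g x) (h x)) \<in> borel_measurable M"
  by (rule borel_measurable_matI) (simp add: tensor_def)

lemma borel_measurable_stress [measurable (raw)]:
  assumes [measurable]: "A \<in> borel_measurable M"
  shows "(\<lambda>x. stress \<nu>1 \<nu>2 (A x)) \<in> borel_measurable M"
proof (rule borel_measurable_matI)
  fix i j
  have *: "(\<lambda>x. stress \<nu>1 \<nu>2 (A x) $ i $ j) =
      (\<lambda>x. \<nu>1 * (A x $ i $ j + A x $ j $ i) + \<nu>2 * (\<Sum>k\<in>UNIV. A x $ k $ k) * (mat 1 :: real ^ 3 ^ 3) $ i $ j)"
    by (auto simp: stress_def trace_def transpose_def)
  show "(\<lambda>x. stress \<nu>1 \<nu>2 (A x) $ i $ j) \<in> borel_measurable M" unfolding * by measurable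
qed

lemma borel_measurable_matrix_vector [measurable (raw)]:
  fixes A :: "'a \<Rightarrow> real ^ 3 ^ 3"
  assumes [measurable]: "A \<in> borel_measurable M" "v \<in> borel_measurable M"
  shows "(\<lambda>x. A x *v v x) \<in> borel_measurable M"
  unfolding borel_measurable_euclidean_space[of "\<lambda>x. A x *v v x"]
  by (auto simp: Basis_vec_def inner_axis matrix_vector_mult_def)

lemma borel_measurable_nn_integral_lborel:
  fixes f :: "'a::euclidean_space \<Rightarrow> 'b::euclidean_space \<Rightarrow> ennreal"
  assumes "(\<lambda>q. f (fst q) (snd q)) \<in> borel_measurable borel"
  shows "(\<lambda>x. \<integral>\<^sup>+y. f x y) \<in> borel_measurable borel"
proof -
  have "(\<lambda>x. \<integral>\<^sup>+y. f x y) \<in> borel_measurable (lborel :: 'a measure)"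
    using assms by (intro lborel.borel_measurable_nn_integral) (simp only: case_prod_unfold lborel_prod measurable_lborel2)
  then show ?thesis by simp
qed

lemma nn_integral_slices:
  fixes h :: "'a::euclidean_space \<times> 'b::euclidean_space \<Rightarrow> ennreal"
  assumes "h \<in> borel_measurable borel"
  shows "(\<integral>\<^sup>+z. h z) = (\<integral>\<^sup>+t. \<integral>\<^sup>+x. h (x, t))"
  unfolding lborel_prod[symmetric]
  by (rule lborel_pair.nn_integral_snd[symmetric]) (simp only: lborel_prod measurable_lborel2 assms)

lemma AE_lborel_slices:
  fixes P :: "'a::euclidean_space \<times> 'b::euclidean_space \<Rightarrow> bool"
  assumes "AE z in lborel. P z"
  shows "AE t in lborel. AE x in lborel. P (x, t)"
proof -
  obtain N where N: "{z. \<not> P z} \<subseteq> N" "emeasure lborel N = 0" "N \<in> sets lborel"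
    using AE_E[OF assms] by auto
  have [measurable]: "N \<in> sets (lborel \<Otimes>\<^sub>M lborel)" using N(3) by (simp only: lborel_prod)
  have "(\<integral>\<^sup>+t. \<integral>\<^sup>+x. indicator N (x, t)) = (\<integral>\<^sup>+z. indicator N z \<partial>(lborel \<Otimes>\<^sub>M lborel))"
    by (rule lborel_pair.nn_integral_snd) measurable
  also have "\<dots> = 0" using N by (simp add: lborel_prod)
  finally have "AE t in lborel. (\<integral>\<^sup>+x. indicator N (x, t)) = 0"
    by (subst (asm) nn_integral_0_iff_AE) measurable
  then show ?thesis
  proof eventually_elim
    case (elim t)
    have "(\<lambda>x. indicator N (x, t) :: ennreal) \<in> borel_measurable lborel" by measurable
    with elim have "AE x in lborel. indicator N (x, t) = (0 :: ennreal)"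
      by (simp add: nn_integral_0_iff_AE)
    then show ?case
    proof eventually_elim
      case (elim x)
      then show ?case using N(1) by (auto simp: indicator_def split: if_splits)
    qed
  qed
qed

text \<open>A Borel function on the whole space that vanishes off \<open>Q\<close> turns integrals
  over \<open>Q\<close> for the completed measure into integrals for \<open>lborel\<close>, where
  product measures and Fubini's theorem are at hand.\<close>

lemma borel_representative:
  fixes g :: "'a::euclidean_space \<Rightarrow> 'b::euclidean_space"
  assumes Q: "open Q" and g: "g \<in> borel_measurable (lebesgue_on Q)"
  obtains g' where "g' \<in> borel_measurable borel" "\<And>z. z \<notin> Q \<Longrightarrow> g' z = 0" "AE z in lborel. z \<in> Q \<longrightarrow> g z = g' z"
proof -
  have Qm: "Q \<in> sets lebesgue" "Q \<in> sets borel" using Q by auto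
  have "\<exists>h\<in>borel_measurable lborel. AE z in lborel. indicator Q z *\<^sub>R (g z \<bullet> b) = h z" for b
  proof (rule completion_ex_borel_measurable_real)
    have "(\<lambda>z. g z \<bullet> b) \<in> borel_measurable (lebesgue_on Q)"
      using g by measurable
    then show "(\<lambda>z. indicator Q z *\<^sub>R (g z \<bullet> b)) \<in> borel_measurable lebesgue"
      using Qm by (subst (asm) borel_measurable_restrict_space_iff) auto
  qed
  then have "\<forall>b. \<exists>h. h \<in> borel_measurable borel \<and> (AE z in lborel. indicator Q z *\<^sub>R (g z \<bullet> b) = h z)"
    by (simp add: Bex_def)
  from choice[OF this] obtain h
    where h: "\<And>b. h b \<in> borel_measurable borel" "\<And>b. AE z in lborel. indicator Q z *\<^sub>R (g z \<bullet> b) = h b z"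
    by auto
  define g' where "g' z = indicator Q z *\<^sub>R (\<Sum>b\<in>Basis. h b z *\<^sub>R b)" for z
  have "AE z in lborel. \<forall>b\<in>Basis. indicator Q z *\<^sub>R (g z \<bullet> b) = h b z"
    using h(2) by (intro AE_finite_allI) auto
  then have "AE z in lborel. z \<in> Q \<longrightarrow> g z = g' z"
  proof eventually_elim
    case (elim z)
    show ?case
    proof
      assume z: "z \<in> Q"
      then have "(\<Sum>b\<in>Basis. h b z *\<^sub>R b) = (\<Sum>b\<in>Basis. (g z \<bullet> b) *\<^sub>R b)"
        using elim by (intro sum.cong) auto
      then show "g z = g' z" using z by (simp add: g'_def euclidean_representation)
    qed
  qed
  moreover have "g' \<in> borel_measurable borel" unfolding g'_def using h(1) Qm(2) by measurable
  moreover have "g' z = 0" if "z \<notin> Q" for z using that by (simp add: g'_def)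
  ultimately show ?thesis using that by blast
qed

text \<open>Integrability is not assumed: where it fails, both integrals take the same default
  value.\<close>

lemma integral_lebesgue_on_cong_lborel:
  fixes f g :: "'a::euclidean_space \<Rightarrow> 'b::euclidean_space"
  assumes "S \<in> sets lebesgue" "AE x in lborel. x \<in> S \<longrightarrow> f x = g x" "\<And>x. x \<notin> S \<Longrightarrow> g x = 0"
    and "g \<in> borel_measurable borel"
  shows "(\<integral>x. f x \<partial>lebesgue_on S) = (\<integral>x. g x)"
proof -
  have m: "g \<in> borel_measurable lebesgue" using assms(4) by (simp add: measurable_completion)
  have ae: "AE x in lebesgue. indicator S x *\<^sub>R f x = g x"
  proof -
    have "AE x in lborel. indicator S x *\<^sub>R f x = g x"
      using assms(2) by eventually_elim (use assms(3) in \<open>auto simp: indicator_def\<close>)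
    then show ?thesis by (rule AE_completion)
  qed
  have "(\<integral>x. f x \<partial>lebesgue_on S) = (\<integral>x. indicator S x *\<^sub>R f x \<partial>lebesgue)"
    using assms(1) by (subst integral_restrict_space) auto
  also have "\<dots> = (\<integral>x. g x \<partial>lebesgue)"
  proof (rule integral_cong_AE[OF _ m ae])
    have "AE x in lebesgue. g x = indicator S x *\<^sub>R f x" using ae by (auto elim: eventually_mono)
    then show "(\<lambda>x. indicator S x *\<^sub>R f x) \<in> borel_measurable lebesgue"
      by (rule borel_measurable_AE[OF m])
  qed
  also have "\<dots> = (\<integral>x. g x)"
    by (rule integral_completion) (use assms(4) in simp)
  finally show ?thesis .
qed

lemma stress_zero [simp]: "stress \<nu>1 \<nu>2 0 = 0"
  by (simp add: stress_def trace_def transpose_def vec_eq_iff)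

text \<open>Everything the estimate needs to know about a solution, with Borel functions defined
  everywhere and zero off the cylinder. The equations are recorded for test functions supported in
  the open cylinder, so that the initial data disappear. The integrands \<open>a1\<close>,
  \<open>a2\<close>, \<open>a3\<close> and \<open>b1\<close> are arbitrary Borel functions
  prescribed on the cylinder; this spares any discussion of derivatives of the test function
  outside. The time integrals carry the constants 32 and \<open>2 * Hardy_const\<close> that result
  from the inequalities for the Sobolev space on each time slice.\<close>

locale energy_flow =
  fixes \<Omega> :: "R3 set" and T \<nu>1 \<nu>2 E c :: real and p :: "real \<Rightarrow> real"
    and f u :: "R3 \<times> real \<Rightarrow> R3" and r :: "R3 \<times> real \<Rightarrow> real" and G :: "R3 \<times> real \<Rightarrow> real ^ 3 ^ 3"
  assumes open_dom: "open \<Omega>" and bounded_dom: "bounded \<Omega>" and T_pos: "T > 0" and E_pos: "E > 0" and c_nonneg: "c \<ge> 0"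
    and r_borel [measurable]: "r \<in> borel_measurable borel" and u_borel [measurable]: "u \<in> borel_measurable borel"
    and G_borel [measurable]: "G \<in> borel_measurable borel" and f_borel [measurable]: "f \<in> borel_measurable borel"
    and p_borel [measurable]: "p \<in> borel_measurable borel"
    and r_nonneg: "0 \<le> r z" and f_bound: "norm (f z) \<le> c"
    and off: "z \<notin> cylinder \<Omega> T \<Longrightarrow> r z = 0" "z \<notin> cylinder \<Omega> T \<Longrightarrow> u z = 0"
      "z \<notin> cylinder \<Omega> T \<Longrightarrow> G z = 0" "z \<notin> cylinder \<Omega> T \<Longrightarrow> f z = 0"
    and p_ge: "0 \<le> s \<Longrightarrow> s powr (3 / 2) \<le> p s" and p_zero: "p 0 = 0"
    and energy_p: "AE t in lborel. (\<integral>\<^sup>+x. ennreal (p (r (x, t)))) \<le> ennreal E"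
    and energy_kin: "AE t in lborel. (\<integral>\<^sup>+x. ennreal (r (x, t) * (norm (u (x, t)))\<^sup>2)) \<le> ennreal E"
    and Sobolev_fin: "AE t in lborel. (\<integral>\<^sup>+x. ennreal (norm (u (x, t)) ^ 6)) < \<infinity>"
    and Sobolev_int: "(\<integral>\<^sup>+t. ennreal (root 3 (enn2real (\<integral>\<^sup>+x. ennreal (norm (u (x, t)) ^ 6))))) \<le> ennreal (32 * E\<^sup>2)"
    and G_int: "(\<integral>\<^sup>+z. ennreal ((norm (G z))\<^sup>2)) \<le> ennreal (E\<^sup>2)"
    and Hardy: "N \<in> borel_measurable borel \<Longrightarrow> (\<And>z. 0 \<le> N z) \<Longrightarrow>
      (\<integral>\<^sup>+z. ennreal (N z * (norm (u z))\<^sup>2) / (1 + (\<integral>\<^sup>+y. ennreal (N (y, snd z) / norm (fst z - y))))) \<le> ennreal (2 * Hardy_const * E\<^sup>2)"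
    and momentum: "open U \<Longrightarrow> closure (cylinder \<Omega> T) \<subseteq> U \<Longrightarrow> smooth_on U \<xi> \<Longrightarrow> compact C \<Longrightarrow> C \<subseteq> cylinder \<Omega> T \<Longrightarrow>
      (\<And>z. z \<notin> C \<Longrightarrow> \<xi> z = 0) \<Longrightarrow>
      a1 \<in> borel_measurable borel \<Longrightarrow> a2 \<in> borel_measurable borel \<Longrightarrow> a3 \<in> borel_measurable borel \<Longrightarrow>
      (\<And>z. z \<notin> cylinder \<Omega> T \<Longrightarrow> a1 z = 0 \<and> a2 z = 0 \<and> a3 z = 0) \<Longrightarrow>
      (\<And>z. z \<in> cylinder \<Omega> T \<Longrightarrow> a1 z = r z * (u z \<bullet> time_deriv \<xi> z) \<and>
        a2 z = (r z *\<^sub>R tensor (u z) (u z) + p (r z) *\<^sub>R mat 1 - stress \<nu>1 \<nu>2 (G z)) \<bullet> grad_vec \<xi> z \<and>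
        a3 z = r z * (f z \<bullet> \<xi> z)) \<Longrightarrow>
      (\<integral>z. a1 z) + (\<integral>z. a2 z) + (\<integral>z. a3 z) = 0"
    and continuity: "open U \<Longrightarrow> closure (cylinder \<Omega> T) \<subseteq> U \<Longrightarrow> smooth_on U \<psi> \<Longrightarrow> compact C \<Longrightarrow> C \<subseteq> cylinder \<Omega> T \<Longrightarrow>
      (\<And>z. z \<notin> C \<Longrightarrow> \<psi> z = 0) \<Longrightarrow> b1 \<in> borel_measurable borel \<Longrightarrow> (\<And>z. z \<notin> cylinder \<Omega> T \<Longrightarrow> b1 z = 0) \<Longrightarrow>
      (\<And>z. z \<in> cylinder \<Omega> T \<Longrightarrow> b1 z = r z * time_deriv \<psi> z + r z * (u z \<bullet> grad \<psi> z)) \<Longrightarrow>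
      (\<integral>z. b1 z) = 0"

lemma AE_lebesgue_on_iff_lborel:
  "S \<in> sets lebesgue \<Longrightarrow> (AE x in lebesgue_on S. P x) \<longleftrightarrow> (AE x in lborel. x \<in> S \<longrightarrow> P x)"
  by (simp add: AE_restrict_space_iff AE_completion_iff)

theorem weak_solution_energy_flow:
  assumes dom: "bounded_C2_domain \<Omega>" and T: "T > 0" and E: "E > 0" and ce: "c\<^sub>e > 0"
    and m: "m > 1" and \<epsilon>: "0 < \<epsilon>"
    and data: "admissible_data \<Omega> T c\<^sub>e c\<^sub>0 f \<rho>0 u0"
    and sol: "weak_solution \<Omega> T \<nu>1 \<nu>2 (pressure m \<epsilon>) f \<rho>0 u0 \<rho> u"
    and energy: "energy_norm \<Omega> T (pressure m \<epsilon>) \<rho> u \<le> ennreal E"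
  obtains r u' G' f' where "energy_flow \<Omega> T \<nu>1 \<nu>2 E c\<^sub>e (pressure m \<epsilon>) f' u' r G'"
    "AE z in lborel. z \<in> cylinder \<Omega> T \<longrightarrow> \<rho> z = r z \<and> u z = u' z"
proof -
  define p where "p = pressure m \<epsilon>"
  define Q where "Q = cylinder \<Omega> T"
  have \<Omega>: "open \<Omega>" "bounded \<Omega>" using dom by (auto simp: bounded_C2_domain_def)
  have \<Omega>m: "\<Omega> \<in> sets lebesgue" and Im: "{0<..<T} \<in> sets lebesgue" using \<Omega> by auto
  have Qo: "open Q" unfolding Q_def cylinder_def using \<Omega> by (intro open_Times) auto
  have Qm: "Q \<in> sets lebesgue" "Q \<in> sets borel" using Qo by auto
  have Qt: "(x, t) \<in> Q \<longleftrightarrow> x \<in> \<Omega> \<and> t \<in> {0<..<T}" for x t by (auto simp: Q_def cylinder_def)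
  have [measurable]: "p \<in> borel_measurable borel" unfolding p_def pressure_def by measurable
  have p_ge: "s powr (3 / 2) \<le> p s" if "0 \<le> s" for s
  proof -
    have "s powr (3 / 2) * 1 \<le> s powr (3 / 2) * (1 + \<epsilon> * s powr m)"
      using \<epsilon> by (intro mult_left_mono) auto
    then show ?thesis by (simp add: p_def pressure_def)
  qed
  have p0: "p 0 = 0" by (simp add: p_def pressure_def)
  have p_nonneg: "0 \<le> p s" for s unfolding p_def pressure_def using \<epsilon> by simp
  obtain Du where Du: "spatial_weak_gradient \<Omega> T u Du"
    and mom: "\<And>\<xi>. smooth_upto_boundary Q \<xi> \<Longrightarrow> (\<forall>x\<in>\<Omega>. \<xi> (x, T) = 0) \<Longrightarrow>
        (\<forall>x\<in>frontier \<Omega>. \<forall>t\<in>{0<..<T}. \<xi> (x, t) = 0) \<Longrightarrow> momentum_eq \<Omega> T \<nu>1 \<nu>2 p f \<rho>0 u0 \<rho> u Du \<xi>"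
    using sol unfolding weak_solution_def Q_def p_def by blast
  have cont: "continuity_eq \<Omega> T \<rho>0 \<rho> u \<psi>" if "smooth_upto_boundary Q \<psi>" "\<forall>x\<in>\<Omega>. \<psi> (x, T) = 0" for \<psi>
    using sol that unfolding weak_solution_def Q_def by blast
  have \<rho>m: "\<rho> \<in> borel_measurable (lebesgue_on Q)" and \<rho>0: "AE z in lebesgue_on Q. \<rho> z \<ge> 0"
    and uL: "u \<in> L2W12_0 \<Omega> T"
    using sol unfolding weak_solution_def Q_def by auto
  have um: "u \<in> borel_measurable (lebesgue_on Q)" using uL unfolding L2W12_0_def Q_def by auto
  have Dm: "Du \<in> borel_measurable (lebesgue_on Q)" using Du unfolding spatial_weak_gradient_def Q_def by auto
  have fm: "f \<in> borel_measurable (lebesgue_on Q)" and fL: "Linf_norm Q f \<le> ennreal c\<^sub>e"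
  proof -
    show "f \<in> borel_measurable (lebesgue_on Q)" using data unfolding admissible_data_def Linf_def Q_def by auto
    have *: "W12_norm \<Omega> u0 + Linf_norm \<Omega> \<rho>0 + Linf_norm Q f \<le> ennreal c\<^sub>e"
      using data unfolding admissible_data_def Q_def by blast
    show "Linf_norm Q f \<le> ennreal c\<^sub>e" by (rule order_trans[OF _ *]) simp
  qed
  obtain r0 where r0: "r0 \<in> borel_measurable borel" "\<And>z. z \<notin> Q \<Longrightarrow> r0 z = 0" "AE z in lborel. z \<in> Q \<longrightarrow> \<rho> z = r0 z"
    by (rule borel_representative[OF Qo \<rho>m]) (rule that)
  obtain u' where u'[measurable]: "u' \<in> borel_measurable borel" and u'0: "\<And>z. z \<notin> Q \<Longrightarrow> u' z = 0"
    and u'ae: "AE z in lborel. z \<in> Q \<longrightarrow> u z = u' z"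
    by (rule borel_representative[OF Qo um]) (rule that)
  obtain G' where G'[measurable]: "G' \<in> borel_measurable borel" and G'0: "\<And>z. z \<notin> Q \<Longrightarrow> G' z = 0"
    and G'ae: "AE z in lborel. z \<in> Q \<longrightarrow> Du z = G' z"
    by (rule borel_representative[OF Qo Dm]) (rule that)
  obtain f0 where f0: "f0 \<in> borel_measurable borel" "\<And>z. z \<notin> Q \<Longrightarrow> f0 z = 0" "AE z in lborel. z \<in> Q \<longrightarrow> f z = f0 z"
    by (rule borel_representative[OF Qo fm]) (rule that)
  \<comment> \<open>Sign of the density and bound of the force are wanted at every point, so both
    representatives are changed on a null set.\<close>
  define r where "r z = max 0 (r0 z)" for z
  define f' where "f' z = (if norm (f0 z) \<le> c\<^sub>e then f0 z else 0)" for z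
  have [measurable]: "r \<in> borel_measurable borel" "f' \<in> borel_measurable borel"
    unfolding r_def f'_def using r0(1) f0(1) by measurable
  have r_off: "r z = 0" and f'_off: "f' z = 0" if "z \<notin> Q" for z using r0(2)[OF that] f0(2)[OF that] by (auto simp: r_def f'_def)
  have r_nonneg: "0 \<le> r z" for z by (simp add: r_def)
  have r_ae: "AE z in lborel. z \<in> Q \<longrightarrow> \<rho> z = r z"
    using r0(3) \<rho>0[unfolded AE_lebesgue_on_iff_lborel[OF Qm(1)]] by eventually_elim (auto simp: r_def)
  have f'_ae: "AE z in lborel. z \<in> Q \<longrightarrow> f z = f' z"
  proof -
    have "AE z in lebesgue_on Q. ennreal (norm (f z)) \<le> Linf_norm Q f"
      unfolding Linf_norm_def by (rule esssup_AE)
    then have "AE z in lebesgue_on Q. norm (f z) \<le> c\<^sub>e"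
    proof eventually_elim
      case (elim z)
      then have "ennreal (norm (f z)) \<le> ennreal c\<^sub>e" using fL by (rule order_trans)
      then show ?case using ce by simp
    qed
    then show ?thesis
      using f0(3) unfolding AE_lebesgue_on_iff_lborel[OF Qm(1)] by eventually_elim (auto simp: f'_def)
  qed
  note r_sl = AE_lborel_slices[OF r_ae, unfolded Qt]
  note u_sl = AE_lborel_slices[OF u'ae, unfolded Qt]
  note G_sl = AE_lborel_slices[OF G'ae, unfolded Qt]
  have off_t: "r (x, t) = 0" "u' (x, t) = 0" "G' (x, t) = 0" if "t \<notin> {0<..<T}" for x t
    using r_off[of "(x, t)"] u'0[of "(x, t)"] G'0[of "(x, t)"] that by (auto simp: Qt)
  have off_x: "r (x, t) = 0" "u' (x, t) = 0" "G' (x, t) = 0" if "x \<notin> \<Omega>" for x t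
    using r_off[of "(x, t)"] u'0[of "(x, t)"] G'0[of "(x, t)"] that by (auto simp: Qt)
  have en1: "LinfL1_norm \<Omega> T (\<lambda>z. p (\<rho> z)) \<le> ennreal E"
    and en2: "LinfL1_norm \<Omega> T (\<lambda>z. \<rho> z * (norm (u z))\<^sup>2) \<le> ennreal E"
    and en3: "L2W12_norm \<Omega> T u \<le> ennreal E"
  proof -
    have *: "LinfL1_norm \<Omega> T (\<lambda>z. p (\<rho> z)) + LinfL1_norm \<Omega> T (\<lambda>z. \<rho> z * (norm (u z))\<^sup>2) + L2W12_norm \<Omega> T u \<le> ennreal E"
      using energy unfolding energy_norm_def p_def .
    show "LinfL1_norm \<Omega> T (\<lambda>z. p (\<rho> z)) \<le> ennreal E"
      by (rule order_trans[OF _ *]) (simp add: add.assoc)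
    show "LinfL1_norm \<Omega> T (\<lambda>z. \<rho> z * (norm (u z))\<^sup>2) \<le> ennreal E"
      by (rule order_trans[OF _ *]) (simp add: add_increasing2)
    show "L2W12_norm \<Omega> T u \<le> ennreal E"
      by (rule order_trans[OF _ *]) simp
  qed
  have e1: "AE t in lborel. t \<in> {0<..<T} \<longrightarrow> (\<integral>\<^sup>+x. ennreal \<bar>p (\<rho> (x, t))\<bar> \<partial>lebesgue_on \<Omega>) \<le> ennreal E"
  proof -
    have "AE t in lebesgue_on {0<..<T}. (\<integral>\<^sup>+x. ennreal \<bar>p (\<rho> (x, t))\<bar> \<partial>lebesgue_on \<Omega>) \<le> LinfL1_norm \<Omega> T (\<lambda>z. p (\<rho> z))"
      unfolding LinfL1_norm_def by (rule esssup_AE)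
    then show ?thesis
      unfolding AE_lebesgue_on_iff_lborel[OF Im] by eventually_elim (use en1 in \<open>auto intro: order_trans\<close>)
  qed
  have e2: "AE t in lborel. t \<in> {0<..<T} \<longrightarrow> (\<integral>\<^sup>+x. ennreal \<bar>\<rho> (x, t) * (norm (u (x, t)))\<^sup>2\<bar> \<partial>lebesgue_on \<Omega>) \<le> ennreal E"
  proof -
    have "AE t in lebesgue_on {0<..<T}. (\<integral>\<^sup>+x. ennreal \<bar>\<rho> (x, t) * (norm (u (x, t)))\<^sup>2\<bar> \<partial>lebesgue_on \<Omega>) \<le>
        LinfL1_norm \<Omega> T (\<lambda>z. \<rho> z * (norm (u z))\<^sup>2)"
      unfolding LinfL1_norm_def by (rule esssup_AE)
    then show ?thesis
      unfolding AE_lebesgue_on_iff_lborel[OF Im] by eventually_elim (use en2 in \<open>auto intro: order_trans\<close>)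
  qed
  define w where "w t = W12_norm \<Omega> (\<lambda>x. u (x, t))" for t
  have w_int: "(\<integral>\<^sup>+t. (w t)\<^sup>2 \<partial>lebesgue_on {0<..<T}) \<le> ennreal (E\<^sup>2)"
  proof -
    have "(\<integral>\<^sup>+t. (w t)\<^sup>2 \<partial>lebesgue_on {0<..<T}) = (L2W12_norm \<Omega> T u)\<^sup>2"
      unfolding L2W12_norm_def w_def by (simp add: ennreal_sqrt_power2)
    also have "\<dots> \<le> (ennreal E)\<^sup>2" by (rule power_mono[OF en3]) simp
    finally show ?thesis using E by (simp add: ennreal_power)
  qed
  have time_bound: "(\<integral>\<^sup>+t. H t) \<le> ennreal (k * E\<^sup>2)"
    if [measurable]: "H \<in> borel_measurable borel" and k: "k > 0"
      and le: "AE t in lborel. t \<in> {0<..<T} \<longrightarrow> H t \<le> ennreal k * (w t)\<^sup>2" and z: "\<And>t. t \<notin> {0<..<T} \<Longrightarrow> H t = 0" for H k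
  proof -
    have kk: "ennreal (1 / k) * ennreal k = 1" using k by (subst ennreal_mult[symmetric]) auto
    \<comment> \<open>The constant is moved to the side of the measurable function \<open>H\<close>.
      Nothing is known about measurability of \<open>w\<close>, so it could not be pulled out of the
      integral on the other side.\<close>
    have "ennreal (1 / k) * (\<integral>\<^sup>+t. H t) = (\<integral>\<^sup>+t. ennreal (1 / k) * H t)"
      by (rule nn_integral_cmult[symmetric]) measurable
    also have "\<dots> = (\<integral>\<^sup>+t. ennreal (1 / k) * H t \<partial>lebesgue_on {0<..<T})"
      by (rule nn_integral_lebesgue_on_eq_lborel[symmetric, OF Im]) (simp add: z)
    also have "\<dots> \<le> (\<integral>\<^sup>+t. (w t)\<^sup>2 \<partial>lebesgue_on {0<..<T})"
    proof (rule nn_integral_mono_AE, unfold AE_lebesgue_on_iff_lborel[OF Im])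
      show "AE t in lborel. t \<in> {0<..<T} \<longrightarrow> ennreal (1 / k) * H t \<le> (w t)\<^sup>2"
        using le
      proof (eventually_elim, intro impI)
        fix t assume "t \<in> {0<..<T} \<longrightarrow> H t \<le> ennreal k * (w t)\<^sup>2" "t \<in> {0<..<T}"
        then have "ennreal (1 / k) * H t \<le> ennreal (1 / k) * (ennreal k * (w t)\<^sup>2)" by (intro mult_left_mono) auto
        then show "ennreal (1 / k) * H t \<le> (w t)\<^sup>2" by (simp only: mult.assoc[symmetric] kk mult_1)
      qed
    qed
    also note w_int
    finally have "ennreal k * (ennreal (1 / k) * (\<integral>\<^sup>+t. H t)) \<le> ennreal k * ennreal (E\<^sup>2)"
      by (intro mult_left_mono) auto
    then show ?thesis
      using k by (simp only: mult.assoc[symmetric] mult.commute[of "ennreal k"] kk mult_1) (simp add: ennreal_mult mult.commute)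
  qed
  have W0: "AE t in lborel. t \<in> {0<..<T} \<longrightarrow> (\<lambda>x. u (x, t)) \<in> W12_0 \<Omega>"
    using uL unfolding L2W12_0_def AE_lebesgue_on_iff_lborel[OF Im] by auto
  have wg: "AE t in lborel. t \<in> {0<..<T} \<longrightarrow> weak_gradient \<Omega> (\<lambda>x. u (x, t)) (\<lambda>x. Du (x, t))"
    using Du unfolding spatial_weak_gradient_def AE_lebesgue_on_iff_lborel[OF Im] by auto
  define B where "B t = (\<integral>\<^sup>+x. ennreal (norm (u' (x, t)) ^ 6))" for t
  have [measurable]: "B \<in> borel_measurable borel"
    unfolding B_def[abs_def] by (rule borel_measurable_nn_integral_lborel) measurable
  have B_le: "AE t in lborel. t \<in> {0<..<T} \<longrightarrow> (w t)\<^sup>2 < \<infinity> \<and> B t \<le> 4096 * (2 * (w t)\<^sup>2) ^ 3"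
    using W0 u_sl
  proof (eventually_elim, intro impI)
    fix t assume 1: "t \<in> {0<..<T} \<longrightarrow> (\<lambda>x. u (x, t)) \<in> W12_0 \<Omega>"
      and 2: "AE x in lborel. x \<in> \<Omega> \<and> t \<in> {0<..<T} \<longrightarrow> u (x, t) = u' (x, t)" and t: "t \<in> {0<..<T}"
    have v: "(\<lambda>x. u (x, t)) \<in> W12_0 \<Omega>" using 1 t by blast
    have "(\<integral>\<^sup>+x. ennreal (norm (u (x, t)) ^ 6) \<partial>lebesgue_on \<Omega>) = B t"
      unfolding B_def using 2 t
      by (intro nn_integral_lebesgue_on_cong_lborel[OF \<Omega>m]) (auto simp: off_x elim: eventually_mono)
    moreover have "(w t)\<^sup>2 < \<infinity>"
      using v by (simp add: w_def W12_0_def W12_def power2_eq_square ennreal_mult_less_top)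
    ultimately show "(w t)\<^sup>2 < \<infinity> \<and> B t \<le> 4096 * (2 * (w t)\<^sup>2) ^ 3"
      using Sobolev_W12_0[OF \<Omega>(1) v] by (simp add: w_def)
  qed
  have "energy_flow \<Omega> T \<nu>1 \<nu>2 E c\<^sub>e p f' u' r G'"
  proof
    show "open \<Omega>" "bounded \<Omega>" "T > 0" "E > 0" "0 \<le> c\<^sub>e" using \<Omega> T E ce by auto
    show "r \<in> borel_measurable borel" "u' \<in> borel_measurable borel" "G' \<in> borel_measurable borel"
      "f' \<in> borel_measurable borel" "p \<in> borel_measurable borel" by measurable
    show "0 \<le> r z" for z by (rule r_nonneg)
    show "norm (f' z) \<le> c\<^sub>e" for z using ce by (simp add: f'_def)
    show "r z = 0" "u' z = 0" "G' z = 0" "f' z = 0" if "z \<notin> cylinder \<Omega> T" for z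
      using that r_off u'0 G'0 f'_off unfolding Q_def by auto
    show "s powr (3 / 2) \<le> p s" if "0 \<le> s" for s using that by (rule p_ge)
    show "p 0 = 0" by (rule p0)
    show "AE t in lborel. (\<integral>\<^sup>+x. ennreal (p (r (x, t)))) \<le> ennreal E"
      using e1 r_sl
    proof eventually_elim
      case (elim t)
      show ?case
      proof (cases "t \<in> {0<..<T}")
        case True
        have "(\<integral>\<^sup>+x. ennreal \<bar>p (\<rho> (x, t))\<bar> \<partial>lebesgue_on \<Omega>) = (\<integral>\<^sup>+x. ennreal (p (r (x, t))))"
          using elim(2) True
          by (intro nn_integral_lebesgue_on_cong_lborel[OF \<Omega>m]) (auto simp: off_x p0 p_nonneg elim: eventually_mono)
        then show ?thesis using elim(1) True by simp
      next
        case False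
        then show ?thesis by (simp add: off_t p0)
      qed
    qed
    show "AE t in lborel. (\<integral>\<^sup>+x. ennreal (r (x, t) * (norm (u' (x, t)))\<^sup>2)) \<le> ennreal E"
      using e2 r_sl u_sl
    proof eventually_elim
      case (elim t)
      show ?case
      proof (cases "t \<in> {0<..<T}")
        case True
        have "AE x in lborel. x \<in> \<Omega> \<longrightarrow> ennreal \<bar>\<rho> (x, t) * (norm (u (x, t)))\<^sup>2\<bar> = ennreal (r (x, t) * (norm (u' (x, t)))\<^sup>2)"
          using elim(2,3) by eventually_elim (use True r_nonneg in auto)
        then have "(\<integral>\<^sup>+x. ennreal \<bar>\<rho> (x, t) * (norm (u (x, t)))\<^sup>2\<bar> \<partial>lebesgue_on \<Omega>) =
            (\<integral>\<^sup>+x. ennreal (r (x, t) * (norm (u' (x, t)))\<^sup>2))"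
          by (intro nn_integral_lebesgue_on_cong_lborel[OF \<Omega>m]) (auto simp: off_x)
        then show ?thesis using elim(1) True by simp
      next
        case False
        then show ?thesis by (simp add: off_t)
      qed
    qed
    show "AE t in lborel. (\<integral>\<^sup>+x. ennreal (norm (u' (x, t)) ^ 6)) < \<infinity>"
      using B_le
    proof eventually_elim
      case (elim t)
      show ?case
      proof (cases "t \<in> {0<..<T}")
        case True
        then obtain y where y: "(w t)\<^sup>2 = ennreal y" "y \<ge> 0" using elim by (cases "(w t)\<^sup>2") auto
        have "B t \<le> 4096 * (2 * (w t)\<^sup>2) ^ 3" using elim True by blast
        also have "\<dots> < \<infinity>" unfolding y(1) by (simp add: power3_eq_cube ennreal_mult_less_top)
        finally show ?thesis by (simp add: B_def)
      qed (simp add: off_t)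
    qed
    show "(\<integral>\<^sup>+t. ennreal (root 3 (enn2real (\<integral>\<^sup>+x. ennreal (norm (u' (x, t)) ^ 6))))) \<le> ennreal (32 * E\<^sup>2)"
      unfolding B_def[symmetric]
    proof (rule time_bound)
      show "(\<lambda>t. ennreal (root 3 (enn2real (B t)))) \<in> borel_measurable borel" by measurable
      \<comment> \<open>The cube root of 4096 (2 y)^3 is 16 times 2 y, which is the constant
        32.\<close>
      show "AE t in lborel. t \<in> {0<..<T} \<longrightarrow> ennreal (root 3 (enn2real (B t))) \<le> ennreal 32 * (w t)\<^sup>2"
        using B_le
      proof (eventually_elim, intro impI)
        fix t assume *: "t \<in> {0<..<T} \<longrightarrow> (w t)\<^sup>2 < \<infinity> \<and> B t \<le> 4096 * (2 * (w t)\<^sup>2) ^ 3" and "t \<in> {0<..<T}"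
        then obtain y where y: "(w t)\<^sup>2 = ennreal y" "y \<ge> 0" by (cases "(w t)\<^sup>2") auto
        have "B t \<le> 4096 * (2 * ennreal y) ^ 3" using * \<open>t \<in> {0<..<T}\<close> y(1) by simp
        also have "\<dots> = ennreal ((32 * y) ^ 3)"
        proof -
          have "4096 * (2 * ennreal y) ^ 3 = ennreal 4096 * ennreal ((2 * y) ^ 3)"
            using y(2) by (simp add: ennreal_mult flip: ennreal_power)
          also have "\<dots> = ennreal (4096 * (2 * y) ^ 3)" using y(2) by (intro ennreal_mult[symmetric]) auto
          also have "4096 * (2 * y) ^ 3 = (32 * y) ^ 3" by (simp add: power3_eq_cube)
          finally show ?thesis .
        qed
        finally have "enn2real (B t) \<le> (32 * y) ^ 3" using y(2) by (intro enn2real_leI) auto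
        then have "root 3 (enn2real (B t)) \<le> root 3 ((32 * y) ^ 3)" by simp
        also have "\<dots> = 32 * y" using y(2) by (intro real_root_power_cancel) auto
        finally have "ennreal (root 3 (enn2real (B t))) \<le> ennreal (32 * y)" by (rule ennreal_leI)
        then show "ennreal (root 3 (enn2real (B t))) \<le> ennreal 32 * (w t)\<^sup>2"
          using y by (simp add: ennreal_mult)
      qed
      show "ennreal (root 3 (enn2real (B t))) = 0" if "t \<notin> {0<..<T}" for t
        unfolding B_def by (simp add: off_t[OF that])
    qed simp
    show "(\<integral>\<^sup>+z. ennreal ((norm (G' z))\<^sup>2)) \<le> ennreal (E\<^sup>2)"
    proof -
      have "(\<integral>\<^sup>+z. ennreal ((norm (G' z))\<^sup>2)) = (\<integral>\<^sup>+t. \<integral>\<^sup>+x. ennreal ((norm (G' (x, t)))\<^sup>2))"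
        by (rule nn_integral_slices) measurable
      also have "\<dots> \<le> ennreal (1 * E\<^sup>2)"
      proof (rule time_bound)
        show "(\<lambda>t. \<integral>\<^sup>+x. ennreal ((norm (G' (x, t)))\<^sup>2)) \<in> borel_measurable borel"
          by (rule borel_measurable_nn_integral_lborel) measurable
        show "AE t in lborel. t \<in> {0<..<T} \<longrightarrow> (\<integral>\<^sup>+x. ennreal ((norm (G' (x, t)))\<^sup>2)) \<le> ennreal 1 * (w t)\<^sup>2"
          using wg G_sl
        proof (eventually_elim, intro impI)
          fix t assume 1: "t \<in> {0<..<T} \<longrightarrow> weak_gradient \<Omega> (\<lambda>x. u (x, t)) (\<lambda>x. Du (x, t))"
            and 2: "AE x in lborel. x \<in> \<Omega> \<and> t \<in> {0<..<T} \<longrightarrow> Du (x, t) = G' (x, t)" and t: "t \<in> {0<..<T}"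
          have "(\<integral>\<^sup>+x. ennreal ((norm (Du (x, t)))\<^sup>2) \<partial>lebesgue_on \<Omega>) = (\<integral>\<^sup>+x. ennreal ((norm (G' (x, t)))\<^sup>2))"
            using 2 t by (intro nn_integral_lebesgue_on_cong_lborel[OF \<Omega>m]) (auto simp: off_x elim: eventually_mono)
          moreover have "(\<integral>\<^sup>+x. ennreal ((norm (Du (x, t)))\<^sup>2) \<partial>lebesgue_on \<Omega>) \<le> (w t)\<^sup>2"
            unfolding w_def using W12_norm_eq[OF \<Omega>(1), of "\<lambda>x. u (x, t)" "\<lambda>x. Du (x, t)"] 1 t by simp
          ultimately show "(\<integral>\<^sup>+x. ennreal ((norm (G' (x, t)))\<^sup>2)) \<le> ennreal 1 * (w t)\<^sup>2" by simp
        qed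
        show "(\<integral>\<^sup>+x. ennreal ((norm (G' (x, t)))\<^sup>2)) = 0" if "t \<notin> {0<..<T}" for t by (simp add: off_t[OF that])
      qed simp
      finally show ?thesis by simp
    qed
    show "(\<integral>\<^sup>+z. ennreal (N z * (norm (u' z))\<^sup>2) / (1 + (\<integral>\<^sup>+y. ennreal (N (y, snd z) / norm (fst z - y))))) \<le> ennreal (2 * Hardy_const * E\<^sup>2)"
      if [measurable]: "N \<in> borel_measurable borel" and N0: "\<And>z. 0 \<le> N z" for N
    proof -
      define W where "W z = 1 + (\<integral>\<^sup>+y. ennreal (N (y, snd z) / norm (fst z - y)))" for z :: "R3 \<times> real"
      have "(\<lambda>z. \<integral>\<^sup>+y. ennreal (N (y, snd z) / norm (fst z - y))) \<in> borel_measurable borel"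
        by (rule borel_measurable_nn_integral_lborel) measurable
      then have [measurable]: "W \<in> borel_measurable borel" unfolding W_def[abs_def] by measurable
      have "(\<integral>\<^sup>+z. ennreal (N z * (norm (u' z))\<^sup>2) / W z) =
          (\<integral>\<^sup>+t. \<integral>\<^sup>+x. ennreal (N (x, t) * (norm (u' (x, t)))\<^sup>2) / W (x, t))"
        by (rule nn_integral_slices) measurable
      also have "\<dots> \<le> ennreal ((2 * Hardy_const) * E\<^sup>2)"
      proof (rule time_bound)
        show "(\<lambda>t. \<integral>\<^sup>+x. ennreal (N (x, t) * (norm (u' (x, t)))\<^sup>2) / W (x, t)) \<in> borel_measurable borel"
          by (rule borel_measurable_nn_integral_lborel) measurable
        show "AE t in lborel. t \<in> {0<..<T} \<longrightarrow>
            (\<integral>\<^sup>+x. ennreal (N (x, t) * (norm (u' (x, t)))\<^sup>2) / W (x, t)) \<le> ennreal (2 * Hardy_const) * (w t)\<^sup>2"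
          using W0 u_sl
        proof (eventually_elim, intro impI)
          fix t assume 1: "t \<in> {0<..<T} \<longrightarrow> (\<lambda>x. u (x, t)) \<in> W12_0 \<Omega>"
            and 2: "AE x in lborel. x \<in> \<Omega> \<and> t \<in> {0<..<T} \<longrightarrow> u (x, t) = u' (x, t)" and t: "t \<in> {0<..<T}"
          have v: "(\<lambda>x. u (x, t)) \<in> W12_0 \<Omega>" using 1 t by blast
          have "(\<integral>\<^sup>+x. ennreal (N (x, t) * (norm (u (x, t)))\<^sup>2) / W (x, t) \<partial>lebesgue_on \<Omega>) =
              (\<integral>\<^sup>+x. ennreal (N (x, t) * (norm (u' (x, t)))\<^sup>2) / W (x, t))"
            using 2 t by (intro nn_integral_lebesgue_on_cong_lborel[OF \<Omega>m]) (auto simp: off_x elim: eventually_mono)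
          moreover have "(\<integral>\<^sup>+x. ennreal (N (x, t) * (norm (u (x, t)))\<^sup>2) / W (x, t) \<partial>lebesgue_on \<Omega>) \<le> ennreal (2 * Hardy_const) * (w t)\<^sup>2"
            using Hardy_W12_0[OF \<Omega>(1) v, of "\<lambda>x. N (x, t)"] N0 Hardy_const(2)
            unfolding W_def w_def by (simp add: ennreal_mult mult_ac)
          ultimately show "(\<integral>\<^sup>+x. ennreal (N (x, t) * (norm (u' (x, t)))\<^sup>2) / W (x, t)) \<le> ennreal (2 * Hardy_const) * (w t)\<^sup>2"
            by simp
        qed
        show "(\<integral>\<^sup>+x. ennreal (N (x, t) * (norm (u' (x, t)))\<^sup>2) / W (x, t)) = 0" if "t \<notin> {0<..<T}" for t
          by (simp add: off_t[OF that])
      qed (use Hardy_const(2) in simp)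
      finally show ?thesis by (simp add: W_def)
    qed
    show "(\<integral>z. a1 z) + (\<integral>z. a2 z) + (\<integral>z. a3 z) = 0"
      if U: "open U" "closure (cylinder \<Omega> T) \<subseteq> U" "smooth_on U \<xi>" and C: "compact C" "C \<subseteq> cylinder \<Omega> T"
        "\<And>z. z \<notin> C \<Longrightarrow> \<xi> z = 0"
        and a: "a1 \<in> borel_measurable borel" "a2 \<in> borel_measurable borel" "a3 \<in> borel_measurable borel"
        "\<And>z. z \<notin> cylinder \<Omega> T \<Longrightarrow> a1 z = 0 \<and> a2 z = 0 \<and> a3 z = 0"
        "\<And>z. z \<in> cylinder \<Omega> T \<Longrightarrow> a1 z = r z * (u' z \<bullet> time_deriv \<xi> z) \<and>
          a2 z = (r z *\<^sub>R tensor (u' z) (u' z) + p (r z) *\<^sub>R mat 1 - stress \<nu>1 \<nu>2 (G' z)) \<bullet> grad_vec \<xi> z \<and>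
          a3 z = r z * (f' z \<bullet> \<xi> z)" for U C \<xi> a1 a2 a3
    proof -
      have z: "\<xi> (x, t) = 0" if "(x, t) \<notin> Q" for x t using that C by (auto simp: Q_def)
      have "frontier \<Omega> \<inter> \<Omega> = {}" using \<Omega>(1) by (auto simp: frontier_def interior_open)
      then have fr: "\<forall>x\<in>frontier \<Omega>. \<forall>t\<in>{0<..<T}. \<xi> (x, t) = 0" by (auto intro!: z simp: Qt)
      have "momentum_eq \<Omega> T \<nu>1 \<nu>2 p f \<rho>0 u0 \<rho> u Du \<xi>"
        by (rule mom[OF _ _ fr]) (use U in \<open>auto simp: smooth_upto_boundary_def Q_def[symmetric] intro!: z simp: Qt\<close>)
      \<comment> \<open>The test function vanishes outside the open cylinder, in particular at time
        0.\<close>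
      moreover have "(\<integral>x. \<rho>0 x * (u0 x \<bullet> \<xi> (x, 0)) \<partial>lebesgue_on \<Omega>) = 0"
        using z[of _ 0] by (simp add: Qt)
      moreover have "(\<integral>z. \<rho> z * (u z \<bullet> time_deriv \<xi> z) \<partial>lebesgue_on Q) = (\<integral>z. a1 z)"
        by (rule integral_lebesgue_on_cong_lborel[OF Qm(1) _ _ a(1)], use r_ae u'ae in eventually_elim)
          (use a(4,5) in \<open>auto simp: Q_def\<close>)
      moreover have "(\<integral>z. (\<rho> z *\<^sub>R tensor (u z) (u z) + p (\<rho> z) *\<^sub>R mat 1 - stress \<nu>1 \<nu>2 (Du z)) \<bullet> grad_vec \<xi> z \<partial>lebesgue_on Q) =
          (\<integral>z. a2 z)"
        by (rule integral_lebesgue_on_cong_lborel[OF Qm(1) _ _ a(2)], use r_ae u'ae G'ae in eventually_elim)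
          (use a(4,5) in \<open>auto simp: Q_def\<close>)
      moreover have "(\<integral>z. \<rho> z * (f z \<bullet> \<xi> z) \<partial>lebesgue_on Q) = (\<integral>z. a3 z)"
        by (rule integral_lebesgue_on_cong_lborel[OF Qm(1) _ _ a(3)], use r_ae f'_ae in eventually_elim)
          (use a(4,5) in \<open>auto simp: Q_def\<close>)
      ultimately show ?thesis unfolding momentum_eq_def Q_def[symmetric] by simp
    qed
    show "(\<integral>z. b1 z) = 0"
      if U: "open U" "closure (cylinder \<Omega> T) \<subseteq> U" "smooth_on U \<psi>" and C: "compact C" "C \<subseteq> cylinder \<Omega> T"
        "\<And>z. z \<notin> C \<Longrightarrow> \<psi> z = 0" and b: "b1 \<in> borel_measurable borel" "\<And>z. z \<notin> cylinder \<Omega> T \<Longrightarrow> b1 z = 0"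
        "\<And>z. z \<in> cylinder \<Omega> T \<Longrightarrow> b1 z = r z * time_deriv \<psi> z + r z * (u' z \<bullet> grad \<psi> z)" for U C \<psi> b1
    proof -
      have z: "\<psi> (x, t) = 0" if "(x, t) \<notin> Q" for x t using that C by (auto simp: Q_def)
      have "continuity_eq \<Omega> T \<rho>0 \<rho> u \<psi>"
        by (rule cont) (use U in \<open>auto simp: smooth_upto_boundary_def Q_def[symmetric] intro!: z simp: Qt\<close>)
      moreover have "(\<integral>x. \<psi> (x, 0) * \<rho>0 x \<partial>lebesgue_on \<Omega>) = 0"
        using z[of _ 0] by (simp add: Qt)
      moreover have "(\<integral>z. \<rho> z * time_deriv \<psi> z + \<rho> z * (u z \<bullet> grad \<psi> z) \<partial>lebesgue_on Q) = (\<integral>z. b1 z)"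
        by (rule integral_lebesgue_on_cong_lborel[OF Qm(1) _ _ b(1)], use r_ae u'ae in eventually_elim)
          (use b(2,3) in \<open>auto simp: Q_def\<close>)
      ultimately show ?thesis unfolding continuity_eq_def Q_def[symmetric] by simp
    qed
  qed
  moreover have "AE z in lborel. z \<in> cylinder \<Omega> T \<longrightarrow> \<rho> z = r z \<and> u z = u' z"
    using r_ae u'ae by eventually_elim (auto simp: Q_def)
  ultimately show ?thesis unfolding p_def by (rule that)
qed

section \<open>The logarithmic kernel\<close>

text \<open>\<open>ker\<close> is the function h of the overview at q = |x|^2 + \<delta>, and this
  is its logarithm. For positive \<delta> the field \<open>kvec\<close> is smooth at the origin, and
  \<delta> = 0 gives the kernel of the final estimate.\<close>

definition Lam :: "real \<Rightarrow> real \<Rightarrow> R3 \<Rightarrow> real" where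
  "Lam a \<delta> x = ln (a / ((norm x)\<^sup>2 + \<delta>))"

definition ker :: "real \<Rightarrow> real \<Rightarrow> real \<Rightarrow> R3 \<Rightarrow> real" where
  "ker a s \<delta> x = Lam a \<delta> x powr s / sqrt ((norm x)\<^sup>2 + \<delta>)"

definition kvec :: "real \<Rightarrow> real \<Rightarrow> real \<Rightarrow> R3 \<Rightarrow> R3" where
  "kvec a s \<delta> x = ker a s \<delta> x *\<^sub>R x"

definition kjac :: "real \<Rightarrow> real \<Rightarrow> real \<Rightarrow> R3 \<Rightarrow> real ^ 3 ^ 3" where
  "kjac a s \<delta> x = ker a s \<delta> x *\<^sub>R mat 1 -
    (ker a s \<delta> x / ((norm x)\<^sup>2 + \<delta>) * (1 + 2 * s / Lam a \<delta> x)) *\<^sub>R tensor x x"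

lemma kernel_measurable [measurable]:
  "Lam a \<delta> \<in> borel_measurable borel" "ker a s \<delta> \<in> borel_measurable borel"
  "kvec a s \<delta> \<in> borel_measurable borel"
  unfolding Lam_def[abs_def] ker_def[abs_def] kvec_def[abs_def] by measurable

lemma kjac_nth_measurable [measurable]: "(\<lambda>x. kjac a s \<delta> x $ i $ j) \<in> borel_measurable borel"
proof -
  have *: "(\<lambda>x. kjac a s \<delta> x $ i $ j) = (\<lambda>x. ker a s \<delta> x * (mat 1 :: real ^ 3 ^ 3) $ i $ j -
      (ker a s \<delta> x / ((norm x)\<^sup>2 + \<delta>) * (1 + 2 * s / Lam a \<delta> x)) * (x $ i * x $ j))"
    by (auto simp: kjac_def tensor_def)
  show ?thesis unfolding * by measurable
qed

lemma kernel_even [simp]: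
  "Lam a \<delta> (- x) = Lam a \<delta> x" "ker a s \<delta> (- x) = ker a s \<delta> x"
  "kjac a s \<delta> (- x) = kjac a s \<delta> x"
  by (simp_all add: Lam_def ker_def kvec_def kjac_def tensor_def)

lemma tensor_mult_vec: "tensor x y *v v = (y \<bullet> v) *\<^sub>R (x :: R3)"
  by (simp add: vec_eq_iff tensor_def matrix_vector_mult_def inner_vec_def sum_distrib_right sum_distrib_left mult_ac)

lemma norm_tensor: "norm (tensor x y) = norm x * norm y" for x y :: R3
proof -
  have "tensor x y \<bullet> tensor x y = (x \<bullet> x) * (y \<bullet> y)"
    by (simp add: inner_vec_def tensor_def sum_product mult_ac)
  then show ?thesis by (simp add: norm_eq_sqrt_inner real_sqrt_mult)
qed

lemma kjac_mult_vec:
  "kjac a s \<delta> x *v v = ker a s \<delta> x *\<^sub>R v -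
    (ker a s \<delta> x / ((norm x)\<^sup>2 + \<delta>) * (1 + 2 * s / Lam a \<delta> x) * (x \<bullet> v)) *\<^sub>R x"
  unfolding kjac_def
  by (simp add: matrix_vector_mult_diff_rdistrib scaleR_matrix_vector_assoc[symmetric] tensor_mult_vec)

context
  fixes a s \<delta> :: real and x :: R3
  assumes \<delta>: "\<delta> > 0" and xa: "(norm x)\<^sup>2 + \<delta> < a"
begin

private lemma q_pos: "(norm x)\<^sup>2 + \<delta> > 0"
  using \<delta> by (simp add: add_nonneg_pos)

private lemma Lam_pos: "Lam a \<delta> x > 0"
  unfolding Lam_def using q_pos xa by (intro ln_gt_zero) simp

lemma kvec_has_derivative: "(kvec a s \<delta> has_derivative (\<lambda>v. kjac a s \<delta> x *v v)) (at x)"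
proof -
  define q where "q = (norm x)\<^sup>2 + \<delta>"
  define L where "L = Lam a \<delta> x"
  have q: "q > 0" "q < a" using q_pos xa by (auto simp: q_def)
  have L: "L > 0" using Lam_pos by (simp add: L_def)
  have dq: "((\<lambda>x. (norm x)\<^sup>2 + \<delta>) has_derivative (\<lambda>v. 2 * (x \<bullet> v))) (at x)"
    unfolding power2_norm_eq_inner by (auto intro!: derivative_eq_intros simp: inner_commute)
  \<comment> \<open>The derivative in q of ln (a / q)^s q^(-1/2), arranged so that the correction s
    / L to the purely algebraic factor 1/2 is visible.\<close>
  define c where "c = - (L powr s / sqrt q) / q * (1 / 2 + s / L)"
  have "((\<lambda>q. ln (a / q) powr s / sqrt q) has_real_derivative c) (at q)"
  proof -
    have Lq: "L = ln (a / q)" by (simp add: L_def Lam_def q_def)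
    have d1: "((\<lambda>q. ln (a / q)) has_real_derivative - (1 / q)) (at q)"
      using q by (auto intro!: derivative_eq_intros simp: field_simps power2_eq_square)
    have d2: "((\<lambda>q. ln (a / q) powr s) has_real_derivative (s * L powr (s - 1) * (- (1 / q)))) (at q)"
      using DERIV_fun_powr[OF d1, of s] L by (simp add: Lq)
    have d3: "(sqrt has_real_derivative (inverse (sqrt q) / 2)) (at q)"
      by (rule DERIV_real_sqrt) (use q in simp)
    have sq: "sqrt q > 0" "sqrt q * sqrt q = q" using q by auto
    have d4: "((\<lambda>q. ln (a / q) powr s / sqrt q) has_real_derivative
        ((s * L powr (s - 1) * (- (1 / q))) * sqrt q - ln (a / q) powr s * (inverse (sqrt q) / 2)) / (sqrt q * sqrt q)) (at q)"
      by (rule DERIV_divide[OF d2 d3]) (use sq in simp)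
    have "L powr (s - 1) = L powr s / L" using L by (simp add: powr_diff)
    then have "((s * L powr (s - 1) * (- (1 / q))) * sqrt q - ln (a / q) powr s * (inverse (sqrt q) / 2)) / (sqrt q * sqrt q) =
        - (L powr s / sqrt q) / q * (1 / 2 + s / L)"
    proof -
      have "(s * (P / L) * (- (1 / (\<rho> * \<rho>))) * \<rho> - P * (inverse \<rho> / 2)) / (\<rho> * \<rho>) =
          - (P / \<rho>) / (\<rho> * \<rho>) * (1 / 2 + s / L)" if "\<rho> > 0" for \<rho> P :: real
        using that L by (simp add: field_simps)
      from this[OF sq(1), of "L powr s"] \<open>L powr (s - 1) = L powr s / L\<close> show ?thesis
        unfolding Lq[symmetric] sq(2) by simp
    qed
    with d4 show ?thesis by (simp only: c_def)
  qed
  then have "((\<lambda>q. ln (a / q) powr s / sqrt q) has_derivative (*) c) (at ((norm x)\<^sup>2 + \<delta>))"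
    by (simp add: has_field_derivative_def q_def)
  from has_derivative_compose[OF dq this]
  have "(ker a s \<delta> has_derivative (\<lambda>v. c * (2 * (x \<bullet> v)))) (at x)"
    by (simp only: ker_def[abs_def] Lam_def)
  moreover have "c = - (ker a s \<delta> x) / q * (1 / 2 + s / L)"
    by (simp add: c_def ker_def L_def q_def)
  ultimately have dker: "(ker a s \<delta> has_derivative (\<lambda>v. - (ker a s \<delta> x) / q * (1 / 2 + s / L) * (2 * (x \<bullet> v)))) (at x)"
    by (simp only:)
  have "(kvec a s \<delta> has_derivative (\<lambda>v. ker a s \<delta> x *\<^sub>R v + (- (ker a s \<delta> x) / q * (1 / 2 + s / L) * (2 * (x \<bullet> v))) *\<^sub>R x)) (at x)"
    unfolding kvec_def[abs_def] by (rule has_derivative_scaleR[OF dker has_derivative_ident])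
  moreover have "ker a s \<delta> x *\<^sub>R v + (- (ker a s \<delta> x) / q * (1 / 2 + s / L) * (2 * (x \<bullet> v))) *\<^sub>R x = kjac a s \<delta> x *v v" for v
  proof -
    have e: "- (ker a s \<delta> x) / q * (1 / 2 + s / L) * (2 * (x \<bullet> v)) =
        - (ker a s \<delta> x / q * (1 + 2 * s / L) * (x \<bullet> v))"
      using q L by (simp add: field_simps)
    show ?thesis
      unfolding kjac_mult_vec q_def[symmetric] L_def[symmetric] e by simp
  qed
  ultimately show ?thesis by (simp only:)
qed

context
  assumes s: "0 < s" "2 * s \<le> Lam a \<delta> x"
begin

lemma ker_nonneg: "ker a s \<delta> x \<ge> 0"
  unfolding ker_def by (intro divide_nonneg_nonneg) (use q_pos in auto)

private lemma ratio: "(norm x)\<^sup>2 / ((norm x)\<^sup>2 + \<delta>) \<le> 1" "0 \<le> (norm x)\<^sup>2 / ((norm x)\<^sup>2 + \<delta>)" "0 \<le> 2 * s / Lam a \<delta> x" "2 * s / Lam a \<delta> x \<le> 1"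
  using q_pos \<delta> s Lam_pos by (auto simp: divide_simps)

text \<open>Without logarithm and regularisation the field is x / |x|, the gradient of the convex
  function |x|, whose Jacobian is nonnegative and vanishes in the radial direction. Negativity
  therefore comes from the logarithm alone, and its derivative costs one power of it.\<close>

lemma kjac_lower: "v \<bullet> (kjac a s \<delta> x *v v) \<ge> - (2 * s * (ker a s \<delta> x / Lam a \<delta> x) * (norm v)\<^sup>2)"
proof -
  define h where "h = ker a s \<delta> x"
  define q where "q = (norm x)\<^sup>2 + \<delta>"
  define e where "e = 2 * s / Lam a \<delta> x"
  have h: "h \<ge> 0" using ker_nonneg by (simp add: h_def)
  have q: "q > 0" using q_pos by (simp add: q_def)
  have e: "0 \<le> e" using ratio by (simp add: e_def)
  have "(x \<bullet> v)\<^sup>2 \<le> (norm x)\<^sup>2 * (norm v)\<^sup>2"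
    using Cauchy_Schwarz_ineq[of x v] by (simp add: power2_norm_eq_inner)
  then have "(x \<bullet> v)\<^sup>2 / q \<le> (norm x)\<^sup>2 / q * (norm v)\<^sup>2"
    using q by (simp add: divide_right_mono)
  also have "\<dots> \<le> 1 * (norm v)\<^sup>2"
    using ratio(1) by (intro mult_right_mono) (auto simp: q_def)
  finally have xv: "(x \<bullet> v)\<^sup>2 / q \<le> (norm v)\<^sup>2" by simp
  have "v \<bullet> (kjac a s \<delta> x *v v) = h * (norm v)\<^sup>2 - h * (1 + e) * ((x \<bullet> v)\<^sup>2 / q)"
    unfolding kjac_mult_vec h_def[symmetric] q_def[symmetric] e_def[symmetric]
    unfolding power2_norm_eq_inner
    by (simp add: inner_diff_right inner_commute[of v x] power2_eq_square)
  also have "\<dots> \<ge> h * (norm v)\<^sup>2 - h * (1 + e) * (norm v)\<^sup>2"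
    using xv h e by (intro diff_left_mono mult_left_mono) auto
  also have "h * (norm v)\<^sup>2 - h * (1 + e) * (norm v)\<^sup>2 = - (2 * s * (h / Lam a \<delta> x) * (norm v)\<^sup>2)"
    by (simp add: e_def algebra_simps)
  finally show ?thesis by (simp add: h_def)
qed

text \<open>The divergence is 3 h minus the radial part, which is at most 2 h once 2 s is below the
  logarithm. It multiplies the pressure and is the source of the positive term.\<close>

lemma kjac_trace: "mat 1 \<bullet> kjac a s \<delta> x \<ge> ker a s \<delta> x"
proof -
  define h where "h = ker a s \<delta> x"
  define q where "q = (norm x)\<^sup>2 + \<delta>"
  define e where "e = 2 * s / Lam a \<delta> x"
  have h: "h \<ge> 0" using ker_nonneg by (simp add: h_def)
  have m: "mat 1 \<bullet> (mat 1 :: real ^ 3 ^ 3) = 3" "mat 1 \<bullet> tensor x x = (norm x)\<^sup>2"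
    by (simp_all add: inner_vec_def mat_def tensor_def sum_3 power2_norm_eq_inner)
  have "mat 1 \<bullet> kjac a s \<delta> x = 3 * h - h * (1 + e) * ((norm x)\<^sup>2 / q)"
    unfolding kjac_def h_def[symmetric] q_def[symmetric] e_def[symmetric]
    by (simp add: inner_diff_right m)
  also have "\<dots> \<ge> 3 * h - h * 2 * 1"
    using h ratio by (intro diff_left_mono mult_mono mult_left_mono) (auto simp: e_def q_def)
  finally show ?thesis using h by (simp add: h_def)
qed

lemma kjac_norm: "norm (kjac a s \<delta> x) \<le> 4 * ker a s \<delta> x"
proof -
  define h where "h = ker a s \<delta> x"
  define q where "q = (norm x)\<^sup>2 + \<delta>"
  define e where "e = 2 * s / Lam a \<delta> x"
  have h: "h \<ge> 0" using ker_nonneg by (simp add: h_def)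
  have q: "q > 0" using q_pos by (simp add: q_def)
  have m: "norm (mat 1 :: real ^ 3 ^ 3) \<le> 2"
  proof -
    have "mat 1 \<bullet> (mat 1 :: real ^ 3 ^ 3) = 3" by (simp add: inner_vec_def mat_def sum_3)
    then have "norm (mat 1 :: real ^ 3 ^ 3) = sqrt 3" by (simp add: norm_eq_sqrt_inner)
    also have "\<dots> \<le> 2" by (rule real_le_lsqrt) auto
    finally show ?thesis .
  qed
  have "norm (kjac a s \<delta> x) \<le> norm (h *\<^sub>R (mat 1 :: real ^ 3 ^ 3)) + norm ((h / q * (1 + e)) *\<^sub>R tensor x x)"
    unfolding kjac_def h_def[symmetric] q_def[symmetric] e_def[symmetric] by (rule norm_triangle_ineq4)
  also have "\<dots> = h * norm (mat 1 :: real ^ 3 ^ 3) + h * (1 + e) * ((norm x)\<^sup>2 / q)"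
    using h q ratio by (simp add: norm_tensor power2_eq_square abs_mult e_def)
  also have "\<dots> \<le> h * 2 + h * 2 * 1"
    using h m ratio by (intro add_mono mult_mono mult_left_mono) (auto simp: e_def q_def)
  finally show ?thesis by (simp add: h_def)
qed

lemma kvec_norm: "norm (kvec a s \<delta> x) \<le> Lam a \<delta> x powr s"
proof -
  have "norm x \<le> sqrt ((norm x)\<^sup>2 + \<delta>)" using \<delta> by (intro real_le_rsqrt) simp
  then have "Lam a \<delta> x powr s * (norm x / sqrt ((norm x)\<^sup>2 + \<delta>)) \<le> Lam a \<delta> x powr s * 1"
    using q_pos by (intro mult_left_mono) (auto simp: divide_le_eq)
  then show ?thesis using q_pos by (simp add: kvec_def ker_def abs_of_pos)
qed

end
end

text \<open>The factor exp 4 keeps the logarithm at least 4 on differences of points of the domain.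
  This exceeds both 2 s < 8/3, needed for the Jacobian, and 2 (5/3 - s) < 10/3, needed for
  monotonicity of the remaining kernel in \<delta>.\<close>

lemma
  fixes a D \<delta> :: real and x :: R3
  assumes a: "a = (D\<^sup>2 + 1) * exp 4"
  shows kernel_scale: "0 < a" "D\<^sup>2 + 1 < a"
    and Lam_ge_4: "0 < \<delta> \<Longrightarrow> \<delta> \<le> 1 \<Longrightarrow> norm x \<le> D \<Longrightarrow> 4 \<le> Lam a \<delta> x \<and> (norm x)\<^sup>2 + \<delta> < a"
proof -
  have D: "0 < D\<^sup>2 + 1" by (simp add: add_nonneg_pos)
  then show a0: "0 < a" "D\<^sup>2 + 1 < a" unfolding a by auto
  assume \<delta>: "0 < \<delta>" "\<delta> \<le> 1" and "norm x \<le> D"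
  then have x: "(norm x)\<^sup>2 \<le> D\<^sup>2" by (intro power_mono) auto
  have "4 = ln (a / (D\<^sup>2 + 1))" unfolding a using D by simp
  also have "\<dots> \<le> Lam a \<delta> x"
    unfolding Lam_def using x \<delta> a0 D by (intro ln_mono divide_left_mono mult_pos_pos divide_pos_pos add_nonneg_pos) auto
  finally show "4 \<le> Lam a \<delta> x \<and> (norm x)\<^sup>2 + \<delta> < a" using x \<delta> a0 by linarith
qed

text \<open>The integral bounds that the kernel has to satisfy uniformly in \<delta>, gathered under
  one constant \<open>I\<close>. The first three are L^3 bounds of kernels to be convolved with the
  density, the constant kernel 1 included (hence the form \<open>1 ^ 3\<close>); the third is the
  critical one. The fourth, an L^2 bound, serves the viscous stress.\<close>

locale log_kernel =
  fixes a s D I :: real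
  assumes D_pos: "D > 0" and a_eq: "a = (D\<^sup>2 + 1) * exp 4" and s: "0 < s" "s < 4 / 3" and I_nonneg: "0 \<le> I"
    and I1: "(\<integral>\<^sup>+x. ennreal (1 ^ 3) * indicator (cball (0 :: R3) D) x) \<le> ennreal I"
    and I2: "0 < \<delta> \<Longrightarrow> \<delta> \<le> 1 \<Longrightarrow> (\<integral>\<^sup>+x. ennreal ((Lam a \<delta> x powr s) ^ 3) * indicator (cball 0 D) x) \<le> ennreal I"
    and I3: "0 < \<delta> \<Longrightarrow> \<delta> \<le> 1 \<Longrightarrow> (\<integral>\<^sup>+x. ennreal (ker a (s - 5 / 3) \<delta> x ^ 3) * indicator (cball 0 D) x) \<le> ennreal I"
    and I4: "0 < \<delta> \<Longrightarrow> \<delta> \<le> 1 \<Longrightarrow> (\<integral>\<^sup>+x. ennreal ((ker a s \<delta> x)\<^sup>2) * indicator (cball 0 D) x) \<le> ennreal I"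

section \<open>Doubling of variables\<close>

lemma norm_transpose_R3: "norm (transpose A) = norm (A :: real ^ 3 ^ 3)"
proof -
  have "transpose A \<bullet> transpose A = A \<bullet> A"
    by (simp add: inner_vec_def transpose_def) (rule sum.swap)
  then show ?thesis by (simp add: norm_eq_sqrt_inner)
qed

lemma norm_mat_1_le: "norm (mat 1 :: real ^ 3 ^ 3) \<le> 2"
proof -
  have "mat 1 \<bullet> (mat 1 :: real ^ 3 ^ 3) = 3" by (simp add: inner_vec_def mat_def sum_3)
  then have "norm (mat 1 :: real ^ 3 ^ 3) = sqrt 3" by (simp add: norm_eq_sqrt_inner)
  also have "\<dots> \<le> 2" by (rule real_le_lsqrt) auto
  finally show ?thesis .
qed

lemma norm_stress_le: "norm (stress \<nu>1 \<nu>2 A) \<le> (2 * \<bar>\<nu>1\<bar> + 4 * \<bar>\<nu>2\<bar>) * norm A"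
proof -
  have tr: "\<bar>trace A\<bar> \<le> 2 * norm A"
  proof -
    have "trace A = mat 1 \<bullet> A"
      by (simp add: trace_def inner_vec_def mat_def if_distrib if_distribR cong: if_cong)
    then have "\<bar>trace A\<bar> \<le> norm (mat 1 :: real ^ 3 ^ 3) * norm A"
      by (simp add: Cauchy_Schwarz_ineq2)
    also have "\<dots> \<le> 2 * norm A" by (intro mult_right_mono norm_mat_1_le) auto
    finally show ?thesis .
  qed
  have "norm (stress \<nu>1 \<nu>2 A) \<le> norm (\<nu>1 *\<^sub>R (A + transpose A)) + norm ((\<nu>2 * trace A) *\<^sub>R (mat 1 :: real ^ 3 ^ 3))"
    unfolding stress_def by (rule norm_triangle_ineq)
  also have "\<dots> \<le> \<bar>\<nu>1\<bar> * (2 * norm A) + (\<bar>\<nu>2\<bar> * (2 * norm A)) * 2"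
  proof (intro add_mono)
    show "norm (\<nu>1 *\<^sub>R (A + transpose A)) \<le> \<bar>\<nu>1\<bar> * (2 * norm A)"
      using norm_triangle_ineq[of A "transpose A"] by (simp add: norm_transpose_R3 mult_left_mono)
    show "norm ((\<nu>2 * trace A) *\<^sub>R (mat 1 :: real ^ 3 ^ 3)) \<le> (\<bar>\<nu>2\<bar> * (2 * norm A)) * 2"
      unfolding norm_scaleR abs_mult real_norm_def
      by (intro mult_mono norm_mat_1_le mult_left_mono tr) auto
  qed
  finally show ?thesis by (simp add: algebra_simps)
qed

lemma le_one_plus_square: "t \<le> 1 + t\<^sup>2" for t :: real
  using zero_le_power2[of "t - 1 / 2"] by (simp add: power2_eq_square algebra_simps)

lemma inner_grad_eq:
  assumes "(\<psi> has_derivative D) (at z)"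
  shows "v \<bullet> grad \<psi> z = D (v, 0)"
proof -
  have D: "frechet_derivative \<psi> (at z) = D" using frechet_derivative_at[OF assms] by simp
  have lin: "linear D" by (rule has_derivative_linear[OF assms])
  have "(v, 0 :: real) = (\<Sum>j\<in>UNIV. v $ j *\<^sub>R (axis j 1, 0))"
    by (auto simp: prod_eq_iff fst_sum snd_sum basis_expansion simp flip: scalar_mult_eq_scaleR)
  then have "D (v, 0) = D (\<Sum>j\<in>UNIV. v $ j *\<^sub>R (axis j 1, 0))" by (rule arg_cong)
  also have "\<dots> = (\<Sum>j\<in>UNIV. v $ j * D (axis j 1, 0))"
    unfolding linear_sum[OF lin] linear_scale[OF lin] real_scaleR_def ..
  finally have "D (v, 0) = (\<Sum>j\<in>UNIV. v $ j * D (axis j 1, 0))" .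
  then show ?thesis by (simp add: inner_vec_def grad_def space_deriv_def D)
qed

section \<open>A priori bounds from the energy\<close>

context energy_flow
begin

abbreviation Q where "Q \<equiv> cylinder \<Omega> T"

lemma Q_open: "open Q"
  unfolding cylinder_def using open_dom by (intro open_Times) auto

lemma mem_Q: "(x, t) \<in> Q \<longleftrightarrow> x \<in> \<Omega> \<and> t \<in> {0<..<T}"
  by (auto simp: cylinder_def)

lemma p_nonneg: "0 \<le> s \<Longrightarrow> 0 \<le> p s"
  using p_ge[of s] by (meson order_trans powr_ge_zero)

lemma s_le_p: "0 \<le> s \<Longrightarrow> s \<le> 1 + p s"
proof (cases "s \<le> 1")
  case True
  moreover assume "0 \<le> s"
  ultimately show ?thesis using p_nonneg[of s] by simp
next
  case False
  then have "s powr 1 \<le> s powr (3 / 2)" by (intro powr_mono) auto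
  then show ?thesis using p_ge[of s] False by simp
qed

definition vol where "vol = measure lborel \<Omega>"

lemma vol: "emeasure lborel \<Omega> = ennreal vol" "vol \<ge> 0"
  using emeasure_bounded_finite[OF bounded_dom] by (auto simp: vol_def emeasure_eq_ennreal_measure)

lemma emeasure_Q: "emeasure lborel Q = ennreal (vol * T)"
proof -
  have "emeasure lborel Q = emeasure (lborel \<Otimes>\<^sub>M lborel) (\<Omega> \<times> {0<..<T})"
    by (simp add: lborel_prod cylinder_def)
  also have "\<dots> = emeasure lborel \<Omega> * emeasure lborel {0<..<T}"
    using open_dom by (intro lborel.emeasure_pair_measure_Times) auto
  finally show ?thesis using T_pos by (simp add: vol ennreal_mult)
qed

lemma nn_integral_le_time:
  assumes "h \<in> borel_measurable (borel :: (R3 \<times> real) measure)" "c' \<ge> 0"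
    and "AE t in lborel. (\<integral>\<^sup>+x. h (x, t)) \<le> ennreal c'" "\<And>z. z \<notin> Q \<Longrightarrow> h z = 0"
  shows "(\<integral>\<^sup>+z. h z) \<le> ennreal (T * c')"
proof -
  have "(\<integral>\<^sup>+z. h z) = (\<integral>\<^sup>+t. \<integral>\<^sup>+x. h (x, t))"
    by (rule nn_integral_slices[OF assms(1)])
  also have "\<dots> \<le> (\<integral>\<^sup>+t. ennreal c' * indicator {0<..<T} t)"
  proof (rule nn_integral_mono_AE)
    show "AE t in lborel. (\<integral>\<^sup>+x. h (x, t)) \<le> ennreal c' * indicator {0<..<T} t"
      using assms(3)
    proof eventually_elim
      case (elim t)
      then show ?case using assms(4)[of "(_, t)"] by (cases "t \<in> {0<..<T}") (auto simp: mem_Q)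
    qed
  qed
  also have "\<dots> = ennreal (T * c')"
    using T_pos assms(2) by (simp add: nn_integral_cmult_indicator ennreal_mult mult.commute)
  finally show ?thesis .
qed

lemma int_p: "(\<integral>\<^sup>+z. ennreal (p (r z))) \<le> ennreal (T * E)"
  using E_pos energy_p by (intro nn_integral_le_time) (auto simp: off p_zero)

lemma int_kin: "(\<integral>\<^sup>+z. ennreal (r z * (norm (u z))\<^sup>2)) \<le> ennreal (T * E)"
  using E_pos energy_kin by (intro nn_integral_le_time) (auto simp: off)

lemma Q_borel [measurable]: "Q \<in> sets borel"
  using Q_open by auto

lemma int_r: "(\<integral>\<^sup>+z. ennreal (r z)) \<le> ennreal (vol * T + T * E)"
proof -
  have "(\<integral>\<^sup>+z. ennreal (r z)) \<le> (\<integral>\<^sup>+z. indicator Q z + ennreal (p (r z)))"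
  proof (intro nn_integral_mono)
    fix z
    have "ennreal (r z) \<le> ennreal (1 + p (r z))" by (intro ennreal_leI s_le_p r_nonneg)
    then show "ennreal (r z) \<le> indicator Q z + ennreal (p (r z))"
      using off(1)[of z] p_nonneg[OF r_nonneg[of z]] by (cases "z \<in> Q") auto
  qed
  also have "\<dots> = ennreal (vol * T) + (\<integral>\<^sup>+z. ennreal (p (r z)))"
    by (subst nn_integral_add) (auto simp: emeasure_Q)
  also have "\<dots> \<le> ennreal (vol * T) + ennreal (T * E)" by (intro add_left_mono int_p)
  also have "\<dots> = ennreal (vol * T + T * E)" using vol T_pos E_pos by simp
  finally show ?thesis .
qed

text \<open>One integrable function dominates every quantity that meets a bounded factor in the
  tested equations, so the product \<open>H z * H w\<close> justifies Fubini's theorem in the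
  doubled variables.\<close>

definition H where "H z = r z + r z * (norm (u z))\<^sup>2 + p (r z) + norm (G z)"

lemma H_borel [measurable]: "H \<in> borel_measurable borel"
  unfolding H_def by measurable

lemma H_nonneg: "0 \<le> H z"
  unfolding H_def using r_nonneg p_nonneg by (intro add_nonneg_nonneg mult_nonneg_nonneg) auto

lemma H_off: "z \<notin> Q \<Longrightarrow> H z = 0"
  by (simp add: H_def off p_zero)

definition IH where "IH = (vol * T + T * E) + T * E + T * E + (vol * T + E\<^sup>2)"

lemma IH_nonneg: "IH \<ge> 0"
  unfolding IH_def using vol T_pos E_pos by (intro add_nonneg_nonneg mult_nonneg_nonneg) auto

lemma int_H: "(\<integral>\<^sup>+z. ennreal (H z)) \<le> ennreal IH"
proof -
  have "(\<integral>\<^sup>+z. ennreal (norm (G z))) \<le> (\<integral>\<^sup>+z. indicator Q z + ennreal ((norm (G z))\<^sup>2))"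
  proof (intro nn_integral_mono)
    fix z
    have "norm (G z) \<le> 1 + (norm (G z))\<^sup>2"
      by (rule le_one_plus_square)
    then have "ennreal (norm (G z)) \<le> ennreal (1 + (norm (G z))\<^sup>2)" by (rule ennreal_leI)
    then show "ennreal (norm (G z)) \<le> indicator Q z + ennreal ((norm (G z))\<^sup>2)"
      using off(3)[of z] by (cases "z \<in> Q") auto
  qed
  also have "\<dots> = ennreal (vol * T) + (\<integral>\<^sup>+z. ennreal ((norm (G z))\<^sup>2))"
    by (subst nn_integral_add) (auto simp: emeasure_Q)
  also have "\<dots> \<le> ennreal (vol * T) + ennreal (E\<^sup>2)" by (intro add_left_mono G_int)
  also have "\<dots> = ennreal (vol * T + E\<^sup>2)" using vol T_pos E_pos by simp
  finally have g: "(\<integral>\<^sup>+z. ennreal (norm (G z))) \<le> ennreal (vol * T + E\<^sup>2)" .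
  have "(\<integral>\<^sup>+z. ennreal (H z)) = (\<integral>\<^sup>+z. ennreal (r z) + ennreal (r z * (norm (u z))\<^sup>2) + ennreal (p (r z)) + ennreal (norm (G z)))"
    unfolding H_def using r_nonneg p_nonneg[OF r_nonneg] by (intro nn_integral_cong) simp
  also have "\<dots> = (\<integral>\<^sup>+z. ennreal (r z)) + (\<integral>\<^sup>+z. ennreal (r z * (norm (u z))\<^sup>2)) +
      (\<integral>\<^sup>+z. ennreal (p (r z))) + (\<integral>\<^sup>+z. ennreal (norm (G z)))"
    by (simp add: nn_integral_add)
  also have "\<dots> \<le> ennreal (vol * T + T * E) + ennreal (T * E) + ennreal (T * E) + ennreal (vol * T + E\<^sup>2)"
    by (intro add_mono int_r int_kin int_p g)
  also have "\<dots> = ennreal IH"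
    unfolding IH_def using vol T_pos E_pos by (simp add: ennreal_plus[symmetric] del: ennreal_plus)
  finally show ?thesis .
qed

lemma H_integrable: "integrable lborel H"
  using order.strict_trans1[OF int_H] H_nonneg by (intro integrableI_nonneg) auto

lemma ru_le: "r z * norm (u z) \<le> r z + r z * (norm (u z))\<^sup>2"
proof -
  have "norm (u z) \<le> 1 + (norm (u z))\<^sup>2"
    by (rule le_one_plus_square)
  from mult_left_mono[OF this r_nonneg[of z]] show ?thesis by (simp add: distrib_left)
qed

lemma ru_le_H: "r z * norm (u z) \<le> H z" "r z \<le> H z" "r z * (norm (u z))\<^sup>2 \<le> H z" "p (r z) \<le> H z" "norm (G z) \<le> H z"
  using ru_le[of z] r_nonneg[of z] p_nonneg[OF r_nonneg[of z]] by (auto simp: H_def intro: add_increasing add_increasing2)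

definition Sig where "Sig z = r z *\<^sub>R tensor (u z) (u z) + p (r z) *\<^sub>R mat 1 - stress \<nu>1 \<nu>2 (G z)"

lemma Sig_borel [measurable]: "Sig \<in> borel_measurable borel"
  unfolding Sig_def[abs_def] by measurable

definition kap where "kap = 2 * \<bar>\<nu>1\<bar> + 4 * \<bar>\<nu>2\<bar>"

lemma norm_Sig: "norm (Sig z) \<le> r z * (norm (u z))\<^sup>2 + 2 * p (r z) + kap * norm (G z)"
proof -
  have "norm (Sig z) \<le> norm (r z *\<^sub>R tensor (u z) (u z)) + norm (p (r z) *\<^sub>R (mat 1 :: real ^ 3 ^ 3)) + norm (stress \<nu>1 \<nu>2 (G z))"
    unfolding Sig_def by (intro order_trans[OF norm_triangle_ineq4] add_mono norm_triangle_ineq) auto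
  also have "norm (r z *\<^sub>R tensor (u z) (u z)) = r z * (norm (u z))\<^sup>2"
  proof -
    have "tensor (u z) (u z) \<bullet> tensor (u z) (u z) = (u z \<bullet> u z) * (u z \<bullet> u z)"
      by (simp add: inner_vec_def tensor_def sum_product mult_ac)
    then have "norm (tensor (u z) (u z)) = (norm (u z))\<^sup>2"
      by (simp add: norm_eq_sqrt_inner real_sqrt_mult)
    then show ?thesis using r_nonneg[of z] by simp
  qed
  also have "norm (p (r z) *\<^sub>R (mat 1 :: real ^ 3 ^ 3)) \<le> 2 * p (r z)"
    using norm_mat_1_le p_nonneg[OF r_nonneg[of z]] mult_left_mono[OF norm_mat_1_le, of "p (r z)"] by simp
  also have "norm (stress \<nu>1 \<nu>2 (G z)) \<le> kap * norm (G z)" unfolding kap_def by (rule norm_stress_le)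
  finally show ?thesis by simp
qed

lemma kap_nonneg: "kap \<ge> 0" by (simp add: kap_def)

lemma Sig_le_H: "norm (Sig z) \<le> (3 + kap) * H z"
proof -
  have "norm (Sig z) \<le> H z + 2 * H z + kap * H z"
    using norm_Sig[of z] ru_le_H[of z] kap_nonneg by (meson add_mono mult_left_mono order_trans zero_le_numeral)
  then show ?thesis by (simp add: algebra_simps)
qed

end

section \<open>The tested equations and the doubled identity\<close>

lemma matrix_vector_axis_nth: "(A *v axis j 1) $ i = A $ i $ j" for A :: "real ^ 3 ^ 3"
  by (simp add: matrix_vector_mult_def axis_def if_distrib cong: if_cong)

lemma abs_mult_le: "\<bar>x\<bar> \<le> a \<Longrightarrow> \<bar>y\<bar> \<le> b \<Longrightarrow> \<bar>x * y\<bar> \<le> a * b" for x y a b :: real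
  unfolding abs_mult by (intro mult_mono) (auto intro: order_trans[OF abs_ge_zero])

text \<open>The cut-off \<zeta> has time derivative \<open>dt\<close> and spatial gradient
  \<open>g\<close>; \<open>X\<close> ties the two times together; \<open>k\<close> is the test field
  with Jacobian \<open>J\<close>, controlled on differences of points of the domain. The constant
  \<open>B\<close> may depend on all regularisations: it ensures integrability and leaves no trace
  in the resulting identity.\<close>

locale doubling = energy_flow +
  fixes \<zeta> dt :: "R3 \<times> real \<Rightarrow> real" and g :: "R3 \<times> real \<Rightarrow> R3" and X X' :: "real \<Rightarrow> real"
    and k :: "R3 \<Rightarrow> R3" and J :: "R3 \<Rightarrow> real ^ 3 ^ 3" and B :: real and C :: "(R3 \<times> real) set"
  assumes C: "compact C" "C \<subseteq> cylinder \<Omega> T" and zeta_off: "z \<notin> C \<Longrightarrow> \<zeta> z = 0"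
    and zeta_nonneg: "0 \<le> \<zeta> z" and B_ge: "1 \<le> B" and zeta_le: "\<zeta> z \<le> 1" and dt_le: "\<bar>dt z\<bar> \<le> B" and g_le: "norm (g z) \<le> B"
    and X_nonneg: "0 \<le> X \<tau>" and X_le: "X \<tau> \<le> B" and X'_le: "\<bar>X' \<tau>\<bar> \<le> B"
    and X_even: "X (- \<tau>) = X \<tau>"
    and zeta_deriv: "(\<zeta> has_derivative (\<lambda>v. fst v \<bullet> g z + snd v * dt z)) (at z)"
    and X_deriv: "(X has_real_derivative X' \<tau>) (at \<tau>)"
    and k_deriv: "x \<in> \<Omega> \<Longrightarrow> y \<in> \<Omega> \<Longrightarrow> (k has_derivative (\<lambda>v. J (x - y) *v v)) (at (x - y))"
    and J_even: "J (- x) = J x" and J_sym: "J x $ i $ j = J x $ j $ i"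
    and k_le: "x \<in> \<Omega> \<Longrightarrow> y \<in> \<Omega> \<Longrightarrow> norm (k (x - y)) \<le> B"
    and J_le: "x \<in> \<Omega> \<Longrightarrow> y \<in> \<Omega> \<Longrightarrow> norm (J (x - y)) \<le> B"
    and meas [measurable]: "\<zeta> \<in> borel_measurable borel" "dt \<in> borel_measurable borel" "g \<in> borel_measurable borel"
      "X \<in> borel_measurable borel" "X' \<in> borel_measurable borel" "k \<in> borel_measurable borel" "J \<in> borel_measurable borel"
    and smooth1: "w \<in> cylinder \<Omega> T \<Longrightarrow> \<exists>U. open U \<and> closure (cylinder \<Omega> T) \<subseteq> U \<and>
      smooth_on U (\<lambda>z. (\<zeta> z * X (snd z - snd w)) *\<^sub>R k (fst z - fst w))"
    and smooth2: "z \<in> cylinder \<Omega> T \<Longrightarrow> \<exists>U. open U \<and> closure (cylinder \<Omega> T) \<subseteq> U \<and>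
      smooth_on U (\<lambda>w. \<zeta> w * X (snd z - snd w) * (v \<bullet> k (fst z - fst w)))"
begin

abbreviation kk where "kk z w \<equiv> k (fst z - fst w)"
abbreviation JJ where "JJ z w \<equiv> J (fst z - fst w)"
abbreviation XX where "XX z w \<equiv> X (snd z - snd w)"
abbreviation XX' where "XX' z w \<equiv> X' (snd z - snd w)"

text \<open>\<open>m1\<close>, \<open>m2\<close>, \<open>m3\<close> are the three integrands of the
  momentum equation in z when the test field is \<zeta>(z) X(t - t') k(x - y) with w = (y, t')
  fixed. \<open>c1\<close> is the integrand of the continuity equation in w for the test function
  \<zeta>(w) X(t - t') u(z) \<bullet> k(x - y) with z fixed.\<close>

definition m1 where "m1 z w = r z * (u z \<bullet> ((dt z * XX z w + \<zeta> z * XX' z w) *\<^sub>R kk z w))"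
definition m2 where "m2 z w = Sig z \<bullet> (XX z w *\<^sub>R (tensor (kk z w) (g z) + \<zeta> z *\<^sub>R JJ z w))"
definition m3 where "m3 z w = r z * (f z \<bullet> ((\<zeta> z * XX z w) *\<^sub>R kk z w))"
definition c1 where "c1 z w = r w * ((dt w * XX z w - \<zeta> w * XX' z w) * (u z \<bullet> kk z w)) +
  r w * (XX z w * ((u w \<bullet> g w) * (u z \<bullet> kk z w) - \<zeta> w * (u z \<bullet> (JJ z w *v u w))))"

lemma product_measurable [measurable]:
  "(\<lambda>q. m1 (fst q) (snd q)) \<in> borel_measurable (borel \<Otimes>\<^sub>M borel)"
  "(\<lambda>q. m2 (fst q) (snd q)) \<in> borel_measurable (borel \<Otimes>\<^sub>M borel)"
  "(\<lambda>q. m3 (fst q) (snd q)) \<in> borel_measurable (borel \<Otimes>\<^sub>M borel)"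
  "(\<lambda>q. c1 (fst q) (snd q)) \<in> borel_measurable (borel \<Otimes>\<^sub>M borel)"
  unfolding m1_def m2_def m3_def c1_def by measurable

lemma off_Q: "z \<notin> Q \<Longrightarrow> m1 z w = 0" "z \<notin> Q \<Longrightarrow> m2 z w = 0" "z \<notin> Q \<Longrightarrow> m3 z w = 0" "w \<notin> Q \<Longrightarrow> c1 z w = 0"
  by (simp_all add: m1_def m2_def m3_def c1_def Sig_def off p_zero)

lemma fst_Q: "z \<in> Q \<Longrightarrow> fst z \<in> \<Omega>"
  by (auto simp: cylinder_def)

text \<open>Crude bounds in the constant \<open>B\<close>, serving integrability.\<close>

lemma m_bounds:
  assumes w: "w \<in> Q"
  shows "\<bar>m1 z w\<bar> \<le> 2 * B ^ 3 * H z" "\<bar>m2 z w\<bar> \<le> 2 * B ^ 3 * (3 + kap) * H z" "\<bar>m3 z w\<bar> \<le> c * B ^ 3 * H z"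
proof -
  have B0: "B \<ge> 0" "0 \<le> B ^ 3" using B_ge by auto
  note nn = B0 H_nonneg[of z] kap_nonneg c_nonneg r_nonneg[of z]
  have kB: "norm (kk z w) \<le> B" and JB: "norm (JJ z w) \<le> B" if "z \<in> Q"
    using k_le J_le fst_Q w that by auto
  have XB: "\<bar>XX z w\<bar> \<le> B" using X_le X_nonneg by (simp add: abs_le_iff order_trans[of _ 0])
  have zB: "\<bar>\<zeta> z\<bar> \<le> 1" using zeta_le zeta_nonneg by (simp add: abs_le_iff order_trans[of _ 0])
  show "\<bar>m1 z w\<bar> \<le> 2 * B ^ 3 * H z"
  proof (cases "z \<in> Q")
    case True
    have e: "\<bar>dt z * XX z w + \<zeta> z * XX' z w\<bar> \<le> B * B + 1 * B"
      by (intro order_trans[OF abs_triangle_ineq] add_mono abs_mult_le dt_le XB zB X'_le)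
    have "B * B + 1 * B \<le> 2 * (B * B)" using B_ge mult_left_mono[OF B_ge, of B] by simp
    with e have e': "\<bar>dt z * XX z w + \<zeta> z * XX' z w\<bar> \<le> 2 * (B * B)" by linarith
    have "\<bar>m1 z w\<bar> \<le> r z * (norm (u z) * (2 * (B * B) * B))"
      unfolding m1_def abs_mult abs_of_nonneg[OF r_nonneg]
      using kB[OF True] e' B0
      by (intro mult_left_mono r_nonneg order_trans[OF Cauchy_Schwarz_ineq2]) (auto intro!: mult_mono)
    also have "\<dots> = (r z * norm (u z)) * (2 * B ^ 3)" by (simp add: power3_eq_cube)
    also have "\<dots> \<le> H z * (2 * B ^ 3)" using B0 by (intro mult_right_mono ru_le_H) auto
    finally show ?thesis by (simp add: mult_ac)
  qed (use nn in \<open>simp add: off_Q\<close>)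
  show "\<bar>m2 z w\<bar> \<le> 2 * B ^ 3 * (3 + kap) * H z"
  proof (cases "z \<in> Q")
    case True
    have "norm (tensor (kk z w) (g z)) \<le> B * B" "norm (\<zeta> z *\<^sub>R JJ z w) \<le> 1 * B"
      unfolding norm_tensor norm_scaleR real_norm_def using B0
      by (intro mult_mono kB[OF True] JB[OF True] g_le zB norm_ge_zero; simp)+
    then have "norm (tensor (kk z w) (g z) + \<zeta> z *\<^sub>R JJ z w) \<le> B * B + 1 * B"
      by (intro order_trans[OF norm_triangle_ineq] add_mono)
    also have "\<dots> \<le> 2 * (B * B)" using B_ge mult_left_mono[OF B_ge, of B] by simp
    finally have e: "norm (tensor (kk z w) (g z) + \<zeta> z *\<^sub>R JJ z w) \<le> 2 * (B * B)" .
    have "\<bar>m2 z w\<bar> \<le> ((3 + kap) * H z) * (B * (2 * (B * B)))"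
      unfolding m2_def using Sig_le_H[of z] e XB B0 nn
      by (intro order_trans[OF Cauchy_Schwarz_ineq2]) (auto intro!: mult_mono)
    then show ?thesis by (simp add: power3_eq_cube mult_ac)
  qed (use nn in \<open>simp add: off_Q\<close>)
  show "\<bar>m3 z w\<bar> \<le> c * B ^ 3 * H z"
  proof (cases "z \<in> Q")
    case True
    have "norm ((\<zeta> z * XX z w) *\<^sub>R kk z w) \<le> (1 * B) * B"
      unfolding norm_scaleR real_norm_def
      by (intro mult_mono abs_mult_le zB XB kB[OF True]) (use B0 in auto)
    then have "\<bar>m3 z w\<bar> \<le> r z * (c * (1 * B * B))"
      unfolding m3_def abs_mult abs_of_nonneg[OF r_nonneg]
      by (intro mult_left_mono r_nonneg order_trans[OF Cauchy_Schwarz_ineq2] mult_mono f_bound)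
        (use c_nonneg in auto)
    also have "\<dots> \<le> r z * (c * B ^ 3)"
      using B_ge mult_left_mono[OF B_ge, of "B * B"] c_nonneg r_nonneg[of z]
      by (intro mult_left_mono) (auto simp: power3_eq_cube)
    also have "\<dots> \<le> H z * (c * B ^ 3)" using B0 c_nonneg by (intro mult_right_mono ru_le_H) auto
    finally show ?thesis by (simp add: mult_ac)
  qed (use nn in \<open>simp add: off_Q\<close>)
qed

lemma c_bound: "\<bar>\<zeta> z * r z * c1 z w\<bar> \<le> 4 * B ^ 3 * H z * H w"
proof (cases "z \<in> Q \<and> w \<in> Q")
  case True
  have B0: "B \<ge> 0" "0 \<le> B ^ 3" using B_ge by auto
  have kB: "norm (kk z w) \<le> B" and JB: "norm (JJ z w) \<le> B"
    using k_le J_le fst_Q True by auto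
  have XB: "\<bar>XX z w\<bar> \<le> B" using X_le X_nonneg by (simp add: abs_le_iff order_trans[of _ 0])
  have zB: "\<bar>\<zeta> z\<bar> \<le> 1" "\<bar>\<zeta> w\<bar> \<le> 1" using zeta_le zeta_nonneg by (simp_all add: abs_le_iff order_trans[of _ 0])
  have uk: "\<bar>u z \<bullet> kk z w\<bar> \<le> norm (u z) * B"
    using kB by (intro order_trans[OF Cauchy_Schwarz_ineq2] mult_left_mono) auto
  have uJ: "\<bar>u z \<bullet> (JJ z w *v u w)\<bar> \<le> norm (u z) * (B * norm (u w))"
    using JB by (intro order_trans[OF Cauchy_Schwarz_ineq2] mult_left_mono order_trans[OF norm_matrix_vector_le] mult_right_mono) auto
  have ug: "\<bar>u w \<bullet> g w\<bar> \<le> norm (u w) * B"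
    using g_le by (intro order_trans[OF Cauchy_Schwarz_ineq2] mult_left_mono) auto
  have BB: "B \<le> B * B" "B * B \<le> B ^ 3"
    using mult_left_mono[OF B_ge, of B] mult_left_mono[OF B_ge, of "B * B"] B0 by (auto simp: power3_eq_cube)
  have "\<bar>(dt w * XX z w - \<zeta> w * XX' z w) * (u z \<bullet> kk z w)\<bar> \<le> (B * B + 1 * B) * (norm (u z) * B)"
    by (intro abs_mult_le order_trans[OF abs_triangle_ineq4] add_mono dt_le XB zB X'_le uk)
  also have "\<dots> \<le> (2 * (B * B)) * (norm (u z) * B)" using BB B0 by (intro mult_right_mono) auto
  finally have t1: "\<bar>(dt w * XX z w - \<zeta> w * XX' z w) * (u z \<bullet> kk z w)\<bar> \<le> 2 * B ^ 3 * norm (u z)"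
    by (simp add: power3_eq_cube mult_ac)
  have "\<bar>XX z w * ((u w \<bullet> g w) * (u z \<bullet> kk z w) - \<zeta> w * (u z \<bullet> (JJ z w *v u w)))\<bar> \<le>
      B * ((norm (u w) * B) * (norm (u z) * B) + 1 * (norm (u z) * (B * norm (u w))))"
    by (intro abs_mult_le order_trans[OF abs_triangle_ineq4] add_mono XB ug uk uJ zB)
  also have "\<dots> = (B * B * B + B * B) * (norm (u z) * norm (u w))" by (simp add: algebra_simps)
  also have "\<dots> \<le> (2 * B ^ 3) * (norm (u z) * norm (u w))"
    using BB by (intro mult_right_mono) (auto simp: power3_eq_cube)
  finally have t2: "\<bar>XX z w * ((u w \<bullet> g w) * (u z \<bullet> kk z w) - \<zeta> w * (u z \<bullet> (JJ z w *v u w)))\<bar> \<le>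
      2 * B ^ 3 * norm (u z) * norm (u w)" by (simp add: mult_ac)
  have "\<bar>c1 z w\<bar> \<le> r w * (2 * B ^ 3 * norm (u z)) + r w * (2 * B ^ 3 * norm (u z) * norm (u w))"
    unfolding c1_def using t1 t2 r_nonneg[of w]
    by (intro order_trans[OF abs_triangle_ineq] add_mono) (simp_all only: abs_mult[of "r w"] abs_of_nonneg[OF r_nonneg] mult_left_mono)
  also have "\<dots> = 2 * B ^ 3 * norm (u z) * (r w + r w * norm (u w))" by (simp add: algebra_simps)
  also have "\<dots> \<le> 2 * B ^ 3 * norm (u z) * (H w + H w)"
    using B0 by (intro mult_left_mono add_mono ru_le_H) auto
  finally have "\<bar>c1 z w\<bar> \<le> 4 * B ^ 3 * norm (u z) * H w" by simp
  then have "\<bar>\<zeta> z * r z\<bar> * \<bar>c1 z w\<bar> \<le> (1 * r z) * (4 * B ^ 3 * norm (u z) * H w)"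
    using zB r_nonneg[of z] H_nonneg B0 by (intro mult_mono) (auto simp: abs_mult intro!: mult_right_mono mult_nonneg_nonneg mult_left_le_one_le)
  also have "\<dots> = (r z * norm (u z)) * (4 * B ^ 3 * H w)" by simp
  also have "\<dots> \<le> H z * (4 * B ^ 3 * H w)"
    using B0 H_nonneg by (intro mult_right_mono ru_le_H) auto
  finally show ?thesis by (simp add: abs_mult mult_ac)
next
  case False
  have "0 \<le> 4 * B ^ 3 * H z * H w" using B_ge H_nonneg by simp
  then show ?thesis using False off(1)[of z] off_Q(4)[of w z] by auto
qed

lemma momentum_tested:
  assumes w: "w \<in> Q"
  shows "integrable lborel (\<lambda>z. m1 z w + m2 z w + m3 z w)" "(\<integral>z. m1 z w + m2 z w + m3 z w) = 0"
proof -
  have i1: "integrable lborel (\<lambda>z. m1 z w)"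
  proof (rule Bochner_Integration.integrable_bound[of lborel "\<lambda>z. 2 * B ^ 3 * H z"])
    show "AE z in lborel. norm (m1 z w) \<le> norm (2 * B ^ 3 * H z)"
      using m_bounds(1)[OF w] by (intro AE_I2) (auto intro: order_trans[OF _ abs_ge_self])
    show "(\<lambda>z. m1 z w) \<in> borel_measurable lborel" unfolding m1_def by measurable
  qed (use H_integrable in simp)
  have i2: "integrable lborel (\<lambda>z. m2 z w)"
  proof (rule Bochner_Integration.integrable_bound[of lborel "\<lambda>z. 2 * B ^ 3 * (3 + kap) * H z"])
    show "AE z in lborel. norm (m2 z w) \<le> norm (2 * B ^ 3 * (3 + kap) * H z)"
      using m_bounds(2)[OF w] by (intro AE_I2) (auto intro: order_trans[OF _ abs_ge_self])
    show "(\<lambda>z. m2 z w) \<in> borel_measurable lborel" unfolding m2_def by measurable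
  qed (use H_integrable in simp)
  have i3: "integrable lborel (\<lambda>z. m3 z w)"
  proof (rule Bochner_Integration.integrable_bound[of lborel "\<lambda>z. c * B ^ 3 * H z"])
    show "AE z in lborel. norm (m3 z w) \<le> norm (c * B ^ 3 * H z)"
      using m_bounds(3)[OF w] by (intro AE_I2) (auto intro: order_trans[OF _ abs_ge_self])
    show "(\<lambda>z. m3 z w) \<in> borel_measurable lborel" unfolding m3_def by measurable
  qed (use H_integrable in simp)
  show "integrable lborel (\<lambda>z. m1 z w + m2 z w + m3 z w)" using i1 i2 i3 by simp
  define \<xi> where "\<xi> z = (\<zeta> z * XX z w) *\<^sub>R kk z w" for z
  obtain U where U: "open U" "closure Q \<subseteq> U" "smooth_on U \<xi>"
    using smooth1[OF w] unfolding \<xi>_def by blast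
  have D: "(\<xi> has_derivative (\<lambda>v. (\<zeta> z * XX z w) *\<^sub>R (JJ z w *v fst v) +
      ((fst v \<bullet> g z + snd v * dt z) * XX z w + \<zeta> z * (XX' z w * snd v)) *\<^sub>R kk z w)) (at z)" if z: "z \<in> Q" for z
  proof -
    have d1: "((\<lambda>z. snd z - snd w) has_derivative (\<lambda>v. snd v)) (at z)" "((\<lambda>z. fst z - fst w) has_derivative (\<lambda>v. fst v)) (at z)"
      by (auto intro!: derivative_eq_intros)
    have dX: "((\<lambda>z. XX z w) has_derivative (\<lambda>v. XX' z w * snd v)) (at z)"
      by (rule has_derivative_compose[OF d1(1) X_deriv[unfolded has_field_derivative_def]])
    have dk: "((\<lambda>z. kk z w) has_derivative (\<lambda>v. JJ z w *v fst v)) (at z)"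
      by (rule has_derivative_compose[OF d1(2) k_deriv[OF fst_Q[OF z] fst_Q[OF w]]])
    show ?thesis unfolding \<xi>_def
      using has_derivative_scaleR[OF has_derivative_mult[OF zeta_deriv dX] dk] by (simp add: add.commute)
  qed
  have td: "time_deriv \<xi> z = (dt z * XX z w + \<zeta> z * XX' z w) *\<^sub>R kk z w" if "z \<in> Q" for z
    unfolding time_deriv_def frechet_derivative_at[OF D[OF that], symmetric] by simp
  have gv: "grad_vec \<xi> z = XX z w *\<^sub>R (tensor (kk z w) (g z) + \<zeta> z *\<^sub>R JJ z w)" if "z \<in> Q" for z
    unfolding grad_vec_def space_deriv_def frechet_derivative_at[OF D[OF that], symmetric]
    by (simp add: vec_eq_iff matrix_vector_axis_nth tensor_def algebra_simps inner_commute)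
  have "(\<integral>z. m1 z w) + (\<integral>z. m2 z w) + (\<integral>z. m3 z w) = 0"
  proof (rule momentum[OF U C])
    show "\<xi> z = 0" if "z \<notin> C" for z using that by (simp add: \<xi>_def zeta_off)
    show "(\<lambda>z. m1 z w) \<in> borel_measurable borel" "(\<lambda>z. m2 z w) \<in> borel_measurable borel" "(\<lambda>z. m3 z w) \<in> borel_measurable borel"
      using i1 i2 i3 by (auto dest: borel_measurable_integrable)
  qed (simp_all add: off_Q, simp add: m1_def m2_def m3_def Sig_def td gv \<xi>_def)
  then show "(\<integral>z. m1 z w + m2 z w + m3 z w) = 0"
    using i1 i2 i3 by simp
qed

text \<open>For fixed z the velocity u(z) is a constant vector, so the test function is smooth in w
  although the velocity field is not. Both the time and the space derivative of the difference
  change sign.\<close>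

lemma continuity_tested:
  assumes z: "z \<in> Q"
  shows "(\<integral>w. c1 z w) = 0"
proof -
  define \<psi> where "\<psi> w = \<zeta> w * XX z w * (u z \<bullet> kk z w)" for w
  obtain U where U: "open U" "closure Q \<subseteq> U" "smooth_on U \<psi>"
    using smooth2[OF z, of "u z"] unfolding \<psi>_def by blast
  have D: "(\<psi> has_derivative (\<lambda>v. \<zeta> w * XX z w * (u z \<bullet> (- (JJ z w *v fst v))) +
      ((fst v \<bullet> g w + snd v * dt w) * XX z w + \<zeta> w * (XX' z w * (- snd v))) * (u z \<bullet> kk z w))) (at w)" if w: "w \<in> Q" for w
  proof -
    have d1: "((\<lambda>w. snd z - snd w) has_derivative (\<lambda>v. - snd v)) (at w)" "((\<lambda>w. fst z - fst w) has_derivative (\<lambda>v. - fst v)) (at w)"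
      by (auto intro!: derivative_eq_intros)
    have dX: "((\<lambda>w. XX z w) has_derivative (\<lambda>v. XX' z w * (- snd v))) (at w)"
      by (rule has_derivative_compose[OF d1(1) X_deriv[unfolded has_field_derivative_def]])
    have "((\<lambda>w. kk z w) has_derivative (\<lambda>v. JJ z w *v (- fst v))) (at w)"
      by (rule has_derivative_compose[OF d1(2) k_deriv[OF fst_Q[OF z] fst_Q[OF w]]])
    then have "((\<lambda>w. u z \<bullet> kk z w) has_derivative (\<lambda>v. u z \<bullet> (JJ z w *v (- fst v)))) (at w)"
      by (rule bounded_linear.has_derivative[OF bounded_linear_inner_right])
    then have dk: "((\<lambda>w. u z \<bullet> kk z w) has_derivative (\<lambda>v. u z \<bullet> (- (JJ z w *v fst v)))) (at w)"
      by (simp add: vec.neg)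
    show ?thesis unfolding \<psi>_def
      using has_derivative_mult[OF has_derivative_mult[OF zeta_deriv dX] dk] by (simp add: add.commute)
  qed
  have td: "time_deriv \<psi> w = (dt w * XX z w - \<zeta> w * XX' z w) * (u z \<bullet> kk z w)" if "w \<in> Q" for w
    unfolding time_deriv_def frechet_derivative_at[OF D[OF that], symmetric] by simp
  have gr: "u w \<bullet> grad \<psi> w = XX z w * ((u w \<bullet> g w) * (u z \<bullet> kk z w) - \<zeta> w * (u z \<bullet> (JJ z w *v u w)))" if "w \<in> Q" for w
    unfolding inner_grad_eq[OF D[OF that]] by (simp add: algebra_simps)
  show ?thesis
  proof (rule continuity[OF U C])
    show "\<psi> w = 0" if "w \<notin> C" for w using that by (simp add: \<psi>_def zeta_off)
    show "(\<lambda>w. c1 z w) \<in> borel_measurable borel" unfolding c1_def by measurable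
  qed (simp_all add: off_Q, simp add: c1_def td gr)
qed

text \<open>The momentum integrand is weighted with \<zeta>(w) r(w) and the continuity integrand
  with \<zeta>(z) r(z). With these weights the two terms containing \<open>X'\<close> are
  opposite.\<close>

definition F where "F z w = \<zeta> w * r w * (m1 z w + m2 z w + m3 z w) + \<zeta> z * r z * c1 z w"

lemma F_borel [measurable]: "(\<lambda>q. F (fst q) (snd q)) \<in> borel_measurable (borel \<Otimes>\<^sub>M borel)"
  unfolding F_def by measurable

text \<open>Each of the two parts is integrated first in its own variable, where the corresponding
  equation makes it vanish.\<close>

theorem doubling_identity:
  "integrable (lborel \<Otimes>\<^sub>M lborel) (\<lambda>q. F (fst q) (snd q))" "(\<integral>q. F (fst q) (snd q) \<partial>(lborel \<Otimes>\<^sub>M lborel)) = 0"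
proof -
  have B0: "B \<ge> 0" "0 \<le> B ^ 3" using B_ge by auto
  have HH: "integrable (lborel \<Otimes>\<^sub>M lborel) (\<lambda>q. H (fst q) * H (snd q))"
    by (rule integrable_pair_mult[OF H_integrable H_integrable])
  define K where "K = 2 * B ^ 3 + 2 * B ^ 3 * (3 + kap) + c * B ^ 3"
  have K0: "K \<ge> 0" unfolding K_def using B0 kap_nonneg c_nonneg by (intro add_nonneg_nonneg mult_nonneg_nonneg) auto
  have Mb: "\<bar>\<zeta> w * r w * (m1 z w + m2 z w + m3 z w)\<bar> \<le> K * (H z * H w)" for z w
  proof (cases "w \<in> Q")
    case True
    have "\<bar>m1 z w + m2 z w + m3 z w\<bar> \<le> K * H z"
      using m_bounds[OF True, of z] unfolding K_def by (simp add: algebra_simps abs_le_iff)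
    moreover have "\<bar>\<zeta> w * r w\<bar> \<le> 1 * H w"
      using zeta_nonneg[of w] zeta_le[of w] r_nonneg[of w] ru_le_H(2)[of w] by (intro abs_mult_le) auto
    ultimately have "\<bar>\<zeta> w * r w\<bar> * \<bar>m1 z w + m2 z w + m3 z w\<bar> \<le> (1 * H w) * (K * H z)"
      using H_nonneg by (intro mult_mono) auto
    then show ?thesis by (simp add: abs_mult mult_ac)
  next
    case False
    then show ?thesis using K0 H_nonneg by (simp add: off)
  qed
  have iM: "integrable (lborel \<Otimes>\<^sub>M lborel) (\<lambda>q. \<zeta> (snd q) * r (snd q) * (m1 (fst q) (snd q) + m2 (fst q) (snd q) + m3 (fst q) (snd q)))"
  proof (rule Bochner_Integration.integrable_bound)
    show "integrable (lborel \<Otimes>\<^sub>M lborel) (\<lambda>q. K * (H (fst q) * H (snd q)))" using HH by simp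
    show "AE q in lborel \<Otimes>\<^sub>M lborel. norm (\<zeta> (snd q) * r (snd q) * (m1 (fst q) (snd q) + m2 (fst q) (snd q) + m3 (fst q) (snd q))) \<le> norm (K * (H (fst q) * H (snd q)))"
      using Mb by (intro AE_I2) (auto intro: order_trans[OF _ abs_ge_self])
  qed measurable
  have iC: "integrable (lborel \<Otimes>\<^sub>M lborel) (\<lambda>q. \<zeta> (fst q) * r (fst q) * c1 (fst q) (snd q))"
  proof (rule Bochner_Integration.integrable_bound)
    show "integrable (lborel \<Otimes>\<^sub>M lborel) (\<lambda>q. 4 * B ^ 3 * (H (fst q) * H (snd q)))" using HH by simp
    show "AE q in lborel \<Otimes>\<^sub>M lborel. norm (\<zeta> (fst q) * r (fst q) * c1 (fst q) (snd q)) \<le> norm (4 * B ^ 3 * (H (fst q) * H (snd q)))"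
      using c_bound by (intro AE_I2) (auto intro: order_trans[OF _ abs_ge_self] simp: mult.assoc)
  qed measurable
  show "integrable (lborel \<Otimes>\<^sub>M lborel) (\<lambda>q. F (fst q) (snd q))"
    unfolding F_def using iM iC by simp
  have "(\<integral>q. \<zeta> (snd q) * r (snd q) * (m1 (fst q) (snd q) + m2 (fst q) (snd q) + m3 (fst q) (snd q)) \<partial>(lborel \<Otimes>\<^sub>M lborel)) =
      (\<integral>w. (\<integral>z. \<zeta> w * r w * (m1 z w + m2 z w + m3 z w)))"
    using lborel_pair.integral_snd[of "\<lambda>z w. \<zeta> w * r w * (m1 z w + m2 z w + m3 z w)"] iM by (simp add: case_prod_unfold)
  also have "\<dots> = (\<integral>w. 0 \<partial>(lborel :: (R3 \<times> real) measure))"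
  proof (rule Bochner_Integration.integral_cong[OF refl])
    fix w
    show "(\<integral>z. \<zeta> w * r w * (m1 z w + m2 z w + m3 z w)) = 0"
      using momentum_tested(2)[of w] by (cases "w \<in> Q") (simp_all add: off)
  qed
  finally have zM: "(\<integral>q. \<zeta> (snd q) * r (snd q) * (m1 (fst q) (snd q) + m2 (fst q) (snd q) + m3 (fst q) (snd q)) \<partial>(lborel \<Otimes>\<^sub>M lborel)) = 0"
    by simp
  have "(\<integral>q. \<zeta> (fst q) * r (fst q) * c1 (fst q) (snd q) \<partial>(lborel \<Otimes>\<^sub>M lborel)) =
      (\<integral>z. (\<integral>w. \<zeta> z * r z * c1 z w))"
    using lborel_pair.integral_fst'[OF iC] by simp
  also have "\<dots> = (\<integral>z. 0 \<partial>(lborel :: (R3 \<times> real) measure))"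
  proof (rule Bochner_Integration.integral_cong[OF refl])
    fix z
    show "(\<integral>w. \<zeta> z * r z * c1 z w) = 0"
      using continuity_tested[of z] by (cases "z \<in> Q") (simp_all add: off)
  qed
  finally have zC: "(\<integral>q. \<zeta> (fst q) * r (fst q) * c1 (fst q) (snd q) \<partial>(lborel \<Otimes>\<^sub>M lborel)) = 0" by simp
  show "(\<integral>q. F (fst q) (snd q) \<partial>(lborel \<Otimes>\<^sub>M lborel)) = 0"
    unfolding F_def using iM iC zM zC by simp
qed

end

section \<open>Young's inequalities and control of the kinetic energy by Sobolev norms\<close>

lemma inner_tensor: "tensor v v' \<bullet> A = v \<bullet> (A *v v')" for A :: "real ^ 3 ^ 3"
  by (simp add: inner_vec_def tensor_def matrix_vector_mult_def sum_distrib_left mult_ac)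

lemma symmetric_matrix_inner:
  fixes A :: "real ^ 3 ^ 3"
  assumes "\<And>i j. A $ i $ j = A $ j $ i"
  shows "v \<bullet> (A *v w) = w \<bullet> (A *v v)"
proof -
  have "v \<bullet> (A *v w) = (\<Sum>i\<in>UNIV. \<Sum>j\<in>UNIV. v $ i * (A $ i $ j * w $ j))"
    by (simp add: inner_vec_def matrix_vector_mult_def sum_distrib_left)
  also have "\<dots> = (\<Sum>j\<in>UNIV. \<Sum>i\<in>UNIV. v $ i * (A $ i $ j * w $ j))" by (rule sum.swap)
  also have "\<dots> = (\<Sum>j\<in>UNIV. \<Sum>i\<in>UNIV. w $ j * (A $ j $ i * v $ i))"
    using assms by (simp add: mult_ac)
  also have "\<dots> = w \<bullet> (A *v v)"
    by (simp add: inner_vec_def matrix_vector_mult_def sum_distrib_left)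
  finally show ?thesis .
qed

text \<open>The exponents are those of Young's inequality with weights \<open>2/5\<close> and \<open>3/5\<close>; it is stated for
  arbitrary \<open>a > 0\<close> because \<open>a\<close> will be a Sobolev norm at a fixed time.\<close>

lemma kinetic_energy_Young:
  fixes \<rho> v L a :: real
  assumes "\<rho> \<ge> 0" "v \<ge> 0" "L > 0" "a > 0"
  shows "6 * (\<rho> * v\<^sup>2 / L) \<le> 1 / 2 * \<rho> powr (3 / 2) + 36 * (L powr (- 5 / 3) * (a * (\<rho> * v\<^sup>2) + v ^ 6 / a\<^sup>2))"
proof -
  define P where "P = \<rho> powr (3 / 2)"
  define W where "W = \<rho> * v\<^sup>2 / L"
  define l where "l = L powr (- 5 / 3)"
  define Y where "Y = a * (\<rho> * v\<^sup>2) + v ^ 6 / a\<^sup>2"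
  have nn: "P \<ge> 0" "W \<ge> 0" "l > 0" "Y \<ge> 0" using assms by (auto simp: P_def W_def l_def Y_def)
  have P2: "P\<^sup>2 = \<rho> ^ 3"
  proof (cases "\<rho> = 0")
    case False
    then have "\<rho> > 0" using assms by simp
    then show ?thesis by (simp add: P_def powr_power powr_numeral)
  qed (simp add: P_def)
  have l3: "l ^ 3 = 1 / L ^ 5"
    using assms powr_minus_divide[of L 5] by (simp add: l_def powr_power)
  \<comment> \<open>Since x^2 y \<le> (x + y)^3, the combination \<open>Y\<close> controls a product
    in which the parameter \<open>a\<close> has cancelled.\<close>
  have Y3: "\<rho>\<^sup>2 * v ^ 10 \<le> Y ^ 3"
  proof -
    define x y where "x = a * (\<rho> * v\<^sup>2)" and "y = v ^ 6 / a\<^sup>2"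
    have xy: "x \<ge> 0" "y \<ge> 0" using assms by (auto simp: x_def y_def)
    have "\<rho>\<^sup>2 * v ^ 10 = x\<^sup>2 * y" using assms by (simp add: x_def y_def power2_eq_square eval_nat_numeral)
    also have "\<dots> \<le> (x + y)\<^sup>2 * (x + y)" using xy by (intro mult_mono power_mono) auto
    finally show ?thesis by (simp add: Y_def x_def y_def power2_eq_square power3_eq_cube)
  qed
  have W5: "W ^ 5 \<le> P\<^sup>2 * (l * Y) ^ 3"
  proof -
    have "W ^ 5 = P\<^sup>2 * l ^ 3 * (\<rho>\<^sup>2 * v ^ 10)"
      unfolding P2 l3 W_def by (simp add: power_divide power_mult_distrib eval_nat_numeral)
    also have "\<dots> \<le> P\<^sup>2 * l ^ 3 * Y ^ 3" using nn by (intro mult_left_mono Y3) auto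
    finally show ?thesis by (simp add: power_mult_distrib mult_ac)
  qed
  \<comment> \<open>Either \<open>W\<close> is at most P / 12, or P < 12 W can be inserted into W^5
    \<le> P^2 (l Y)^3, and then W^3 \<le> 144 (l Y)^3 \<le> (6 l Y)^3. Multiplied by 6, the share P
    / 12 becomes exactly half of the pressure power.\<close>
  have "W \<le> P / 12 + 6 * (l * Y)"
  proof (cases "W \<le> P / 12")
    case True
    then show ?thesis using nn by (intro add_increasing2) auto
  next
    case False
    then have W: "W > 0" "P < 12 * W" using nn by auto
    have "P\<^sup>2 \<le> (12 * W)\<^sup>2" using W nn by (intro power_mono) auto
    then have "W ^ 5 \<le> (12 * W)\<^sup>2 * (l * Y) ^ 3"
      using W5 nn by (meson mult_right_mono order_trans zero_le_power mult_nonneg_nonneg less_imp_le)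
    also have "W ^ 5 = W\<^sup>2 * W ^ 3" by (simp flip: power_add)
    also have "(12 * W)\<^sup>2 * (l * Y) ^ 3 = W\<^sup>2 * (144 * (l * Y) ^ 3)" by (simp add: power_mult_distrib)
    finally have "W ^ 3 \<le> 144 * (l * Y) ^ 3"
      by (rule mult_left_le_imp_le) (use W in simp)
    also have "\<dots> \<le> 216 * (l * Y) ^ 3" using nn by (intro mult_right_mono) auto
    also have "\<dots> = (6 * (l * Y)) ^ 3" by (simp add: power_mult_distrib)
    finally have "W ^ 3 \<le> (6 * (l * Y)) ^ 3" .
    then have "W \<le> 6 * (l * Y)" using nn by (subst (asm) power_mono_iff) auto
    then show ?thesis using nn by simp
  qed
  then have "6 * W \<le> 1 / 2 * P + 36 * (l * Y)" by simp
  then show ?thesis by (simp add: P_def W_def l_def Y_def)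
qed

context energy_flow
begin

definition B6 where "B6 t = (\<integral>\<^sup>+x. ennreal (norm (u (x, t)) ^ 6))"
text \<open>The cube root is the squared L^6 norm of the velocity at time t, and the summand 1 keeps
  it away from zero. It is the weight for which both summands of \<open>Y\<close> have a spatial
  integral of order \<open>At t\<close>, which is integrable in time.\<close>

definition At where "At t = 1 + root 3 (enn2real (B6 t))"
definition Y where "Y z = At (snd z) * (r z * (norm (u z))\<^sup>2) + norm (u z) ^ 6 / (At (snd z))\<^sup>2"

lemma B6_borel [measurable]: "B6 \<in> borel_measurable borel"
  unfolding B6_def[abs_def] by (rule borel_measurable_nn_integral_lborel) measurable

lemma At_borel [measurable]: "At \<in> borel_measurable borel"
  unfolding At_def[abs_def] by measurable

lemma At_ge: "At t \<ge> 1"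
  by (simp add: At_def)

lemma Y_borel [measurable]: "Y \<in> borel_measurable borel"
  unfolding Y_def[abs_def] by measurable

lemma Y_nonneg: "Y z \<ge> 0"
  unfolding Y_def using At_ge[of "snd z"] r_nonneg[of z] by (intro add_nonneg_nonneg mult_nonneg_nonneg) auto

lemma Y_off: "z \<notin> Q \<Longrightarrow> Y z = 0"
  by (simp add: Y_def off)

definition IY where "IY = (E + 1) * (T + 32 * E\<^sup>2)"

lemma int_Y: "(\<integral>\<^sup>+z. ennreal (Y z)) \<le> ennreal IY"
proof -
  have "(\<integral>\<^sup>+z. ennreal (Y z)) = (\<integral>\<^sup>+t. \<integral>\<^sup>+x. ennreal (Y (x, t)))"
    by (rule nn_integral_slices) measurable
  also have "\<dots> \<le> (\<integral>\<^sup>+t. ennreal (E + 1) * (indicator {0<..<T} t + ennreal (root 3 (enn2real (B6 t)))))"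
  proof (rule nn_integral_mono_AE)
    show "AE t in lborel. (\<integral>\<^sup>+x. ennreal (Y (x, t))) \<le>
        ennreal (E + 1) * (indicator {0<..<T} t + ennreal (root 3 (enn2real (B6 t))))"
      using energy_kin Sobolev_fin
    proof eventually_elim
      case (elim t)
      show ?case
      proof (cases "t \<in> {0<..<T}")
        case True
        define A where "A = At t"
        have A: "A \<ge> 1" using At_ge by (simp add: A_def)
        define bb where "bb = enn2real (B6 t)"
        have bb: "B6 t = ennreal bb" "bb \<ge> 0" using elim(2) by (auto simp: bb_def B6_def)
        \<comment> \<open>The integral of |u|^6 is at most the cube of the weight, so dividing it by
          the square leaves at most the weight itself.\<close>
        have "bb = root 3 bb ^ 3" using bb by simp
        also have "\<dots> \<le> A ^ 3" unfolding A_def At_def bb_def[symmetric] using bb by (intro power_mono) auto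
        finally have bA: "bb / A\<^sup>2 \<le> A" using A by (simp add: divide_le_eq power2_eq_square power3_eq_cube)
        have um: "(\<lambda>x. norm (u (x, t))) \<in> borel_measurable borel" "(\<lambda>x. r (x, t)) \<in> borel_measurable borel"
          by measurable
        note [measurable] = um
        have "(\<integral>\<^sup>+x. ennreal (Y (x, t))) =
            (\<integral>\<^sup>+x. ennreal A * ennreal (r (x, t) * (norm (u (x, t)))\<^sup>2) + ennreal (1 / A\<^sup>2) * ennreal (norm (u (x, t)) ^ 6))"
          unfolding Y_def A_def[symmetric] using A r_nonneg
          by (intro nn_integral_cong) (simp add: A_def[symmetric] ennreal_mult[symmetric])
        also have "\<dots> = ennreal A * (\<integral>\<^sup>+x. ennreal (r (x, t) * (norm (u (x, t)))\<^sup>2)) +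
            ennreal (1 / A\<^sup>2) * B6 t"
          unfolding B6_def by (simp add: nn_integral_add nn_integral_cmult)
        also have "\<dots> \<le> ennreal A * ennreal E + ennreal (1 / A\<^sup>2) * ennreal bb"
          using elim(1) bb by (intro add_mono mult_left_mono) auto
        also have "\<dots> = ennreal (A * E + bb / A\<^sup>2)"
          using A bb E_pos by (simp add: ennreal_mult[symmetric] ennreal_plus[symmetric] del: ennreal_plus)
        also have "\<dots> \<le> ennreal ((E + 1) * A)" using bA by (intro ennreal_leI) (simp add: algebra_simps)
        also have "\<dots> = ennreal (E + 1) * (1 + ennreal (root 3 bb))"
          unfolding A_def At_def bb_def[symmetric] using E_pos bb by (simp add: ennreal_mult)
        finally show ?thesis using True by (simp add: bb_def)
      next
        case False
        then have "Y (x, t) = 0" for x by (intro Y_off) (simp add: mem_Q)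
        then show ?thesis by simp
      qed
    qed
  qed
  also have "\<dots> = ennreal (E + 1) * (ennreal T + (\<integral>\<^sup>+t. ennreal (root 3 (enn2real (B6 t)))))"
    using T_pos by (simp add: nn_integral_cmult nn_integral_add)
  also have "\<dots> \<le> ennreal (E + 1) * (ennreal T + ennreal (32 * E\<^sup>2))"
    using Sobolev_int unfolding B6_def by (intro mult_left_mono add_left_mono) auto
  also have "ennreal T + ennreal (32 * E\<^sup>2) = ennreal (T + 32 * E\<^sup>2)"
    using T_pos by (intro ennreal_plus[symmetric]) auto
  also have "ennreal (E + 1) * \<dots> = ennreal IY"
    unfolding IY_def using E_pos by (intro ennreal_mult'[symmetric]) simp
  finally show ?thesis .
qed

lemma product_le_powers: "\<rho> * q \<le> \<rho> powr (3 / 2) + q ^ 3" if "\<rho> \<ge> 0" "q \<ge> 0" for \<rho> q :: real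
proof (cases "q \<le> sqrt \<rho>")
  case True
  have "\<rho> * q \<le> \<rho> * sqrt \<rho>" using True that by (intro mult_left_mono) auto
  also have "\<dots> = \<rho> powr (3 / 2)"
    using that powr_add[of \<rho> 1 "1 / 2"] by (cases "\<rho> = 0") (auto simp: powr_half_sqrt)
  finally show ?thesis using that by (intro add_increasing2) auto
next
  case False
  then have "\<rho> \<le> q\<^sup>2" using that by (simp add: real_sqrt_le_iff sqrt_le_D)
  then have "\<rho> * q \<le> q\<^sup>2 * q" using that by (intro mult_right_mono) auto
  then show ?thesis by (simp add: power3_eq_cube power2_eq_square add_increasing)
qed

text \<open>The pairing of L^(3/2) with L^3, in the additive form of Young's inequality: at almost
  every time the integral of \<open>p\<close> pays for the density, and the L^3 bound on the ball of
  radius \<open>D\<close> pays for the kernel. The bound is uniform in the point x, so a factor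
  integrable in z may stand in front. The mollifier contributes its mass.\<close>

lemma density_convolution:
  fixes q :: "R3 \<Rightarrow> real" and X :: "real \<Rightarrow> real"
  assumes [measurable]: "q \<in> borel_measurable borel" "X \<in> borel_measurable borel" and q0: "\<And>x. 0 \<le> q x"
    and X0: "\<And>\<tau>. 0 \<le> X \<tau>" and X1: "(\<integral>\<^sup>+\<tau>. ennreal (X \<tau>) \<partial>lborel) \<le> 1"
    and D: "\<And>x y. x \<in> \<Omega> \<Longrightarrow> y \<in> \<Omega> \<Longrightarrow> norm (x - y) \<le> D" and x: "x \<in> \<Omega>"
    and I: "(\<integral>\<^sup>+x. ennreal (q x ^ 3) * indicator (cball 0 D) x) \<le> ennreal I" "I \<ge> 0"
  shows "(\<integral>\<^sup>+w. ennreal (X (t - snd w) * r w * q (x - fst w))) \<le> ennreal (E + I)"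
proof -
  have [measurable]: "cball (0 :: R3) D \<in> sets borel" by simp
  have "(\<integral>\<^sup>+w. ennreal (X (t - snd w) * r w * q (x - fst w))) =
      (\<integral>\<^sup>+t'. \<integral>\<^sup>+y. ennreal (X (t - t') * r (y, t') * q (x - y)))"
    by (subst nn_integral_slices) auto
  also have "\<dots> \<le> (\<integral>\<^sup>+t'. ennreal (X (t - t')) * ennreal (E + I))"
  proof (rule nn_integral_mono_AE)
    show "AE t' in lborel. (\<integral>\<^sup>+y. ennreal (X (t - t') * r (y, t') * q (x - y))) \<le> ennreal (X (t - t')) * ennreal (E + I)"
      using energy_p
    proof eventually_elim
      case (elim t')
      have [measurable]: "(\<lambda>y. r (y, t')) \<in> borel_measurable borel" by measurable
      have "(\<integral>\<^sup>+y. ennreal (X (t - t') * r (y, t') * q (x - y))) \<le>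
          (\<integral>\<^sup>+y. ennreal (X (t - t')) * (ennreal (p (r (y, t'))) + ennreal (q (x - y) ^ 3) * indicator (cball 0 D) (x - y)))"
      proof (intro nn_integral_mono)
        fix y
        have "ennreal (r (y, t') * q (x - y)) \<le> ennreal (p (r (y, t'))) + ennreal (q (x - y) ^ 3) * indicator (cball 0 D) (x - y)"
        proof (cases "(y, t') \<in> Q")
          case True
          then have "norm (x - y) \<le> D" using D x by (auto simp: mem_Q)
          have "r (y, t') * q (x - y) \<le> p (r (y, t')) + q (x - y) ^ 3"
            using product_le_powers[OF r_nonneg q0, of "(y, t')" "x - y"] p_ge[OF r_nonneg, of "(y, t')"] by linarith
          then have "ennreal (r (y, t') * q (x - y)) \<le> ennreal (p (r (y, t')) + q (x - y) ^ 3)" by (rule ennreal_leI)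
          also have "\<dots> = ennreal (p (r (y, t'))) + ennreal (q (x - y) ^ 3)"
            using p_nonneg[OF r_nonneg] q0 by (intro ennreal_plus) auto
          finally show ?thesis using \<open>norm (x - y) \<le> D\<close> by simp
        qed (simp add: off)
        then have "ennreal (X (t - t')) * ennreal (r (y, t') * q (x - y)) \<le>
            ennreal (X (t - t')) * (ennreal (p (r (y, t'))) + ennreal (q (x - y) ^ 3) * indicator (cball 0 D) (x - y))"
          by (intro mult_left_mono) auto
        then show "ennreal (X (t - t') * r (y, t') * q (x - y)) \<le>
            ennreal (X (t - t')) * (ennreal (p (r (y, t'))) + ennreal (q (x - y) ^ 3) * indicator (cball 0 D) (x - y))"
          using X0 r_nonneg q0 by (simp add: ennreal_mult[symmetric] mult.assoc)
      qed
      also have "\<dots> = ennreal (X (t - t')) * ((\<integral>\<^sup>+y. ennreal (p (r (y, t')))) +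
          (\<integral>\<^sup>+y. ennreal (q (x - y) ^ 3) * indicator (cball 0 D) (x - y)))"
        by (subst nn_integral_cmult) (auto simp: nn_integral_add)
      also have "(\<integral>\<^sup>+y. ennreal (q (x - y) ^ 3) * indicator (cball 0 D) (x - y)) =
          (\<integral>\<^sup>+y. ennreal (q y ^ 3) * indicator (cball 0 D) y)"
        by (rule nn_integral_lborel_reflect) measurable
      also have "ennreal (X (t - t')) * ((\<integral>\<^sup>+y. ennreal (p (r (y, t')))) + (\<integral>\<^sup>+y. ennreal (q y ^ 3) * indicator (cball 0 D) y)) \<le>
          ennreal (X (t - t')) * (ennreal E + ennreal I)"
        using elim I by (intro mult_left_mono add_mono) auto
      also have "ennreal E + ennreal I = ennreal (E + I)" using E_pos I by simp
      finally show ?case .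
    qed
  qed
  also have "\<dots> = (\<integral>\<^sup>+t'. ennreal (X (t - t'))) * ennreal (E + I)"
    by (rule nn_integral_multc) measurable
  also have "(\<integral>\<^sup>+t'. ennreal (X (t - t'))) = (\<integral>\<^sup>+t'. ennreal (X t'))"
    by (rule nn_integral_lborel_reflect) measurable
  also have "\<dots> * ennreal (E + I) \<le> 1 * ennreal (E + I)" by (intro mult_right_mono X1) auto
  finally show ?thesis by simp
qed

end

section \<open>Symmetrisation and absorption for the logarithmic kernel\<close>

locale log_doubling = doubling \<Omega> T \<nu>1 \<nu>2 E c p f u r G \<zeta> dt g X X' "kvec a s \<delta>" "kjac a s \<delta>" B C + log_kernel a s D I
  for \<Omega> :: "R3 set" and T \<nu>1 \<nu>2 E c :: real and p :: "real \<Rightarrow> real"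
    and f u :: "R3 \<times> real \<Rightarrow> R3" and r :: "R3 \<times> real \<Rightarrow> real" and G :: "R3 \<times> real \<Rightarrow> real ^ 3 ^ 3"
    and \<zeta> dt g X X' a s \<delta> B C D I +
  fixes b :: real
  assumes delta: "0 < \<delta>" and delta_le: "\<delta> \<le> 1"
    and D: "x \<in> \<Omega> \<Longrightarrow> y \<in> \<Omega> \<Longrightarrow> norm (x - y) \<le> D"
    and b: "1 \<le> b" "\<bar>dt z\<bar> \<le> b" "norm (g z) \<le> b"
    and X_int: "(\<integral>\<^sup>+\<tau>. ennreal (X \<tau>) \<partial>lborel) = 1"
begin

abbreviation hh where "hh z w \<equiv> ker a s \<delta> (fst z - fst w)"
abbreviation hm where "hm z w \<equiv> ker a (s - 5 / 3) \<delta> (fst z - fst w)"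
abbreviation LL where "LL z w \<equiv> Lam a \<delta> (fst z - fst w)"

definition Good where "Good z w = XX z w * (\<zeta> z * \<zeta> w * r w * p (r z) * hh z w)"

text \<open>Each ordered pair contributes 5 + \<open>kap\<close> + \<open>c\<close> directly; the
  product of velocities at two different points is split into halves, and the halves of the two
  orderings add up to the sixth unit.\<close>

definition K0 where "K0 = b * (6 + kap + c)"

text \<open>The first group comes from the viscous stress, the second is what Young's inequality
  leaves of the negative part of the convective term, and the third collects the force and the
  derivatives of the cut-off. The indicator of the cylinder keeps the squared kernel from being
  integrated over all z.\<close>

definition Bad where "Bad z w = XX z w * r w * (2 * kap * ((norm (G z))\<^sup>2 + (hh z w)\<^sup>2 * indicator Q z) +
  36 * (hm z w * Y z) + K0 * (LL z w powr s * H z))"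

lemma ker_ge_0: "ker a s' \<delta> x \<ge> 0"
  unfolding ker_def using delta by (intro divide_nonneg_nonneg) auto

lemma K0_nonneg: "K0 \<ge> 0"
  unfolding K0_def using b kap_nonneg c_nonneg by simp

lemma Bad_nonneg: "Bad z w \<ge> 0"
  unfolding Bad_def
  by (intro mult_nonneg_nonneg add_nonneg_nonneg X_nonneg r_nonneg kap_nonneg ker_ge_0 Y_nonneg K0_nonneg H_nonneg)
    auto

lemma Good_nonneg: "Good z w \<ge> 0"
  unfolding Good_def
  by (intro mult_nonneg_nonneg X_nonneg zeta_nonneg r_nonneg p_nonneg ker_ge_0)

lemma product_measurable' [measurable]:
  "(\<lambda>q. Good (fst q) (snd q)) \<in> borel_measurable (borel \<Otimes>\<^sub>M borel)"
  "(\<lambda>q. Bad (fst q) (snd q)) \<in> borel_measurable (borel \<Otimes>\<^sub>M borel)"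
  unfolding Good_def Bad_def by measurable

lemma XX_sym: "XX w z = XX z w"
  using X_even[of "snd z - snd w"] by simp

definition Rem where "Rem z w = \<zeta> w * r w * (r z * (dt z * (u z \<bullet> kk z w)) +
    Sig z \<bullet> tensor (kk z w) (g z) + r z * (\<zeta> z * (f z \<bullet> kk z w))) +
  \<zeta> z * r z * r w * ((dt w + u w \<bullet> g w) * (u z \<bullet> kk z w))"

text \<open>The terms with \<open>X'\<close> cancel in this identity. The mollifier survives as a
  nonnegative common factor, so pointwise inequalities can be proved for the other factor, and its
  width never enters a bound.\<close>

lemma F_eq: "F z w = XX z w * (Rem z w + \<zeta> w * \<zeta> z * r w * (r z * (u z \<bullet> (JJ z w *v u z)) +
    p (r z) * (mat 1 \<bullet> JJ z w) - stress \<nu>1 \<nu>2 (G z) \<bullet> JJ z w - r z * (u z \<bullet> (JJ z w *v u w))))"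
proof -
  have S: "Sig z \<bullet> JJ z w = r z * (u z \<bullet> (JJ z w *v u z)) + p (r z) * (mat 1 \<bullet> JJ z w) - stress \<nu>1 \<nu>2 (G z) \<bullet> JJ z w"
    unfolding Sig_def by (simp add: inner_diff_left inner_add_left inner_tensor)
  show ?thesis
    unfolding F_def m1_def m2_def m3_def c1_def Rem_def
    unfolding inner_scaleR_right inner_add_right S by (simp add: algebra_simps)
qed

context
  fixes z w
  assumes z: "z \<in> Q" and w: "w \<in> Q"
begin

private definition x where "x = fst z - fst w"
private definition h where "h = ker a s \<delta> x"
private definition L where "L = Lam a \<delta> x"

private lemma xD: "norm x \<le> D" "(norm x)\<^sup>2 + \<delta> < a" "2 * s \<le> Lam a \<delta> x" "4 \<le> L"
proof -
  show 1: "norm x \<le> D" unfolding x_def using z w fst_Q D by auto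
  note L = Lam_ge_4[OF a_eq delta delta_le 1]
  show "(norm x)\<^sup>2 + \<delta> < a" "4 \<le> L" using L by (simp_all add: L_def)
  show "2 * s \<le> Lam a \<delta> x" using L s by linarith
qed

private lemma h0: "h \<ge> 0" by (simp add: h_def ker_ge_0)

private lemma kvec_le: "norm (kvec a s \<delta> x) \<le> L powr s"
  unfolding L_def by (rule kvec_norm[OF delta xD(2) s(1) xD(3)])

private lemma Rem_le:
  "\<bar>Rem z w\<bar> \<le> b * L powr s * (r w * ((5 + kap + c) * H z) + (1 / 2) * (r w * H z + r z * H w))"
proof -
  define N where "N = L powr s"
  have N: "N \<ge> 0" by (simp add: N_def)
  have k: "norm (kvec a s \<delta> x) \<le> N" using kvec_le by (simp add: N_def)
  have zz: "\<bar>\<zeta> z\<bar> \<le> 1" "\<bar>\<zeta> w\<bar> \<le> 1"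
    using zeta_nonneg[of z] zeta_le[of z] zeta_nonneg[of w] zeta_le[of w] by auto
  have rr: "\<bar>r z\<bar> \<le> r z" "\<bar>r w\<bar> \<le> r w" using r_nonneg[of z] r_nonneg[of w] by auto
  have b0: "b \<ge> 0" using b by simp
  have uk: "\<bar>u z \<bullet> kvec a s \<delta> x\<bar> \<le> norm (u z) * N"
    using k by (intro order_trans[OF Cauchy_Schwarz_ineq2] mult_left_mono) auto
  have fk: "\<bar>f z \<bullet> kvec a s \<delta> x\<bar> \<le> c * N"
    using k f_bound[of z] c_nonneg by (intro order_trans[OF Cauchy_Schwarz_ineq2] mult_mono) auto
  have kt: "norm (tensor (kvec a s \<delta> x) (g z)) \<le> N * b"
    unfolding norm_tensor using k b(3)[of z] N by (intro mult_mono) auto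
  have "0 \<le> (3 + kap) * H z" using H_nonneg[of z] kap_nonneg by simp
  then have St: "\<bar>Sig z \<bullet> tensor (kvec a s \<delta> x) (g z)\<bar> \<le> ((3 + kap) * H z) * (N * b)"
    by (intro order_trans[OF Cauchy_Schwarz_ineq2] mult_mono[OF Sig_le_H kt]) auto
  have ug: "\<bar>u w \<bullet> g w\<bar> \<le> norm (u w) * b"
    using b(3)[of w] by (intro order_trans[OF Cauchy_Schwarz_ineq2] mult_left_mono) auto
  have "\<bar>Rem z w\<bar> \<le> 1 * r w * (r z * (b * (norm (u z) * N)) + ((3 + kap) * H z) * (N * b) + r z * (1 * (c * N))) +
      1 * r z * r w * ((b + norm (u w) * b) * (norm (u z) * N))"
    unfolding Rem_def x_def[symmetric]
    by (intro order_trans[OF abs_triangle_ineq] add_mono abs_mult_le zz rr b(2) uk fk St ug)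
  also have "\<dots> = N * (r w * (b * (2 * (r z * norm (u z)) + (3 + kap) * H z) + c * r z) + b * (r z * r w * (norm (u z) * norm (u w))))"
    by (simp add: algebra_simps)
  also have "\<dots> \<le> N * (r w * (b * (2 * H z + (3 + kap) * H z) + b * (c * H z)) + b * ((1 / 2) * (r w * H z + r z * H w)))"
  proof (intro mult_left_mono add_mono N r_nonneg b0 ru_le_H order_refl)
    have "c * r z \<le> 1 * (c * H z)" using ru_le_H(2)[of z] c_nonneg by (simp add: mult_left_mono)
    also have "\<dots> \<le> b * (c * H z)" using b c_nonneg H_nonneg[of z] by (intro mult_right_mono) auto
    finally show "c * r z \<le> b * (c * H z)" .
    have "norm (u z) * norm (u w) \<le> (1 / 2) * ((norm (u z))\<^sup>2 + (norm (u w))\<^sup>2)"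
      using sum_squares_bound[of "norm (u z)" "norm (u w)"] by simp
    then have "r z * r w * (norm (u z) * norm (u w)) \<le> r z * r w * ((1 / 2) * ((norm (u z))\<^sup>2 + (norm (u w))\<^sup>2))"
      using r_nonneg by (intro mult_left_mono) auto
    also have "\<dots> = (1 / 2) * (r w * (r z * (norm (u z))\<^sup>2) + r z * (r w * (norm (u w))\<^sup>2))"
      by (simp add: algebra_simps)
    also have "\<dots> \<le> (1 / 2) * (r w * H z + r z * H w)"
      by (intro mult_left_mono add_mono ru_le_H r_nonneg) auto
    finally show "r z * r w * (norm (u z) * norm (u w)) \<le> (1 / 2) * (r w * H z + r z * H w)" .
  qed (use kap_nonneg in auto)
  also have "\<dots> = b * N * (r w * ((5 + kap + c) * H z) + (1 / 2) * (r w * H z + r z * H w))"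
    by (simp add: algebra_simps)
  finally show ?thesis by (simp add: N_def)
qed

private lemma stress_le: "\<bar>stress \<nu>1 \<nu>2 (G z) \<bullet> JJ z w\<bar> \<le> 2 * kap * ((norm (G z))\<^sup>2 + h\<^sup>2)"
proof -
  have "norm (kjac a s \<delta> x) \<le> 4 * h" unfolding h_def by (rule kjac_norm[OF delta xD(2) s(1) xD(3)])
  then have "\<bar>stress \<nu>1 \<nu>2 (G z) \<bullet> JJ z w\<bar> \<le> (kap * norm (G z)) * (4 * h)"
    unfolding x_def[symmetric] kap_def using kap_nonneg h0
    by (intro order_trans[OF Cauchy_Schwarz_ineq2] mult_mono norm_stress_le) (auto simp: kap_def)
  also have "\<dots> = 2 * kap * (2 * norm (G z) * h)" by simp
  also have "\<dots> \<le> 2 * kap * ((norm (G z))\<^sup>2 + h\<^sup>2)"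
    using kap_nonneg by (intro mult_left_mono sum_squares_bound) auto
  finally show ?thesis .
qed

text \<open>The kernel h times \<open>kinetic_energy_Young\<close>, with the weight of the current
  time slice as free parameter. Half of the pressure is spent, and the kernel h L^(-5/3) of the
  remainder is the one whose cube is barely integrable.\<close>

private lemma Young: "4 * s * (h / L) * (r z * (norm (u z))\<^sup>2) \<le> 1 / 2 * (p (r z) * h) + 36 * (ker a (s - 5 / 3) \<delta> x * Y z)"
proof -
  have L0: "L > 0" using xD(4) by simp
  define q where "q = sqrt ((norm x)\<^sup>2 + \<delta>)"
  have q: "q > 0" unfolding q_def using delta by (simp add: add_nonneg_pos)
  have hL: "h = L powr s / q" by (simp add: h_def ker_def L_def q_def)
  have "4 * s * (h / L) * (r z * (norm (u z))\<^sup>2) = 4 * s * (h * (r z * (norm (u z))\<^sup>2 / L))" by simp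
  \<comment> \<open>From s < 4/3 follows 4 s < 16/3.\<close>
  also have "\<dots> \<le> 6 * (h * (r z * (norm (u z))\<^sup>2 / L))"
    using s h0 L0 r_nonneg[of z] by (intro mult_right_mono) auto
  also have "\<dots> = h * (6 * (r z * (norm (u z))\<^sup>2 / L))" by simp
  also have "\<dots> \<le> h * (1 / 2 * r z powr (3 / 2) + 36 * (L powr (- 5 / 3) * Y z))"
    unfolding Y_def using At_ge[of "snd z"]
    by (intro mult_left_mono kinetic_energy_Young r_nonneg L0 h0) auto
  also have "\<dots> \<le> h * (1 / 2 * p (r z) + 36 * (L powr (- 5 / 3) * Y z))"
    using p_ge[OF r_nonneg[of z]] by (intro mult_left_mono add_right_mono h0) auto
  also have "\<dots> = 1 / 2 * (p (r z) * h) + 36 * ((L powr s * L powr (- 5 / 3)) / q * Y z)"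
    by (simp add: hL algebra_simps)
  also have "L powr s * L powr (- 5 / 3) = L powr (s - 5 / 3)" by (simp flip: powr_add)
  also have "L powr (s - 5 / 3) / q = ker a (s - 5 / 3) \<delta> x" by (simp add: ker_def L_def q_def)
  finally show ?thesis .
qed

private lemma half:
  "1 / 2 * (\<zeta> z * \<zeta> w * r w * p (r z) * h) - r w * (2 * kap * ((norm (G z))\<^sup>2 + h\<^sup>2) + 36 * (ker a (s - 5 / 3) \<delta> x * Y z))
    \<le> \<zeta> z * \<zeta> w * r w * (p (r z) * (mat 1 \<bullet> JJ z w) - stress \<nu>1 \<nu>2 (G z) \<bullet> JJ z w - 4 * s * (h / L) * (r z * (norm (u z))\<^sup>2))"
proof -
  define q where "q = \<zeta> z * \<zeta> w * r w"
  have q: "0 \<le> q" "q \<le> r w"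
  proof -
    show "0 \<le> q" unfolding q_def by (intro mult_nonneg_nonneg zeta_nonneg r_nonneg)
    have "\<zeta> z * \<zeta> w \<le> 1 * 1" by (intro mult_mono zeta_le zeta_nonneg) auto
    then have "\<zeta> z * \<zeta> w * r w \<le> 1 * r w" by (intro mult_right_mono r_nonneg) auto
    then show "q \<le> r w" by (simp add: q_def)
  qed
  define e where "e = 2 * kap * ((norm (G z))\<^sup>2 + h\<^sup>2) + 36 * (ker a (s - 5 / 3) \<delta> x * Y z)"
  have e: "e \<ge> 0" unfolding e_def
    by (intro add_nonneg_nonneg mult_nonneg_nonneg kap_nonneg ker_ge_0 Y_nonneg) auto
  have tr: "p (r z) * h \<le> p (r z) * (mat 1 \<bullet> JJ z w)"
    unfolding h_def x_def[symmetric]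
    by (intro mult_left_mono kjac_trace[OF delta xD(2) s(1) xD(3)] p_nonneg r_nonneg)
  have "1 / 2 * (p (r z) * h) - e \<le> p (r z) * (mat 1 \<bullet> JJ z w) - stress \<nu>1 \<nu>2 (G z) \<bullet> JJ z w - 4 * s * (h / L) * (r z * (norm (u z))\<^sup>2)"
    using tr stress_le Young unfolding e_def by (simp add: abs_le_iff)
  then have "q * (1 / 2 * (p (r z) * h) - e) \<le> q * (p (r z) * (mat 1 \<bullet> JJ z w) - stress \<nu>1 \<nu>2 (G z) \<bullet> JJ z w - 4 * s * (h / L) * (r z * (norm (u z))\<^sup>2))"
    using q by (intro mult_left_mono) auto
  moreover have "q * e \<le> r w * e" using q e by (intro mult_right_mono)
  ultimately show ?thesis unfolding q_def e_def by (simp add: algebra_simps)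
qed

lemma one_sided:
  "1 / 2 * (\<zeta> z * \<zeta> w * r w * p (r z) * hh z w)
    - r w * (2 * kap * ((norm (G z))\<^sup>2 + (hh z w)\<^sup>2) + 36 * (hm z w * Y z))
    \<le> \<zeta> z * \<zeta> w * r w * (p (r z) * (mat 1 \<bullet> JJ z w) - stress \<nu>1 \<nu>2 (G z) \<bullet> JJ z w -
      4 * s * (hh z w / LL z w) * (r z * (norm (u z))\<^sup>2))"
  using half unfolding h_def L_def x_def .

lemma Rem_bound:
  "\<bar>Rem z w\<bar> \<le> b * LL z w powr s * (r w * ((5 + kap + c) * H z) + (1 / 2) * (r w * H z + r z * H w))"
  using Rem_le unfolding L_def x_def .

text \<open>The quadratic form is that of the Jacobian at v = u(z) - u(w), so
  \<open>kjac_lower\<close> applies; |v|^2 \<le> 2 |u(z)|^2 + 2 |u(w)|^2 then doubles the constant 2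
  s.\<close>

lemma convective:
  "\<zeta> w * \<zeta> z * (r z * r w) * (u z \<bullet> (JJ z w *v u z) - 2 * (u z \<bullet> (JJ z w *v u w)) + u w \<bullet> (JJ z w *v u w)) \<ge>
    - (\<zeta> z * \<zeta> w * (4 * s * (hh z w / LL z w)) *
      (r w * (r z * (norm (u z))\<^sup>2) + r z * (r w * (norm (u w))\<^sup>2)))"
proof -
  define v where "v = u z - u w"
  define q where "q = \<zeta> w * \<zeta> z * (r z * r w)"
  define m where "m = 2 * s * (h / L)"
  have q: "q \<ge> 0" unfolding q_def by (intro mult_nonneg_nonneg zeta_nonneg r_nonneg)
  have m: "m \<ge> 0" unfolding m_def using s h0 xD(4) by simp
  have sym: "u w \<bullet> (JJ z w *v u z) = u z \<bullet> (JJ z w *v u w)"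
    by (rule symmetric_matrix_inner) (rule J_sym)
  have e: "u z \<bullet> (JJ z w *v u z) - 2 * (u z \<bullet> (JJ z w *v u w)) + u w \<bullet> (JJ z w *v u w) = v \<bullet> (JJ z w *v v)"
    unfolding v_def by (simp add: vec.diff inner_diff_left inner_diff_right sym)
  have "v \<bullet> (JJ z w *v v) \<ge> - (m * (norm v)\<^sup>2)"
    unfolding m_def h_def L_def x_def[symmetric] by (rule kjac_lower[OF delta xD(2) s(1) xD(3)])
  moreover have "(norm v)\<^sup>2 \<le> 2 * ((norm (u z))\<^sup>2 + (norm (u w))\<^sup>2)"
  proof -
    have "norm v \<le> norm (u z) + norm (u w)" unfolding v_def by (rule norm_triangle_ineq4)
    then have "(norm v)\<^sup>2 \<le> (norm (u z) + norm (u w))\<^sup>2" by (intro power_mono) auto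
    then show ?thesis using sum_squares_bound[of "norm (u z)" "norm (u w)"] by (simp add: power2_sum)
  qed
  ultimately have "v \<bullet> (JJ z w *v v) \<ge> - (m * (2 * ((norm (u z))\<^sup>2 + (norm (u w))\<^sup>2)))"
    using mult_left_mono[OF _ m, of "(norm v)\<^sup>2" "2 * ((norm (u z))\<^sup>2 + (norm (u w))\<^sup>2)"] by linarith
  then have "q * (v \<bullet> (JJ z w *v v)) \<ge> q * (- (m * (2 * ((norm (u z))\<^sup>2 + (norm (u w))\<^sup>2))))"
    using q by (intro mult_left_mono)
  then show ?thesis
    unfolding e q_def m_def h_def L_def x_def by (simp add: algebra_simps)
qed

end

text \<open>A single ordering contains a mixed term u(z) \<bullet> J u(w) of no sign. Since the
  Jacobian is even and symmetric, adding the exchanged ordering completes the square. Half of the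
  pressure term absorbs the negative part of that square, and the other half remains on the
  left.\<close>

theorem pointwise_bound:
  "1 / 2 * (Good z w + Good w z) - (Bad z w + Bad w z) \<le> F z w + F w z"
proof (cases "z \<in> Q \<and> w \<in> Q")
  case False
  have F0: "F z w = 0" if "z \<notin> Q \<or> w \<notin> Q" for z w
    using that by (auto simp: F_def off off_Q)
  have G0: "Good z w = 0" if "z \<notin> Q \<or> w \<notin> Q" for z w
    using that by (auto simp: Good_def off p_zero)
  show ?thesis using False F0[of z w] F0[of w z] G0[of z w] G0[of w z] Bad_nonneg[of z w] Bad_nonneg[of w z] by auto
next
  case True
  then have z: "z \<in> Q" and w: "w \<in> Q" by auto
  define x where "x = fst z - fst w"
  have wx: "fst w - fst z = - x" by (simp add: x_def)
  define N where "N = Lam a \<delta> x powr s"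
  have J: "JJ w z = JJ z w" unfolding wx kernel_even x_def ..
  define A where "A z w = r z * (u z \<bullet> (JJ z w *v u z)) + p (r z) * (mat 1 \<bullet> JJ z w) - stress \<nu>1 \<nu>2 (G z) \<bullet> JJ z w - r z * (u z \<bullet> (JJ z w *v u w))" for z w
  define V where "V = ker a s \<delta> x / Lam a \<delta> x"
  define bad where "bad z = 2 * kap * ((norm (G z))\<^sup>2 + (ker a s \<delta> x)\<^sup>2) + 36 * (ker a (s - 5 / 3) \<delta> x * Y z)" for z
  have s1: "1 / 2 * (\<zeta> z * \<zeta> w * r w * p (r z) * ker a s \<delta> x) - r w * bad z \<le>
      \<zeta> z * \<zeta> w * r w * (p (r z) * (mat 1 \<bullet> JJ z w) - stress \<nu>1 \<nu>2 (G z) \<bullet> JJ z w - 4 * s * V * (r z * (norm (u z))\<^sup>2))"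
    using one_sided[OF z w] unfolding bad_def V_def x_def .
  have s2: "1 / 2 * (\<zeta> w * \<zeta> z * r z * p (r w) * ker a s \<delta> x) - r z * bad w \<le>
      \<zeta> w * \<zeta> z * r z * (p (r w) * (mat 1 \<bullet> JJ z w) - stress \<nu>1 \<nu>2 (G w) \<bullet> JJ z w - 4 * s * V * (r w * (norm (u w))\<^sup>2))"
    using one_sided[OF w z] unfolding J unfolding bad_def V_def wx kernel_even x_def[symmetric] .
  have s3: "- (\<zeta> z * \<zeta> w * (4 * s * V) * (r w * (r z * (norm (u z))\<^sup>2) + r z * (r w * (norm (u w))\<^sup>2))) \<le>
      \<zeta> w * \<zeta> z * (r z * r w) * (u z \<bullet> (JJ z w *v u z) - 2 * (u z \<bullet> (JJ z w *v u w)) + u w \<bullet> (JJ z w *v u w))"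
    using convective[OF z w] unfolding V_def x_def .
  have sym: "u w \<bullet> (JJ z w *v u z) = u z \<bullet> (JJ z w *v u w)"
    by (rule symmetric_matrix_inner) (rule J_sym)
  have R1: "\<bar>Rem z w\<bar> \<le> b * N * (r w * ((5 + kap + c) * H z) + (1 / 2) * (r w * H z + r z * H w))"
    using Rem_bound[OF z w] unfolding N_def x_def .
  have R2: "\<bar>Rem w z\<bar> \<le> b * N * (r z * ((5 + kap + c) * H w) + (1 / 2) * (r z * H w + r w * H z))"
    using Rem_bound[OF w z] unfolding N_def wx kernel_even .
  have "b * N * (r w * ((5 + kap + c) * H z) + (1 / 2) * (r w * H z + r z * H w)) +
      b * N * (r z * ((5 + kap + c) * H w) + (1 / 2) * (r z * H w + r w * H z)) =
      r w * (K0 * (N * H z)) + r z * (K0 * (N * H w))"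
    unfolding K0_def by (simp add: field_simps)
  then have R: "Rem z w + Rem w z \<ge> - (r w * (K0 * (N * H z)) + r z * (K0 * (N * H w)))"
    using R1 R2 by linarith
  \<comment> \<open>Each ordering contributes one mixed term and one diagonal term; together they
    are the quadratic form of \<open>convective\<close>.\<close>
  have "\<zeta> w * \<zeta> z * r w * A z w + \<zeta> z * \<zeta> w * r z * A w z =
      \<zeta> z * \<zeta> w * r w * (p (r z) * (mat 1 \<bullet> JJ z w) - stress \<nu>1 \<nu>2 (G z) \<bullet> JJ z w) +
      \<zeta> w * \<zeta> z * r z * (p (r w) * (mat 1 \<bullet> JJ z w) - stress \<nu>1 \<nu>2 (G w) \<bullet> JJ z w) +
      \<zeta> w * \<zeta> z * (r z * r w) * (u z \<bullet> (JJ z w *v u z) - 2 * (u z \<bullet> (JJ z w *v u w)) + u w \<bullet> (JJ z w *v u w))"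
    unfolding A_def J sym by (simp add: algebra_simps)
  also have "\<dots> \<ge> 1 / 2 * (\<zeta> z * \<zeta> w * r w * p (r z) * ker a s \<delta> x) - r w * bad z +
      (1 / 2 * (\<zeta> w * \<zeta> z * r z * p (r w) * ker a s \<delta> x) - r z * bad w)"
    using s1 s2 s3 by (simp add: algebra_simps)
  finally have T: "1 / 2 * (\<zeta> z * \<zeta> w * r w * p (r z) * ker a s \<delta> x) - r w * bad z +
      (1 / 2 * (\<zeta> w * \<zeta> z * r z * p (r w) * ker a s \<delta> x) - r z * bad w) \<le>
      \<zeta> w * \<zeta> z * r w * A z w + \<zeta> z * \<zeta> w * r z * A w z" .
  define l where "l = 1 / 2 * (\<zeta> z * \<zeta> w * r w * p (r z) * ker a s \<delta> x) + 1 / 2 * (\<zeta> w * \<zeta> z * r z * p (r w) * ker a s \<delta> x)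
      - (r w * (bad z + K0 * (N * H z)) + r z * (bad w + K0 * (N * H w)))"
  have "l \<le> (Rem z w + \<zeta> w * \<zeta> z * r w * A z w) + (Rem w z + \<zeta> z * \<zeta> w * r z * A w z)"
    using T R unfolding l_def distrib_left by linarith
  then have "XX z w * l \<le> XX z w * ((Rem z w + \<zeta> w * \<zeta> z * r w * A z w) + (Rem w z + \<zeta> z * \<zeta> w * r z * A w z))"
    by (intro mult_left_mono X_nonneg)
  also have "\<dots> = F z w + F w z"
    unfolding F_eq[of z w] F_eq[of w z] A_def XX_sym[of w z] by (simp add: distrib_left)
  also have "XX z w * l = 1 / 2 * (Good z w + Good w z) - (Bad z w + Bad w z)"
    unfolding l_def Good_def Bad_def XX_sym[of w z] wx kernel_even x_def[symmetric] bad_def N_def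
    using z w by (simp add: algebra_simps)
  finally show ?thesis .
qed


section \<open>Integration of the error terms\<close>

lemma Bad_inner:
  "(\<integral>\<^sup>+w. ennreal (Bad z w)) \<le> ennreal ((2 * kap * (norm (G z))\<^sup>2 + 36 * Y z + K0 * H z) * (E + I)) +
    (\<integral>\<^sup>+w. ennreal (XX z w * r w * (2 * kap * (hh z w)\<^sup>2 * indicator Q z)))"
proof (cases "z \<in> Q")
  case False
  then have "Bad z w = 0" for w by (simp add: Bad_def off Y_off H_off)
  then show ?thesis by simp
next
  case True
  note zO = fst_Q[OF True]
  have conv: "(\<integral>\<^sup>+w. ennreal (XX z w * r w * q (fst z - fst w))) \<le> ennreal (E + I)"
    if "q \<in> borel_measurable borel" "\<And>x. 0 \<le> q x" "(\<integral>\<^sup>+x. ennreal (q x ^ 3) * indicator (cball 0 D) x) \<le> ennreal I" for q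
    using density_convolution[OF that(1) meas(4) that(2) X_nonneg _ D zO that(3) I_nonneg, of "snd z"] X_int by simp
  define S where "S q = (\<integral>\<^sup>+w. ennreal (XX z w * r w * q (fst z - fst w)))" for q
  have S: "S (\<lambda>_. 1) \<le> ennreal (E + I)" "S (\<lambda>x. ker a (s - 5 / 3) \<delta> x) \<le> ennreal (E + I)"
      "S (\<lambda>x. Lam a \<delta> x powr s) \<le> ennreal (E + I)"
    unfolding S_def using I1 I2[OF delta delta_le] I3[OF delta delta_le] by (intro conv; simp add: ker_ge_0)+
  define A1 where "A1 = 2 * kap * (norm (G z))\<^sup>2"
  define A2 where "A2 = 36 * Y z"
  define A3 where "A3 = K0 * H z"
  have A: "A1 \<ge> 0" "A2 \<ge> 0" "A3 \<ge> 0"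
    unfolding A1_def A2_def A3_def using kap_nonneg Y_nonneg K0_nonneg H_nonneg by auto
  have "(\<integral>\<^sup>+w. ennreal (Bad z w)) =
      (\<integral>\<^sup>+w. ennreal A1 * ennreal (XX z w * r w * 1) + ennreal A2 * ennreal (XX z w * r w * hm z w) +
        ennreal A3 * ennreal (XX z w * r w * LL z w powr s) +
        ennreal (XX z w * r w * (2 * kap * (hh z w)\<^sup>2 * indicator Q z)))"
  proof (rule nn_integral_cong)
    fix w
    have X0: "0 \<le> XX z w * r w" by (intro mult_nonneg_nonneg X_nonneg r_nonneg)
    have nn: "0 \<le> A1 * (XX z w * r w * 1)" "0 \<le> A2 * (XX z w * r w * hm z w)"
      "0 \<le> A3 * (XX z w * r w * LL z w powr s)"
      "0 \<le> XX z w * r w * (2 * kap * (hh z w)\<^sup>2 * indicator Q z)"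
      using A X0 kap_nonneg ker_ge_0 by (auto intro!: mult_nonneg_nonneg)
    have "Bad z w = A1 * (XX z w * r w * 1) + A2 * (XX z w * r w * hm z w) +
        A3 * (XX z w * r w * LL z w powr s) +
        XX z w * r w * (2 * kap * (hh z w)\<^sup>2 * indicator Q z)"
      unfolding Bad_def A1_def A2_def A3_def by (simp add: algebra_simps)
    then show "ennreal (Bad z w) = ennreal A1 * ennreal (XX z w * r w * 1) + ennreal A2 * ennreal (XX z w * r w * hm z w) +
        ennreal A3 * ennreal (XX z w * r w * LL z w powr s) +
        ennreal (XX z w * r w * (2 * kap * (hh z w)\<^sup>2 * indicator Q z))"
      using nn A by (simp only: ennreal_plus add_nonneg_nonneg ennreal_mult')
  qed
  also have "\<dots> = ennreal A1 * S (\<lambda>_. 1) + ennreal A2 * S (\<lambda>x. ker a (s - 5 / 3) \<delta> x) + ennreal A3 * S (\<lambda>x. Lam a \<delta> x powr s) +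
      (\<integral>\<^sup>+w. ennreal (XX z w * r w * (2 * kap * (hh z w)\<^sup>2 * indicator Q z)))"
    unfolding S_def by (subst nn_integral_add; (subst nn_integral_add)?; (subst nn_integral_add)?) (simp_all add: nn_integral_cmult)
  also have "\<dots> \<le> ennreal A1 * ennreal (E + I) + ennreal A2 * ennreal (E + I) + ennreal A3 * ennreal (E + I) +
      (\<integral>\<^sup>+w. ennreal (XX z w * r w * (2 * kap * (hh z w)\<^sup>2 * indicator Q z)))"
    by (intro add_mono mult_left_mono S order_refl) auto
  also have "ennreal A1 * ennreal (E + I) + ennreal A2 * ennreal (E + I) + ennreal A3 * ennreal (E + I) =
      ennreal ((A1 + A2 + A3) * (E + I))"
    using A E_pos I_nonneg by (simp add: ennreal_mult distrib_right)
  finally show ?thesis by (simp add: A1_def A2_def A3_def)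
qed

text \<open>The squared kernel behaves like |x|^(-2) up to logarithms and is not in L^3, so its
  convolution with the density has no uniform bound of the kind used in \<open>Bad_inner\<close>. It
  carries no other factor that depends on z beyond the indicator, however, and can be integrated in
  z first, leaving the mass of the density.\<close>

lemma kernel_square_integral:
  "(\<integral>\<^sup>+z. \<integral>\<^sup>+w. ennreal (XX z w * r w * (2 * kap * (hh z w)\<^sup>2 * indicator Q z)))
    \<le> ennreal (2 * kap * (I * (vol * T + T * E)))"
proof -
  have [measurable]: "cball (0 :: R3) D \<in> sets borel" by simp
  have kap2: "0 \<le> 2 * kap" using kap_nonneg by simp
  have "(\<integral>\<^sup>+z. \<integral>\<^sup>+w. ennreal (XX z w * r w * (2 * kap * (hh z w)\<^sup>2 * indicator Q z))) =
      (\<integral>\<^sup>+w. \<integral>\<^sup>+z. ennreal (XX z w * r w * (2 * kap * (hh z w)\<^sup>2 * indicator Q z)))"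
    by (rule lborel_pair.Fubini') (simp add: case_prod_unfold)
  also have "\<dots> \<le> (\<integral>\<^sup>+w. ennreal (2 * kap * I) * ennreal (r w))"
  proof (rule nn_integral_mono)
    fix w
    show "(\<integral>\<^sup>+z. ennreal (XX z w * r w * (2 * kap * (hh z w)\<^sup>2 * indicator Q z))) \<le> ennreal (2 * kap * I) * ennreal (r w)"
    proof (cases "w \<in> Q")
      case True
      define k where "k x = ennreal ((ker a s \<delta> x)\<^sup>2) * indicator (cball 0 D) x" for x :: R3
      have [measurable]: "k \<in> borel_measurable borel" unfolding k_def[abs_def] by measurable
      have "(\<integral>\<^sup>+z. ennreal (XX z w * r w * (2 * kap * (hh z w)\<^sup>2 * indicator Q z))) \<le>
          (\<integral>\<^sup>+z. (ennreal (2 * kap) * ennreal (r w)) * (ennreal (XX z w) * k (fst w - fst z)))"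
      proof (rule nn_integral_mono)
        fix z
        show "ennreal (XX z w * r w * (2 * kap * (hh z w)\<^sup>2 * indicator Q z)) \<le>
            (ennreal (2 * kap) * ennreal (r w)) * (ennreal (XX z w) * k (fst w - fst z))"
        proof (cases "z \<in> Q")
          case zQ: True
          have "norm (fst w - fst z) \<le> D" by (intro D fst_Q True zQ)
          moreover have "ker a s \<delta> (fst w - fst z) = hh z w"
            using kernel_even(2)[of a s \<delta> "fst z - fst w"] by simp
          ultimately have "k (fst w - fst z) = ennreal ((hh z w)\<^sup>2)"
            by (simp add: k_def)
          moreover have "XX z w * r w * (2 * kap * (hh z w)\<^sup>2 * indicator Q z) =
              ((2 * kap) * r w) * (XX z w * (hh z w)\<^sup>2)" using zQ by simp
          ultimately show ?thesis
            using kap2 r_nonneg[of w] X_nonneg[of "snd z - snd w"] by (simp only: ennreal_mult mult_nonneg_nonneg zero_le_power2 order_refl)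
        qed simp
      qed
      also have "\<dots> = (ennreal (2 * kap) * ennreal (r w)) * (\<integral>\<^sup>+z. ennreal (XX z w) * k (fst w - fst z))"
        by (rule nn_integral_cmult) measurable
      also have "(\<integral>\<^sup>+z. ennreal (XX z w) * k (fst w - fst z)) = (\<integral>\<^sup>+t. \<integral>\<^sup>+x. ennreal (X (t - snd w)) * k (fst w - x))"
        by (subst nn_integral_slices) auto
      also have "\<dots> = (\<integral>\<^sup>+t. ennreal (X (t - snd w)) * (\<integral>\<^sup>+x. k (fst w - x)))"
        by (subst nn_integral_cmult) auto
      also have "(\<integral>\<^sup>+x. k (fst w - x)) = (\<integral>\<^sup>+x. k x)"
        by (rule nn_integral_lborel_reflect) measurable
      also have "(\<integral>\<^sup>+t. ennreal (X (t - snd w)) * (\<integral>\<^sup>+x. k x)) =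
          (\<integral>\<^sup>+t. ennreal (X (t - snd w))) * (\<integral>\<^sup>+x. k x)"
        by (rule nn_integral_multc) measurable
      also have "(\<integral>\<^sup>+t. ennreal (X (t - snd w))) = (\<integral>\<^sup>+t. ennreal (X (snd w - t)))"
        using X_even[of "t - snd w" for t] by (intro nn_integral_cong arg_cong[where f = ennreal]) simp
      also have "\<dots> = 1"
        using nn_integral_lborel_reflect[of "\<lambda>\<tau>. ennreal (X \<tau>)" "snd w"] X_int by simp
      also have "(ennreal (2 * kap) * ennreal (r w)) * (1 * (\<integral>\<^sup>+x. k x)) \<le> (ennreal (2 * kap) * ennreal (r w)) * (1 * ennreal I)"
        unfolding k_def by (intro mult_left_mono I4 delta delta_le) auto
      also have "\<dots> = ennreal (2 * kap * I) * ennreal (r w)"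
        using kap2 I_nonneg by (simp only: ennreal_mult mult_1_left mult_ac)
      finally show ?thesis .
    qed (simp add: off)
  qed
  also have "\<dots> = ennreal (2 * kap * I) * (\<integral>\<^sup>+w. ennreal (r w))" by (rule nn_integral_cmult) measurable
  also have "\<dots> \<le> ennreal (2 * kap * I) * ennreal (vol * T + T * E)" by (intro mult_left_mono int_r) auto
  also have "\<dots> = ennreal (2 * kap * (I * (vol * T + T * E)))"
    using kap2 I_nonneg by (subst ennreal_mult'[symmetric]) (auto simp: mult_ac)
  finally show ?thesis .
qed

definition CB where "CB = (2 * kap * E\<^sup>2 + 36 * IY + K0 * IH) * (E + I) + 2 * kap * (I * (vol * T + T * E))"

lemma CB_nonneg: "CB \<ge> 0"
  unfolding CB_def IY_def using kap_nonneg E_pos T_pos K0_nonneg IH_nonneg I_nonneg vol(2)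
  by (intro add_nonneg_nonneg mult_nonneg_nonneg) auto

lemma Bad_integral: "(\<integral>\<^sup>+q. ennreal (Bad (fst q) (snd q)) \<partial>(lborel \<Otimes>\<^sub>M lborel)) \<le> ennreal CB"
proof -
  have kap2: "0 \<le> 2 * kap" using kap_nonneg by simp
  have EI: "0 \<le> E + I" using E_pos I_nonneg by simp
  have IY0: "0 \<le> IY" unfolding IY_def using E_pos T_pos by simp
  have "(\<integral>\<^sup>+q. ennreal (Bad (fst q) (snd q)) \<partial>(lborel \<Otimes>\<^sub>M lborel)) = (\<integral>\<^sup>+z. \<integral>\<^sup>+w. ennreal (Bad z w))"
    by (subst lborel.nn_integral_fst[symmetric]) auto
  also have "\<dots> \<le> (\<integral>\<^sup>+z. ennreal ((2 * kap * (norm (G z))\<^sup>2 + 36 * Y z + K0 * H z) * (E + I)) +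
    (\<integral>\<^sup>+w. ennreal (XX z w * r w * (2 * kap * (hh z w)\<^sup>2 * indicator Q z))))"
    by (intro nn_integral_mono Bad_inner)
  also have "\<dots> = (\<integral>\<^sup>+z. ennreal ((2 * kap * (norm (G z))\<^sup>2 + 36 * Y z + K0 * H z) * (E + I))) +
    (\<integral>\<^sup>+z. \<integral>\<^sup>+w. ennreal (XX z w * r w * (2 * kap * (hh z w)\<^sup>2 * indicator Q z)))"
    by (rule nn_integral_add) measurable
  also have "(\<integral>\<^sup>+z. ennreal ((2 * kap * (norm (G z))\<^sup>2 + 36 * Y z + K0 * H z) * (E + I))) =
      (\<integral>\<^sup>+z. ((ennreal (2 * kap) * ennreal ((norm (G z))\<^sup>2) + ennreal 36 * ennreal (Y z)) + ennreal K0 * ennreal (H z)) * ennreal (E + I))"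
    using kap2 Y_nonneg K0_nonneg H_nonneg EI
    by (intro nn_integral_cong) (simp only: ennreal_mult ennreal_plus add_nonneg_nonneg mult_nonneg_nonneg zero_le_power2 zero_le_numeral)
  also have "\<dots> = ((ennreal (2 * kap) * (\<integral>\<^sup>+z. ennreal ((norm (G z))\<^sup>2)) + ennreal 36 * (\<integral>\<^sup>+z. ennreal (Y z))) +
      ennreal K0 * (\<integral>\<^sup>+z. ennreal (H z))) * ennreal (E + I)"
    by (subst nn_integral_multc, measurable, subst nn_integral_add, measurable, subst nn_integral_add, measurable)
      (simp add: nn_integral_cmult)
  also have "\<dots> \<le> ((ennreal (2 * kap) * ennreal (E\<^sup>2) + ennreal 36 * ennreal IY) + ennreal K0 * ennreal IH) * ennreal (E + I)"
    by (intro mult_right_mono add_mono mult_left_mono G_int int_Y int_H) auto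
  also have "\<dots> = ennreal ((2 * kap * E\<^sup>2 + 36 * IY + K0 * IH) * (E + I))"
    using kap2 IY0 K0_nonneg IH_nonneg EI
    by (simp only: ennreal_mult ennreal_plus add_nonneg_nonneg mult_nonneg_nonneg zero_le_power2 zero_le_numeral)
  finally have "(\<integral>\<^sup>+q. ennreal (Bad (fst q) (snd q)) \<partial>(lborel \<Otimes>\<^sub>M lborel)) \<le>
      ennreal ((2 * kap * E\<^sup>2 + 36 * IY + K0 * IH) * (E + I)) + ennreal (2 * kap * (I * (vol * T + T * E)))"
    using kernel_square_integral by (meson add_mono order_refl order_trans)
  also have "\<dots> = ennreal CB"
    unfolding CB_def using kap2 IY0 K0_nonneg IH_nonneg EI I_nonneg vol(2) T_pos E_pos
    by (intro ennreal_plus[symmetric] mult_nonneg_nonneg add_nonneg_nonneg) auto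
  finally show ?thesis .
qed

text \<open>\<open>F\<close> and its transpose integrate to zero, so integrating the pointwise bound
  gives at most twice the integral of \<open>Bad\<close>. Integrability of \<open>Good\<close> is
  not known beforehand; the error is moved to the other side, so that both sides are nonnegative and
  extended integrals can be compared.\<close>

theorem Good_bound: "(\<integral>\<^sup>+q. ennreal (Good (fst q) (snd q)) \<partial>(lborel \<Otimes>\<^sub>M lborel)) \<le> ennreal (2 * CB)"
proof -
  let ?M = "(lborel :: (R3 \<times> real) measure) \<Otimes>\<^sub>M (lborel :: (R3 \<times> real) measure)"
  have swap: "integrable ?M (\<lambda>q. h (snd q) (fst q))" "(\<integral>q. h (snd q) (fst q) \<partial>?M) = (\<integral>q. h (fst q) (snd q) \<partial>?M)"
    if "integrable ?M (\<lambda>q. h (fst q) (snd q))" for h :: "R3 \<times> real \<Rightarrow> R3 \<times> real \<Rightarrow> real"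
    using lborel_pair.integrable_product_swap[OF that] lborel_pair.integral_product_swap[of "\<lambda>q. h (fst q) (snd q)"] that
    by (simp_all add: case_prod_unfold)
  have swapn: "(\<integral>\<^sup>+q. ennreal (Good (snd q) (fst q)) \<partial>?M) = (\<integral>\<^sup>+q. ennreal (Good (fst q) (snd q)) \<partial>?M)"
  proof -
    have "(\<integral>\<^sup>+q. ennreal (Good (snd q) (fst q)) \<partial>?M) = (\<integral>\<^sup>+z. \<integral>\<^sup>+w. ennreal (Good w z))"
      by (subst lborel.nn_integral_fst[symmetric]) (auto simp: Good_def)
    also have "\<dots> = (\<integral>\<^sup>+w. \<integral>\<^sup>+z. ennreal (Good w z))"
      by (rule lborel_pair.Fubini') (simp add: case_prod_unfold Good_def)
    also have "\<dots> = (\<integral>\<^sup>+q. ennreal (Good (fst q) (snd q)) \<partial>?M)"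
      by (subst lborel.nn_integral_fst[symmetric]) auto
    finally show ?thesis .
  qed
  have Bm: "(\<lambda>q. Bad (fst q) (snd q)) \<in> borel_measurable ?M" by measurable
  have iB: "integrable ?M (\<lambda>q. Bad (fst q) (snd q))"
    by (rule integrableI_bounded) (use Bm Bad_integral Bad_nonneg in \<open>auto intro: le_less_trans[OF _ ennreal_less_top]\<close>)
  have B: "(\<integral>q. Bad (fst q) (snd q) \<partial>?M) \<le> CB"
    using Bad_integral CB_nonneg Bad_nonneg nn_integral_eq_integral[OF iB] by simp
  note iF = doubling_identity
  let ?R = "\<lambda>q. (F (fst q) (snd q) + F (snd q) (fst q)) + (Bad (fst q) (snd q) + Bad (snd q) (fst q))"
  have iR: "integrable ?M ?R" using iF(1) iB swap(1)[OF iF(1)] swap(1)[OF iB] by simp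
  have IR: "(\<integral>q. ?R q \<partial>?M) = 2 * (\<integral>q. Bad (fst q) (snd q) \<partial>?M)"
    using iF iB swap[OF iF(1)] swap[OF iB] by simp
  have le: "1 / 2 * (Good (fst q) (snd q) + Good (snd q) (fst q)) \<le> ?R q" for q
    using pointwise_bound[of "fst q" "snd q"] by linarith
  have R0: "0 \<le> ?R q" for q
    by (rule order_trans[OF _ le]) (use Good_nonneg in simp)
  have "(\<integral>\<^sup>+q. ennreal (Good (fst q) (snd q)) \<partial>?M) + (\<integral>\<^sup>+q. ennreal (Good (snd q) (fst q)) \<partial>?M) =
      (\<integral>\<^sup>+q. ennreal (Good (fst q) (snd q)) + ennreal (Good (snd q) (fst q)) \<partial>?M)"
    by (rule nn_integral_add[symmetric]) (auto simp: Good_def)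
  also have "\<dots> \<le> (\<integral>\<^sup>+q. ennreal 2 * ennreal (?R q) \<partial>?M)"
  proof (rule nn_integral_mono)
    fix q
    have "ennreal (Good (fst q) (snd q) + Good (snd q) (fst q)) \<le> ennreal (2 * ?R q)"
      by (rule ennreal_leI, rule order_trans[OF _ mult_left_mono[OF le[of q], of 2]]) simp_all
    then show "ennreal (Good (fst q) (snd q)) + ennreal (Good (snd q) (fst q)) \<le> ennreal 2 * ennreal (?R q)"
      using R0[of q] Good_nonneg by (simp only: ennreal_plus ennreal_mult zero_le_numeral)
  qed
  also have "\<dots> = ennreal 2 * (\<integral>\<^sup>+q. ennreal (?R q) \<partial>?M)" by (rule nn_integral_cmult) (use iR in measurable)
  also have "(\<integral>\<^sup>+q. ennreal (?R q) \<partial>?M) = ennreal (\<integral>q. ?R q \<partial>?M)"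
    by (rule nn_integral_eq_integral[OF iR]) (use R0 in simp)
  also have "\<dots> \<le> ennreal (2 * CB)" unfolding IR using B by (intro ennreal_leI) simp
  finally have "ennreal 2 * (\<integral>\<^sup>+q. ennreal (Good (fst q) (snd q)) \<partial>?M) \<le> ennreal 2 * ennreal (2 * CB)"
    unfolding swapn by (simp add: mult_2[symmetric] mult_left_mono)
  then show ?thesis by (simp add: ennreal_mult_le_mult_iff)
qed

end

section \<open>Uniform integrability of the regularised kernels\<close>

lemma Lam_le_powr:
  assumes "x \<noteq> 0" "\<delta> \<ge> 0" "a > 0"
  shows "Lam a \<delta> x \<le> 8 * a powr (1 / 8) * norm x powr (- 1 / 4)"
proof -
  define y where "y = a / (norm x)\<^sup>2"
  have n: "norm x > 0" using assms by simp
  have y: "y > 0" using assms by (simp add: y_def)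
  have "Lam a \<delta> x \<le> ln y"
    unfolding Lam_def y_def using assms n by (intro ln_mono divide_left_mono mult_pos_pos add_pos_nonneg divide_pos_pos) auto
  also have "ln y = 8 * ln (y powr (1 / 8))" using y by (simp add: ln_powr)
  also have "\<dots> \<le> 8 * y powr (1 / 8)" using ln_le_minus_one[of "y powr (1 / 8)"] y by simp
  also have "y powr (1 / 8) = a powr (1 / 8) * norm x powr (- 1 / 4)"
  proof -
    have "((norm x)\<^sup>2) powr (1 / 8) = norm x powr (1 / 4)"
      using n by (simp add: powr_powr flip: powr_numeral)
    then show ?thesis
      unfolding y_def using n assms by (simp add: powr_divide powr_minus_divide)
  qed
  finally show ?thesis by simp
qed

text \<open>As \<open>q\<close> grows by a factor \<open>v\<close>, the factor \<open>ln (a / q) powr (- \<kappa>)\<close> grows by at most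
  \<open>(1 + ln v / L) powr \<kappa> \<le> v powr (\<kappa> / L)\<close>, which \<open>q powr (- 1 / 2)\<close> compensates.\<close>

lemma ker_antimono:
  assumes "x \<noteq> 0" "\<delta> \<ge> 0" "\<kappa> \<ge> 0" "2 * \<kappa> \<le> Lam a \<delta> x" "(norm x)\<^sup>2 + \<delta> < a"
  shows "ker a (- \<kappa>) \<delta> x \<le> ker a (- \<kappa>) 0 x"
proof -
  define q0 q where "q0 = (norm x)\<^sup>2" and "q = q0 + \<delta>"
  define L L0 where "L = Lam a \<delta> x" and "L0 = Lam a 0 x"
  have q: "0 < q0" "q0 \<le> q" "q < a" using assms by (auto simp: q0_def q_def)
  have L: "L = ln (a / q)" "L0 = ln (a / q0)" by (simp_all add: L_def L0_def Lam_def q0_def q_def)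
  have Lp: "L > 0" unfolding L using q by (intro ln_gt_zero) simp
  have LL: "L0 = L + ln (q / q0)" unfolding L using q by (simp add: ln_div)
  have l0: "0 \<le> ln (q / q0)" using q by (intro ln_ge_zero) simp
  have L0p: "L0 > 0" using LL l0 Lp by simp
  have "(L0 / L) powr \<kappa> \<le> exp (ln (q / q0) / L) powr \<kappa>"
  proof (intro powr_mono2)
    have "L0 / L = 1 + ln (q / q0) / L" using LL Lp by (simp add: field_simps)
    then show "L0 / L \<le> exp (ln (q / q0) / L)" using exp_ge_add_one_self[of "ln (q / q0) / L"] by simp
  qed (use assms L0p Lp in auto)
  also have "\<dots> = exp (\<kappa> / L * ln (q / q0))" by (simp add: powr_def)
  also have "\<dots> \<le> exp (1 / 2 * ln (q / q0))"
    using assms(4) Lp l0 by (subst exp_le_cancel_iff, intro mult_right_mono) (auto simp: L_def field_simps)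
  also have "\<dots> = sqrt q / sqrt q0"
    using q by (simp add: powr_half_sqrt[symmetric] powr_divide[symmetric] powr_def[of "q / q0"])
  finally have "L0 powr \<kappa> / L powr \<kappa> \<le> sqrt q / sqrt q0" using L0p Lp by (simp add: powr_divide)
  then have "1 / (L powr \<kappa> * sqrt q) \<le> 1 / (L0 powr \<kappa> * sqrt q0)"
    using q L0p Lp by (simp add: divide_simps mult.commute)
  then show ?thesis
    by (simp add: ker_def L_def[symmetric] L0_def[symmetric] q_def q0_def powr_minus_divide)
qed

text \<open>The noncritical bounds waste the logarithm: an eighth root in a / |x|^2 dominates it, so
  the integrands are of order |x|^(-1) and |x|^(-11/4), both integrable in three dimensions. In the
  critical bound every logarithm counts, and \<delta> is removed by monotonicity first.\<close>

lemma log_kernel_exists: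
  assumes D: "D > 0" and a: "a = (D\<^sup>2 + 1) * exp 4" and s: "0 < s" "s < 4 / 3"
  obtains I where "log_kernel a s D I"
proof -
  have [measurable]: "cball (0 :: R3) D \<in> sets borel" by simp
  note a0 = kernel_scale[OF a]
  define M where "M = 8 * a powr (1 / 8)"
  have M: "M \<ge> 0" by (simp add: M_def)
  define J where "J p = (\<integral>\<^sup>+x. ennreal (norm x powr (- p)) * indicator (cball 0 D) x \<partial>(lborel :: R3 measure))" for p
  define J0 where "J0 = (\<integral>\<^sup>+x. ennreal (1 ^ 3) * indicator (cball (0 :: R3) D) x)"
  \<comment> \<open>The exponent 3 (s - 5/3) equals -1 - (4 - 3 s); its excess over the borderline
    is positive exactly when s < 4/3.\<close>
  define J3 where "J3 = (\<integral>\<^sup>+x. ennreal (norm x powr (- 3) * ln (a / (norm x)\<^sup>2) powr (- 1 - (4 - 3 * s))) * indicator (cball 0 D) x \<partial>(lborel :: R3 measure))"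
  have J0f: "J0 < \<infinity>" unfolding J0_def using emeasure_lborel_cball_finite[of "0 :: R3" D] by (simp add: less_top)
  have Jf: "J 1 < \<infinity>" "J (11 / 4) < \<infinity>" unfolding J_def by (intro powr_kernel_integrable D; simp)+
  have J3f: "J3 < \<infinity>" unfolding J3_def by (rule log_kernel_integrable) (use D a0 s in auto)
  define S where "S = J0 + ennreal (M ^ 4) * J 1 + J3 + ennreal (M ^ 3) * J (11 / 4)"
  have Sf: "S < \<infinity>" unfolding S_def using J0f Jf J3f by (simp add: ennreal_mult_less_top)
  have S: "ennreal (enn2real S) = S" using Sf by simp
  have bound: "(\<integral>\<^sup>+x. ennreal ((Lam a \<delta> x powr s) ^ 3) * indicator (cball 0 D) x) \<le> S"
    "(\<integral>\<^sup>+x. ennreal (ker a (s - 5 / 3) \<delta> x ^ 3) * indicator (cball 0 D) x) \<le> S"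
    "(\<integral>\<^sup>+x. ennreal ((ker a s \<delta> x)\<^sup>2) * indicator (cball 0 D) x) \<le> S"
    if \<delta>: "0 < \<delta>" "\<delta> \<le> 1" for \<delta>
  proof -
    have L4: "4 \<le> Lam a \<delta> x" "(norm x)\<^sup>2 + \<delta> < a" if "norm x \<le> D" for x
      using Lam_ge_4[OF a \<delta> that] by auto
    have "(\<integral>\<^sup>+x. ennreal ((Lam a \<delta> x powr s) ^ 3) * indicator (cball 0 D) x) \<le>
        (\<integral>\<^sup>+x. ennreal (M ^ 4) * (ennreal (norm x powr (- 1)) * indicator (cball (0 :: R3) D) x))"
    proof (rule nn_integral_mono_AE)
      show "AE x in lborel. ennreal ((Lam a \<delta> x powr s) ^ 3) * indicator (cball 0 D) x \<le>
          ennreal (M ^ 4) * (ennreal (norm x powr (- 1)) * indicator (cball (0 :: R3) D) x)"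
        using AE_lborel_singleton[of "0 :: R3"]
      proof eventually_elim
        case (elim x)
        show ?case
        proof (cases "norm x \<le> D")
          case True
          have L: "4 \<le> Lam a \<delta> x" using L4 True by simp
          have "(Lam a \<delta> x powr s) ^ 3 = Lam a \<delta> x powr (3 * s)" using L by (simp add: powr_power mult.commute)
          also have "\<dots> \<le> Lam a \<delta> x powr 4" using L s by (intro powr_mono) auto
          also have "\<dots> = Lam a \<delta> x ^ 4" using L by (simp add: powr_numeral)
          also have "\<dots> \<le> (M * norm x powr (- 1 / 4)) ^ 4"
            unfolding M_def using L elim \<delta> a0 by (intro power_mono Lam_le_powr) auto
          also have "\<dots> = M ^ 4 * norm x powr (- 1)"
            using elim by (simp add: power_mult_distrib powr_power)
          finally show ?thesis using True M by (simp add: ennreal_mult[symmetric] ennreal_leI)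
        qed simp
      qed
    qed
    also have "\<dots> = ennreal (M ^ 4) * J 1" unfolding J_def by (rule nn_integral_cmult) measurable
    also have "\<dots> \<le> S" unfolding S_def by (intro add_increasing2[OF zero_le] add_increasing[OF zero_le]) simp
    finally show "(\<integral>\<^sup>+x. ennreal ((Lam a \<delta> x powr s) ^ 3) * indicator (cball 0 D) x) \<le> S" .
    have "(\<integral>\<^sup>+x. ennreal ((ker a s \<delta> x)\<^sup>2) * indicator (cball 0 D) x) \<le>
        (\<integral>\<^sup>+x. ennreal (M ^ 3) * (ennreal (norm x powr (- (11 / 4))) * indicator (cball (0 :: R3) D) x))"
    proof (rule nn_integral_mono_AE)
      show "AE x in lborel. ennreal ((ker a s \<delta> x)\<^sup>2) * indicator (cball 0 D) x \<le>
          ennreal (M ^ 3) * (ennreal (norm x powr (- (11 / 4))) * indicator (cball (0 :: R3) D) x)"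
        using AE_lborel_singleton[of "0 :: R3"]
      proof eventually_elim
        case (elim x)
        show ?case
        proof (cases "norm x \<le> D")
          case True
          have L: "4 \<le> Lam a \<delta> x" using L4 True by simp
          have n: "norm x > 0" using elim by simp
          have "(ker a s \<delta> x)\<^sup>2 = Lam a \<delta> x powr (2 * s) / ((norm x)\<^sup>2 + \<delta>)"
            unfolding ker_def power_divide using L \<delta> by (simp add: powr_power mult.commute)
          also have "\<dots> \<le> Lam a \<delta> x powr 3 / (norm x)\<^sup>2"
            using L s n \<delta> by (intro frac_le powr_mono) auto
          also have "\<dots> = Lam a \<delta> x ^ 3 / (norm x)\<^sup>2" using L by (simp add: powr_numeral)
          also have "\<dots> \<le> (M * norm x powr (- 1 / 4)) ^ 3 / (norm x)\<^sup>2"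
            unfolding M_def using L elim \<delta> a0 by (intro divide_right_mono power_mono Lam_le_powr) auto
          also have "\<dots> = M ^ 3 * (norm x powr (- 3 / 4) / norm x powr 2)"
            using n by (simp add: power_mult_distrib powr_power powr_numeral)
          also have "norm x powr (- 3 / 4) / norm x powr 2 = norm x powr (- (11 / 4))"
            unfolding powr_diff[symmetric] by simp
          finally show ?thesis using True M by (simp add: ennreal_mult[symmetric] ennreal_leI)
        qed simp
      qed
    qed
    also have "\<dots> = ennreal (M ^ 3) * J (11 / 4)" unfolding J_def by (rule nn_integral_cmult) measurable
    also have "\<dots> \<le> S" unfolding S_def by (intro add_increasing[OF zero_le]) simp
    finally show "(\<integral>\<^sup>+x. ennreal ((ker a s \<delta> x)\<^sup>2) * indicator (cball 0 D) x) \<le> S" .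
    have "(\<integral>\<^sup>+x. ennreal (ker a (s - 5 / 3) \<delta> x ^ 3) * indicator (cball 0 D) x) \<le> J3"
      unfolding J3_def
    proof (rule nn_integral_mono_AE)
      show "AE x in lborel. ennreal (ker a (s - 5 / 3) \<delta> x ^ 3) * indicator (cball 0 D) x \<le>
          ennreal (norm x powr (- 3) * ln (a / (norm x)\<^sup>2) powr (- 1 - (4 - 3 * s))) * indicator (cball 0 D) x"
        using AE_lborel_singleton[of "0 :: R3"]
      proof eventually_elim
        case (elim x)
        show ?case
        proof (cases "norm x \<le> D")
          case True
          have L: "4 \<le> Lam a \<delta> x" using L4 True by simp
          have n: "norm x > 0" using elim by simp
          have L0: "Lam a 0 x > 0"
            unfolding Lam_def using n L4(2)[OF True] \<delta> by (intro ln_gt_zero) (simp add: less_divide_eq)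
          have "ker a (- (5 / 3 - s)) \<delta> x \<le> ker a (- (5 / 3 - s)) 0 x"
            by (rule ker_antimono) (use elim \<delta> s L L4(2)[OF True] in auto)
          then have "ker a (s - 5 / 3) \<delta> x ^ 3 \<le> ker a (s - 5 / 3) 0 x ^ 3"
            using \<delta> by (intro power_mono) (auto simp: ker_def)
          also have "\<dots> = Lam a 0 x powr (3 * (s - 5 / 3)) / norm x ^ 3"
            unfolding ker_def power_divide using L0 by (simp add: powr_power mult.commute)
          also have "3 * (s - 5 / 3) = - 1 - (4 - 3 * s)" by simp
          also have "Lam a 0 x powr (- 1 - (4 - 3 * s)) / norm x ^ 3 = norm x powr (- 3) * ln (a / (norm x)\<^sup>2) powr (- 1 - (4 - 3 * s))"
            using n by (simp add: Lam_def powr_minus_divide powr_numeral)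
          finally show ?thesis using True by (simp add: ennreal_leI)
        qed simp
      qed
    qed
    also have "\<dots> \<le> S" unfolding S_def by (intro add_increasing2[OF zero_le] add_increasing[OF zero_le]) simp
    finally show "(\<integral>\<^sup>+x. ennreal (ker a (s - 5 / 3) \<delta> x ^ 3) * indicator (cball 0 D) x) \<le> S" .
  qed
  have "J0 \<le> S" by (simp add: S_def add.assoc)
  then show ?thesis
    by (intro that[of "enn2real S"] log_kernel.intro) (use D a s bound in \<open>simp_all add: S J0_def\<close>)
qed

section \<open>Cut-off functions\<close>

lemma bump_derivative_bounds: "0 \<le> bump [:0, 0, 1:] s" "bump [:0, 0, 1:] s \<le> 2"
proof -
  have "y * y * exp (- y) \<le> 2" if "y \<ge> 0" for y :: real
  proof -
    have "y * y \<le> 2 * exp y" using exp_lower_Taylor_quadratic[OF that] that by (simp add: power2_eq_square)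
    then show ?thesis by (simp add: exp_minus field_simps)
  qed
  from this[of "1 / s"] show "0 \<le> bump [:0, 0, 1:] s" "bump [:0, 0, 1:] s \<le> 2"
    by (auto simp: bump_def)
qed

lemma bump_continuous: "continuous_on S (bump p)"
  by (rule DERIV_continuous_on[OF has_field_derivative_at_within[OF bump_has_real_derivative]])

lemma bump_borel [measurable]: "bump p \<in> borel_measurable borel"
  by (intro borel_measurable_continuous_onI bump_continuous)

lemma bump_1_has_real_derivative: "(bump [:1:] has_real_derivative bump [:0, 0, 1:] s) (at s)"
  using bump_has_real_derivative[of "[:1:]" s] by simp

definition cutoff :: "R3 \<times> real \<Rightarrow> real \<Rightarrow> R3 \<times> real \<Rightarrow> real" where
  "cutoff z0 R z = bump [:1:] (R\<^sup>2 - (norm (z - z0))\<^sup>2)"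

text \<open>The scalar that, multiplied by z - z0, is the space-time gradient of the
  cut-off.\<close>

definition cutoff' :: "R3 \<times> real \<Rightarrow> real \<Rightarrow> R3 \<times> real \<Rightarrow> real" where
  "cutoff' z0 R z = - 2 * bump [:0, 0, 1:] (R\<^sup>2 - (norm (z - z0))\<^sup>2)"

lemma cut_measurable [measurable]: "cutoff z0 R \<in> borel_measurable borel" "cutoff' z0 R \<in> borel_measurable borel"
  unfolding cutoff_def[abs_def] cutoff'_def[abs_def] by measurable

lemma cut_bounds: "0 \<le> cutoff z0 R z" "cutoff z0 R z \<le> 1"
  by (simp_all add: cutoff_def bump_bounds)

lemma cut_off: "R \<ge> 0 \<Longrightarrow> z \<notin> cball z0 R \<Longrightarrow> cutoff z0 R z = 0"
  using power_mono[of R "norm (z - z0)" 2] by (auto simp: cutoff_def bump_def dist_norm norm_minus_commute not_less)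

lemma cut_has_derivative:
  "(cutoff z0 R has_derivative (\<lambda>v. fst v \<bullet> (cutoff' z0 R z *\<^sub>R fst (z - z0)) + snd v * (cutoff' z0 R z * snd (z - z0)))) (at z)"
proof -
  have d: "((\<lambda>z. R\<^sup>2 - (norm (z - z0))\<^sup>2) has_derivative (\<lambda>v. - 2 * (v \<bullet> (z - z0)))) (at z)"
    unfolding power2_norm_eq_inner by (auto intro!: derivative_eq_intros simp: inner_commute)
  have "(cutoff z0 R has_derivative (\<lambda>v. bump [:0, 0, 1:] (R\<^sup>2 - (norm (z - z0))\<^sup>2) * (- 2 * (v \<bullet> (z - z0))))) (at z)"
    unfolding cutoff_def[abs_def]
    by (rule has_derivative_compose[OF d bump_1_has_real_derivative[unfolded has_field_derivative_def]])
  then show ?thesis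
    by (simp add: cutoff'_def inner_prod_def algebra_simps)
qed

lemma cutoff'_bound:
  assumes "R \<ge> 0"
  shows "\<bar>cutoff' z0 R z * snd (z - z0)\<bar> \<le> 4 * R" "norm (cutoff' z0 R z *\<^sub>R fst (z - z0)) \<le> 4 * R"
proof -
  have b: "\<bar>cutoff' z0 R z\<bar> * norm (z - z0) \<le> 4 * R"
  proof (cases "norm (z - z0) \<le> R")
    case True
    have "\<bar>cutoff' z0 R z\<bar> \<le> 4" using bump_derivative_bounds by (simp add: cutoff'_def)
    then show ?thesis using True by (intro mult_mono) auto
  next
    case False
    then have "R\<^sup>2 \<le> (norm (z - z0))\<^sup>2" using assms by (intro power_mono) auto
    then have "\<not> 0 < R\<^sup>2 - (norm (z - z0))\<^sup>2" by linarith
    then have "cutoff' z0 R z = 0" unfolding cutoff'_def bump_def by (simp only: if_False mult_zero_right)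
    then show ?thesis using assms by simp
  qed
  have d: "\<bar>snd d\<bar> \<le> norm d" "norm (fst d) \<le> norm d" for d :: "R3 \<times> real"
    using norm_snd_le[of "snd d" "fst d"] norm_fst_le[of "fst d" "snd d"] by simp_all
  show "\<bar>cutoff' z0 R z * snd (z - z0)\<bar> \<le> 4 * R"
    unfolding abs_mult by (rule order_trans[OF mult_left_mono[OF d(1) abs_ge_zero] b])
  show "norm (cutoff' z0 R z *\<^sub>R fst (z - z0)) \<le> 4 * R"
    unfolding norm_scaleR real_norm_def by (rule order_trans[OF mult_left_mono[OF d(2) abs_ge_zero] b])
qed

definition mass :: "real \<Rightarrow> real" where
  "mass \<eta> = (\<integral>\<tau>. bump [:1:] (\<eta>\<^sup>2 - \<tau>\<^sup>2) \<partial>lborel)"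

definition mol :: "real \<Rightarrow> real \<Rightarrow> real" where
  "mol \<eta> \<tau> = bump [:1:] (\<eta>\<^sup>2 - \<tau>\<^sup>2) / mass \<eta>"

definition mol' :: "real \<Rightarrow> real \<Rightarrow> real" where
  "mol' \<eta> \<tau> = bump [:0, 0, 1:] (\<eta>\<^sup>2 - \<tau>\<^sup>2) * (- 2 * \<tau>) / mass \<eta>"

lemma mol_measurable [measurable]: "mol \<eta> \<in> borel_measurable borel" "mol' \<eta> \<in> borel_measurable borel"
  unfolding mol_def[abs_def] mol'_def[abs_def] by measurable

lemma mol_even: "mol \<eta> (- \<tau>) = mol \<eta> \<tau>"
  by (simp add: mol_def)

lemma mol_has_derivative: "(mol \<eta> has_real_derivative mol' \<eta> \<tau>) (at \<tau>)"
proof -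
  have d: "((\<lambda>\<tau>. \<eta>\<^sup>2 - \<tau>\<^sup>2) has_real_derivative (- 2 * \<tau>)) (at \<tau>)" by (auto intro!: derivative_eq_intros)
  show ?thesis
    unfolding mol_def[abs_def] mol'_def
    by (intro DERIV_cdivide DERIV_chain2[OF bump_1_has_real_derivative d])
qed

context
  fixes \<eta> :: real
  assumes eta: "\<eta> > 0"
begin

lemma mol_off_aux: "\<tau> \<notin> {- \<eta>..\<eta>} \<Longrightarrow> \<eta>\<^sup>2 - \<tau>\<^sup>2 \<le> 0"
  using eta abs_le_square_iff[of \<eta> \<tau>] by (auto simp: abs_if split: if_splits)

lemma mol_off: "\<bar>\<tau>\<bar> > \<eta> \<Longrightarrow> mol \<eta> \<tau> = 0" "\<bar>\<tau>\<bar> > \<eta> \<Longrightarrow> mol' \<eta> \<tau> = 0"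
  using mol_off_aux[of \<tau>] by (auto simp: mol_def mol'_def bump_def abs_if split: if_splits)

lemma mass_integrable: "integrable lborel (\<lambda>\<tau>. bump [:1:] (\<eta>\<^sup>2 - \<tau>\<^sup>2))"
proof (rule integrable_compact_support)
  show "continuous_on UNIV (\<lambda>\<tau>. bump [:1:] (\<eta>\<^sup>2 - \<tau>\<^sup>2))"
    by (intro continuous_on_compose2[OF bump_continuous[of UNIV]] continuous_intros) auto
  show "bump [:1:] (\<eta>\<^sup>2 - \<tau>\<^sup>2) = 0" if "\<tau> \<notin> {- \<eta>..\<eta>}" for \<tau>
    using mol_off_aux[OF that] by (simp add: bump_def)
qed simp

lemma mass_pos: "mass \<eta> > 0"
proof -
  define e where "e = exp (- 1 / (\<eta>\<^sup>2 / 2))"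
  have "0 < e * \<eta>" using eta by (simp add: e_def)
  also have "e * \<eta> = (\<integral>\<tau>. indicator {- \<eta> / 2..\<eta> / 2} \<tau> * e \<partial>lborel)" using eta by simp
  also have "\<dots> \<le> mass \<eta>"
    unfolding mass_def
  proof (rule integral_mono)
    show "integrable lborel (\<lambda>\<tau>. indicator {- \<eta> / 2..\<eta> / 2} \<tau> * e)"
      by (intro integrable_mult_left integrable_real_indicator emeasure_bounded_finite) auto
    show "integrable lborel (\<lambda>\<tau>. bump [:1:] (\<eta>\<^sup>2 - \<tau>\<^sup>2))" by (rule mass_integrable)
    fix \<tau> :: real
    show "indicator {- \<eta> / 2..\<eta> / 2} \<tau> * e \<le> bump [:1:] (\<eta>\<^sup>2 - \<tau>\<^sup>2)"
    proof (cases "\<tau> \<in> {- \<eta> / 2..\<eta> / 2}")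
      case True
      then have "\<bar>\<tau>\<bar> \<le> \<bar>\<eta> / 2\<bar>" using eta by (auto simp: abs_le_iff)
      then have "\<tau>\<^sup>2 \<le> (\<eta> / 2)\<^sup>2" by (simp only: abs_le_square_iff)
      then have "\<tau>\<^sup>2 \<le> \<eta>\<^sup>2 / 4" by (simp add: power_divide)
      then have "\<eta>\<^sup>2 / 2 \<le> \<eta>\<^sup>2 - \<tau>\<^sup>2" using zero_le_power2[of \<tau>] by linarith
      moreover have "\<eta>\<^sup>2 > 0" using eta by simp
      ultimately have "0 < \<eta>\<^sup>2 - \<tau>\<^sup>2" "1 / (\<eta>\<^sup>2 - \<tau>\<^sup>2) \<le> 1 / (\<eta>\<^sup>2 / 2)"
        by (linarith, intro frac_le) auto
      then show ?thesis using True unfolding bump_def e_def by simp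
    qed (simp add: bump_bounds)
  qed
  finally show ?thesis .
qed

lemma mol_nonneg: "0 \<le> mol \<eta> \<tau>"
  unfolding mol_def using mass_pos bump_bounds by (intro divide_nonneg_nonneg) auto

lemma mol_integral: "(\<integral>\<^sup>+\<tau>. ennreal (mol \<eta> \<tau>) \<partial>lborel) = 1"
proof -
  have "(\<integral>\<^sup>+\<tau>. ennreal (mol \<eta> \<tau>) \<partial>lborel) = ennreal (\<integral>\<tau>. mol \<eta> \<tau> \<partial>lborel)"
    by (rule nn_integral_eq_integral) (use mass_integrable mol_nonneg in \<open>auto simp: mol_def\<close>)
  also have "(\<integral>\<tau>. mol \<eta> \<tau> \<partial>lborel) = mass \<eta> / mass \<eta>"
    unfolding mol_def[abs_def] by (simp add: mass_def)
  finally show ?thesis using mass_pos by simp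
qed

lemma mol_le: "mol \<eta> \<tau> \<le> 1 / mass \<eta>" "\<bar>mol' \<eta> \<tau>\<bar> \<le> 4 * \<eta> / mass \<eta>"
proof -
  show "mol \<eta> \<tau> \<le> 1 / mass \<eta>"
    unfolding mol_def using mass_pos bump_bounds by (intro divide_right_mono) auto
  show "\<bar>mol' \<eta> \<tau>\<bar> \<le> 4 * \<eta> / mass \<eta>"
  proof (cases "\<bar>\<tau>\<bar> \<le> \<eta>")
    case True
    have "\<bar>bump [:0, 0, 1:] (\<eta>\<^sup>2 - \<tau>\<^sup>2) * (- 2 * \<tau>)\<bar> \<le> 2 * (2 * \<eta>)"
      using bump_derivative_bounds True by (intro abs_mult_le) (auto simp: abs_le_iff)
    then show ?thesis
      unfolding mol'_def abs_divide using mass_pos by (simp add: divide_right_mono)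
  next
    case False
    then show ?thesis using mol_off(2)[of \<tau>] mass_pos eta by simp
  qed
qed

end

section \<open>The logarithmic kernel is smooth\<close>

text \<open>Real powers and the square root are rewritten with exp and ln. The expression agrees
  with \<open>ker\<close> on \<open>U\<close>, where q lies between 0 and a and the inner logarithm
  is positive.\<close>

lemma elem_smooth_ker:
  assumes "\<And>i. elem_smooth U (\<lambda>z. y z $ i)" "\<delta> > 0" "\<And>z. z \<in> U \<Longrightarrow> (norm (y z))\<^sup>2 + \<delta> < a"
  obtains h where "elem_smooth U h" "\<And>z. z \<in> U \<Longrightarrow> h z = ker a s \<delta> (y z)"
proof -
  define q where "q z = (\<Sum>i\<in>UNIV. y z $ i * y z $ i) + \<delta>" for z
  have q: "q z = (norm (y z))\<^sup>2 + \<delta>" for z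
    by (simp add: q_def power2_norm_eq_inner inner_vec_def)
  have qp: "q z > 0" for z unfolding q using assms(2) by (simp add: add_nonneg_pos)
  have qa: "q z < a" if "z \<in> U" for z unfolding q by (rule assms(3)[OF that])
  have eq: "elem_smooth U q"
    unfolding q_def[abs_def] by (intro elem_smooth.add elem_smooth_sum elem_smooth.mult elem_smooth.const assms(1)) simp
  have eL: "elem_smooth U (\<lambda>z. ln (a * inverse (q z)))"
  proof (intro elem_smooth.ln elem_smooth.mult elem_smooth.const elem_smooth.inverse eq)
    fix z assume "z \<in> U"
    then show "0 < a * inverse (q z)" "q z \<noteq> 0" using qa[of z] qp[of z] by auto
  qed
  have Lp: "ln (a * inverse (q z)) > 0" if "z \<in> U" for z
    using qa[OF that] qp[of z] by (intro ln_gt_zero) (simp add: field_simps)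
  define h where "h z = exp (s * ln (ln (a * inverse (q z)))) * exp ((- 1 / 2) * ln (q z))" for z
  show ?thesis
  proof
    show "elem_smooth U h"
      unfolding h_def[abs_def]
      by (rule elem_smooth.mult[OF elem_smooth.exp[OF elem_smooth.mult[OF elem_smooth.const elem_smooth.ln[OF eL Lp]]]
            elem_smooth.exp[OF elem_smooth.mult[OF elem_smooth.const elem_smooth.ln[OF eq qp]]]])
    show "h z = ker a s \<delta> (y z)" if "z \<in> U" for z
    proof -
      have "exp ((- 1 / 2) * ln (q z)) = 1 / sqrt (q z)"
      proof -
        have "exp ((- 1 / 2) * ln (q z)) = q z powr (- (1 / 2))" unfolding powr_def using qp[of z] by simp
        also have "\<dots> = 1 / sqrt (q z)" using qp[of z] by (simp only: powr_minus_divide powr_half_sqrt less_imp_le)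
        finally show ?thesis .
      qed
      moreover have "Lam a \<delta> (y z) = ln (a * inverse (q z))" by (simp add: Lam_def q divide_inverse)
      ultimately show ?thesis
        unfolding h_def ker_def q[symmetric] powr_def using Lp[OF that] by simp
    qed
  qed
qed

lemma elem_smooth_fst_nth: "elem_smooth U (\<lambda>z :: R3 \<times> real. fst z $ i)"
  using elem_smooth.inner[of U "(axis i 1, 0) :: R3 \<times> real"] by (simp add: inner_prod_def)

lemma elem_smooth_snd: "elem_smooth U (\<lambda>z :: R3 \<times> real. snd z)"
  using elem_smooth.inner[of U "(0, 1) :: R3 \<times> real"] by (simp add: inner_prod_def)

lemma elem_smooth_cut: "elem_smooth U (cutoff z0 R)"
proof -
  have "(norm (z - z0))\<^sup>2 = (\<Sum>i\<in>UNIV. (fst z $ i - fst z0 $ i) * (fst z $ i - fst z0 $ i)) + (snd z - snd z0) * (snd z - snd z0)" for z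
    by (simp add: power2_norm_eq_inner inner_prod_def inner_vec_def)
  then have e: "cutoff z0 R = (\<lambda>z. bump [:1:] (R\<^sup>2 - ((\<Sum>i\<in>UNIV. (fst z $ i - fst z0 $ i) * (fst z $ i - fst z0 $ i)) + (snd z - snd z0) * (snd z - snd z0))))"
    unfolding cutoff_def by presburger
  have 1: "elem_smooth U (\<lambda>z. fst z $ i - fst z0 $ i)" for i
    by (rule elem_smooth_diff[OF elem_smooth_fst_nth elem_smooth.const])
  have 2: "elem_smooth U (\<lambda>z. snd z - snd z0)" by (rule elem_smooth_diff[OF elem_smooth_snd elem_smooth.const])
  have 3: "elem_smooth U (\<lambda>z. \<Sum>i\<in>UNIV. (fst z $ i - fst z0 $ i) * (fst z $ i - fst z0 $ i))"
    by (rule elem_smooth_sum[OF finite elem_smooth.mult[OF 1 1]])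
  show ?thesis
    unfolding e by (rule elem_smooth.bump[OF elem_smooth_diff[OF elem_smooth.const elem_smooth.add[OF 3 elem_smooth.mult[OF 2 2]]]])
qed

lemma elem_smooth_mol:
  assumes "elem_smooth U \<tau>"
  shows "elem_smooth U (\<lambda>z. mol \<eta> (\<tau> z))"
proof -
  have e: "(\<lambda>z. mol \<eta> (\<tau> z)) = (\<lambda>z. bump [:1:] (\<eta>\<^sup>2 - \<tau> z * \<tau> z) * inverse (mass \<eta>))"
    by (simp add: mol_def divide_inverse power2_eq_square)
  show ?thesis
    unfolding e
    by (rule elem_smooth.mult[OF elem_smooth.bump[OF elem_smooth_diff[OF elem_smooth.const elem_smooth.mult[OF assms assms]]] elem_smooth.const])
qed

lemma smooth_on_cong: "open U \<Longrightarrow> (\<And>x. x \<in> U \<Longrightarrow> f x = g x) \<Longrightarrow> smooth_on U f \<Longrightarrow> smooth_on U g"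
  unfolding smooth_on_def by (intro allI Ck_on_cong[of U f g]) simp_all

lemma kjac_measurable [measurable]: "kjac a s \<delta> \<in> borel_measurable borel"
  by (rule borel_measurable_matI) measurable

context energy_flow
begin

text \<open>Test functions must be smooth on a neighbourhood of the closed cylinder, but the kernel
  is smooth only while its logarithm is positive. The gap between D^2 + \<delta> and
  \<open>a\<close> provides such a neighbourhood.\<close>

lemma smooth_kernel_domain:
  assumes D: "\<And>x y. x \<in> \<Omega> \<Longrightarrow> y \<in> \<Omega> \<Longrightarrow> norm (x - y) \<le> D" and a: "D\<^sup>2 + \<delta> < a" and w: "w \<in> Q"
  shows "open {z :: R3 \<times> real. (norm (fst z - fst w))\<^sup>2 + \<delta> < a}" "closure Q \<subseteq> {z. (norm (fst z - fst w))\<^sup>2 + \<delta> < a}"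
proof -
  show "open {z :: R3 \<times> real. (norm (fst z - fst w))\<^sup>2 + \<delta> < a}"
    by (intro open_Collect_less continuous_intros)
  have "closure Q \<subseteq> {z. norm (fst z - fst w) \<le> D}"
  proof (rule closure_minimal)
    show "Q \<subseteq> {z. norm (fst z - fst w) \<le> D}" using D w by (auto simp: cylinder_def)
    show "closed {z :: R3 \<times> real. norm (fst z - fst w) \<le> D}" by (intro closed_Collect_le continuous_intros)
  qed
  also have "\<dots> \<subseteq> {z. (norm (fst z - fst w))\<^sup>2 + \<delta> < a}"
  proof
    fix z :: "R3 \<times> real" assume "z \<in> {z. norm (fst z - fst w) \<le> D}"
    then have "(norm (fst z - fst w))\<^sup>2 \<le> D\<^sup>2" by (intro power_mono) auto
    then show "z \<in> {z. (norm (fst z - fst w))\<^sup>2 + \<delta> < a}" using a by simp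
  qed
  finally show "closure Q \<subseteq> {z. (norm (fst z - fst w))\<^sup>2 + \<delta> < a}" .
qed

lemma smooth_momentum_test:
  assumes "\<And>x y. x \<in> \<Omega> \<Longrightarrow> y \<in> \<Omega> \<Longrightarrow> norm (x - y) \<le> D" "D\<^sup>2 + \<delta> < a" "\<delta> > 0" "w \<in> Q"
  shows "\<exists>U. open U \<and> closure Q \<subseteq> U \<and>
    smooth_on U (\<lambda>z. (cutoff z0 R z * mol \<eta> (snd z - snd w)) *\<^sub>R kvec a s \<delta> (fst z - fst w))"
proof -
  define U :: "(R3 \<times> real) set" where "U = {z. (norm (fst z - fst w))\<^sup>2 + \<delta> < a}"
  have U: "open U" "closure Q \<subseteq> U"
    unfolding U_def by (rule smooth_kernel_domain[OF assms(1,2,4)]; assumption)+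
  have y: "elem_smooth U (\<lambda>z. (fst z - fst w) $ i)" for i
    using elem_smooth_diff[OF elem_smooth_fst_nth elem_smooth.const] by simp
  obtain h where h: "elem_smooth U h" "\<And>z. z \<in> U \<Longrightarrow> h z = ker a s \<delta> (fst z - fst w)"
    using elem_smooth_ker[OF y assms(3), of a s] by (auto simp: U_def)
  have m: "elem_smooth U (\<lambda>z. mol \<eta> (snd z - snd w))"
    by (rule elem_smooth_mol[OF elem_smooth_diff[OF elem_smooth_snd elem_smooth.const]])
  have e: "elem_smooth U (\<lambda>z. ((cutoff z0 R z * mol \<eta> (snd z - snd w)) *\<^sub>R (h z *\<^sub>R (fst z - fst w))) $ i)" for i
    using elem_smooth.mult[OF elem_smooth.mult[OF elem_smooth_cut m] elem_smooth.mult[OF h(1) y]] by (simp add: mult.assoc)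
  have "smooth_on U (\<lambda>z. (cutoff z0 R z * mol \<eta> (snd z - snd w)) *\<^sub>R (h z *\<^sub>R (fst z - fst w)))"
    by (rule elem_smooth_vec_smooth_on[OF U(1) e])
  then have "smooth_on U (\<lambda>z. (cutoff z0 R z * mol \<eta> (snd z - snd w)) *\<^sub>R kvec a s \<delta> (fst z - fst w))"
    by (rule smooth_on_cong[OF U(1), rotated]) (simp add: h(2) kvec_def)
  then show ?thesis using U by (intro exI[of _ U] conjI)
qed

lemma smooth_continuity_test:
  assumes "\<And>x y. x \<in> \<Omega> \<Longrightarrow> y \<in> \<Omega> \<Longrightarrow> norm (x - y) \<le> D" "D\<^sup>2 + \<delta> < a" "\<delta> > 0" "z \<in> Q"
  shows "\<exists>U. open U \<and> closure Q \<subseteq> U \<and>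
    smooth_on U (\<lambda>w. cutoff z0 R w * mol \<eta> (snd z - snd w) * (v \<bullet> kvec a s \<delta> (fst z - fst w)))"
proof -
  define U :: "(R3 \<times> real) set" where "U = {w. (norm (fst w - fst z))\<^sup>2 + \<delta> < a}"
  have U: "open U" "closure Q \<subseteq> U"
    unfolding U_def by (rule smooth_kernel_domain[OF assms(1,2,4)]; assumption)+
  have y: "elem_smooth U (\<lambda>w. (fst z - fst w) $ i)" for i
    using elem_smooth_diff[OF elem_smooth.const elem_smooth_fst_nth] by simp
  have ya: "(norm (fst z - fst w))\<^sup>2 + \<delta> < a" if "w \<in> U" for w
    using that by (simp add: U_def norm_minus_commute)
  obtain h where h: "elem_smooth U h" "\<And>w. w \<in> U \<Longrightarrow> h w = ker a s \<delta> (fst z - fst w)"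
    using elem_smooth_ker[OF y assms(3) ya, of s] by auto
  have m: "elem_smooth U (\<lambda>w. mol \<eta> (snd z - snd w))"
    by (rule elem_smooth_mol[OF elem_smooth_diff[OF elem_smooth.const elem_smooth_snd]])
  have i: "elem_smooth U (\<lambda>w. \<Sum>i\<in>UNIV. v $ i * (fst z - fst w) $ i)"
    by (rule elem_smooth_sum[OF finite elem_smooth.mult[OF elem_smooth.const y]])
  have "smooth_on U (\<lambda>w. cutoff z0 R w * mol \<eta> (snd z - snd w) * (h w * (\<Sum>i\<in>UNIV. v $ i * (fst z - fst w) $ i)))"
    by (rule elem_smooth_smooth_on[OF U(1) elem_smooth.mult[OF elem_smooth.mult[OF elem_smooth_cut m] elem_smooth.mult[OF h(1) i]]])
  then have "smooth_on U (\<lambda>w. cutoff z0 R w * mol \<eta> (snd z - snd w) * (v \<bullet> kvec a s \<delta> (fst z - fst w)))"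
    by (rule smooth_on_cong[OF U(1), rotated]) (simp add: h(2) kvec_def inner_vec_def sum_distrib_left mult_ac)
  then show ?thesis using U by (intro exI[of _ U] conjI)
qed

text \<open>The error bound as a function of the gradient bound \<open>b\<close> of the cut-off and
  of \<open>I\<close>, free of the mollifier and of \<delta>.\<close>

definition CC where "CC b I = (2 * kap * E\<^sup>2 + 36 * IY + b * (6 + kap + c) * IH) * (E + I) + 2 * kap * (I * (vol * T + T * E))"

lemma CC_nonneg: "b \<ge> 0 \<Longrightarrow> I \<ge> 0 \<Longrightarrow> 0 \<le> CC b I"
  unfolding CC_def IY_def using kap_nonneg E_pos T_pos IH_nonneg c_nonneg vol(2)
  by (intro add_nonneg_nonneg mult_nonneg_nonneg) auto

lemma log_doubling_CB:
  assumes "log_doubling \<Omega> T \<nu>1 \<nu>2 E c p f u r G \<zeta> dt g X X' a s \<delta> B C D I b"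
  shows "log_doubling.CB \<Omega> T \<nu>1 \<nu>2 E c I b = CC b I"
  unfolding log_doubling.CB_def[OF assms] log_doubling.K0_def[OF assms] CC_def ..

end

section \<open>Localisation at a ball\<close>

locale localized_flow = energy_flow \<Omega> T \<nu>1 \<nu>2 E c p f u r G + log_kernel a s D I
  for \<Omega> T \<nu>1 \<nu>2 E c p f u r G a s D I +
  fixes z0 :: "R3 \<times> real" and R :: real
  assumes R: "R > 0" "cball z0 R \<subseteq> cylinder \<Omega> T"
    and D: "x \<in> \<Omega> \<Longrightarrow> y \<in> \<Omega> \<Longrightarrow> norm (x - y) \<le> D"
begin

text \<open>The qualitative constant \<open>B\<close> blows up as \<eta> or \<delta> tends to 0 and
  is therefore hidden behind an existential quantifier. The gradient bound \<open>1 + 4 * R\<close>,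
  which does enter the estimate, depends on the ball alone.\<close>

lemma log_doubling_cut:
  assumes \<eta>: "\<eta> > 0" and \<delta>: "0 < \<delta>" "\<delta> \<le> 1"
  shows "\<exists>B. log_doubling \<Omega> T \<nu>1 \<nu>2 E c p f u r G (cutoff z0 R) (\<lambda>z. cutoff' z0 R z * snd (z - z0)) (\<lambda>z. cutoff' z0 R z *\<^sub>R fst (z - z0))
    (mol \<eta>) (mol' \<eta>) a s \<delta> B (cball z0 R) D I (1 + 4 * R)"
proof -
  have aD': "D\<^sup>2 + \<delta> < a" using kernel_scale(2)[OF a_eq] \<delta> by linarith
  have L4: "4 \<le> Lam a \<delta> x" "(norm x)\<^sup>2 + \<delta> < a" if "norm x \<le> D" for x
    using Lam_ge_4[OF a_eq \<delta> that] by auto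
  define M where "M = ln (a / \<delta>) powr s"
  have a\<delta>: "a > 0" "\<delta> < a" using aD' zero_le_power2[of D] \<delta> kernel_scale(1)[OF a_eq] by linarith+
  have Lle: "Lam a \<delta> x \<le> ln (a / \<delta>)" for x
    unfolding Lam_def using \<delta> a\<delta> by (intro ln_mono divide_left_mono mult_pos_pos divide_pos_pos add_nonneg_pos) auto
  have M: "M \<ge> 0" by (simp add: M_def)
  have LM: "Lam a \<delta> x powr s \<le> M" if "norm x \<le> D" for x
    unfolding M_def using s Lle L4(1)[OF that] by (intro powr_mono2) auto
  have kM: "norm (kvec a s \<delta> x) \<le> M" "norm (kjac a s \<delta> x) \<le> 4 * (M / sqrt \<delta>)" if "norm x \<le> D" for x
  proof -
    have s2: "2 * s \<le> Lam a \<delta> x" using L4(1)[OF that] s by linarith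
    show "norm (kvec a s \<delta> x) \<le> M"
      using kvec_norm[OF \<delta>(1) L4(2)[OF that] s(1) s2] LM[OF that] by linarith
    have "ker a s \<delta> x \<le> M / sqrt \<delta>"
      unfolding ker_def using LM[OF that] \<delta> M by (intro frac_le real_sqrt_le_mono) auto
    then show "norm (kjac a s \<delta> x) \<le> 4 * (M / sqrt \<delta>)"
      using kjac_norm[OF \<delta>(1) L4(2)[OF that] s(1) s2] by linarith
  qed
  have mp: "mass \<eta> > 0" by (rule mass_pos[OF \<eta>])
  define B where "B = 1 + 4 * R + 1 / mass \<eta> + 4 * \<eta> / mass \<eta> + M + 4 * (M / sqrt \<delta>)"
  have nn: "0 \<le> 1 / mass \<eta>" "0 \<le> 4 * \<eta> / mass \<eta>" "0 \<le> 4 * (M / sqrt \<delta>)" "0 \<le> 4 * R"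
    using mp \<eta> M \<delta> R by auto
  have B: "1 \<le> B" "4 * R \<le> B" "1 / mass \<eta> \<le> B" "4 * \<eta> / mass \<eta> \<le> B" "M \<le> B" "4 * (M / sqrt \<delta>) \<le> B"
    unfolding B_def using nn M by linarith+
  show ?thesis
  proof (intro exI[of _ B] log_doubling.intro doubling.intro energy_flow_axioms log_kernel_axioms doubling_axioms.intro log_doubling_axioms.intro)
    show "cutoff z0 R z = 0" if "z \<notin> cball z0 R" for z by (rule cut_off) (use R that in auto)
    show "\<bar>cutoff' z0 R z * snd (z - z0)\<bar> \<le> B" "norm (cutoff' z0 R z *\<^sub>R fst (z - z0)) \<le> B" for z
      by (rule order_trans[OF cutoff'_bound(1) B(2)], use R in simp, rule order_trans[OF cutoff'_bound(2) B(2)], use R in simp)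
    show "\<bar>cutoff' z0 R z * snd (z - z0)\<bar> \<le> 1 + 4 * R" "norm (cutoff' z0 R z *\<^sub>R fst (z - z0)) \<le> 1 + 4 * R" for z
      using cutoff'_bound[of R z0 z] R by auto
    show "(cutoff z0 R has_derivative (\<lambda>v. fst v \<bullet> (cutoff' z0 R z *\<^sub>R fst (z - z0)) + snd v * (cutoff' z0 R z * snd (z - z0)))) (at z)" for z
      by (rule cut_has_derivative)
    show "mol \<eta> \<tau> \<le> B" "\<bar>mol' \<eta> \<tau>\<bar> \<le> B" for \<tau>
      by (rule order_trans[OF mol_le(1)[OF \<eta>] B(3)], rule order_trans[OF mol_le(2)[OF \<eta>] B(4)])
    show "(kvec a s \<delta> has_derivative (\<lambda>v. kjac a s \<delta> (x - y) *v v)) (at (x - y))" if "x \<in> \<Omega>" "y \<in> \<Omega>" for x y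
      by (rule kvec_has_derivative[OF \<delta>(1) L4(2)[OF D[OF that]]])
    show "norm (kvec a s \<delta> (x - y)) \<le> B" "norm (kjac a s \<delta> (x - y)) \<le> B" if "x \<in> \<Omega>" "y \<in> \<Omega>" for x y
      by (rule order_trans[OF kM(1)[OF D[OF that]] B(5)], rule order_trans[OF kM(2)[OF D[OF that]] B(6)])
    show "kjac a s \<delta> x $ i $ j = kjac a s \<delta> x $ j $ i" for x i j
      by (simp add: kjac_def tensor_def mat_def mult.commute)
    show "\<exists>U. open U \<and> closure Q \<subseteq> U \<and>
        smooth_on U (\<lambda>z. (cutoff z0 R z * mol \<eta> (snd z - snd w)) *\<^sub>R kvec a s \<delta> (fst z - fst w))" if "w \<in> Q" for w
      by (rule smooth_momentum_test[OF D aD' \<delta>(1) that])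
    show "\<exists>U. open U \<and> closure Q \<subseteq> U \<and>
        smooth_on U (\<lambda>w. cutoff z0 R w * mol \<eta> (snd z - snd w) * (v \<bullet> kvec a s \<delta> (fst z - fst w)))" if "z \<in> Q" for z v
      by (rule smooth_continuity_test[OF D aD' \<delta>(1) that])
    show "norm (x - y) \<le> D" if "x \<in> \<Omega>" "y \<in> \<Omega>" for x y by (rule D[OF that])
    show "(\<lambda>z. cutoff' z0 R z * snd (z - z0)) \<in> borel_measurable borel"
      "(\<lambda>z. cutoff' z0 R z *\<^sub>R fst (z - z0)) \<in> borel_measurable borel" by measurable
  qed (use R B(1) \<delta> in \<open>simp_all add: cut_bounds mol_nonneg[OF \<eta>] mol_even mol_has_derivative
      mol_integral[OF \<eta>] cut_measurable mol_measurable kernel_measurable kjac_measurable\<close>)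
qed

end

section \<open>Removal of the mollifier and of the regularisation\<close>

lemma AE_lborel_snd:
  assumes "AE t in (lborel :: real measure). P t"
  shows "AE z in (lborel :: (R3 \<times> real) measure). P (snd z)"
proof -
  obtain N where N: "{t. \<not> P t} \<subseteq> N" "emeasure lborel N = 0" "N \<in> sets lborel"
    using AE_E[OF assms] by auto
  have "emeasure (lborel \<Otimes>\<^sub>M lborel) ((UNIV :: R3 set) \<times> N) = 0"
    using N by (subst lborel.emeasure_pair_measure_Times) auto
  then have "emeasure (lborel :: (R3 \<times> real) measure) (UNIV \<times> N) = 0" by (simp add: lborel_prod)
  moreover have "(UNIV :: R3 set) \<times> N \<in> sets (lborel :: (R3 \<times> real) measure)"
    using N unfolding lborel_prod[symmetric] by (intro pair_measureI) auto
  ultimately show ?thesis using N by (intro AE_I[of _ _ "UNIV \<times> N"]) auto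
qed

context
  fixes A Bf :: "R3 \<times> real \<Rightarrow> real" and k :: "real \<Rightarrow> R3 \<Rightarrow> real" and C :: real
  assumes meas [measurable]: "A \<in> borel_measurable borel" "Bf \<in> borel_measurable borel" "\<And>\<delta>. k \<delta> \<in> borel_measurable borel"
    and nn: "\<And>z. 0 \<le> A z" "\<And>z. 0 \<le> Bf z" "\<And>\<delta> x. 0 \<le> \<delta> \<Longrightarrow> 0 \<le> k \<delta> x" and C: "C \<ge> 0"
begin

private definition \<Phi> where
  "\<Phi> \<delta> \<tau> = (\<integral>\<^sup>+z. \<integral>\<^sup>+y. ennreal (A z * (Bf (y, snd z - \<tau>) * k \<delta> (fst z - y))))"

text \<open>\<Phi> is the doubled integral with the two times exactly \<tau> apart. Its average with
  the weight \<open>mol \<eta>\<close> is at most C, so it cannot exceed C + 1 on the whole support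
  of the weight; the slack 1 gives the contradiction.\<close>

private lemma shift_exists:
  assumes le: "(\<integral>\<^sup>+z. \<integral>\<^sup>+w. ennreal (mol \<eta> (snd z - snd w) * (A z * (Bf w * k \<delta> (fst z - fst w))))) \<le> ennreal C"
    and \<eta>: "\<eta> > 0" and \<delta>: "\<delta> \<ge> 0"
  shows "\<exists>\<tau>. \<bar>\<tau>\<bar> \<le> \<eta> \<and> \<Phi> \<delta> \<tau> \<le> ennreal (C + 1)"
proof (rule ccontr)
  assume "\<not> ?thesis"
  then have gt: "ennreal (C + 1) \<le> \<Phi> \<delta> \<tau>" if "\<bar>\<tau>\<bar> \<le> \<eta>" for \<tau> using that by (meson linear)
  have nk: "0 \<le> k \<delta> x" for x using nn(3) \<delta> by simp
  define W where "W z \<tau> = (\<integral>\<^sup>+y. ennreal (A z * (Bf (y, snd z - \<tau>) * k \<delta> (fst z - y))))" for z \<tau>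
  have "(\<lambda>q :: ((R3 \<times> real) \<times> real) \<times> R3. ennreal (A (fst (fst q)) * (Bf (snd q, snd (fst (fst q)) - snd (fst q)) * k \<delta> (fst (fst (fst q)) - snd q))))
      \<in> borel_measurable borel"
    by measurable
  then have Wm [measurable]: "(\<lambda>q. W (fst q) (snd q)) \<in> borel_measurable (lborel \<Otimes>\<^sub>M lborel)"
    unfolding W_def
    by (intro lborel.borel_measurable_nn_integral) (simp only: case_prod_unfold lborel_prod measurable_lborel2)
  have "ennreal (C + 1) = (\<integral>\<^sup>+\<tau>. ennreal (mol \<eta> \<tau>) \<partial>lborel) * ennreal (C + 1)" by (simp add: mol_integral[OF \<eta>])
  also have "\<dots> = (\<integral>\<^sup>+\<tau>. ennreal (mol \<eta> \<tau>) * ennreal (C + 1) \<partial>lborel)" by (rule nn_integral_multc[symmetric]) measurable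
  also have "\<dots> \<le> (\<integral>\<^sup>+\<tau>. ennreal (mol \<eta> \<tau>) * \<Phi> \<delta> \<tau> \<partial>lborel)"
  proof (intro nn_integral_mono)
    fix \<tau>
    show "ennreal (mol \<eta> \<tau>) * ennreal (C + 1) \<le> ennreal (mol \<eta> \<tau>) * \<Phi> \<delta> \<tau>"
      using mol_off(1)[OF \<eta>, of \<tau>] gt[of \<tau>] by (cases "\<bar>\<tau>\<bar> \<le> \<eta>") (auto intro: mult_left_mono)
  qed
  also have "\<dots> = (\<integral>\<^sup>+\<tau>. \<integral>\<^sup>+z. ennreal (mol \<eta> \<tau>) * W z \<tau> \<partial>lborel \<partial>lborel)"
    unfolding \<Phi>_def W_def[symmetric]
  proof (rule nn_integral_cong)
    fix \<tau>
    have "(\<lambda>z. W z \<tau>) \<in> borel_measurable lborel"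
      using measurable_compose[OF measurable_Pair2' Wm, of \<tau>] by simp
    then show "ennreal (mol \<eta> \<tau>) * (\<integral>\<^sup>+z. W z \<tau>) = (\<integral>\<^sup>+z. ennreal (mol \<eta> \<tau>) * W z \<tau>)"
      by (rule nn_integral_cmult[symmetric])
  qed
  also have "\<dots> = (\<integral>\<^sup>+z. \<integral>\<^sup>+\<tau>. ennreal (mol \<eta> \<tau>) * W z \<tau> \<partial>lborel)"
  proof (rule lborel_pair.Fubini')
    have "(\<lambda>q. ennreal (mol \<eta> (snd q)) * W (fst q) (snd q)) \<in> borel_measurable ((lborel :: (R3 \<times> real) measure) \<Otimes>\<^sub>M lborel)"
      by measurable
    then show "(\<lambda>(z, \<tau>). ennreal (mol \<eta> \<tau>) * W z \<tau>) \<in> borel_measurable ((lborel :: (R3 \<times> real) measure) \<Otimes>\<^sub>M lborel)"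
      by (simp only: case_prod_unfold)
  qed
  also have "\<dots> = (\<integral>\<^sup>+z. \<integral>\<^sup>+w. ennreal (mol \<eta> (snd z - snd w) * (A z * (Bf w * k \<delta> (fst z - fst w)))))"
  proof (rule nn_integral_cong)
    fix z :: "R3 \<times> real"
    define h where "h w = ennreal (mol \<eta> (snd z - snd w) * (A z * (Bf w * k \<delta> (fst z - fst w))))" for w
    have hm [measurable]: "h \<in> borel_measurable borel" unfolding h_def[abs_def] by measurable
    have sm: "(\<lambda>t. \<integral>\<^sup>+y. h (y, t)) \<in> borel_measurable borel"
      by (rule borel_measurable_nn_integral_lborel) measurable
    have "(\<integral>\<^sup>+w. h w) = (\<integral>\<^sup>+t. \<integral>\<^sup>+y. h (y, t))"
      by (rule nn_integral_slices[OF hm])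
    also have "\<dots> = (\<integral>\<^sup>+\<tau>. \<integral>\<^sup>+y. h (y, snd z - \<tau>) \<partial>lborel \<partial>lborel)"
      by (rule nn_integral_lborel_reflect[symmetric, OF sm])
    also have "\<dots> = (\<integral>\<^sup>+\<tau>. ennreal (mol \<eta> \<tau>) * W z \<tau> \<partial>lborel)"
    proof (rule nn_integral_cong)
      fix \<tau>
      have "h (y, snd z - \<tau>) = ennreal (mol \<eta> \<tau>) * ennreal (A z * (Bf (y, snd z - \<tau>) * k \<delta> (fst z - y)))" for y
        using mol_nonneg[OF \<eta>, of \<tau>] by (simp add: h_def ennreal_mult')
      then show "(\<integral>\<^sup>+y. h (y, snd z - \<tau>)) = ennreal (mol \<eta> \<tau>) * W z \<tau>"
        unfolding W_def by (simp only:) (rule nn_integral_cmult, measurable)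
    qed
    finally show "(\<integral>\<^sup>+\<tau>. ennreal (mol \<eta> \<tau>) * W z \<tau> \<partial>lborel) = (\<integral>\<^sup>+w. ennreal (mol \<eta> (snd z - snd w) * (A z * (Bf w * k \<delta> (fst z - fst w)))))"
      unfolding h_def by simp
  qed
  also have "\<dots> \<le> ennreal C" by (rule le)
  finally show False using C by (simp add: ennreal_le_iff)
qed

text \<open>Continuity of translations in \<open>L\<^sup>1\<close> turns the almost optimal shifts into an almost everywhere
  convergent subsequence, so that Fatou's lemma applies although nothing is known about time regularity.\<close>

lemma mollified_doubling_limit:
  assumes int: "integrable lborel Bf"
    and le: "\<And>\<eta> \<delta>. 0 < \<eta> \<Longrightarrow> 0 < \<delta> \<Longrightarrow> \<delta> \<le> 1 \<Longrightarrow>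
      (\<integral>\<^sup>+z. \<integral>\<^sup>+w. ennreal (mol \<eta> (snd z - snd w) * (A z * (Bf w * k \<delta> (fst z - fst w))))) \<le> ennreal C"
    and lim: "\<And>z y d. A z \<noteq> 0 \<Longrightarrow> Bf (y, snd z) \<noteq> 0 \<Longrightarrow> y \<noteq> fst z \<Longrightarrow> d \<longlonglongrightarrow> 0 \<Longrightarrow> (\<And>n. 0 < d n) \<Longrightarrow>
      (\<lambda>n. k (d n) (fst z - y)) \<longlonglongrightarrow> k 0 (fst z - y)"
  shows "(\<integral>\<^sup>+z. \<integral>\<^sup>+y. ennreal (A z * (Bf (y, snd z) * k 0 (fst z - y)))) \<le> ennreal (C + 1)"
proof -
  define e where "e n = inverse (real (Suc n))" for n
  have e: "0 < e n" "e n \<le> 1" for n by (auto simp: e_def divide_simps)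
  have e0: "e \<longlonglongrightarrow> 0" unfolding e_def by (rule LIMSEQ_inverse_real_of_nat)
  \<comment> \<open>Mollifier width and regularisation are tied to the same sequence, so one passage
    to the limit removes both.\<close>
  have "\<forall>n. \<exists>\<tau>. \<bar>\<tau>\<bar> \<le> e n \<and> \<Phi> (e n) \<tau> \<le> ennreal (C + 1)"
  proof
    fix n
    show "\<exists>\<tau>. \<bar>\<tau>\<bar> \<le> e n \<and> \<Phi> (e n) \<tau> \<le> ennreal (C + 1)"
      using shift_exists[OF le[OF e(1)[of n] e(1)[of n] e(2)[of n]] e(1)] e(1)[of n] by auto
  qed
  from choice[OF this] obtain \<tau> where \<tau>: "\<And>n. \<bar>\<tau> n\<bar> \<le> e n" "\<And>n. \<Phi> (e n) (\<tau> n) \<le> ennreal (C + 1)" by auto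
  have \<tau>0: "\<tau> \<longlonglongrightarrow> 0"
    by (rule Lim_null_comparison[OF _ e0]) (use \<tau>(1) in simp)
  define h where "h n = (0 :: R3, - \<tau> n)" for n
  have h0: "h \<longlonglongrightarrow> 0"
    unfolding h_def zero_prod_def using tendsto_minus[OF \<tau>0] by (intro tendsto_Pair) auto
  have "\<exists>\<sigma>::nat\<Rightarrow>nat. strict_mono \<sigma> \<and> (AE w in lborel. (\<lambda>n. Bf (w + h (\<sigma> n)) - Bf w) \<longlonglongrightarrow> 0)"
    using translation_continuous_L1[OF int h0] int
    by (intro tendsto_L1_AE_subseq[where u = "\<lambda>n w. Bf (w + h n) - Bf w"]) (auto intro: integrable_lborel_translate)
  then obtain \<sigma> :: "nat \<Rightarrow> nat" where \<sigma>: "strict_mono \<sigma>" "AE w in lborel. (\<lambda>n. Bf (w + h (\<sigma> n)) - Bf w) \<longlonglongrightarrow> 0" by blast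
  have e\<sigma>: "(\<lambda>n. e (\<sigma> n)) \<longlonglongrightarrow> 0" using LIMSEQ_subseq_LIMSEQ[OF e0 \<sigma>(1)] by (simp add: o_def)
  have conv: "AE z in (lborel :: (R3 \<times> real) measure). AE y in lborel. (\<lambda>n. Bf (y, snd z - \<tau> (\<sigma> n))) \<longlonglongrightarrow> Bf (y, snd z)"
  proof (rule AE_lborel_snd[where P = "\<lambda>t. AE y in lborel. (\<lambda>n. Bf (y, t - \<tau> (\<sigma> n))) \<longlonglongrightarrow> Bf (y, t)"],
      rule AE_mp[OF AE_lborel_slices[OF \<sigma>(2)]], rule AE_I2, rule impI)
    fix t
    assume "AE y in lborel. (\<lambda>n. Bf ((y, t) + h (\<sigma> n)) - Bf (y, t)) \<longlonglongrightarrow> 0"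
    then show "AE y in lborel. (\<lambda>n. Bf (y, t - \<tau> (\<sigma> n))) \<longlonglongrightarrow> Bf (y, t)"
    proof eventually_elim
      case (elim y)
      then show ?case using LIM_zero_iff[of "\<lambda>n. Bf (y, t - \<tau> (\<sigma> n))" "Bf (y, t)" sequentially] by (simp add: h_def)
    qed
  qed
  define F where "F n z y = ennreal (A z * (Bf (y, snd z - \<tau> (\<sigma> n)) * k (e (\<sigma> n)) (fst z - y)))" for n z y
  have Fm: "(\<lambda>z. \<integral>\<^sup>+y. F n z y) \<in> borel_measurable lborel" for n
    unfolding F_def measurable_lborel2 by (rule borel_measurable_nn_integral_lborel) measurable
  have "(\<integral>\<^sup>+z. \<integral>\<^sup>+y. ennreal (A z * (Bf (y, snd z) * k 0 (fst z - y)))) \<le>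
      (\<integral>\<^sup>+z. \<integral>\<^sup>+y. liminf (\<lambda>n. F n z y))"
  proof (rule nn_integral_mono_AE)
    show "AE z in lborel. (\<integral>\<^sup>+y. ennreal (A z * (Bf (y, snd z) * k 0 (fst z - y)))) \<le> (\<integral>\<^sup>+y. liminf (\<lambda>n. F n z y))"
      using conv
    proof eventually_elim
      case (elim z)
      show ?case
      proof (rule nn_integral_mono_AE)
        show "AE y in lborel. ennreal (A z * (Bf (y, snd z) * k 0 (fst z - y))) \<le> liminf (\<lambda>n. F n z y)"
          using elim AE_lborel_singleton[of "fst z"]
        proof eventually_elim
          case (elim y)
          show ?case
          \<comment> \<open>If a factor vanishes there is nothing to show; convergence of the kernel
            is assumed for the other pairs only.\<close>
          proof (cases "A z = 0 \<or> Bf (y, snd z) = 0")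
            case False
            have "(\<lambda>n. k (e (\<sigma> n)) (fst z - y)) \<longlonglongrightarrow> k 0 (fst z - y)"
              using False elim e by (intro lim e\<sigma>) auto
            then have "(\<lambda>n. F n z y) \<longlonglongrightarrow> ennreal (A z * (Bf (y, snd z) * k 0 (fst z - y)))"
              unfolding F_def using elim by (intro tendsto_ennrealI tendsto_mult tendsto_const)
            from lim_imp_Liminf[OF sequentially_bot this] show ?thesis by simp
          qed auto
        qed
      qed
    qed
  qed
  also have "\<dots> \<le> (\<integral>\<^sup>+z. liminf (\<lambda>n. \<integral>\<^sup>+y. F n z y))"
  proof (intro nn_integral_mono nn_integral_liminf)
    show "F n z \<in> borel_measurable lborel" for n z unfolding F_def[abs_def] by measurable
  qed
  also have "\<dots> \<le> liminf (\<lambda>n. \<integral>\<^sup>+z. \<integral>\<^sup>+y. F n z y)"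
    by (intro nn_integral_liminf Fm)
  also have "\<dots> \<le> ennreal (C + 1)"
    using \<tau>(2) by (intro Liminf_le always_eventually) (auto simp: F_def \<Phi>_def)
  finally show ?thesis .
qed

end

context localized_flow
begin

lemma logarithmic_pressure_bound:
  "(\<integral>\<^sup>+z. \<integral>\<^sup>+y. ennreal (cutoff z0 R z * p (r z) * (cutoff z0 R (y, snd z) * r (y, snd z) * ker a s 0 (fst z - y))))
    \<le> ennreal (2 * CC (1 + 4 * R) I + 1)"
proof (rule mollified_doubling_limit[where A = "\<lambda>z. cutoff z0 R z * p (r z)" and Bf = "\<lambda>z. cutoff z0 R z * r z" and k = "\<lambda>\<delta>. ker a s \<delta>"])
  show "(\<lambda>z. cutoff z0 R z * p (r z)) \<in> borel_measurable borel" "(\<lambda>z. cutoff z0 R z * r z) \<in> borel_measurable borel"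
    "ker a s \<delta> \<in> borel_measurable borel" for \<delta> by measurable
  show "0 \<le> cutoff z0 R z * p (r z)" "0 \<le> cutoff z0 R z * r z" for z
    by (intro mult_nonneg_nonneg cut_bounds p_nonneg r_nonneg)+
  show "0 \<le> ker a s \<delta> x" if "0 \<le> \<delta>" for \<delta> x using that by (simp add: ker_def)
  note aD = kernel_scale(2)[OF a_eq]
  have bound: "(\<integral>\<^sup>+z. \<integral>\<^sup>+w. ennreal (mol \<eta> (snd z - snd w) *
      (cutoff z0 R z * p (r z) * (cutoff z0 R w * r w * ker a s \<delta> (fst z - fst w)))))
      \<le> ennreal (2 * CC (1 + 4 * R) I)" if \<eta>\<delta>: "0 < \<eta>" "0 < \<delta>" "\<delta> \<le> 1" for \<eta> \<delta>
  proof -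
    obtain B where B: "log_doubling \<Omega> T \<nu>1 \<nu>2 E c p f u r G (cutoff z0 R) (\<lambda>z. cutoff' z0 R z * snd (z - z0)) (\<lambda>z. cutoff' z0 R z *\<^sub>R fst (z - z0))
      (mol \<eta>) (mol' \<eta>) a s \<delta> B (cball z0 R) D I (1 + 4 * R)" using log_doubling_cut[OF \<eta>\<delta>] by blast
    interpret ld: log_doubling \<Omega> T \<nu>1 \<nu>2 E c p f u r G "cutoff z0 R" "\<lambda>z. cutoff' z0 R z * snd (z - z0)" "\<lambda>z. cutoff' z0 R z *\<^sub>R fst (z - z0)"
      "mol \<eta>" "mol' \<eta>" a s \<delta> B "cball z0 R" D I "1 + 4 * R" by (rule B)
    have "(\<integral>\<^sup>+z. \<integral>\<^sup>+w. ennreal (mol \<eta> (snd z - snd w) *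
        (cutoff z0 R z * p (r z) * (cutoff z0 R w * r w * ker a s \<delta> (fst z - fst w))))) =
        (\<integral>\<^sup>+z. \<integral>\<^sup>+w. ennreal (ld.Good z w))"
      unfolding ld.Good_def by (simp add: mult_ac)
    also have "\<dots> = (\<integral>\<^sup>+q. ennreal (ld.Good (fst q) (snd q)) \<partial>(lborel \<Otimes>\<^sub>M lborel))"
      by (subst lborel.nn_integral_fst[symmetric]) auto
    also have "\<dots> \<le> ennreal (2 * CC (1 + 4 * R) I)" using ld.Good_bound unfolding log_doubling_CB[OF B] .
    finally show "(\<integral>\<^sup>+z. \<integral>\<^sup>+w. ennreal (mol \<eta> (snd z - snd w) *
      (cutoff z0 R z * p (r z) * (cutoff z0 R w * r w * ker a s \<delta> (fst z - fst w)))))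
      \<le> ennreal (2 * CC (1 + 4 * R) I)" .
  qed
  show "0 \<le> 2 * CC (1 + 4 * R) I" using CC_nonneg[of "1 + 4 * R" I] R I_nonneg by simp
  show "(\<integral>\<^sup>+z. \<integral>\<^sup>+w. ennreal (mol \<eta> (snd z - snd w) *
      (cutoff z0 R z * p (r z) * (cutoff z0 R w * r w * ker a s \<delta> (fst z - fst w)))))
      \<le> ennreal (2 * CC (1 + 4 * R) I)" if "0 < \<eta>" "0 < \<delta>" "\<delta> \<le> 1" for \<eta> \<delta>
    by (rule bound[OF that])
  show "integrable lborel (\<lambda>z. cutoff z0 R z * r z)"
  proof (rule Bochner_Integration.integrable_bound[OF H_integrable])
    have "norm (cutoff z0 R z * r z) \<le> norm (H z)" for z
    proof -
      have "cutoff z0 R z * r z \<le> 1 * r z" by (intro mult_right_mono cut_bounds r_nonneg)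
      then show ?thesis using ru_le_H(2)[of z] H_nonneg[of z] cut_bounds(1)[of z0 R z] r_nonneg[of z] by (simp add: abs_mult)
    qed
    then show "AE z in lborel. norm (cutoff z0 R z * r z) \<le> norm (H z)" by simp
  qed measurable
  show "(\<lambda>n. ker a s (d n) (fst z - y)) \<longlonglongrightarrow> ker a s 0 (fst z - y)"
    if z: "cutoff z0 R z * p (r z) \<noteq> 0" "cutoff z0 R (y, snd z) * r (y, snd z) \<noteq> 0" "y \<noteq> fst z"
      and d: "d \<longlonglongrightarrow> 0" for z y d
  proof -
    define q where "q = (norm (fst z - y))\<^sup>2"
    \<comment> \<open>Nonzero factors force both points into the domain, hence within distance
      \<open>D\<close>, where the logarithm is positive and the kernel is continuous in
      \<delta>.\<close>
    have "z \<in> Q" "(y, snd z) \<in> Q" using z off(1) p_zero by (metis mult_zero_right)+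
    then have "norm (fst z - y) \<le> D" using D by (auto simp: cylinder_def)
    then have "q \<le> D\<^sup>2" unfolding q_def by (intro power_mono) auto
    then have q: "0 < q" "q < a" using z aD by (auto simp: q_def)
    then have L: "0 < ln (a / q)" by (intro ln_gt_zero) simp
    have dq: "(\<lambda>n. q + d n) \<longlonglongrightarrow> q" using tendsto_add[OF tendsto_const d, of q] by simp
    have "(\<lambda>n. ln (a / (q + d n)) powr s / sqrt (q + d n)) \<longlonglongrightarrow> ln (a / q) powr s / sqrt q"
      using q L by (intro tendsto_divide tendsto_powr tendsto_ln tendsto_const tendsto_real_sqrt dq) auto
    then show ?thesis by (simp add: ker_def Lam_def q_def)
  qed
qed

end

section \<open>From the potential of the density to the kinetic energy\<close>

lemma ln_le_eighth_root: "ln y \<le> 8 * y powr (1 / 8)" if "y > 0" for y :: real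
proof -
  have "ln y = 8 * ln (y powr (1 / 8))" using that by (simp add: ln_powr)
  also have "\<dots> \<le> 8 * y powr (1 / 8)" using ln_le_minus_one[of "y powr (1 / 8)"] that by simp
  finally show ?thesis .
qed

text \<open>The logarithm of the density is exchanged for the logarithm of the distance. If q = e +
  \<rho> is at most (a / d^2)^2, then ln q is at most twice the logarithm of the kernel, and 2^s
  \<le> 4. Otherwise 1 / d \<le> q^(1/4), while (ln q)^s \<le> 64 q^(1/4), and the product is at
  most 64 q^(3/2). The constant 512 is 64 times 4^(3/2), from q \<le> 4 max(1, \<rho>).\<close>

lemma kernel_comparison:
  fixes \<rho> d a s :: real
  assumes \<rho>: "\<rho> \<ge> 0" and d: "d > 0" "d\<^sup>2 < a" and a: "a \<ge> 1" and s: "0 < s" "s \<le> 2"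
  shows "\<rho> * ln (exp 1 + \<rho>) powr s / d \<le> 4 * (\<rho> * (ln (a / d\<^sup>2) powr s / d)) + 512 * (1 + \<rho> powr (3 / 2))"
proof -
  define q where "q = exp 1 + \<rho>"
  define L where "L = ln (a / d\<^sup>2)"
  have q: "q \<ge> exp 1" "q > 0" "\<rho> \<le> q" "q \<ge> 1" using \<rho> one_le_exp_iff[of "1 :: real"] unfolding q_def by linarith+
  have l1: "1 \<le> ln q" using q by (subst ln_ge_iff) auto
  have ad: "a / d\<^sup>2 > 1" "a / d\<^sup>2 > 0" using d a by auto
  have L: "L > 0" unfolding L_def using ad by (intro ln_gt_zero)
  show ?thesis
  proof (cases "q \<le> (a / d\<^sup>2)\<^sup>2")
    case True
    then have "ln q \<le> ln ((a / d\<^sup>2)\<^sup>2)" using q by (intro ln_mono) auto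
    also have "\<dots> = 2 * L" unfolding L_def using ad by (simp only: ln_realpow of_nat_numeral)
    finally have "ln q powr s \<le> (2 * L) powr s" using s l1 by (intro powr_mono2) auto
    also have "\<dots> = 2 powr s * L powr s" using L by (simp add: powr_mult)
    also have "\<dots> \<le> 2 powr 2 * L powr s" using s by (intro mult_right_mono powr_mono) auto
    finally have "ln q powr s \<le> 4 * L powr s" by simp
    then have "\<rho> * ln q powr s / d \<le> \<rho> * (4 * L powr s) / d"
      using \<rho> d by (intro divide_right_mono mult_left_mono) auto
    also have "\<dots> = 4 * (\<rho> * (L powr s / d))" by simp
    finally show ?thesis unfolding L_def[symmetric] q_def[symmetric] by (rule add_increasing2[rotated]) simp
  next
    case False
    then have "a / d\<^sup>2 \<le> sqrt q" by (intro real_le_rsqrt) simp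
    then have "1 / d\<^sup>2 \<le> sqrt q" using a d by (smt (verit) divide_right_mono zero_le_power2)
    then have "sqrt (1 / d\<^sup>2) \<le> sqrt (sqrt q)" by (rule real_sqrt_le_mono)
    also have "sqrt (1 / d\<^sup>2) = 1 / d" using d by (simp add: real_sqrt_divide)
    also have "sqrt (sqrt q) = q powr (1 / 4)" using q by (simp add: powr_half_sqrt[symmetric] powr_powr)
    finally have d4: "1 / d \<le> q powr (1 / 4)" .
    have "ln q powr s \<le> ln q powr 2" using s l1 by (intro powr_mono) auto
    also have "\<dots> = (ln q)\<^sup>2" using l1 by simp
    also have "\<dots> \<le> (8 * q powr (1 / 8))\<^sup>2" using l1 q by (intro power_mono ln_le_eighth_root) auto
    also have "\<dots> = 64 * q powr (1 / 4)" using q by (simp add: power_mult_distrib powr_power)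
    finally have lq: "ln q powr s \<le> 64 * q powr (1 / 4)" .
    have "\<rho> * ln q powr s / d = \<rho> * ln q powr s * (1 / d)" by simp
    also have "\<dots> \<le> q * (64 * q powr (1 / 4)) * q powr (1 / 4)"
      using lq d4 q \<rho> d by (intro mult_mono) auto
    also have "\<dots> = 64 * (q powr 1 * q powr (1 / 4) * q powr (1 / 4))" using q by simp
    also have "\<dots> = 64 * q powr (3 / 2)" unfolding powr_add[symmetric] by simp
    also have "q powr (3 / 2) \<le> 8 * (1 + \<rho> powr (3 / 2))"
    proof -
      have "q \<le> 4 * max 1 \<rho>" using exp_le by (simp add: q_def max_def)
      then have "q powr (3 / 2) \<le> (4 * max 1 \<rho>) powr (3 / 2)" using q by (intro powr_mono2) auto
      also have "\<dots> = 4 powr (3 / 2) * max 1 \<rho> powr (3 / 2)" by (simp add: powr_mult)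
      also have "(4 :: real) powr (3 / 2) = 8"
      proof -
        have "(4 :: real) powr (3 / 2) = (2 powr 2) powr (3 / 2)" by simp
        also have "\<dots> = 2 powr 3" by (simp only: powr_powr) simp
        finally show ?thesis by simp
      qed
      also have "max 1 \<rho> powr (3 / 2) \<le> 1 + \<rho> powr (3 / 2)" by (simp add: max_def)
      finally show ?thesis by simp
    qed
    finally have "\<rho> * ln q powr s / d \<le> 512 * (1 + \<rho> powr (3 / 2))" by simp
    moreover have "0 \<le> 4 * (\<rho> * (L powr s / d))" using \<rho> d by simp
    ultimately show ?thesis unfolding L_def[symmetric] q_def[symmetric] by linarith
  qed
qed

text \<open>Weighted arithmetic-geometric mean inequality with weights \<open>2/7, 2/7, 2/7, 1/7\<close>; the auxiliary
  factors \<open>W\<close> and \<open>A\<close> cancel in the product.\<close>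

lemma interpolation_inequality:
  fixes \<zeta> \<rho> v l W A \<sigma> :: real
  assumes "0 \<le> \<zeta>" "\<zeta> \<le> 1" "0 \<le> \<rho>" "0 \<le> v" "0 < l" "0 < W" "0 < A"
  shows "\<zeta> * (\<rho> * v\<^sup>2) * l powr \<sigma> \<le>
    \<zeta> * \<rho> powr (3 / 2) * W + \<zeta> * \<rho> * l powr (7 * \<sigma> / 2) * v\<^sup>2 / W + (A * (\<rho> * v\<^sup>2) + v ^ 6 / A\<^sup>2)"
proof -
  define x where "x = \<zeta> * \<rho> powr (3 / 2) * W"
  define y where "y = \<zeta> * \<rho> * l powr (7 * \<sigma> / 2) * v\<^sup>2 / W"
  define b where "b = A * (\<rho> * v\<^sup>2)"
  define d where "d = v ^ 6 / A\<^sup>2"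
  have nn: "0 \<le> x" "0 \<le> y" "0 \<le> b" "0 \<le> d" unfolding x_def y_def b_def d_def using assms by auto
  define S where "S = x + y + (b + d)"
  have P2: "(\<rho> powr (3 / 2))\<^sup>2 = \<rho> ^ 3"
  proof (cases "\<rho> = 0")
    case False
    then have "\<rho> > 0" using assms by simp
    then show ?thesis by (simp add: powr_power powr_numeral)
  qed simp
  \<comment> \<open>The seventh power of the left side carries the logarithm to the power 7
    \<sigma>. On the right it sits in \<open>y\<close> alone, which enters squared; hence the
    exponent 7 \<sigma> / 2, which is the s of the kernel.\<close>
  have l2: "(l powr (7 * \<sigma> / 2))\<^sup>2 = (l powr \<sigma>) ^ 7" using assms by (simp add: powr_power mult.commute)
  have "(\<zeta> * (\<rho> * v\<^sup>2) * l powr \<sigma>) ^ 7 = \<zeta> ^ 3 * (\<zeta> ^ 4 * \<rho> ^ 7 * v ^ 14 * (l powr \<sigma>) ^ 7)"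
    by (simp add: power_mult_distrib eval_nat_numeral)
  also have "\<dots> \<le> 1 * (\<zeta> ^ 4 * \<rho> ^ 7 * v ^ 14 * (l powr \<sigma>) ^ 7)"
    using assms by (intro mult_right_mono power_le_one) auto
  also have "\<dots> = x\<^sup>2 * y\<^sup>2 * b\<^sup>2 * d"
    unfolding x_def y_def b_def d_def power_mult_distrib power_divide P2 l2
    using assms by (simp add: field_simps)
  also have "\<dots> \<le> S\<^sup>2 * S\<^sup>2 * S\<^sup>2 * S"
    unfolding S_def using nn by (intro mult_mono power_mono) auto
  also have "\<dots> = S ^ 7" by (simp add: eval_nat_numeral)
  finally have "\<zeta> * (\<rho> * v\<^sup>2) * l powr \<sigma> \<le> S"
    using nn assms by (subst (asm) power_mono_iff) (auto simp: S_def)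
  then show ?thesis by (simp add: S_def x_def y_def b_def d_def)
qed

text \<open>If v \<le> e + \<rho>, then 1 + \<rho> v^2 \<le> (e + \<rho>)^3 and the logarithms
  differ by a factor 3. Otherwise \<rho> \<le> v, so \<omega> = \<rho> v^2 is at most v^3, the
  logarithmic factor is at most 3 v, and (\<omega> v)^3 \<le> (A \<omega>)^2 (v^6 / A^2) is
  controlled by the last summand for every A.\<close>

lemma logarithm_comparison:
  fixes \<rho> v A \<sigma> :: real
  assumes \<rho>: "0 \<le> \<rho>" and v: "0 \<le> v" and A: "0 < A" and \<sigma>: "0 < \<sigma>" "\<sigma> \<le> 1"
  shows "(\<rho> * v\<^sup>2) * ln (1 + \<rho> * v\<^sup>2) powr \<sigma> \<le>
    3 * ((\<rho> * v\<^sup>2) * ln (exp 1 + \<rho>) powr \<sigma>) + 3 * (A * (\<rho> * v\<^sup>2) + v ^ 6 / A\<^sup>2)"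
proof -
  define \<omega> where "\<omega> = \<rho> * v\<^sup>2"
  define q where "q = exp 1 + \<rho>"
  define Y where "Y = A * \<omega> + v ^ 6 / A\<^sup>2"
  have \<omega>: "\<omega> \<ge> 0" using \<rho> by (simp add: \<omega>_def)
  have q: "q \<ge> exp 1" "q \<ge> 1" "q > 0" "\<rho> \<le> q" using \<rho> one_le_exp_iff[of "1 :: real"] unfolding q_def by linarith+
  have l1: "1 \<le> ln q" using q by (subst ln_ge_iff) auto
  have Y: "Y \<ge> 0" unfolding Y_def using A \<omega> by simp
  have ln0: "0 \<le> ln (1 + \<omega>)" using \<omega> by simp
  show ?thesis
  proof (cases "v \<le> q")
    case True
    have "1 + \<omega> \<le> q ^ 3"
    proof -
      have "\<omega> \<le> \<rho> * q\<^sup>2" unfolding \<omega>_def using True v \<rho> by (intro mult_left_mono power_mono) auto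
      moreover have "1 \<le> exp 1 * q\<^sup>2"
        using mult_mono[of 1 "exp 1" 1 "q\<^sup>2"] one_le_power[OF q(2), of 2] by simp
      moreover have "q ^ 3 = exp 1 * q\<^sup>2 + \<rho> * q\<^sup>2"
        unfolding power3_eq_cube power2_eq_square by (subst (1) q_def) (simp add: algebra_simps)
      ultimately show ?thesis by linarith
    qed
    then have "ln (1 + \<omega>) \<le> ln (q ^ 3)" using \<omega> q by (intro ln_mono) auto
    also have "\<dots> = 3 * ln q" using q by (simp only: ln_realpow)
    finally have "ln (1 + \<omega>) powr \<sigma> \<le> (3 * ln q) powr \<sigma>" using \<sigma> ln0 by (intro powr_mono2) auto
    also have "\<dots> = 3 powr \<sigma> * ln q powr \<sigma>" using l1 by (simp add: powr_mult)
    also have "\<dots> \<le> 3 powr 1 * ln q powr \<sigma>" using \<sigma> by (intro mult_right_mono powr_mono) auto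
    finally have "\<omega> * ln (1 + \<omega>) powr \<sigma> \<le> \<omega> * (3 * ln q powr \<sigma>)" using \<omega> by (intro mult_left_mono) auto
    then show ?thesis using Y unfolding \<omega>_def[symmetric] q_def[symmetric] Y_def[symmetric] by simp
  next
    case False
    then have vq: "q \<le> v" "1 \<le> v" "\<rho> \<le> v" using q by auto
    have "\<rho> * v\<^sup>2 \<le> v * v\<^sup>2" using vq by (intro mult_right_mono) auto
    then have \<omega>3: "\<omega> \<le> v ^ 3" by (simp add: \<omega>_def power3_eq_cube power2_eq_square)
    have "ln (1 + \<omega>) \<le> ln ((1 + v) ^ 3)"
    proof (rule ln_mono)
      have "1 + v ^ 3 \<le> (1 + v) ^ 3" using v by (simp add: power3_eq_cube algebra_simps)
      then show "1 + \<omega> \<le> (1 + v) ^ 3" using \<omega>3 by linarith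
    qed (use \<omega> v in auto)
    also have "\<dots> = 3 * ln (1 + v)" using v by (simp only: ln_realpow)
    also have "\<dots> \<le> 3 * v" using ln_add_one_self_le_self[OF v] by simp
    finally have "ln (1 + \<omega>) powr \<sigma> \<le> (3 * v) powr \<sigma>" using \<sigma> ln0 by (intro powr_mono2) auto
    also have "\<dots> \<le> (3 * v) powr 1" using \<sigma> vq by (intro powr_mono) auto
    also have "\<dots> = 3 * v" using vq by simp
    finally have L: "ln (1 + \<omega>) powr \<sigma> \<le> 3 * v" .
    have "(\<omega> * ln (1 + \<omega>) powr \<sigma>) ^ 3 \<le> (\<omega> * (3 * v)) ^ 3"
      using L \<omega> by (intro power_mono mult_left_mono) auto
    also have "\<dots> = 27 * (\<omega>\<^sup>2 * (\<omega> * v ^ 3))" by (simp add: power_mult_distrib power3_eq_cube power2_eq_square)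
    also have "\<dots> \<le> 27 * (\<omega>\<^sup>2 * (v ^ 3 * v ^ 3))" using \<omega>3 v by (intro mult_left_mono mult_right_mono) auto
    also have "\<dots> = 27 * ((A * \<omega>)\<^sup>2 * (v ^ 6 / A\<^sup>2))" using A by (simp add: power_mult_distrib flip: power_add)
    also have "\<dots> \<le> 27 * (Y\<^sup>2 * Y)"
      unfolding Y_def using A \<omega> v by (intro mult_left_mono mult_mono power_mono) auto
    also have "\<dots> = (3 * Y) ^ 3" by (simp add: power3_eq_cube power2_eq_square)
    finally have "\<omega> * ln (1 + \<omega>) powr \<sigma> \<le> 3 * Y"
      using Y \<omega> by (subst (asm) power_mono_iff) auto
    moreover have "0 \<le> 3 * (\<omega> * ln q powr \<sigma>)" using \<omega> by simp
    ultimately show ?thesis unfolding \<omega>_def[symmetric] q_def[symmetric] Y_def[symmetric] by linarith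
  qed
qed

context energy_flow
begin

definition Nlog where "Nlog z0 R s z = cutoff z0 R z * r z * ln (exp 1 + r z) powr s"

text \<open>The potential is taken in space at the fixed time of z. It may be infinite, which is why
  the weight lives in the extended reals.\<close>

definition Wlog where "Wlog z0 R s z = 1 + (\<integral>\<^sup>+y. ennreal (Nlog z0 R s (y, snd z) / norm (fst z - y)))"

lemma Nlog_measurable [measurable]: "Nlog z0 R s \<in> borel_measurable borel"
  unfolding Nlog_def[abs_def] by measurable

lemma Nlog_nonneg: "0 \<le> Nlog z0 R s z"
  unfolding Nlog_def by (intro mult_nonneg_nonneg cut_bounds r_nonneg) simp

lemma Wlog_measurable [measurable]: "Wlog z0 R s \<in> borel_measurable borel"
proof -
  have "(\<lambda>z. \<integral>\<^sup>+y. ennreal (Nlog z0 R s (y, snd z) / norm (fst z - y))) \<in> borel_measurable borel"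
    by (rule borel_measurable_nn_integral_lborel) measurable
  then show ?thesis unfolding Wlog_def[abs_def] by measurable
qed

text \<open>The first summand is the bounded part of \<open>Wlog_le\<close> integrated against the
  pressure; the second is the bound of \<open>logarithmic_pressure_bound\<close> with the factor 4
  of \<open>kernel_comparison\<close>.\<close>

definition C1 where "C1 R I = (1 + 512 * (vol + E)) * (T * E) + 4 * (2 * CC (1 + 4 * R) I + 1)"

end

context localized_flow
begin

text \<open>Integrating \<open>kernel_comparison\<close> over y exchanges the potential of the
  logarithmically enlarged density for the convolution with the logarithmic kernel. The remainder 1
  + \<rho>^(3/2) is covered by the volume of the domain and the pressure energy of the time
  slice.\<close>

lemma Wlog_le:
  assumes z: "z \<in> Q" and e: "(\<integral>\<^sup>+x. ennreal (p (r (x, snd z)))) \<le> ennreal E"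
  shows "Wlog z0 R s z \<le> ennreal (1 + 512 * (vol + E)) +
    4 * (\<integral>\<^sup>+y. ennreal (cutoff z0 R (y, snd z) * r (y, snd z) * ker a s 0 (fst z - y)))"
proof -
  have [measurable]: "\<Omega> \<in> sets borel" using open_dom by simp
  note aD = kernel_scale(2)[OF a_eq]
  then have a1: "1 \<le> a" using zero_le_power2[of D] by linarith
  define k where "k y = cutoff z0 R (y, snd z) * r (y, snd z) * ker a s 0 (fst z - y)" for y
  have k0: "0 \<le> k y" for y
    unfolding k_def by (intro mult_nonneg_nonneg cut_bounds r_nonneg) (simp add: ker_def)
  have km [measurable]: "k \<in> borel_measurable borel" unfolding k_def[abs_def] by measurable
  have "(\<integral>\<^sup>+y. ennreal (Nlog z0 R s (y, snd z) / norm (fst z - y))) \<le>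
      (\<integral>\<^sup>+y. 4 * ennreal (k y) + 512 * (indicator \<Omega> y + ennreal (p (r (y, snd z)))))"
  proof (rule nn_integral_mono_AE)
    show "AE y in lborel. ennreal (Nlog z0 R s (y, snd z) / norm (fst z - y)) \<le>
        4 * ennreal (k y) + 512 * (indicator \<Omega> y + ennreal (p (r (y, snd z))))"
      using AE_lborel_singleton[of "fst z"]
    proof eventually_elim
      case (elim y)
      show ?case
      proof (cases "(y, snd z) \<in> Q")
        case True
        define \<rho> where "\<rho> = r (y, snd z)"
        define \<zeta> where "\<zeta> = cutoff z0 R (y, snd z)"
        define d where "d = norm (fst z - y)"
        have \<zeta>: "0 \<le> \<zeta>" "\<zeta> \<le> 1" unfolding \<zeta>_def by (rule cut_bounds)+
        have \<rho>: "0 \<le> \<rho>" unfolding \<rho>_def by (rule r_nonneg)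
        have d: "d > 0" "d \<le> D" unfolding d_def using elim D z True by (auto simp: cylinder_def)
        have "d\<^sup>2 \<le> D\<^sup>2" using d by (intro power_mono) auto
        then have d2: "d\<^sup>2 < a" using aD by linarith
        have "\<zeta> * (\<rho> * ln (exp 1 + \<rho>) powr s / d) \<le> \<zeta> * (4 * (\<rho> * (ln (a / d\<^sup>2) powr s / d)) + 512 * (1 + \<rho> powr (3 / 2)))"
          using s by (intro mult_left_mono kernel_comparison \<rho> d(1) d2 a1 \<zeta>(1)) auto
        also have "\<dots> = 4 * (\<zeta> * \<rho> * (ln (a / d\<^sup>2) powr s / d)) + \<zeta> * (512 * (1 + \<rho> powr (3 / 2)))"
          by (simp add: algebra_simps)
        also have "\<zeta> * (512 * (1 + \<rho> powr (3 / 2))) \<le> 1 * (512 * (1 + \<rho> powr (3 / 2)))"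
          using \<zeta> by (intro mult_right_mono) auto
        also have "1 * (512 * (1 + \<rho> powr (3 / 2))) \<le> 512 * (1 + p \<rho>)" using p_ge[OF \<rho>] by simp
        also have "\<zeta> * \<rho> * (ln (a / d\<^sup>2) powr s / d) = k y"
          unfolding k_def ker_def Lam_def \<zeta>_def \<rho>_def d_def by simp
        finally have "\<zeta> * (\<rho> * ln (exp 1 + \<rho>) powr s / d) \<le> 4 * k y + 512 * (1 + p \<rho>)" by simp
        then have "ennreal (Nlog z0 R s (y, snd z) / norm (fst z - y)) \<le> ennreal (4 * k y + 512 * (1 + p \<rho>))"
          unfolding Nlog_def \<zeta>_def \<rho>_def d_def by (intro ennreal_leI) (simp add: mult_ac)
        also have "\<dots> = 4 * ennreal (k y) + 512 * (1 + ennreal (p \<rho>))"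
          using k0[of y] p_nonneg[OF \<rho>] by (simp add: ennreal_mult')
        finally show ?thesis using True by (simp add: \<rho>_def mem_Q)
      qed (simp add: Nlog_def off)
    qed
  qed
  also have "\<dots> = 4 * (\<integral>\<^sup>+y. ennreal (k y)) + 512 * (emeasure lborel \<Omega> + (\<integral>\<^sup>+y. ennreal (p (r (y, snd z)))))"
    by (simp add: nn_integral_add nn_integral_cmult)
  also have "\<dots> \<le> 4 * (\<integral>\<^sup>+y. ennreal (k y)) + 512 * (ennreal vol + ennreal E)"
    unfolding vol(1) by (intro add_left_mono mult_left_mono e) auto
  finally have "Wlog z0 R s z \<le> 1 + (4 * (\<integral>\<^sup>+y. ennreal (k y)) + 512 * (ennreal vol + ennreal E))"
    unfolding Wlog_def by (rule add_left_mono)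
  also have "\<dots> = (1 + 512 * (ennreal vol + ennreal E)) + 4 * (\<integral>\<^sup>+y. ennreal (k y))"
    by (simp add: add_ac)
  also have "1 + 512 * (ennreal vol + ennreal E) = ennreal (1 + 512 * (vol + E))"
    using vol(2) E_pos by (simp add: ennreal_mult')
  finally show ?thesis unfolding k_def .
qed

text \<open>The first of the terms between which the kinetic energy is interpolated; the Hardy
  weight meets the pressure here and the velocity in the second term.\<close>

lemma weighted_pressure: "(\<integral>\<^sup>+z. ennreal (cutoff z0 R z * p (r z)) * Wlog z0 R s z) \<le> ennreal (C1 R I)"
proof -
  define J where "J z = (\<integral>\<^sup>+y. ennreal (cutoff z0 R z * p (r z) * (cutoff z0 R (y, snd z) * r (y, snd z) * ker a s 0 (fst z - y))))" for z
  have Jm [measurable]: "J \<in> borel_measurable borel"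
    unfolding J_def[abs_def] by (rule borel_measurable_nn_integral_lborel) measurable
  define c1 where "c1 = 1 + 512 * (vol + E)"
  have c1: "c1 \<ge> 0" unfolding c1_def using vol(2) E_pos by simp
  have "(\<integral>\<^sup>+z. ennreal (cutoff z0 R z * p (r z)) * Wlog z0 R s z) \<le> (\<integral>\<^sup>+z. ennreal c1 * ennreal (p (r z)) + 4 * J z)"
  proof (rule nn_integral_mono_AE)
    show "AE z in lborel. ennreal (cutoff z0 R z * p (r z)) * Wlog z0 R s z \<le> ennreal c1 * ennreal (p (r z)) + 4 * J z"
      using AE_lborel_snd[OF energy_p]
    proof eventually_elim
      case (elim z)
      show ?case
      proof (cases "z \<in> Q")
        case True
        define P where "P = cutoff z0 R z * p (r z)"
        have P: "0 \<le> P" "P \<le> p (r z)"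
        proof -
          show "0 \<le> P" unfolding P_def by (intro mult_nonneg_nonneg cut_bounds p_nonneg r_nonneg)
          have "P \<le> 1 * p (r z)" unfolding P_def by (intro mult_right_mono cut_bounds p_nonneg r_nonneg)
          then show "P \<le> p (r z)" by simp
        qed
        have "ennreal P * Wlog z0 R s z \<le> ennreal P * (ennreal c1 +
            4 * (\<integral>\<^sup>+y. ennreal (cutoff z0 R (y, snd z) * r (y, snd z) * ker a s 0 (fst z - y))))"
          unfolding c1_def by (intro mult_left_mono Wlog_le True elim) simp
        also have "\<dots> = ennreal P * ennreal c1 +
            4 * (ennreal P * (\<integral>\<^sup>+y. ennreal (cutoff z0 R (y, snd z) * r (y, snd z) * ker a s 0 (fst z - y))))"
          by (simp add: distrib_left mult_ac)
        also have "ennreal P * (\<integral>\<^sup>+y. ennreal (cutoff z0 R (y, snd z) * r (y, snd z) * ker a s 0 (fst z - y))) =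
            (\<integral>\<^sup>+y. ennreal P * ennreal (cutoff z0 R (y, snd z) * r (y, snd z) * ker a s 0 (fst z - y)))"
          by (rule nn_integral_cmult[symmetric]) measurable
        also have "\<dots> = J z"
          unfolding J_def P_def[symmetric] using P(1) by (simp add: ennreal_mult')
        also have "ennreal P * ennreal c1 \<le> ennreal (p (r z)) * ennreal c1"
          by (intro mult_right_mono ennreal_leI P) simp
        finally show ?thesis unfolding P_def by (simp add: mult.commute add_right_mono)
      qed (simp add: off p_zero)
    qed
  qed
  also have "\<dots> = ennreal c1 * (\<integral>\<^sup>+z. ennreal (p (r z))) + 4 * (\<integral>\<^sup>+z. J z)"
    by (simp add: nn_integral_add nn_integral_cmult)
  also have "\<dots> \<le> ennreal c1 * ennreal (T * E) + 4 * ennreal (2 * CC (1 + 4 * R) I + 1)"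
    unfolding J_def
    by (intro add_mono mult_left_mono int_p logarithmic_pressure_bound) auto
  also have "\<dots> = ennreal (C1 R I)"
    unfolding C1_def c1_def[symmetric] using c1 T_pos E_pos CC_nonneg[of "1 + 4 * R" I] R I_nonneg by (simp add: ennreal_mult')
  finally show ?thesis .
qed

lemma C1_nonneg: "0 \<le> C1 R I"
  unfolding C1_def using CC_nonneg[of "1 + 4 * R" I] R I_nonneg vol(2) E_pos T_pos by (intro add_nonneg_nonneg mult_nonneg_nonneg) auto

lemma kinetic_energy_log_density:
  assumes \<sigma>: "s = 7 * \<sigma> / 2"
  shows "(\<integral>\<^sup>+z. ennreal (cutoff z0 R z * (r z * (norm (u z))\<^sup>2) * ln (exp 1 + r z) powr \<sigma>)) \<le> ennreal (C1 R I + 2 * Hardy_const * E\<^sup>2 + IY)"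
proof -
  have IY0: "0 \<le> IY" unfolding IY_def using E_pos T_pos by simp
  have "(\<integral>\<^sup>+z. ennreal (cutoff z0 R z * (r z * (norm (u z))\<^sup>2) * ln (exp 1 + r z) powr \<sigma>)) \<le>
      (\<integral>\<^sup>+z. ennreal (cutoff z0 R z * p (r z)) * Wlog z0 R s z + ennreal (Nlog z0 R s z * (norm (u z))\<^sup>2) / Wlog z0 R s z + ennreal (Y z))"
  proof (rule nn_integral_mono)
    fix z
    define \<zeta> where "\<zeta> = cutoff z0 R z"
    have \<zeta>: "0 \<le> \<zeta>" "\<zeta> \<le> 1" unfolding \<zeta>_def by (rule cut_bounds)+
    have \<rho>: "0 \<le> r z" by (rule r_nonneg)
    have A: "0 < At (snd z)" using At_ge[of "snd z"] by simp
    have l: "0 < ln (exp 1 + r z)"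
      using \<rho> one_less_exp_iff[of "1 :: real"] by (intro ln_gt_zero) linarith
    show "ennreal (cutoff z0 R z * (r z * (norm (u z))\<^sup>2) * ln (exp 1 + r z) powr \<sigma>) \<le>
        ennreal (cutoff z0 R z * p (r z)) * Wlog z0 R s z + ennreal (Nlog z0 R s z * (norm (u z))\<^sup>2) / Wlog z0 R s z + ennreal (Y z)"
    \<comment> \<open>At a point of infinite potential either the left side is zero, because the
      localised density vanishes, or the pressure term on the right is infinite.\<close>
    proof (cases "Wlog z0 R s z = \<infinity>")
      case True
      show ?thesis
      proof (cases "\<zeta> * r z = 0")
        case True
        then show ?thesis by (auto simp: \<zeta>_def)
      next
        case False
        then have "0 < \<zeta>" "0 < r z" using \<zeta> \<rho> by auto
        moreover have "0 < r z powr (3 / 2)" using \<open>0 < r z\<close> by simp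
        ultimately have "0 < \<zeta> * p (r z)" using p_ge[OF \<rho>] by (intro mult_pos_pos) linarith+
        then have "ennreal (\<zeta> * p (r z)) \<noteq> 0" unfolding ennreal_eq_0_iff by linarith
        then show ?thesis unfolding True \<zeta>_def by (simp add: ennreal_mult_top)
      qed
    next
      case False
      define W where "W = enn2real (Wlog z0 R s z)"
      have W: "Wlog z0 R s z = ennreal W" using False by (simp add: W_def less_top)
      have "1 \<le> Wlog z0 R s z" unfolding Wlog_def by simp
      then have W1: "1 \<le> W" unfolding W by simp
      have "\<zeta> * (r z * (norm (u z))\<^sup>2) * ln (exp 1 + r z) powr \<sigma> \<le>
          \<zeta> * r z powr (3 / 2) * W + \<zeta> * r z * ln (exp 1 + r z) powr (7 * \<sigma> / 2) * (norm (u z))\<^sup>2 / W +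
          (At (snd z) * (r z * (norm (u z))\<^sup>2) + norm (u z) ^ 6 / (At (snd z))\<^sup>2)"
        using \<zeta> \<rho> A l W1 by (intro interpolation_inequality) auto
      also have "\<dots> = \<zeta> * r z powr (3 / 2) * W + Nlog z0 R s z * (norm (u z))\<^sup>2 / W + Y z"
        unfolding Y_def Nlog_def \<zeta>_def \<sigma> ..
      also have "\<dots> \<le> \<zeta> * p (r z) * W + Nlog z0 R s z * (norm (u z))\<^sup>2 / W + Y z"
        using \<zeta> W1 by (intro add_right_mono mult_right_mono mult_left_mono p_ge \<rho>) auto
      finally have "ennreal (\<zeta> * (r z * (norm (u z))\<^sup>2) * ln (exp 1 + r z) powr \<sigma>) \<le>
          ennreal (\<zeta> * p (r z) * W + Nlog z0 R s z * (norm (u z))\<^sup>2 / W + Y z)" by (rule ennreal_leI)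
      also have "\<dots> = ennreal (\<zeta> * p (r z)) * ennreal W + ennreal (Nlog z0 R s z * (norm (u z))\<^sup>2) / ennreal W + ennreal (Y z)"
      proof -
        have n: "0 \<le> \<zeta> * p (r z)" "0 \<le> Nlog z0 R s z * (norm (u z))\<^sup>2" "0 \<le> Y z" "0 \<le> W"
          using \<zeta> p_nonneg[OF \<rho>] Nlog_nonneg Y_nonneg W1 by auto
        then have "0 \<le> \<zeta> * p (r z) * W" "0 \<le> Nlog z0 R s z * (norm (u z))\<^sup>2 / W" by auto
        then show ?thesis using n W1 by (simp only: ennreal_plus add_nonneg_nonneg ennreal_mult divide_ennreal less_le_trans[OF zero_less_one])
      qed
      finally show ?thesis unfolding W \<zeta>_def .
    qed
  qed
  also have "\<dots> = (\<integral>\<^sup>+z. ennreal (cutoff z0 R z * p (r z)) * Wlog z0 R s z) +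
      (\<integral>\<^sup>+z. ennreal (Nlog z0 R s z * (norm (u z))\<^sup>2) / Wlog z0 R s z) + (\<integral>\<^sup>+z. ennreal (Y z))"
    by (simp add: nn_integral_add)
  also have "\<dots> \<le> ennreal (C1 R I) + ennreal (2 * Hardy_const * E\<^sup>2) + ennreal IY"
    using Hardy[OF Nlog_measurable Nlog_nonneg, of z0 R s]
    by (intro add_mono weighted_pressure int_Y) (simp add: Wlog_def)
  also have "\<dots> = ennreal (C1 R I + 2 * Hardy_const * E\<^sup>2 + IY)" using C1_nonneg IY0 Hardy_const(2) by (simp add: ennreal_plus)
  finally show ?thesis .
qed

lemma local_estimate:
  assumes \<sigma>: "s = 7 * \<sigma> / 2"
  shows "(\<integral>\<^sup>+z. ennreal (r z * (norm (u z))\<^sup>2 * ln (1 + r z * (norm (u z))\<^sup>2) powr \<sigma>) * indicator (ball z0 (R / 2)) z)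
    \<le> ennreal (3 * exp (4 / (3 * R\<^sup>2)) * (C1 R I + 2 * Hardy_const * E\<^sup>2 + IY) + 3 * IY)"
proof -
  have IY0: "0 \<le> IY" unfolding IY_def using E_pos T_pos by simp
  \<comment> \<open>On the ball of half the radius R^2 - |z - z0|^2 is at least 3 R^2 / 4, so 1 /
    \<beta> bounds the cut-off from below.\<close>
  define \<beta> where "\<beta> = exp (4 / (3 * R\<^sup>2))"
  have "(\<integral>\<^sup>+z. ennreal (r z * (norm (u z))\<^sup>2 * ln (1 + r z * (norm (u z))\<^sup>2) powr \<sigma>) * indicator (ball z0 (R / 2)) z) \<le>
      (\<integral>\<^sup>+z. ennreal (3 * \<beta>) * ennreal (cutoff z0 R z * (r z * (norm (u z))\<^sup>2) * ln (exp 1 + r z) powr \<sigma>) + ennreal 3 * ennreal (Y z))"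
  proof (rule nn_integral_mono)
    fix z
    show "ennreal (r z * (norm (u z))\<^sup>2 * ln (1 + r z * (norm (u z))\<^sup>2) powr \<sigma>) * indicator (ball z0 (R / 2)) z \<le>
      ennreal (3 * \<beta>) * ennreal (cutoff z0 R z * (r z * (norm (u z))\<^sup>2) * ln (exp 1 + r z) powr \<sigma>) + ennreal 3 * ennreal (Y z)"
    proof (cases "z \<in> ball z0 (R / 2)")
      case True
      define X where "X = r z * (norm (u z))\<^sup>2 * ln (exp 1 + r z) powr \<sigma>"
      have X: "0 \<le> X" unfolding X_def using r_nonneg[of z] by simp
      have "norm (z - z0) \<le> R / 2" using True by (simp add: dist_norm norm_minus_commute)
      then have "(norm (z - z0))\<^sup>2 \<le> (R / 2)\<^sup>2" by (intro power_mono) auto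
      then have q: "3 * R\<^sup>2 / 4 \<le> R\<^sup>2 - (norm (z - z0))\<^sup>2" by (simp add: power_divide)
      have q0: "0 < 3 * R\<^sup>2 / 4" using R by simp
      have "1 / (R\<^sup>2 - (norm (z - z0))\<^sup>2) \<le> 1 / (3 * R\<^sup>2 / 4)" using q q0 by (intro frac_le) auto
      then have "exp (- (4 / (3 * R\<^sup>2))) \<le> cutoff z0 R z"
        unfolding cutoff_def bump_def using less_le_trans[OF q0 q] by simp
      then have "1 \<le> \<beta> * cutoff z0 R z"
        unfolding \<beta>_def by (simp add: exp_minus field_simps)
      then have "1 * X \<le> (\<beta> * cutoff z0 R z) * X" using X by (rule mult_right_mono)
      then have X2: "X \<le> \<beta> * (cutoff z0 R z * X)" by (simp add: mult.assoc)
      have "r z * (norm (u z))\<^sup>2 * ln (1 + r z * (norm (u z))\<^sup>2) powr \<sigma> \<le> 3 * X + 3 * Y z"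
        unfolding X_def Y_def using At_ge[of "snd z"] s \<sigma> by (intro logarithm_comparison r_nonneg) auto
      also have "\<dots> \<le> (3 * \<beta>) * (cutoff z0 R z * X) + 3 * Y z" using X2 by simp
      finally have "ennreal (r z * (norm (u z))\<^sup>2 * ln (1 + r z * (norm (u z))\<^sup>2) powr \<sigma>) \<le> ennreal ((3 * \<beta>) * (cutoff z0 R z * X) + 3 * Y z)"
        by (rule ennreal_leI)
      also have "\<dots> = ennreal (3 * \<beta>) * ennreal (cutoff z0 R z * X) + ennreal 3 * ennreal (Y z)"
      proof -
        have "0 \<le> 3 * \<beta>" "0 \<le> cutoff z0 R z * X" "0 \<le> Y z" using X cut_bounds(1)[of z0 R z] Y_nonneg by (auto simp: \<beta>_def)
        then show ?thesis by (simp only: ennreal_plus ennreal_mult mult_nonneg_nonneg zero_le_numeral)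
      qed
      finally show ?thesis using True by (simp add: X_def mult.assoc)
    qed simp
  qed
  also have "\<dots> = ennreal (3 * \<beta>) * (\<integral>\<^sup>+z. ennreal (cutoff z0 R z * (r z * (norm (u z))\<^sup>2) * ln (exp 1 + r z) powr \<sigma>)) + ennreal 3 * (\<integral>\<^sup>+z. ennreal (Y z))"
    by (simp add: nn_integral_add nn_integral_cmult)
  also have "\<dots> \<le> ennreal (3 * \<beta>) * ennreal (C1 R I + 2 * Hardy_const * E\<^sup>2 + IY) + ennreal 3 * ennreal IY"
    by (intro add_mono mult_left_mono kinetic_energy_log_density[OF \<sigma>] int_Y) auto
  also have "\<dots> = ennreal (3 * \<beta> * (C1 R I + 2 * Hardy_const * E\<^sup>2 + IY) + 3 * IY)"
  proof -
    have "0 \<le> 3 * \<beta>" "0 \<le> C1 R I + 2 * Hardy_const * E\<^sup>2 + IY" using C1_nonneg IY0 Hardy_const(2) by (auto simp: \<beta>_def intro!: add_nonneg_nonneg)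
    then show ?thesis using IY0 by (simp only: ennreal_plus ennreal_mult mult_nonneg_nonneg zero_le_numeral)
  qed
  finally show ?thesis by (simp add: \<beta>_def)
qed

end

section \<open>Covering of the compact set and conclusion\<close>

theorem theorem1p2:
  fixes \<Omega> :: "R3 set" and K :: "(R3 \<times> real) set" and T \<nu>1 \<nu>2 \<sigma> E c\<^sub>e :: real
  assumes "bounded_C2_domain \<Omega>" and "T > 0"
    and "\<nu>1 > 0" and "\<nu>1 + \<nu>2 \<ge> 0"
    and "0 < \<sigma>" and "\<sigma> < 8 / 21"
    and "compact K" and "K \<subseteq> cylinder \<Omega> T"
    and "E > 0" and "c\<^sub>e > 0"
  shows "\<exists>c :: real. \<forall>(m :: real) (\<epsilon> :: real) (c\<^sub>0 :: real) f \<rho>0 u0 \<rho> u.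
    m > 1 \<and> 0 < \<epsilon> \<and> \<epsilon> \<le> 1 \<and> c\<^sub>0 > 0 \<and>
    admissible_data \<Omega> T c\<^sub>e c\<^sub>0 f \<rho>0 u0 \<and>
    weak_solution \<Omega> T \<nu>1 \<nu>2 (pressure m \<epsilon>) f \<rho>0 u0 \<rho> u \<and>
    energy_norm \<Omega> T (pressure m \<epsilon>) \<rho> u \<le> ennreal E \<longrightarrow>
      integrable (lebesgue_on K)
        (\<lambda>z. \<rho> z * (norm (u z))\<^sup>2 * (ln (1 + \<rho> z * (norm (u z))\<^sup>2)) powr \<sigma>) \<and>
      (\<integral>z. \<rho> z * (norm (u z))\<^sup>2 * (ln (1 + \<rho> z * (norm (u z))\<^sup>2)) powr \<sigma> \<partial>lebesgue_on K) \<le> c"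
proof -
  have dom: "open \<Omega>" "bounded \<Omega>" using assms(1) by (auto simp: bounded_C2_domain_def)
  have Q: "open (cylinder \<Omega> T)" unfolding cylinder_def using dom by (intro open_Times) auto
  have K: "K \<in> sets borel" "K \<in> sets lebesgue"
    using assms(7) by (auto simp: compact_imp_closed borel_closed lmeasurable_compact fmeasurableD)
  \<comment> \<open>This choice turns the hypothesis \<sigma> < 8/21 into s < 4/3.\<close>
  define s where "s = 7 * \<sigma> / 2"
  have s: "0 < s" "s < 4 / 3" using assms(5,6) by (auto simp: s_def)
  obtain D where D: "D > 0" "\<And>x y. x \<in> \<Omega> \<Longrightarrow> y \<in> \<Omega> \<Longrightarrow> norm (x - y) \<le> D"
  proof
    show "diameter \<Omega> + 1 > 0" using diameter_ge_0[OF dom(2)] by simp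
    show "norm (x - y) \<le> diameter \<Omega> + 1" if "x \<in> \<Omega>" "y \<in> \<Omega>" for x y
      using diameter_bounded_bound[OF dom(2) that] by (simp add: dist_norm)
  qed
  define a where "a = (D\<^sup>2 + 1) * exp 4"
  obtain I where I: "log_kernel a s D I"
    using log_kernel_exists[OF D(1) a_def s] .
  have "\<exists>R>0. cball z R \<subseteq> cylinder \<Omega> T" if "z \<in> K" for z
    using Q assms(8) that open_contains_cball by blast
  then obtain R where R: "\<And>z. z \<in> K \<Longrightarrow> 0 < R z" "\<And>z. z \<in> K \<Longrightarrow> cball z (R z) \<subseteq> cylinder \<Omega> T" by metis
  \<comment> \<open>The covering uses balls of half the radius, the sets on which
    \<open>local_estimate\<close> holds.\<close>
  obtain Z where Z: "Z \<subseteq> K" "finite Z" "K \<subseteq> (\<Union>z\<in>Z. ball z (R z / 2))"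
  proof (rule compactE_image[OF assms(7), of K "\<lambda>z. ball z (R z / 2)"])
    show "K \<subseteq> (\<Union>z\<in>K. ball z (R z / 2))" using R(1) by force
  qed auto
  \<comment> \<open>The constants of the locale are used as explicit functions of their parameters,
    before any solution is chosen: neither m, \<epsilon> nor the data occur in them. The absolute
    value makes the sum over the covering nonnegative without a case distinction.\<close>
  define L where "L R = \<bar>3 * exp (4 / (3 * R\<^sup>2)) * (energy_flow.C1 \<Omega> T \<nu>1 \<nu>2 E c\<^sub>e R I + 2 * Hardy_const * E\<^sup>2 + energy_flow.IY T E) + 3 * energy_flow.IY T E\<bar>" for R
  define c where "c = (\<Sum>z\<in>Z. L (R z))"
  have c: "c \<ge> 0" unfolding c_def L_def by (intro sum_nonneg) simp
  show ?thesis
  proof (intro exI[of _ c] allI impI)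
    fix m \<epsilon> c\<^sub>0 :: real and f u :: "R3 \<times> real \<Rightarrow> R3" and \<rho>0 :: "R3 \<Rightarrow> real" and u0 :: "R3 \<Rightarrow> R3" and \<rho> :: "R3 \<times> real \<Rightarrow> real"
    assume H: "m > 1 \<and> 0 < \<epsilon> \<and> \<epsilon> \<le> 1 \<and> c\<^sub>0 > 0 \<and>
      admissible_data \<Omega> T c\<^sub>e c\<^sub>0 f \<rho>0 u0 \<and>
      weak_solution \<Omega> T \<nu>1 \<nu>2 (pressure m \<epsilon>) f \<rho>0 u0 \<rho> u \<and>
      energy_norm \<Omega> T (pressure m \<epsilon>) \<rho> u \<le> ennreal E"
    then have H': "m > 1" "0 < \<epsilon>" "admissible_data \<Omega> T c\<^sub>e c\<^sub>0 f \<rho>0 u0"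
      "weak_solution \<Omega> T \<nu>1 \<nu>2 (pressure m \<epsilon>) f \<rho>0 u0 \<rho> u"
      "energy_norm \<Omega> T (pressure m \<epsilon>) \<rho> u \<le> ennreal E" by auto
    obtain r v G g where flow: "energy_flow \<Omega> T \<nu>1 \<nu>2 E c\<^sub>e (pressure m \<epsilon>) g v r G"
      and eq: "AE z in lborel. z \<in> cylinder \<Omega> T \<longrightarrow> \<rho> z = r z \<and> u z = v z"
      by (rule weak_solution_energy_flow[OF assms(1,2,9,10) H']) (rule that)
    interpret energy_flow \<Omega> T \<nu>1 \<nu>2 E c\<^sub>e "pressure m \<epsilon>" g v r G by (rule flow)
    define \<phi> where "\<phi> z = r z * (norm (v z))\<^sup>2 * ln (1 + r z * (norm (v z))\<^sup>2) powr \<sigma>" for z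
    define \<psi> where "\<psi> z = \<rho> z * (norm (u z))\<^sup>2 * ln (1 + \<rho> z * (norm (u z))\<^sup>2) powr \<sigma>" for z
    have \<phi>0: "\<phi> z \<ge> 0" for z unfolding \<phi>_def using r_nonneg by simp
    have \<phi>m [measurable]: "\<phi> \<in> borel_measurable borel" unfolding \<phi>_def[abs_def] by measurable
    have loc: "(\<integral>\<^sup>+z. ennreal (\<phi> z) * indicator (ball x (R x / 2)) z \<partial>lborel) \<le> ennreal (L (R x))" if x: "x \<in> K" for x
    proof -
      have "localized_flow \<Omega> T \<nu>1 \<nu>2 E c\<^sub>e (pressure m \<epsilon>) g v r G a s D I x (R x)"
        using R[OF x] D(2) by (intro localized_flow.intro flow I localized_flow_axioms.intro) auto
      from localized_flow.local_estimate[OF this s_def]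
      show ?thesis unfolding \<phi>_def L_def by (rule order_trans) (intro ennreal_leI abs_ge_self)
    qed
    have "(\<integral>\<^sup>+z. ennreal (\<phi> z) * indicator K z \<partial>lborel) \<le> (\<integral>\<^sup>+z. (\<Sum>x\<in>Z. ennreal (\<phi> z) * indicator (ball x (R x / 2)) z) \<partial>lborel)"
    proof (rule nn_integral_mono)
      fix z
      show "ennreal (\<phi> z) * indicator K z \<le> (\<Sum>x\<in>Z. ennreal (\<phi> z) * indicator (ball x (R x / 2)) z)"
      proof (cases "z \<in> K")
        case True
        then obtain x where x: "x \<in> Z" "z \<in> ball x (R x / 2)" using Z(3) by blast
        then have "ennreal (\<phi> z) * indicator K z = ennreal (\<phi> z) * indicator (ball x (R x / 2)) z" using True by simp
        also have "\<dots> \<le> (\<Sum>x\<in>Z. ennreal (\<phi> z) * indicator (ball x (R x / 2)) z)"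
          by (rule member_le_sum[OF x(1) _ Z(2)]) simp
        finally show ?thesis .
      qed simp
    qed
    also have "\<dots> = (\<Sum>x\<in>Z. \<integral>\<^sup>+z. ennreal (\<phi> z) * indicator (ball x (R x / 2)) z \<partial>lborel)"
      by (rule nn_integral_sum) (intro borel_measurable_times_ennreal measurable_compose[OF _ measurable_ennreal] borel_measurable_indicator; simp)
    also have "\<dots> \<le> (\<Sum>x\<in>Z. ennreal (L (R x)))" using Z(1) by (intro sum_mono loc) auto
    also have "\<dots> = ennreal c" unfolding c_def by (rule sum_ennreal) (simp add: L_def)
    finally have bound: "(\<integral>\<^sup>+z. ennreal (\<phi> z) \<partial>lebesgue_on K) \<le> ennreal c"
      using K by (simp add: nn_integral_restrict_space nn_integral_completion)
    have \<phi>K: "\<phi> \<in> borel_measurable (lebesgue_on K)"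
      by (intro measurable_restrict_space1 measurable_completion) (simp add: \<phi>m)
    have int: "integrable (lebesgue_on K) \<phi>"
      by (rule integrableI_nonneg) (use \<phi>K \<phi>0 bound in \<open>auto intro: le_less_trans[OF _ ennreal_less_top]\<close>)
    have "ennreal (\<integral>z. \<phi> z \<partial>lebesgue_on K) \<le> ennreal c"
      using bound \<phi>0 by (subst nn_integral_eq_integral[OF int, symmetric]) auto
    then have le: "(\<integral>z. \<phi> z \<partial>lebesgue_on K) \<le> c" using c by (simp add: ennreal_le_iff)
    \<comment> \<open>The bound is established for the Borel representatives and carried back to the
      given solution, with which they agree almost everywhere on the cylinder and hence on
      \<open>K\<close>.\<close>
    have ae: "AE z in lebesgue_on K. \<phi> z = \<psi> z"
      unfolding AE_lebesgue_on_iff_lborel[OF K(2)] using eq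
    proof eventually_elim
      case (elim z)
      then show ?case using assms(8) by (auto simp: \<phi>_def \<psi>_def)
    qed
    have sol: "\<rho> \<in> borel_measurable (lebesgue_on (cylinder \<Omega> T))" "u \<in> borel_measurable (lebesgue_on (cylinder \<Omega> T))"
      using H'(4) by (auto simp: weak_solution_def L2W12_0_def)
    have [measurable]: "\<rho> \<in> borel_measurable (lebesgue_on K)" "u \<in> borel_measurable (lebesgue_on K)"
      by (rule measurable_restrict_mono[OF sol(1) assms(8)], rule measurable_restrict_mono[OF sol(2) assms(8)])
    have \<psi>K: "\<psi> \<in> borel_measurable (lebesgue_on K)" unfolding \<psi>_def[abs_def] by measurable
    have "integrable (lebesgue_on K) \<psi>" using int integrable_cong_AE[OF \<phi>K \<psi>K ae] by simp
    moreover have "(\<integral>z. \<psi> z \<partial>lebesgue_on K) \<le> c" using le integral_cong_AE[OF \<phi>K \<psi>K ae] by simp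
    ultimately show "integrable (lebesgue_on K)
        (\<lambda>z. \<rho> z * (norm (u z))\<^sup>2 * (ln (1 + \<rho> z * (norm (u z))\<^sup>2)) powr \<sigma>) \<and>
      (\<integral>z. \<rho> z * (norm (u z))\<^sup>2 * (ln (1 + \<rho> z * (norm (u z))\<^sup>2)) powr \<sigma> \<partial>lebesgue_on K) \<le> c"
      unfolding \<psi>_def by simp
  qed
qed

end
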